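(* There exists an absolute constant $C$ such that for every $n\ge2$, every integer $1\le k<n$, every origin-symmetric convex body $L$ in $\mathbb{R}^n$, and every measure $\mu$ with even continuous non-negative density on $L$, $$\mu(L)\ \le\ \big(C\,\mathrm{v.r.}(L^\circ)\big)^k\,\frac{n}{n-k}\,c_{n,k}\,\max_{H\in Gr_{n-k}}\mu(L\cap H)\,|L|^{k/n}.$$
   Context: $L^\circ=\{y:\langle x,y\rangle\le1\ \forall x\in L\}$ is the polar body. The volume ratio of a convex body $K$ is $\mathrm{v.r.}(K)=\inf\{(|K|/|E|)^{1/n}: E\subset K,\ E \text{ an ellipsoid}\}$ (for origin-symmetric $K$ one may take ellipsoids centered at the origin). $Gr_{n-k}$ is the Grassmannian of $(n-k)$-dimensional linear subspaces of $\mathbb{R}^n$. If $\mu$ has density $g$, $\mu(L)=\int_Lg$ and $\mu(L\cap H)=\int_{L\cap H}g$ with respect to $(n-k)$-dimensional Lebesgue measure on $H$. $|\cdot|$ is volume, $B_2^m$ the Euclidean unit ball in $\mathbb{R}^m$, $c_{n,k}=|B_2^n|^{\frac{n-k}{n}}/|B_2^{n-k}|$. *)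

theory Defs
  imports "HOL-Analysis.Analysis"
begin

text \<open>R^n is modelled, uniformly in n, as the extensional functions {..<n} -> real
  (values outside {..<n} are undefined), with Lebesgue measure the n-fold product of lborel.\<close>

definition Rn :: "nat \<Rightarrow> (nat \<Rightarrow> real) set" where
  "Rn n = PiE {..<n} (\<lambda>_. UNIV)"

definition lebn :: "nat \<Rightarrow> (nat \<Rightarrow> real) measure" where
  "lebn n = PiM {..<n} (\<lambda>_. lborel)"

definition vol :: "nat \<Rightarrow> (nat \<Rightarrow> real) set \<Rightarrow> real" where
  "vol n A = measure (lebn n) A"

definition ip :: "nat \<Rightarrow> (nat \<Rightarrow> real) \<Rightarrow> (nat \<Rightarrow> real) \<Rightarrow> real" where
  "ip n x y = (\<Sum>i<n. x i * y i)"

definition negn :: "nat \<Rightarrow> (nat \<Rightarrow> real) \<Rightarrow> (nat \<Rightarrow> real)" where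
  "negn n x = restrict (\<lambda>i. - x i) {..<n}"

definition unit_ball :: "nat \<Rightarrow> (nat \<Rightarrow> real) set" where
  "unit_ball n = {x \<in> Rn n. ip n x x \<le> 1}"

definition convex_body :: "nat \<Rightarrow> (nat \<Rightarrow> real) set \<Rightarrow> bool" where
  "convex_body n K \<longleftrightarrow> K \<subseteq> Rn n \<and> compact K \<and>
     (\<forall>x\<in>K. \<forall>y\<in>K. \<forall>u::real. 0 \<le> u \<and> u \<le> 1 \<longrightarrow>
        restrict (\<lambda>i. u * x i + (1 - u) * y i) {..<n} \<in> K) \<and>
     (\<exists>x\<in>K. \<exists>r>0. {y \<in> Rn n. ip n (\<lambda>i. y i - x i) (\<lambda>i. y i - x i) < r\<^sup>2} \<subseteq> K)"

definition origin_symmetric :: "nat \<Rightarrow> (nat \<Rightarrow> real) set \<Rightarrow> bool" where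
  "origin_symmetric n K \<longleftrightarrow> (\<forall>x\<in>K. negn n x \<in> K)"

definition polar :: "nat \<Rightarrow> (nat \<Rightarrow> real) set \<Rightarrow> (nat \<Rightarrow> real) set" where
  "polar n L = {y \<in> Rn n. \<forall>x\<in>L. ip n x y \<le> 1}"

definition ellipsoid :: "nat \<Rightarrow> (nat \<Rightarrow> real) set \<Rightarrow> bool" where
  "ellipsoid n E \<longleftrightarrow> (\<exists>a\<in>Rn n. \<exists>A :: nat \<Rightarrow> nat \<Rightarrow> real.
      (\<forall>i<n. \<forall>j<n. A i j = A j i) \<and>
      (\<forall>v\<in>Rn n. v \<noteq> (\<lambda>i\<in>{..<n}. 0) \<longrightarrow> (\<Sum>i<n. \<Sum>j<n. A i j * v i * v j) > 0) \<and>
      E = {x \<in> Rn n. (\<Sum>i<n. \<Sum>j<n. A i j * (x i - a i) * (x j - a j)) \<le> 1})"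

definition volume_ratio :: "nat \<Rightarrow> (nat \<Rightarrow> real) set \<Rightarrow> real" where
  "volume_ratio n K = Inf {(vol n K / vol n E) powr (1 / real n) | E. ellipsoid n E \<and> E \<subseteq> K}"

text \<open>Orthonormal (m)-frames in R^n; their spans are exactly the elements of Gr_m.\<close>
definition frames :: "nat \<Rightarrow> nat \<Rightarrow> (nat \<Rightarrow> nat \<Rightarrow> real) set" where
  "frames n m = {U. (\<forall>j<m. U j \<in> Rn n) \<and>
      (\<forall>i<m. \<forall>j<m. ip n (U i) (U j) = (if i = j then 1 else 0))}"

definition frame_map :: "nat \<Rightarrow> nat \<Rightarrow> (nat \<Rightarrow> nat \<Rightarrow> real) \<Rightarrow> (nat \<Rightarrow> real) \<Rightarrow> (nat \<Rightarrow> real)" where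
  "frame_map n m U t = restrict (\<lambda>i. \<Sum>j<m. t j * U j i) {..<n}"

definition mu :: "nat \<Rightarrow> ((nat \<Rightarrow> real) \<Rightarrow> real) \<Rightarrow> (nat \<Rightarrow> real) set \<Rightarrow> real" where
  "mu n g L = integral\<^sup>L (lebn n) (\<lambda>x. indicator L x * g x)"

text \<open>mu(L \<inter> H), H = span U, integrated w.r.t. m-dim Lebesgue measure on H.\<close>
definition mu_sec :: "nat \<Rightarrow> nat \<Rightarrow> ((nat \<Rightarrow> real) \<Rightarrow> real) \<Rightarrow> (nat \<Rightarrow> real) set
     \<Rightarrow> (nat \<Rightarrow> nat \<Rightarrow> real) \<Rightarrow> real" where
  "mu_sec n m g L U = integral\<^sup>L (lebn m)
     (\<lambda>t. indicator L (frame_map n m U t) * g (frame_map n m U t))"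

definition c_nk :: "nat \<Rightarrow> nat \<Rightarrow> real" where
  "c_nk n k = vol n (unit_ball n) powr (real (n - k) / real n) / vol (n - k) (unit_ball (n - k))"

end

theory Submission
  imports Defs "HOL-Probability.Probability"
begin

text \<open>
  If \<open>L\<close> lies in a centred ellipsoid \<open>E\<close>, averaging the integrals of the density over the images
  of Gaussian matrices adapted to \<open>E\<close> bounds \<open>\<mu>(L)\<close> by \<open>5^k |E|^{k/n} max \<mu>(L \<inter> H)\<close>. An
  ellipsoid inside the polar body of \<open>L\<close> gives such an \<open>E\<close> by polarity, and
  \<open>(|E|/|L|)^{1/n}\<close> is then at most a constant times the volume ratio of the polar body by the
  Bourgain-Milman inequality.

  The Bourgain-Milman inequality is proved by induction on the dimension \<open>n\<close>. A volume count for
  the exponential tilts of the uniform measure on \<open>K\<close> yields a tilt by a point of \<open>n K\<^sup>\<circ>\<close> whose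
  covariance has determinant at most \<open>C^n |K| / |n K\<^sup>\<circ>|\<close>. Putting this covariance into
  isotropic position, \<open>K\<close> plus a ball \<open>B\<close> of radius \<open>sqrt (2 n)\<close> has volume at most \<open>C^n\<close>; so a random
  section of \<open>K\<close> of codimension \<open>k = n div 3\<close> lies in a multiple of \<open>B\<close>, and has a volume
  product bounded below in terms of \<open>|K|\<close>. The complementary projection is handled by the
  induction hypothesis.
\<close>

section \<open>Lebesgue measure on finite-dimensional coordinate spaces\<close>

text \<open>Coordinate spaces are indexed by arbitrary finite sets of naturals, so that the
  induction can pass from \<open>I\<close> to a subset and sections and projections can be taken
  along coordinates; other subspaces are first rotated into coordinate position. Determinants are
  replaced by the factor in a change of variables, and the Grassmannian by Gaussian matrices: the
  law of \<open>G t\<close> depends on \<open>t\<close> only through its norm, so averages over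
  subspaces become integrals against the weight \<open>1 / |y| ^ k\<close>. This weight is at least
  1 on the unit ball, which serves the upper bound for the measure of L, and it is cancelled by a
  factor \<open>|x| ^ k\<close> when a subspace with a short section is sought. Volume products in
  dimension n have the order n^(-n) up to c^n, hence the normalising factor n^n; it originates in
  the dilation of the polar body by n, under which tilting changes densities by at most a factor
  exponential in n. Such losses are harmless there, since n-th roots are taken at the end, whereas
  the slicing step itself may lose only a factor exponential in the codimension k.\<close>

abbreviation vecs :: "nat set \<Rightarrow> (nat \<Rightarrow> real) set" where
  "vecs I \<equiv> PiE I (\<lambda>_. UNIV)"

definition leb :: "nat set \<Rightarrow> (nat \<Rightarrow> real) measure" where
  "leb I = PiM I (\<lambda>_. lborel)"

definition dot :: "nat set \<Rightarrow> (nat \<Rightarrow> real) \<Rightarrow> (nat \<Rightarrow> real) \<Rightarrow> real" where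
  "dot I x y = (\<Sum>i\<in>I. x i * y i)"

text \<open>Vectors are \<open>undefined\<close> outside \<open>I\<close>, so pointwise sums would
  leave \<open>vecs I\<close>; the restriction repairs this. A difference is
  \<open>comb I 1 x (-1) y\<close>, and a multiple of \<open>x\<close> is written with coefficient 0
  on a dummy second vector.\<close>

definition comb :: "nat set \<Rightarrow> real \<Rightarrow> (nat \<Rightarrow> real) \<Rightarrow> real \<Rightarrow> (nat \<Rightarrow> real) \<Rightarrow> nat \<Rightarrow> real" where
  "comb I a x b y = restrict (\<lambda>i. a * x i + b * y i) I"

definition lin :: "nat set \<Rightarrow> nat set \<Rightarrow> (nat \<Rightarrow> nat \<Rightarrow> real) \<Rightarrow> (nat \<Rightarrow> real) \<Rightarrow> nat \<Rightarrow> real" where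
  "lin I J A x = restrict (\<lambda>i. \<Sum>j\<in>J. A i j * x j) I"

definition transp :: "(nat \<Rightarrow> nat \<Rightarrow> real) \<Rightarrow> nat \<Rightarrow> nat \<Rightarrow> real" where
  "transp A i j = A j i"

definition mat_mult :: "nat set \<Rightarrow> (nat \<Rightarrow> nat \<Rightarrow> real) \<Rightarrow> (nat \<Rightarrow> nat \<Rightarrow> real) \<Rightarrow> nat \<Rightarrow> nat \<Rightarrow> real" where
  "mat_mult J A B i k = (\<Sum>j\<in>J. A i j * B j k)"

text \<open>\<open>d\<close> stands for the absolute determinant of \<open>T\<close>. The change of
  variables is stated for pullbacks of non-negative functions, so composition and inversion are
  formal and no images of sets have to be measured.\<close>

definition scales :: "nat set \<Rightarrow> ((nat \<Rightarrow> real) \<Rightarrow> nat \<Rightarrow> real) \<Rightarrow> real \<Rightarrow> bool" where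
  "scales I T d \<longleftrightarrow> T \<in> leb I \<rightarrow>\<^sub>M leb I \<and> 0 < d \<and>
     (\<forall>f\<in>borel_measurable (leb I). (\<integral>\<^sup>+x. f x \<partial>leb I) = ennreal d * (\<integral>\<^sup>+x. f (T x) \<partial>leb I))"

interpretation lborel_prod: product_sigma_finite "\<lambda>_::nat. lborel :: real measure"
  by unfold_locales

lemma space_leb [simp]: "space (leb I) = vecs I"
  by (simp add: leb_def space_PiM)

lemma sigma_finite_leb: "finite I \<Longrightarrow> sigma_finite_measure (leb I)"
  unfolding leb_def by (rule lborel_prod.sigma_finite)

lemma pair_sigma_finite_leb: "finite I \<Longrightarrow> finite J \<Longrightarrow> pair_sigma_finite (leb I) (leb J)"
  by (simp add: pair_sigma_finite_def sigma_finite_leb)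

lemma leb_component [measurable]: "i \<in> I \<Longrightarrow> (\<lambda>x. x i) \<in> borel_measurable (leb I)"
  unfolding leb_def using measurable_component_singleton[of i I "\<lambda>_. lborel :: real measure"] by simp

lemma measurable_lbI:
  assumes "\<And>i. i \<in> I \<Longrightarrow> (\<lambda>x. f x i) \<in> borel_measurable M"
  shows "(\<lambda>x. restrict (f x) I) \<in> M \<rightarrow>\<^sub>M leb I"
  unfolding leb_def by (rule measurable_restrict) (use assms in simp)

lemma measurable_leb_comp:
  assumes "f \<in> M \<rightarrow>\<^sub>M leb I" "i \<in> I"
  shows "(\<lambda>x. f x i) \<in> borel_measurable M"
  using measurable_compose[OF assms(1) leb_component[OF assms(2)]] .

lemma comb_meas [measurable (raw)]:
  assumes [measurable]: "f \<in> M \<rightarrow>\<^sub>M leb I" "g \<in> M \<rightarrow>\<^sub>M leb I" "a \<in> borel_measurable M" "b \<in> borel_measurable M"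
  shows "(\<lambda>x. comb I (a x) (f x) (b x) (g x)) \<in> M \<rightarrow>\<^sub>M leb I"
  unfolding comb_def
  by (intro measurable_lbI borel_measurable_add borel_measurable_times measurable_leb_comp[where I = I] assms)

lemma lin_meas [measurable (raw)]:
  assumes [measurable]: "f \<in> M \<rightarrow>\<^sub>M leb J"
  shows "(\<lambda>x. lin I J A (f x)) \<in> M \<rightarrow>\<^sub>M leb I"
  unfolding lin_def
  by (auto intro!: measurable_lbI borel_measurable_sum borel_measurable_times measurable_leb_comp[OF assms])

lemma dot_meas [measurable (raw)]:
  assumes [measurable]: "f \<in> M \<rightarrow>\<^sub>M leb I" "g \<in> M \<rightarrow>\<^sub>M leb I"
  shows "(\<lambda>x. dot I (f x) (g x)) \<in> borel_measurable M"
  unfolding dot_def by (intro borel_measurable_sum borel_measurable_times measurable_leb_comp[where I = I] assms)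

lemma dot_meas_const [measurable (raw)]:
  assumes [measurable]: "f \<in> M \<rightarrow>\<^sub>M leb I"
  shows "(\<lambda>x. dot I (f x) y) \<in> borel_measurable M" "(\<lambda>x. dot I y (f x)) \<in> borel_measurable M"
  unfolding dot_def by (auto intro!: borel_measurable_sum borel_measurable_times measurable_leb_comp[OF assms])

lemma comb_in [simp]: "comb I a x b y \<in> vecs I"
  by (simp add: comb_def)

lemma lin_in [simp]: "lin I J A x \<in> vecs I"
  by (simp add: lin_def)

lemma comb_app [simp]: "i \<in> I \<Longrightarrow> comb I a x b y i = a * x i + b * y i"
  by (simp add: comb_def)

lemma lin_app: "i \<in> I \<Longrightarrow> lin I J A x i = (\<Sum>j\<in>J. A i j * x j)"
  by (simp add: lin_def)

lemma vecs_eqI: "x \<in> vecs I \<Longrightarrow> y \<in> vecs I \<Longrightarrow> (\<And>i. i \<in> I \<Longrightarrow> x i = y i) \<Longrightarrow> x = y"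
  by (rule PiE_ext)

lemma dot_cong: "(\<And>i. i \<in> I \<Longrightarrow> x i = x' i) \<Longrightarrow> (\<And>i. i \<in> I \<Longrightarrow> y i = y' i) \<Longrightarrow> dot I x y = dot I x' y'"
  by (simp add: dot_def)

lemma dot_commute: "dot I x y = dot I y x"
  by (simp add: dot_def mult.commute)

lemma dot_comb_left [simp]: "dot I (comb I a x b y) z = a * dot I x z + b * dot I y z"
  by (simp add: dot_def sum_distrib_left sum.distrib[symmetric] algebra_simps)

lemma dot_comb_right [simp]: "dot I z (comb I a x b y) = a * dot I z x + b * dot I z y"
  by (simp add: dot_def sum_distrib_left sum.distrib[symmetric] algebra_simps)

lemma dot_self_nonneg [simp]: "0 \<le> dot I x x"
  by (simp add: dot_def sum_nonneg)

lemma dot_lin: "finite I \<Longrightarrow> finite J \<Longrightarrow> dot I (lin I J A x) y = dot J x (lin J I (transp A) y)"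
  unfolding dot_def lin_def transp_def
  by (simp add: sum_distrib_left sum_distrib_right sum.swap[of _ I J] algebra_simps)

lemma lin_cong: "(\<And>j. j \<in> J \<Longrightarrow> x j = y j) \<Longrightarrow> lin I J A x = lin I J A y"
  by (auto simp: lin_def fun_eq_iff intro!: sum.cong)

lemma lin_comb [simp]: "lin I J A (comb J a x b y) = comb I a (lin I J A x) b (lin I J A y)"
  by (auto simp: lin_def comb_def fun_eq_iff sum_distrib_left sum.distrib[symmetric] algebra_simps intro!: sum.cong)

lemma lin_lin:
  assumes "finite J" "finite K"
  shows "lin I J A (lin J K B x) = lin I K (mat_mult J A B) x"
proof (rule vecs_eqI)
  fix i assume i: "i \<in> I"
  have "lin I J A (lin J K B x) i = (\<Sum>j\<in>J. \<Sum>k\<in>K. A i j * (B j k * x k))"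
    using i by (simp add: lin_app sum_distrib_left)
  also have "\<dots> = (\<Sum>k\<in>K. \<Sum>j\<in>J. A i j * (B j k * x k))"
    by (rule sum.swap)
  also have "\<dots> = lin I K (mat_mult J A B) x i"
    using i by (simp add: lin_app mat_mult_def sum_distrib_right mult.assoc)
  finally show "lin I J A (lin J K B x) i = lin I K (mat_mult J A B) x i" .
qed auto

lemma transp_mat_mult: "transp (mat_mult J A B) = mat_mult J (transp B) (transp A)"
  by (simp add: fun_eq_iff transp_def mat_mult_def mult.commute)

lemma transp_transp [simp]: "transp (transp A) = A"
  by (simp add: fun_eq_iff transp_def)

lemma emeasure_leb_PiE:
  assumes "finite I" "\<And>i. i \<in> I \<Longrightarrow> A i \<in> sets borel"
  shows "emeasure (leb I) (PiE I A) = (\<Prod>i\<in>I. emeasure lborel (A i))"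
  unfolding leb_def by (rule lborel_prod.emeasure_PiM) (use assms in auto)

lemma scales_D:
  assumes "scales I T d" "f \<in> borel_measurable (leb I)"
  shows "(\<integral>\<^sup>+x. f x \<partial>leb I) = ennreal d * (\<integral>\<^sup>+x. f (T x) \<partial>leb I)"
  using assms by (simp add: scales_def)

lemma scales_meas: "scales I T d \<Longrightarrow> T \<in> leb I \<rightarrow>\<^sub>M leb I"
  by (simp add: scales_def)

lemma scales_pos: "scales I T d \<Longrightarrow> 0 < d"
  by (simp add: scales_def)

lemma scales_comp:
  assumes S: "scales I S d" and T: "scales I T e"
  shows "scales I (\<lambda>x. S (T x)) (d * e)"
  unfolding scales_def
proof (intro conjI ballI)
  note [measurable] = scales_meas[OF S] scales_meas[OF T]
  show "(\<lambda>x. S (T x)) \<in> leb I \<rightarrow>\<^sub>M leb I" by measurable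
  show "0 < d * e" using scales_pos[OF S] scales_pos[OF T] by simp
  fix f :: "(nat \<Rightarrow> real) \<Rightarrow> ennreal" assume [measurable]: "f \<in> borel_measurable (leb I)"
  have "(\<integral>\<^sup>+x. f x \<partial>leb I) = ennreal d * (\<integral>\<^sup>+x. f (S x) \<partial>leb I)"
    by (rule scales_D[OF S]) measurable
  also have "(\<integral>\<^sup>+x. f (S x) \<partial>leb I) = ennreal e * (\<integral>\<^sup>+x. f (S (T x)) \<partial>leb I)"
    by (rule scales_D[OF T]) measurable
  finally show "(\<integral>\<^sup>+x. f x \<partial>leb I) = ennreal (d * e) * (\<integral>\<^sup>+x. f (S (T x)) \<partial>leb I)"
    using scales_pos[OF S] scales_pos[OF T] by (simp add: ennreal_mult' mult.assoc)
qed

lemma scales_cong: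
  assumes T: "scales I T d" and eq: "\<And>x. x \<in> vecs I \<Longrightarrow> T x = S x"
  shows "scales I S d"
  unfolding scales_def
proof (intro conjI ballI)
  show "S \<in> leb I \<rightarrow>\<^sub>M leb I"
    using scales_meas[OF T] eq by (subst measurable_cong[of _ S T]) simp_all
  show "0 < d" by (rule scales_pos[OF T])
  fix f :: "(nat \<Rightarrow> real) \<Rightarrow> ennreal" assume f: "f \<in> borel_measurable (leb I)"
  have "(\<integral>\<^sup>+x. f (T x) \<partial>leb I) = (\<integral>\<^sup>+x. f (S x) \<partial>leb I)"
    by (rule nn_integral_cong) (simp add: eq)
  then show "(\<integral>\<^sup>+x. f x \<partial>leb I) = ennreal d * (\<integral>\<^sup>+x. f (S x) \<partial>leb I)"
    by (subst scales_D[OF T f]) (rule arg_cong)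
qed

lemma scales_inverse:
  assumes T: "scales I T d" and S: "S \<in> leb I \<rightarrow>\<^sub>M leb I" and inv: "\<And>x. x \<in> vecs I \<Longrightarrow> S (T x) = x"
  shows "scales I S (1 / d)"
  unfolding scales_def
proof (intro conjI ballI)
  show "S \<in> leb I \<rightarrow>\<^sub>M leb I" by fact
  show "0 < 1 / d" using scales_pos[OF T] by simp
  fix f :: "(nat \<Rightarrow> real) \<Rightarrow> ennreal" assume [measurable]: "f \<in> borel_measurable (leb I)"
  note [measurable] = S
  have "(\<integral>\<^sup>+x. f (S x) \<partial>leb I) = ennreal d * (\<integral>\<^sup>+x. f (S (T x)) \<partial>leb I)"
    by (rule scales_D[OF T]) measurable
  also have "(\<integral>\<^sup>+x. f (S (T x)) \<partial>leb I) = (\<integral>\<^sup>+x. f x \<partial>leb I)"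
    by (rule nn_integral_cong) (simp add: inv)
  finally show "(\<integral>\<^sup>+x. f x \<partial>leb I) = ennreal (1 / d) * (\<integral>\<^sup>+x. f (S x) \<partial>leb I)"
    using scales_pos[OF T] by (simp add: mult.assoc[symmetric] ennreal_mult'[symmetric])
qed

lemma scales_emeasure:
  assumes T: "scales I T d" and A: "A \<in> sets (leb I)"
  shows "emeasure (leb I) A = ennreal d * emeasure (leb I) {x \<in> vecs I. T x \<in> A}"
proof -
  note [measurable] = scales_meas[OF T] A
  have "emeasure (leb I) A = (\<integral>\<^sup>+x. indicator A x \<partial>leb I)" by simp
  also have "\<dots> = ennreal d * (\<integral>\<^sup>+x. indicator A (T x) \<partial>leb I)"
    by (rule scales_D[OF T]) measurable
  also have "(\<integral>\<^sup>+x. indicator A (T x) \<partial>leb I) = (\<integral>\<^sup>+x. indicator {x \<in> vecs I. T x \<in> A} x \<partial>leb I)"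
    by (rule nn_integral_cong) (simp add: indicator_def)
  also have "\<dots> = emeasure (leb I) {x \<in> vecs I. T x \<in> A}"
  proof (rule nn_integral_indicator)
    have "T -` A \<inter> space (leb I) \<in> sets (leb I)" by measurable
    also have "T -` A \<inter> space (leb I) = {x \<in> vecs I. T x \<in> A}" by auto
    finally show "{x \<in> vecs I. T x \<in> A} \<in> sets (leb I)" .
  qed
  finally show ?thesis .
qed

text \<open>A product measure is determined by its values on boxes, and there the claim is the
  affine substitution in one variable, applied in each coordinate.\<close>

lemma scales_affine:
  assumes I: "finite I" and c: "c \<noteq> 0"
  shows "scales I (\<lambda>x. comb I c x 1 a) (\<bar>c\<bar> ^ card I)"
proof -
  let ?T = "\<lambda>x. comb I c x 1 a"
  have T [measurable]: "?T \<in> leb I \<rightarrow>\<^sub>M leb I"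
    unfolding comb_def by (rule measurable_lbI) auto
  let ?P = "scale_measure (ennreal (\<bar>c\<bar> ^ card I)) (distr (leb I) (leb I) ?T)"
  have "?P = leb I"
    unfolding leb_def
  proof (rule lborel_prod.PiM_eqI[OF I], unfold leb_def[symmetric])
    show "sets ?P = sets (leb I)" by simp
    fix A :: "nat \<Rightarrow> real set" assume A: "\<And>i. i \<in> I \<Longrightarrow> A i \<in> sets lborel"
    have PA: "PiE I A \<in> sets (leb I)"
      unfolding leb_def by (rule sets_PiM_I_finite) (use I A in auto)
    have vA: "(\<lambda>x. a i + c * x) -` A i \<in> sets borel" if "i \<in> I" for i
    proof -
      have "A i \<in> sets borel" using A[OF that] by simp
      moreover have "(\<lambda>x. a i + c * x) \<in> borel_measurable borel" by measurable
      ultimately have "(\<lambda>x. a i + c * x) -` A i \<inter> space borel \<in> sets borel" by (rule measurable_sets[rotated])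
      then show "(\<lambda>x. a i + c * x) -` A i \<in> sets borel" by simp
    qed
    have one: "emeasure lborel (A i) = ennreal \<bar>c\<bar> * emeasure lborel ((\<lambda>x. a i + c * x) -` A i)" if "i \<in> I" for i
    proof -
      have Ai: "A i \<in> sets borel" using A[OF that] by simp
      have "emeasure lborel (A i) = (\<integral>\<^sup>+x. indicator (A i) x \<partial>lborel)" using Ai by simp
      also have "\<dots> = ennreal \<bar>c\<bar> * (\<integral>\<^sup>+x. indicator (A i) (a i + c * x) \<partial>lborel)"
        by (rule nn_integral_real_affine) (use Ai c in auto)
      also have "(\<integral>\<^sup>+x. indicator (A i) (a i + c * x) \<partial>lborel) = (\<integral>\<^sup>+x. indicator ((\<lambda>x. a i + c * x) -` A i) x \<partial>lborel)"
        by (simp add: indicator_def)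
      also have "\<dots> = emeasure lborel ((\<lambda>x. a i + c * x) -` A i)"
        by (rule nn_integral_indicator) (use vA[OF that] in simp)
      finally show ?thesis .
    qed
    have vim: "?T -` PiE I A \<inter> space (leb I) = PiE I (\<lambda>i. (\<lambda>x. a i + c * x) -` A i)"
      by (auto simp: PiE_iff comb_def algebra_simps)
    have "emeasure ?P (PiE I A) = ennreal (\<bar>c\<bar> ^ card I) * emeasure (leb I) (?T -` PiE I A \<inter> space (leb I))"
      using PA by (simp add: emeasure_distr)
    also have "emeasure (leb I) (?T -` PiE I A \<inter> space (leb I)) = (\<Prod>i\<in>I. emeasure lborel ((\<lambda>x. a i + c * x) -` A i))"
      unfolding vim by (rule emeasure_leb_PiE[OF I vA])
    also have "ennreal (\<bar>c\<bar> ^ card I) = (\<Prod>i\<in>I. ennreal \<bar>c\<bar>)"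
      by (simp add: ennreal_power)
    finally show "emeasure ?P (PiE I A) = (\<Prod>i\<in>I. emeasure lborel (A i))"
      by (simp add: one prod.distrib ennreal_power)
  qed
  have "(\<integral>\<^sup>+x. f x \<partial>leb I) = ennreal (\<bar>c\<bar> ^ card I) * (\<integral>\<^sup>+x. f (?T x) \<partial>leb I)"
    if [measurable]: "f \<in> borel_measurable (leb I)" for f :: "_ \<Rightarrow> ennreal"
  proof -
    have "(\<integral>\<^sup>+x. f x \<partial>leb I) = (\<integral>\<^sup>+x. f x \<partial>?P)" unfolding \<open>?P = leb I\<close> ..
    also have "\<dots> = ennreal (\<bar>c\<bar> ^ card I) * (\<integral>\<^sup>+x. f (?T x) \<partial>leb I)"
      by (simp add: nn_integral_scale_measure nn_integral_distr)
    finally show ?thesis .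
  qed
  note main = this
  have "0 < \<bar>c\<bar> ^ card I" using c by simp
  with T show ?thesis unfolding scales_def by (intro conjI ballI main)
qed

lemma nn_integral_leb_insert:
  assumes "finite I" "i \<notin> I" "f \<in> borel_measurable (leb (insert i I))"
  shows "(\<integral>\<^sup>+x. f x \<partial>leb (insert i I)) = (\<integral>\<^sup>+ x. (\<integral>\<^sup>+ y. f (x(i := y)) \<partial>lborel) \<partial>leb I)"
    "(\<integral>\<^sup>+x. f x \<partial>leb (insert i I)) = (\<integral>\<^sup>+ y. (\<integral>\<^sup>+ x. f (x(i := y)) \<partial>leb I) \<partial>lborel)"
  using lborel_prod.product_nn_integral_insert[of I i f] lborel_prod.product_nn_integral_insert_rev[of I i f] assms
  by (simp_all add: leb_def)

lemma upd_meas [measurable (raw)]: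
  assumes "f \<in> M \<rightarrow>\<^sub>M leb I" "g \<in> borel_measurable M"
  shows "(\<lambda>x. (f x)(i := g x)) \<in> M \<rightarrow>\<^sub>M leb (insert i I)"
  using assms unfolding leb_def by (intro measurable_fun_upd[of "insert i I" I i]) auto

text \<open>The identity matrix with row \<open>i\<close> replaced, \<open>a\<close> being its
  diagonal entry. Products of these matrices suffice for the Cholesky factorisation.\<close>

definition shear :: "nat \<Rightarrow> real \<Rightarrow> (nat \<Rightarrow> real) \<Rightarrow> nat \<Rightarrow> nat \<Rightarrow> real" where
  "shear i a c = (\<lambda>k j. if k = i then (if j = i then a else c j) else if k = j then 1 else 0)"

lemma lin_shear:
  assumes "finite I" "i \<in> I" "k \<in> I"
  shows "lin I I (shear i a c) x k = (if k = i then a * x i + (\<Sum>j\<in>I - {i}. c j * x j) else x k)"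
proof (cases "k = i")
  case True
  have "lin I I (shear i a c) x k = (\<Sum>j\<in>I. (if j = i then a else c j) * x j)"
    using assms True by (simp add: lin_app shear_def)
  also have "\<dots> = a * x i + (\<Sum>j\<in>I - {i}. c j * x j)"
    using assms by (subst sum.remove[of I i]) (auto intro!: sum.cong)
  finally show ?thesis using True by simp
next
  case False
  then have "lin I I (shear i a c) x k = (\<Sum>j\<in>I. if j = k then x j else 0)"
    unfolding lin_app[OF assms(3)] by (intro sum.cong) (auto simp: shear_def)
  then show ?thesis using False assms by simp
qed

lemma lin_transp_shear:
  assumes "finite I" "i \<in> I" "k \<in> I"
  shows "lin I I (transp (shear i a c)) x k = (if k = i then a * x i else x k + c k * x i)"
proof (cases "k = i")
  case True
  have "lin I I (transp (shear i a c)) x k = (\<Sum>j\<in>I. if j = i then a * x j else 0)"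
    unfolding lin_app[OF assms(3)] using True by (intro sum.cong) (auto simp: shear_def transp_def)
  then show ?thesis using True assms by simp
next
  case False
  have "lin I I (transp (shear i a c)) x k = (\<Sum>j\<in>I. (if j = i then c k * x j else 0) + (if j = k then x j else 0))"
    unfolding lin_app[OF assms(3)] using False by (intro sum.cong) (auto simp: shear_def transp_def)
  then show ?thesis using False assms by (simp add: sum.distrib)
qed

text \<open>Integrating over coordinate \<open>i\<close> innermost, the map acts on it as y -> b + a
  y with b depending on the other coordinates only.\<close>

lemma scales_shear:
  assumes I: "finite I" and i: "i \<in> I" and a: "a \<noteq> 0"
  shows "scales I (lin I I (shear i a c)) \<bar>a\<bar>"
  unfolding scales_def
proof (intro conjI ballI)
  show "lin I I (shear i a c) \<in> leb I \<rightarrow>\<^sub>M leb I" by measurable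
  show "0 < \<bar>a\<bar>" using a by simp
  fix f :: "(nat \<Rightarrow> real) \<Rightarrow> ennreal" assume f: "f \<in> borel_measurable (leb I)"
  define J where "J = I - {i}"
  have J: "I = insert i J" "i \<notin> J" "finite J" using I i by (auto simp: J_def)
  have f' [measurable]: "f \<in> borel_measurable (leb (insert i J))" using f J(1) by simp
  have "(\<integral>\<^sup>+x. f (lin I I (shear i a c) x) \<partial>leb I) =
     (\<integral>\<^sup>+ x. (\<integral>\<^sup>+ y. f (lin I I (shear i a c) (x(i := y))) \<partial>lborel) \<partial>leb J)"
    unfolding J(1) by (rule nn_integral_leb_insert) (use J in measurable)
  also have "ennreal \<bar>a\<bar> * \<dots> = (\<integral>\<^sup>+ x. ennreal \<bar>a\<bar> * (\<integral>\<^sup>+ y. f (lin I I (shear i a c) (x(i := y))) \<partial>lborel) \<partial>leb J)"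
    unfolding J(1)
    by (rule nn_integral_cmult[symmetric]) measurable
  also have "\<dots> = (\<integral>\<^sup>+ x. (\<integral>\<^sup>+ y. f (x(i := y)) \<partial>lborel) \<partial>leb J)"
  proof (rule nn_integral_cong)
    fix x assume x: "x \<in> space (leb J)"
    let ?b = "\<Sum>j\<in>J. c j * x j"
    have eq: "lin I I (shear i a c) (x(i := y)) = x(i := ?b + a * y)" for y
    proof (rule vecs_eqI[of _ I])
      show "x(i := ?b + a * y) \<in> vecs I" using x J by (auto simp: PiE_iff extensional_def)
      fix k assume k: "k \<in> I"
      have "(\<Sum>j\<in>I - {i}. c j * (x(i := y)) j) = ?b" unfolding J_def by (rule sum.cong) auto
      then show "lin I I (shear i a c) (x(i := y)) k = (x(i := ?b + a * y)) k"
        using k by (simp add: lin_shear[OF I i])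
    qed simp
    have [measurable]: "(\<lambda>y. f (x(i := y))) \<in> borel_measurable borel"
      using x by (intro measurable_compose[OF _ f'] upd_meas) (auto intro!: measurable_const)
    show "ennreal \<bar>a\<bar> * (\<integral>\<^sup>+ y. f (lin I I (shear i a c) (x(i := y))) \<partial>lborel) = (\<integral>\<^sup>+ y. f (x(i := y)) \<partial>lborel)"
      unfolding eq by (rule nn_integral_real_affine[symmetric]) (use a in auto)
  qed
  also have "\<dots> = (\<integral>\<^sup>+x. f x \<partial>leb I)"
    unfolding J(1) by (rule nn_integral_leb_insert[symmetric]) (use J in measurable)
  finally show "(\<integral>\<^sup>+x. f x \<partial>leb I) = ennreal \<bar>a\<bar> * (\<integral>\<^sup>+x. f (lin I I (shear i a c) x) \<partial>leb I)" by simp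
qed

text \<open>The order of integration is opposite to that for \<open>scales_shear\<close>: with
  coordinate \<open>i\<close> outermost, the map translates the remaining coordinates by a multiple
  of it and multiplies coordinate \<open>i\<close> by \<open>a\<close>.\<close>

lemma scales_transp_shear:
  assumes I: "finite I" and i: "i \<in> I" and a: "a \<noteq> 0"
  shows "scales I (lin I I (transp (shear i a c))) \<bar>a\<bar>"
  unfolding scales_def
proof (intro conjI ballI)
  let ?T = "lin I I (transp (shear i a c))"
  show "?T \<in> leb I \<rightarrow>\<^sub>M leb I" by measurable
  show "0 < \<bar>a\<bar>" using a by simp
  fix f :: "(nat \<Rightarrow> real) \<Rightarrow> ennreal" assume f: "f \<in> borel_measurable (leb I)"
  define J where "J = I - {i}"
  have J: "I = insert i J" "i \<notin> J" "finite J" using I i by (auto simp: J_def)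
  have f' [measurable]: "f \<in> borel_measurable (leb (insert i J))" using f J(1) by simp
  interpret lJ: sigma_finite_measure "leb J" by (rule sigma_finite_leb[OF J(3)])
  have "(\<integral>\<^sup>+x. f (?T x) \<partial>leb I) = (\<integral>\<^sup>+ y. (\<integral>\<^sup>+ x. f (?T (x(i := y))) \<partial>leb J) \<partial>lborel)"
    unfolding J(1) by (rule nn_integral_leb_insert) (use J in measurable)
  also have "\<dots> = (\<integral>\<^sup>+ y. (\<integral>\<^sup>+ x. f (x(i := 0 + a * y)) \<partial>leb J) \<partial>lborel)"
  proof (rule nn_integral_cong)
    fix y :: real
    have eq: "?T (x(i := y)) = (comb J 1 x 1 (\<lambda>j. c j * y))(i := 0 + a * y)" for x
    proof (rule vecs_eqI[of _ I])
      show "(comb J 1 x 1 (\<lambda>j. c j * y))(i := 0 + a * y) \<in> vecs I"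
        unfolding J(1) comb_def by (auto simp: PiE_iff extensional_def)
      fix k assume k: "k \<in> I"
      then show "?T (x(i := y)) k = ((comb J 1 x 1 (\<lambda>j. c j * y))(i := 0 + a * y)) k"
        using J(2) by (auto simp: lin_transp_shear[OF I i] comb_def J_def)
    qed simp
    have "(\<integral>\<^sup>+ x. f (x(i := 0 + a * y)) \<partial>leb J) = ennreal (\<bar>1\<bar> ^ card J) *
       (\<integral>\<^sup>+ x. f ((comb J 1 x 1 (\<lambda>j. c j * y))(i := 0 + a * y)) \<partial>leb J)"
      by (rule scales_D[OF scales_affine[OF J(3)]]) (simp, measurable)
    then show "(\<integral>\<^sup>+ x. f (?T (x(i := y))) \<partial>leb J) = (\<integral>\<^sup>+ x. f (x(i := 0 + a * y)) \<partial>leb J)"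
      unfolding eq by simp
  qed
  also have "ennreal \<bar>a\<bar> * \<dots> = (\<integral>\<^sup>+ y. (\<integral>\<^sup>+ x. f (x(i := y)) \<partial>leb J) \<partial>lborel)"
    by (rule nn_integral_real_affine[symmetric]) (use a in auto)
  also have "\<dots> = (\<integral>\<^sup>+x. f x \<partial>leb I)"
    unfolding J(1) by (rule nn_integral_leb_insert[symmetric]) (use J in measurable)
  finally show "(\<integral>\<^sup>+x. f x \<partial>leb I) = ennreal \<bar>a\<bar> * (\<integral>\<^sup>+x. f (?T x) \<partial>leb I)" by simp
qed

section \<open>Volume scaling of linear maps and the Cholesky decomposition\<close>

lemma lin_id:
  assumes "finite I" "x \<in> vecs I" "\<And>i j. i \<in> I \<Longrightarrow> j \<in> I \<Longrightarrow> A i j = (if i = j then 1 else 0)"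
  shows "lin I I A x = x"
proof (rule vecs_eqI[OF lin_in assms(2)])
  fix i assume i: "i \<in> I"
  have "lin I I A x i = (\<Sum>j\<in>I. if j = i then x j else 0)"
    unfolding lin_app[OF i] using i assms(3) by (intro sum.cong) auto
  then show "lin I I A x i = x i" using i assms(1) by simp
qed

definition unitv :: "nat set \<Rightarrow> nat \<Rightarrow> nat \<Rightarrow> real" where
  "unitv I i = restrict (\<lambda>j. if j = i then 1 else 0) I"

lemma unitv_in [simp]: "unitv I i \<in> vecs I"
  by (simp add: unitv_def)

lemma dot_unitv [simp]:
  assumes "finite I" "i \<in> I"
  shows "dot I (unitv I i) x = x i" "dot I x (unitv I i) = x i"
proof -
  have "dot I (unitv I i) x = (\<Sum>j\<in>I. if j = i then x j else 0)"
    unfolding dot_def by (rule sum.cong) (auto simp: unitv_def)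
  then show "dot I (unitv I i) x = x i" using assms by simp
  then show "dot I x (unitv I i) = x i" by (simp add: dot_commute)
qed

lemma lin_unitv: "finite J \<Longrightarrow> j \<in> J \<Longrightarrow> i \<in> I \<Longrightarrow> lin I J A (unitv J j) i = A i j"
  using dot_unitv(2)[of J j "A i"] by (simp add: lin_app dot_def)

lemma dot_ext:
  assumes "finite I" "x \<in> vecs I" "y \<in> vecs I" "\<And>z. z \<in> vecs I \<Longrightarrow> dot I z x = dot I z y"
  shows "x = y"
proof (rule vecs_eqI[OF assms(2,3)])
  fix i assume "i \<in> I"
  then show "x i = y i" using assms(4)[of "unitv I i"] assms(1) by simp
qed

definition inv_mat :: "nat set \<Rightarrow> (nat \<Rightarrow> nat \<Rightarrow> real) \<Rightarrow> (nat \<Rightarrow> nat \<Rightarrow> real) \<Rightarrow> bool" where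
  "inv_mat I M N \<longleftrightarrow> (\<forall>x\<in>vecs I. lin I I M (lin I I N x) = x \<and> lin I I N (lin I I M x) = x)"

lemma inv_mat_sym: "inv_mat I M N \<Longrightarrow> inv_mat I N M"
  by (simp add: inv_mat_def)

lemma inv_mat_transp:
  assumes "finite I" "inv_mat I M N"
  shows "inv_mat I (transp M) (transp N)"
proof -
  have "lin I I (transp M) (lin I I (transp N) x) = x" if "inv_mat I M N" "x \<in> vecs I" for M N x
  proof (rule dot_ext[OF assms(1) lin_in that(2)])
    fix z assume z: "z \<in> vecs I"
    have "dot I z (lin I I (transp M) (lin I I (transp N) x)) = dot I (lin I I N (lin I I M z)) x"
      using assms(1) by (simp add: dot_lin)
    then show "dot I z (lin I I (transp M) (lin I I (transp N) x)) = dot I z x"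
      using that(1) z by (simp add: inv_mat_def)
  qed
  from this[OF assms(2)] this[OF inv_mat_sym[OF assms(2)]] show ?thesis
    by (simp add: inv_mat_def)
qed

text \<open>Demanding the same factor for \<open>M\<close> and its transpose stands in for \<open>det M = det (transp M)\<close>; no determinant is used anywhere.\<close>
definition vol_mat :: "nat set \<Rightarrow> (nat \<Rightarrow> nat \<Rightarrow> real) \<Rightarrow> (nat \<Rightarrow> nat \<Rightarrow> real) \<Rightarrow> real \<Rightarrow> bool" where
  "vol_mat I M N d \<longleftrightarrow> scales I (lin I I M) d \<and> scales I (lin I I (transp M)) d \<and> inv_mat I M N"

lemma lin_meas': "lin I J A \<in> leb J \<rightarrow>\<^sub>M leb I"
  using lin_meas[of "\<lambda>x. x" "leb J" J I A] by simp

lemma vol_mat_inverse: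
  assumes "finite I" "vol_mat I M N d"
  shows "vol_mat I N M (1 / d)"
proof -
  have i: "inv_mat I M N" "inv_mat I (transp M) (transp N)"
    using assms inv_mat_transp by (auto simp: vol_mat_def)
  have "scales I (lin I I N) (1 / d)"
    using assms i(1) by (intro scales_inverse[of I "lin I I M", OF _ lin_meas']) (auto simp: vol_mat_def inv_mat_def)
  moreover have "scales I (lin I I (transp N)) (1 / d)"
    using assms i(2) by (intro scales_inverse[of I "lin I I (transp M)", OF _ lin_meas']) (auto simp: vol_mat_def inv_mat_def)
  ultimately show ?thesis using i by (simp add: vol_mat_def inv_mat_sym)
qed

lemma vol_mat_transp:
  assumes "finite I" "vol_mat I M N d"
  shows "vol_mat I (transp M) (transp N) d"
  using assms by (auto simp: vol_mat_def inv_mat_transp)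

lemma vol_mat_mat_mult:
  assumes I: "finite I" and 1: "vol_mat I M N d" and 2: "vol_mat I M' N' d'"
  shows "vol_mat I (mat_mult I M M') (mat_mult I N' N) (d * d')"
proof -
  have "scales I (lin I I (mat_mult I M M')) (d * d')"
    using 1 2 I by (intro scales_cong[OF scales_comp[of I "lin I I M" d "lin I I M'" d']]) (auto simp: vol_mat_def lin_lin)
  moreover have "scales I (lin I I (mat_mult I (transp M') (transp M))) (d' * d)"
    using 1 2 I by (intro scales_cong[OF scales_comp[of I "lin I I (transp M')" d' "lin I I (transp M)" d]]) (auto simp: vol_mat_def lin_lin)
  moreover have "inv_mat I (mat_mult I M M') (mat_mult I N' N)"
    using 1 2 I by (simp add: vol_mat_def inv_mat_def lin_lin[symmetric])
  ultimately show ?thesis by (simp add: vol_mat_def transp_mat_mult mult.commute)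
qed

lemma vol_mat_id:
  assumes "finite I"
  shows "vol_mat I (\<lambda>i j. if i = j then 1 else 0) (\<lambda>i j. if i = j then 1 else 0) 1"
proof -
  have "scales I (\<lambda>x. x) 1" by (simp add: scales_def)
  then have "scales I (lin I I (\<lambda>i j. if i = j then 1 else 0)) 1"
    by (rule scales_cong) (simp add: lin_id[OF assms])
  moreover have "transp (\<lambda>i j. if i = j then 1 else 0) = (\<lambda>i j. if i = j then 1 else 0)"
    by (auto simp: transp_def fun_eq_iff)
  ultimately show ?thesis by (simp add: vol_mat_def inv_mat_def lin_id[OF assms])
qed

lemma vol_mat_shear:
  assumes I: "finite I" and i: "i \<in> I" and a: "a \<noteq> 0"
  shows "vol_mat I (shear i a c) (shear i (1 / a) (\<lambda>j. - c j / a)) \<bar>a\<bar>"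
proof -
  have "lin I I (shear i b e) (lin I I (shear i (1 / b) (\<lambda>j. - e j / b)) x) = x"
    if "x \<in> vecs I" "b \<noteq> 0" for x b e
  proof (rule vecs_eqI[OF lin_in that(1)])
    fix k assume k: "k \<in> I"
    have "(\<Sum>j\<in>I - {i}. e j * lin I I (shear i (1 / b) (\<lambda>j. - e j / b)) x j) = (\<Sum>j\<in>I - {i}. e j * x j)"
      by (rule sum.cong) (auto simp: lin_shear[OF I i])
    moreover have "(\<Sum>j\<in>I - {i}. - e j / b * x j) = - (\<Sum>j\<in>I - {i}. e j * x j) / b"
      by (simp add: sum_divide_distrib sum_negf)
    ultimately show "lin I I (shear i b e) (lin I I (shear i (1 / b) (\<lambda>j. - e j / b)) x) k = x k"
      using k that(2) i by (auto simp: lin_shear[OF I i] field_simps)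
  qed
  note inv = this
  have "(\<lambda>j. - (- c j / a) / (1 / a)) = c" using a by auto
  with inv[of _ a c] inv[of _ "1 / a" "\<lambda>j. - c j / a"] a
  have "inv_mat I (shear i a c) (shear i (1 / a) (\<lambda>j. - c j / a))"
    by (simp add: inv_mat_def)
  then show ?thesis using scales_shear[OF assms] scales_transp_shear[OF assms] by (simp add: vol_mat_def)
qed

section \<open>Quadratic forms and their reduction to sums of squares\<close>

definition quad_form :: "nat set \<Rightarrow> (nat \<Rightarrow> nat \<Rightarrow> real) \<Rightarrow> (nat \<Rightarrow> real) \<Rightarrow> real" where
  "quad_form J S x = (\<Sum>i\<in>J. \<Sum>j\<in>J. S i j * x i * x j)"

text \<open>Completing the square in coordinate \<open>i\<close>; what remains is the Schur
  complement of the entry \<open>S i i\<close>.\<close>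

lemma quad_form_insert:
  assumes J: "finite J" "i \<notin> J" and sym: "\<And>j. j \<in> J \<Longrightarrow> S j i = S i j" and a: "S i i \<noteq> 0"
  shows "quad_form (insert i J) S x = S i i * (x i + (\<Sum>j\<in>J. S i j / S i i * x j))\<^sup>2
     + quad_form J (\<lambda>j k. S j k - S i j * S i k / S i i) x"
proof -
  define b where "b = (\<Sum>j\<in>J. S i j * x j)"
  have b1: "(\<Sum>j\<in>J. S i j * x i * x j) = b * x i" "(\<Sum>j\<in>J. S j i * x j * x i) = b * x i"
    using sym by (auto simp: b_def sum_distrib_right sum_distrib_left mult_ac intro!: sum.cong)
  have b2: "(\<Sum>j\<in>J. S i j / S i i * x j) = b / S i i"
    by (simp add: b_def sum_divide_distrib)
  have bb: "(\<Sum>j\<in>J. \<Sum>k\<in>J. S i j * S i k / S i i * x j * x k) = b * b / S i i"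
    unfolding b_def sum_product by (simp add: sum_divide_distrib mult_ac)
  have "quad_form J (\<lambda>j k. S j k - S i j * S i k / S i i) x = quad_form J S x - b * b / S i i"
    unfolding quad_form_def bb[symmetric] by (simp add: sum_subtractf algebra_simps)
  moreover have "quad_form (insert i J) S x = S i i * x i * x i + 2 * (b * x i) + quad_form J S x"
    using J by (simp add: quad_form_def sum.distrib b1)
  moreover have "S i i * (x i + b / S i i)\<^sup>2 = S i i * x i * x i + 2 * (b * x i) + b * b / S i i"
    using a by (simp add: power2_eq_square field_simps)
  ultimately show ?thesis unfolding b2 by linarith
qed

text \<open>Induction on the set \<open>J\<close> of coordinates that enter the form. All matrices
  live on the full \<open>I\<close>, and \<open>M\<close> fixes the coordinates outside
  \<open>J\<close>; hence the shear that creates the square for a new coordinate can be composed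
  with the matrix for the Schur complement without disturbing that square.\<close>

lemma cholesky_aux:
  assumes "finite J" "finite I" "J \<subseteq> I"
    "\<And>i j. i \<in> J \<Longrightarrow> j \<in> J \<Longrightarrow> S i j = S j i"
    "\<And>x. \<exists>j\<in>J. x j \<noteq> 0 \<Longrightarrow> 0 < quad_form J S x"
  shows "\<exists>M N d. vol_mat I M N d \<and> (\<forall>x. \<forall>i\<in>I - J. lin I I M x i = x i) \<and>
     (\<forall>x. quad_form J S x = (\<Sum>i\<in>J. (lin I I M x i)\<^sup>2))"
  using assms
proof (induction J arbitrary: S rule: finite_induct)
  case empty
  have "lin I I (\<lambda>i j. if i = j then 1 else 0) x i = x i" if "i \<in> I" for x :: "nat \<Rightarrow> real" and i
    using lin_id[OF empty(1), of "restrict x I" "\<lambda>i j. if i = j then 1 else 0"] that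
      lin_cong[of I "restrict x I" x I "\<lambda>i j. if i = j then 1 else 0"] by (auto simp: fun_eq_iff)
  with vol_mat_id[OF empty(1)] show ?case by (auto simp: quad_form_def intro!: exI)
next
  case (insert i J)
  have sym: "\<And>j. j \<in> J \<Longrightarrow> S j i = S i j" using insert.prems(3) by auto
  have a: "S i i > 0"
  proof -
    have "0 < quad_form (insert i J) S (\<lambda>j. if j = i then 1 else 0)"
      by (rule insert.prems(4)) auto
    also have "\<dots> = S i i"
    proof -
      have "j \<noteq> i" if "j \<in> J" for j using that insert.hyps by auto
      then show ?thesis using insert.hyps by (simp add: quad_form_def cong: sum.cong)
    qed
    finally show ?thesis .
  qed
  define S' where "S' = (\<lambda>j k. S j k - S i j * S i k / S i i)"
  have q: "quad_form (insert i J) S x = S i i * (x i + (\<Sum>j\<in>J. S i j / S i i * x j))\<^sup>2 + quad_form J S' x" for x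
    unfolding S'_def by (rule quad_form_insert) (use insert.hyps sym a in auto)
  have "\<exists>M N d. vol_mat I M N d \<and> (\<forall>x. \<forall>i\<in>I - J. lin I I M x i = x i) \<and>
     (\<forall>x. quad_form J S' x = (\<Sum>i\<in>J. (lin I I M x i)\<^sup>2))"
  proof (rule insert.IH)
    show "finite I" "J \<subseteq> I" using insert.prems by auto
    show "S' j k = S' k j" if "j \<in> J" "k \<in> J" for j k
      using insert.prems(3)[of j k] that by (simp add: S'_def)
    fix x :: "nat \<Rightarrow> real" assume "\<exists>j\<in>J. x j \<noteq> 0"
    then obtain j where j: "j \<in> J" "x j \<noteq> 0" by auto
    \<comment> \<open>The value at \<open>i\<close> makes the completed square vanish, so positivity
      of the full form at \<open>y\<close> is positivity of the Schur complement at
      \<open>x\<close>.\<close>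
    define y where "y = x(i := - (\<Sum>j\<in>J. S i j / S i i * x j))"
    have yx: "y k = x k" if "k \<in> J" for k using that insert.hyps by (auto simp: y_def)
    have "0 < quad_form (insert i J) S y"
      using j yx[OF j(1)] by (intro insert.prems(4) bexI[of _ j]) auto
    also have "\<dots> = quad_form J S' y"
    proof -
      have "(\<Sum>j\<in>J. S i j / S i i * y j) = (\<Sum>j\<in>J. S i j / S i i * x j)"
        by (rule sum.cong) (auto simp: yx)
      then show ?thesis unfolding q by (simp add: y_def)
    qed
    also have "\<dots> = quad_form J S' x" unfolding quad_form_def by (intro sum.cong) (auto simp: yx)
    finally show "0 < quad_form J S' x" .
  qed
  then obtain M N d where M: "vol_mat I M N d" "\<And>x k. k \<in> I - J \<Longrightarrow> lin I I M x k = x k"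
    "\<And>x. quad_form J S' x = (\<Sum>i\<in>J. (lin I I M x i)\<^sup>2)" by blast
  \<comment> \<open>With diagonal entry \<open>sqrt (S i i)\<close>, these coefficients make
    coordinate \<open>i\<close> of \<open>lin I I E x\<close> the square root of the completed
    square.\<close>
  define c where "c = (\<lambda>j. if j \<in> J then S i j / sqrt (S i i) else 0)"
  define E where "E = shear i (sqrt (S i i)) c"
  have I: "finite I" "i \<in> I" "i \<in> I - J" "J \<subseteq> I - {i}" using insert by auto
  have gE: "vol_mat I E (shear i (1 / sqrt (S i i)) (\<lambda>j. - c j / sqrt (S i i))) \<bar>sqrt (S i i)\<bar>"
    unfolding E_def by (rule vol_mat_shear) (use I a in auto)
  have LE: "lin I I (mat_mult I M E) x = lin I I M (lin I I E x)" for x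
    using I by (simp add: lin_lin)
  have sq: "lin I I E x i = sqrt (S i i) * (x i + (\<Sum>j\<in>J. S i j / S i i * x j))" for x
  proof -
    have "(\<Sum>j\<in>I - {i}. c j * x j) = (\<Sum>j\<in>J. S i j / sqrt (S i i) * x j)"
      using I by (intro sum.mono_neutral_cong_right) (auto simp: c_def)
    also have "\<dots> = sqrt (S i i) * (\<Sum>j\<in>J. S i j / S i i * x j)"
      unfolding sum_distrib_left using a
      by (intro sum.cong refl) (simp add: field_simps real_sqrt_mult[symmetric])
    finally show ?thesis using I by (simp add: E_def lin_shear algebra_simps)
  qed
  have "quad_form (insert i J) S x = (\<Sum>k\<in>insert i J. (lin I I (mat_mult I M E) x k)\<^sup>2)" for x
  proof -
    have "quad_form J S' x = quad_form J S' (lin I I E x)"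
      unfolding quad_form_def using I insert.hyps by (intro sum.cong) (auto simp: E_def lin_shear[OF I(1,2)] subset_iff)
    then have "quad_form (insert i J) S x = (lin I I E x i)\<^sup>2 + (\<Sum>k\<in>J. (lin I I M (lin I I E x) k)\<^sup>2)"
      unfolding q sq M(3)[symmetric] using a by (simp add: power_mult_distrib)
    then show ?thesis using insert.hyps I by (simp add: LE M(2))
  qed
  moreover have "lin I I (mat_mult I M E) x k = x k" if "k \<in> I - insert i J" for x k
    unfolding LE using that I by (simp add: M(2) E_def lin_shear)
  ultimately show ?case using vol_mat_mat_mult[OF I(1) M(1) gE] by blast
qed

text \<open>\<open>d\<close> squared takes the place of the determinant of \<open>S\<close>. Gram
  matrices, covariance matrices and the matrices that define ellipsoids are all factored by this
  lemma.\<close>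

lemma cholesky:
  assumes "finite I" "\<And>i j. i \<in> I \<Longrightarrow> j \<in> I \<Longrightarrow> S i j = S j i"
    "\<And>x. x \<in> vecs I \<Longrightarrow> \<exists>j\<in>I. x j \<noteq> 0 \<Longrightarrow> 0 < quad_form I S x"
  obtains M N d where "vol_mat I M N d" "\<And>x. quad_form I S x = dot I (lin I I M x) (lin I I M x)"
proof -
  have "0 < quad_form I S x" if "\<exists>j\<in>I. x j \<noteq> 0" for x
  proof -
    have "quad_form I S x = quad_form I S (restrict x I)" by (simp add: quad_form_def)
    then show ?thesis using assms(3)[of "restrict x I"] that by auto
  qed
  from cholesky_aux[OF assms(1,1) subset_refl assms(2) this] that show ?thesis
    by (auto simp: dot_def power2_eq_square)
qed

lemma lin_bound:
  assumes "finite I" "finite J"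
  shows "\<exists>c>0. \<forall>x r. (\<forall>j\<in>J. \<bar>x j\<bar> \<le> r) \<longrightarrow> r \<ge> 0 \<longrightarrow> (\<forall>i\<in>I. \<bar>lin I J A x i\<bar> \<le> c * r)"
proof (intro exI conjI allI impI ballI)
  let ?c = "1 + (\<Sum>i\<in>I. \<Sum>j\<in>J. \<bar>A i j\<bar>)"
  show "?c > 0" by (simp add: add_pos_nonneg sum_nonneg)
  fix x i and r :: real assume x: "\<forall>j\<in>J. \<bar>x j\<bar> \<le> r" and i: "i \<in> I" and r: "r \<ge> 0"
  have "\<bar>lin I J A x i\<bar> \<le> (\<Sum>j\<in>J. \<bar>A i j * x j\<bar>)" using i by (simp add: lin_app)
  also have "\<dots> \<le> (\<Sum>j\<in>J. \<bar>A i j\<bar> * r)"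
    by (intro sum_mono) (simp add: abs_mult mult_left_mono x)
  also have "\<dots> = (\<Sum>j\<in>J. \<bar>A i j\<bar>) * r" by (simp add: sum_distrib_right)
  also have "\<dots> \<le> ?c * r"
  proof (rule mult_right_mono[OF _ r])
    have "(\<Sum>j\<in>J. \<bar>A i j\<bar>) \<le> (\<Sum>i\<in>I. \<Sum>j\<in>J. \<bar>A i j\<bar>)"
      using i assms by (intro member_le_sum) (auto intro: sum_nonneg)
    then show "(\<Sum>j\<in>J. \<bar>A i j\<bar>) \<le> ?c" by simp
  qed
  finally show "\<bar>lin I J A x i\<bar> \<le> ?c * r" .
qed

definition cube :: "nat set \<Rightarrow> real \<Rightarrow> (nat \<Rightarrow> real) set" where
  "cube I r = PiE I (\<lambda>_. {-r..r})"

lemma cube_iff: "x \<in> cube I r \<longleftrightarrow> x \<in> vecs I \<and> (\<forall>i\<in>I. \<bar>x i\<bar> \<le> r)"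
  by (auto simp: cube_def PiE_iff abs_le_iff)

lemma cube_sets [measurable]: "finite I \<Longrightarrow> cube I r \<in> sets (leb I)"
  unfolding cube_def leb_def by (rule sets_PiM_I_finite) auto

lemma emeasure_cube: "finite I \<Longrightarrow> r \<ge> 0 \<Longrightarrow> emeasure (leb I) (cube I r) = ennreal ((2 * r) ^ card I)"
  unfolding cube_def by (subst emeasure_leb_PiE) (auto simp: ennreal_power)

text \<open>Uniqueness of Haar measure: both \<open>\<integral> f\<close> and \<open>\<integral> f (T x)\<close> are read off from \<open>\<integral>\<integral> f (x + T y) g (T y)\<close>, with \<open>g\<close> the indicator of a cube, by exchanging the integrals.\<close>
lemma scales_linear:
  assumes I: "finite I" and inv: "inv_mat I A N"
  shows "\<exists>d. scales I (lin I I A) d"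
proof -
  let ?T = "lin I I A"
  interpret pair_sigma_finite "leb I" "leb I" by (rule pair_sigma_finite_leb[OF I I])
  obtain a where a: "a > 0" "\<And>x r i. (\<forall>j\<in>I. \<bar>x j\<bar> \<le> r) \<Longrightarrow> r \<ge> 0 \<Longrightarrow> i \<in> I \<Longrightarrow> \<bar>lin I I A x i\<bar> \<le> a * r"
    using lin_bound[OF I I, of A] by blast
  obtain b where b: "b > 0" "\<And>x r i. (\<forall>j\<in>I. \<bar>x j\<bar> \<le> r) \<Longrightarrow> r \<ge> 0 \<Longrightarrow> i \<in> I \<Longrightarrow> \<bar>lin I I N x i\<bar> \<le> b * r"
    using lin_bound[OF I I, of N] by blast
  let ?C = "{x \<in> vecs I. ?T x \<in> cube I 1}"
  define v where "v = emeasure (leb I) ?C"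
  have Cm [measurable]: "?C \<in> sets (leb I)"
  proof -
    have "?T -` cube I 1 \<inter> space (leb I) \<in> sets (leb I)"
      by (rule measurable_sets[OF lin_meas' cube_sets[OF I]])
    also have "?T -` cube I 1 \<inter> space (leb I) = ?C" by auto
    finally show ?thesis .
  qed
  \<comment> \<open>\<open>A\<close> and its inverse \<open>N\<close> are bounded maps, so the
    preimage of the unit cube lies between two cubes and its volume \<open>v\<close> can be divided
    by.\<close>
  have "cube I (1 / a) \<subseteq> ?C" using a(2)[of _ "1 / a"] a(1) by (auto simp: cube_iff)
  then have v1: "v \<ge> ennreal ((2 * (1 / a)) ^ card I)"
    unfolding v_def using a(1) I by (subst emeasure_cube[symmetric]) (auto intro!: emeasure_mono)
  have "?C \<subseteq> cube I b"
  proof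
    fix x assume x: "x \<in> ?C"
    then have "x = lin I I N (?T x)" using inv by (auto simp: inv_mat_def)
    then show "x \<in> cube I b" using x b(2)[of "?T x" 1] by (auto simp: cube_iff)
  qed
  then have v2: "v \<le> ennreal ((2 * b) ^ card I)"
    unfolding v_def using b(1) I by (subst emeasure_cube[symmetric]) (auto intro!: emeasure_mono)
  have "0 < (2 * (1 / a)) ^ card I" using a(1) by simp
  then have vpos: "v \<noteq> 0" using v1 by (metis ennreal_eq_0_iff le_zero_eq not_le)
  have vfin: "v < \<top>" using v2 by (rule le_less_trans) simp
  obtain w where w: "v = ennreal w" "w > 0"
    using vpos vfin by (cases v) (auto simp: less_le)
  have main: "(\<integral>\<^sup>+x. f x \<partial>leb I) * v = ennreal (2 ^ card I) * (\<integral>\<^sup>+x. f (?T x) \<partial>leb I)"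
    if [measurable]: "f \<in> borel_measurable (leb I)" for f :: "_ \<Rightarrow> ennreal"
  proof -
    define g :: "(nat \<Rightarrow> real) \<Rightarrow> ennreal" where "g = indicator (cube I 1)"
    have gm [measurable]: "g \<in> borel_measurable (leb I)" unfolding g_def using I by measurable
    have gT: "(\<integral>\<^sup>+y. g (?T y) \<partial>leb I) = v"
    proof -
      have "(\<integral>\<^sup>+y. g (?T y) \<partial>leb I) = (\<integral>\<^sup>+y. indicator ?C y \<partial>leb I)"
        by (rule nn_integral_cong) (auto simp: g_def indicator_def)
      then show ?thesis using Cm by (simp add: v_def)
    qed
    have "(\<integral>\<^sup>+x. f x \<partial>leb I) * v = (\<integral>\<^sup>+y. (\<integral>\<^sup>+x. f x \<partial>leb I) * g (?T y) \<partial>leb I)"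
      by (subst nn_integral_cmult) (auto simp: gT)
    also have "\<dots> = (\<integral>\<^sup>+y. (\<integral>\<^sup>+x. f (comb I 1 x 1 (?T y)) * g (?T y) \<partial>leb I) \<partial>leb I)"
    proof (rule nn_integral_cong)
      fix y assume "y \<in> space (leb I)"
      have "(\<integral>\<^sup>+x. f x \<partial>leb I) = ennreal (\<bar>1\<bar> ^ card I) * (\<integral>\<^sup>+x. f (comb I 1 x 1 (?T y)) \<partial>leb I)"
        by (rule scales_D[OF scales_affine[OF I]]) auto
      moreover have "(\<lambda>x. f (comb I 1 x 1 (?T y))) \<in> borel_measurable (leb I)"
        by (rule measurable_compose[OF comb_meas]) (auto intro!: measurable_const)
      ultimately show "(\<integral>\<^sup>+x. f x \<partial>leb I) * g (?T y) = (\<integral>\<^sup>+x. f (comb I 1 x 1 (?T y)) * g (?T y) \<partial>leb I)"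
        by (simp add: nn_integral_multc)
    qed
    also have "\<dots> = (\<integral>\<^sup>+x. (\<integral>\<^sup>+y. f (comb I 1 x 1 (?T y)) * g (?T y) \<partial>leb I) \<partial>leb I)"
      by (rule Fubini') measurable
    also have "\<dots> = (\<integral>\<^sup>+x. (\<integral>\<^sup>+y. f (?T y) * g (comb I 1 (?T y) (-1) x) \<partial>leb I) \<partial>leb I)"
    proof (rule nn_integral_cong)
      fix x assume x: "x \<in> space (leb I)"
      have xm: "(\<lambda>_. x) \<in> leb I \<rightarrow>\<^sub>M leb I" using x by (intro measurable_const)
      \<comment> \<open>Translating y by the preimage of -x under \<open>A\<close> turns x + T y
        into T y and T y into T y - x, which moves the dependence on x from \<open>f\<close> to
        \<open>g\<close>.\<close>
      let ?F = "\<lambda>y. f (comb I 1 x 1 (?T y)) * g (?T y)"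
      have "(\<lambda>y. f (comb I 1 x 1 (?T y))) \<in> borel_measurable (leb I)"
        by (rule measurable_compose[OF comb_meas]) (auto intro!: xm lin_meas')
      then have Fm: "?F \<in> borel_measurable (leb I)" by measurable
      have "(\<integral>\<^sup>+y. ?F y \<partial>leb I) = ennreal (\<bar>1\<bar> ^ card I) * (\<integral>\<^sup>+y. ?F (comb I 1 y 1 (lin I I N (comb I (-1) x 0 x))) \<partial>leb I)"
        by (rule scales_D[OF scales_affine[OF I] Fm]) simp
      also have "\<dots> = (\<integral>\<^sup>+y. f (?T y) * g (comb I 1 (?T y) (-1) x) \<partial>leb I)"
      proof -
        have "?F (comb I 1 y 1 (lin I I N (comb I (-1) x 0 x))) = f (?T y) * g (comb I 1 (?T y) (-1) x)" for y
        proof -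
          have "?T (comb I 1 y 1 (lin I I N (comb I (-1) x 0 x))) = comb I 1 (?T y) 1 (comb I (-1) x 0 x)"
            using inv by (simp add: inv_mat_def del: lin_comb add: lin_comb[of I I A 1 y])
          moreover have "comb I 1 (?T y) 1 (comb I (-1) x 0 x) = comb I 1 (?T y) (-1) x"
            by (rule vecs_eqI[of _ I]) auto
          moreover have "comb I 1 x 1 (comb I 1 (?T y) (-1) x) = ?T y"
            by (rule vecs_eqI[of _ I]) auto
          ultimately show ?thesis by simp
        qed
        then show ?thesis by simp
      qed
      finally show "(\<integral>\<^sup>+y. ?F y \<partial>leb I) = (\<integral>\<^sup>+y. f (?T y) * g (comb I 1 (?T y) (-1) x) \<partial>leb I)" .
    qed
    also have "\<dots> = (\<integral>\<^sup>+y. (\<integral>\<^sup>+x. f (?T y) * g (comb I 1 (?T y) (-1) x) \<partial>leb I) \<partial>leb I)"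
      by (rule Fubini'[symmetric]) measurable
    also have "\<dots> = (\<integral>\<^sup>+y. f (?T y) * ennreal (2 ^ card I) \<partial>leb I)"
    proof (rule nn_integral_cong)
      fix y assume "y \<in> space (leb I)"
      have "ennreal (2 ^ card I) = (\<integral>\<^sup>+x. g x \<partial>leb I)"
        unfolding g_def using I by (simp add: emeasure_cube)
      also have "\<dots> = ennreal (\<bar>-1\<bar> ^ card I) * (\<integral>\<^sup>+x. g (comb I (-1) x 1 (?T y)) \<partial>leb I)"
        by (rule scales_D[OF scales_affine[OF I]]) auto
      also have "(\<lambda>x. comb I (-1) x 1 (?T y)) = (\<lambda>x. comb I 1 (?T y) (-1) x)"
        by (auto simp: comb_def fun_eq_iff)
      finally have "ennreal (2 ^ card I) = (\<integral>\<^sup>+x. g (comb I 1 (?T y) (-1) x) \<partial>leb I)" by simp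
      moreover have "(\<lambda>x. g (comb I 1 (?T y) (-1) x)) \<in> borel_measurable (leb I)"
        by (rule measurable_compose[OF comb_meas]) (auto intro!: measurable_const)
      ultimately show "(\<integral>\<^sup>+x. f (?T y) * g (comb I 1 (?T y) (-1) x) \<partial>leb I) = f (?T y) * ennreal (2 ^ card I)"
        by (simp add: nn_integral_cmult)
    qed
    also have "\<dots> = ennreal (2 ^ card I) * (\<integral>\<^sup>+x. f (?T x) \<partial>leb I)"
      by (subst nn_integral_multc) (auto simp: mult.commute)
    finally show ?thesis .
  qed
  have "scales I ?T (2 ^ card I / w)"
    unfolding scales_def
  proof (intro conjI ballI)
    show "?T \<in> leb I \<rightarrow>\<^sub>M leb I" by (rule lin_meas')
    show "0 < 2 ^ card I / w" using w by simp
    fix f :: "(nat \<Rightarrow> real) \<Rightarrow> ennreal" assume f: "f \<in> borel_measurable (leb I)"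
    have "(\<integral>\<^sup>+x. f x \<partial>leb I) = (\<integral>\<^sup>+x. f x \<partial>leb I) * v * ennreal (1 / w)"
      using w by (simp add: mult.assoc ennreal_mult'[symmetric])
    also have "\<dots> = ennreal (2 ^ card I / w) * (\<integral>\<^sup>+x. f (?T x) \<partial>leb I)"
      unfolding main[OF f] using w by (simp add: mult_ac ennreal_mult'[symmetric] ennreal_mult''[symmetric])
        (simp add: mult.assoc[symmetric] ennreal_mult'[symmetric] ennreal_mult''[symmetric])
    finally show "(\<integral>\<^sup>+x. f x \<partial>leb I) = ennreal (2 ^ card I / w) * (\<integral>\<^sup>+x. f (?T x) \<partial>leb I)" .
  qed
  then show ?thesis by blast
qed

section \<open>Orthonormal frames\<close>

definition gauss :: "nat set \<Rightarrow> (nat \<Rightarrow> real) \<Rightarrow> real" where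
  "gauss I x = exp (- dot I x x / 2)"

lemma gauss_meas [measurable (raw)]:
  assumes [measurable]: "f \<in> M \<rightarrow>\<^sub>M leb I"
  shows "(\<lambda>x. gauss I (f x)) \<in> borel_measurable M"
  unfolding gauss_def by measurable

lemma gauss_pos [simp]: "0 < gauss I x" "0 \<le> gauss I x"
  by (auto simp: gauss_def)

lemma gauss_prod: "finite I \<Longrightarrow> gauss I x = (\<Prod>i\<in>I. sqrt (2 * pi) * std_normal_density (x i))"
  by (simp add: gauss_def dot_def normal_density_def exp_sum sum_divide_distrib power2_eq_square sum_negf[symmetric])

lemma nn_integral_std_normal: "(\<integral>\<^sup>+x. ennreal (std_normal_density x) \<partial>lborel) = 1"
proof -
  interpret prob_space "density lborel std_normal_density"
    by (rule prob_space_normal_density) simp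
  from emeasure_space_1 show ?thesis by (simp add: emeasure_density)
qed

lemma nn_integral_gauss:
  assumes "finite I"
  shows "(\<integral>\<^sup>+x. ennreal (gauss I x) \<partial>leb I) = ennreal (sqrt (2 * pi) ^ card I)"
proof -
  have "(\<integral>\<^sup>+x. ennreal (gauss I x) \<partial>leb I) = (\<integral>\<^sup>+x. (\<Prod>i\<in>I. ennreal (sqrt (2 * pi) * std_normal_density (x i))) \<partial>leb I)"
    using assms by (intro nn_integral_cong) (simp add: gauss_prod prod_ennreal)
  also have "\<dots> = (\<Prod>i\<in>I. (\<integral>\<^sup>+x. ennreal (sqrt (2 * pi) * std_normal_density x) \<partial>lborel))"
    unfolding leb_def by (rule lborel_prod.product_nn_integral_prod[OF assms]) simp
  also have "(\<integral>\<^sup>+x. ennreal (sqrt (2 * pi) * std_normal_density x) \<partial>lborel) = ennreal (sqrt (2 * pi))"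
    by (subst ennreal_mult') (auto simp: nn_integral_cmult nn_integral_std_normal)
  finally show ?thesis by (simp add: ennreal_power)
qed

text \<open>\<open>scales_linear\<close> supplies some factor; the Gaussian integral is invariant
  under the isometry and neither 0 nor infinite, so the factor is 1.\<close>

lemma scales_isometry:
  assumes I: "finite I" and inv: "inv_mat I A N"
    and iso: "\<And>x. x \<in> vecs I \<Longrightarrow> dot I (lin I I A x) (lin I I A x) = dot I x x"
  shows "scales I (lin I I A) 1"
proof -
  obtain d where d: "scales I (lin I I A) d" using scales_linear[OF I inv] by blast
  have "(\<integral>\<^sup>+x. ennreal (gauss I x) \<partial>leb I) = ennreal d * (\<integral>\<^sup>+x. ennreal (gauss I (lin I I A x)) \<partial>leb I)"
    by (rule scales_D[OF d]) measurable
  also have "(\<integral>\<^sup>+x. ennreal (gauss I (lin I I A x)) \<partial>leb I) = (\<integral>\<^sup>+x. ennreal (gauss I x) \<partial>leb I)"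
    by (rule nn_integral_cong) (simp add: gauss_def iso)
  finally have "sqrt (2 * pi) ^ card I = d * sqrt (2 * pi) ^ card I"
    using scales_pos[OF d] unfolding nn_integral_gauss[OF I] by (simp flip: ennreal_mult')
  then show ?thesis using d by simp
qed

text \<open>The orthonormal vectors are the columns, indexed by \<open>J\<close>, so that
  \<open>lin I J U\<close> is an isometric embedding of the smaller space.\<close>

definition frame :: "nat set \<Rightarrow> nat set \<Rightarrow> (nat \<Rightarrow> nat \<Rightarrow> real) \<Rightarrow> bool" where
  "frame I J U \<longleftrightarrow> (\<forall>i\<in>J. \<forall>j\<in>J. (\<Sum>l\<in>I. U l i * U l j) = (if i = j then 1 else 0))"

lemma frame_transp_lin:
  assumes "finite I" "finite J" "frame I J U" "x \<in> vecs J"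
  shows "lin J I (transp U) (lin I J U x) = x"
  unfolding lin_lin[OF assms(1,2)]
  by (rule lin_id[OF assms(2,4)]) (use assms(3) in \<open>auto simp: mat_mult_def transp_def frame_def\<close>)

lemma frame_dot:
  assumes "finite I" "finite J" "frame I J U"
  shows "dot I (lin I J U x) (lin I J U y) = dot J x y"
proof -
  have "lin J I (transp U) (lin I J U y) = restrict y J"
    using frame_transp_lin[OF assms, of "restrict y J"] lin_cong[of J "restrict y J" y I U] by simp
  then have "dot I (lin I J U x) (lin I J U y) = dot J x (restrict y J)"
    using assms by (simp add: dot_lin)
  also have "\<dots> = dot J x y" by (rule dot_cong) auto
  finally show ?thesis .
qed

text \<open>Polarisation recovers all inner products from norms; unit vectors then give the entries
  of the Gram matrix.\<close>

lemma frame_of_isometry: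
  assumes "finite I" "finite J" and iso: "\<And>x. x \<in> vecs J \<Longrightarrow> dot I (lin I J U x) (lin I J U x) = dot J x x"
  shows "frame I J U"
  unfolding frame_def
proof (intro ballI)
  fix i j assume ij: "i \<in> J" "j \<in> J"
  have polar_set: "dot I (lin I J U x) (lin I J U y) = dot J x y" if "x \<in> vecs J" "y \<in> vecs J" for x y
    using iso[of "comb J 1 x 1 y"] iso[OF that(1)] iso[OF that(2)]
      dot_commute[of I "lin I J U x" "lin I J U y"] dot_commute[of J x y] by simp
  have "dot I (lin I J U (unitv J i)) (lin I J U (unitv J j)) = (\<Sum>l\<in>I. U l i * U l j)"
    unfolding dot_def using ij assms by (intro sum.cong) (auto simp: lin_unitv)
  moreover have "dot J (unitv J i) (unitv J j) = (if i = j then 1 else 0)"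
    using ij assms(1,2) by simp (simp add: unitv_def)
  ultimately show "(\<Sum>l\<in>I. U l i * U l j) = (if i = j then 1 else 0)"
    using polar_set[of "unitv J i" "unitv J j"] by simp
qed

text \<open>\<open>r\<close> is the unit vector at \<open>l\<close> minus its orthogonal projection
  to the span of the columns; the second claim is Pythagoras.\<close>

lemma frame_residual:
  assumes "finite I" "finite J" "frame I J U" "l \<in> I"
    and r_def: "r = (\<lambda>i. (if i = l then 1 else 0) - (\<Sum>j\<in>J. U l j * U i j))"
  shows "\<And>j. j \<in> J \<Longrightarrow> (\<Sum>i\<in>I. r i * U i j) = 0"
    and "(\<Sum>i\<in>I. r i * r i) = 1 - (\<Sum>j\<in>J. U l j * U l j)"
proof -
  show orth: "(\<Sum>i\<in>I. r i * U i j) = 0" if j: "j \<in> J" for j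
  proof -
    have "(\<Sum>i\<in>I. r i * U i j) = (\<Sum>i\<in>I. (if i = l then U i j else 0)) - (\<Sum>i\<in>I. \<Sum>k\<in>J. U l k * (U i k * U i j))"
      unfolding r_def by (simp add: left_diff_distrib sum_subtractf sum_distrib_right mult.assoc if_distrib[of "\<lambda>x. x * _"] cong: if_cong)
    also have "(\<Sum>i\<in>I. \<Sum>k\<in>J. U l k * (U i k * U i j)) = (\<Sum>k\<in>J. U l k * (\<Sum>i\<in>I. U i k * U i j))"
      by (subst sum.swap) (simp add: sum_distrib_left)
    also have "\<dots> = (\<Sum>k\<in>J. if k = j then U l k else 0)"
      using assms(3) j by (intro sum.cong) (auto simp: frame_def)
    finally show ?thesis using assms(1,2,4) j by simp
  qed
  have "(\<Sum>i\<in>I. r i * r i) = (\<Sum>i\<in>I. (if i = l then r i else 0)) - (\<Sum>i\<in>I. \<Sum>j\<in>J. U l j * (r i * U i j))"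
    unfolding sum_subtractf[symmetric]
  proof (rule sum.cong[OF refl])
    fix i
    have "r i * r i = r i * ((if i = l then 1 else 0) - (\<Sum>j\<in>J. U l j * U i j))" by (simp add: r_def)
    also have "\<dots> = (if i = l then r i else 0) - (\<Sum>j\<in>J. U l j * (r i * U i j))"
      unfolding right_diff_distrib sum_distrib_left by (simp add: mult_ac)
    finally show "r i * r i = (if i = l then r i else 0) - (\<Sum>j\<in>J. U l j * (r i * U i j))" .
  qed
  also have "(\<Sum>i\<in>I. \<Sum>j\<in>J. U l j * (r i * U i j)) = (\<Sum>j\<in>J. U l j * (\<Sum>i\<in>I. r i * U i j))"
    by (subst sum.swap) (simp add: sum_distrib_left)
  finally show "(\<Sum>i\<in>I. r i * r i) = 1 - (\<Sum>j\<in>J. U l j * U l j)"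
    using assms(1,4) by (simp add: orth) (simp add: r_def)
qed

lemma frame_col_sum:
  assumes "finite I" "finite J" "frame I J U"
  shows "(\<Sum>l\<in>I. \<Sum>j\<in>J. U l j * U l j) = real (card J)"
  using assms by (subst sum.swap) (simp add: frame_def)

text \<open>A Gram-Schmidt step. The squared lengths of the projected unit vectors sum to
  \<open>card J\<close>, which is less than \<open>card I\<close>, so some unit vector has a nonzero
  residual, and this is normalised.\<close>

lemma frame_extend_one:
  assumes "finite I" "J \<subset> I" "frame I J U" "j0 \<in> I - J"
  shows "\<exists>U'. frame I (insert j0 J) U' \<and> (\<forall>j\<in>J. \<forall>l. U' l j = U l j)"
proof -
  have fJ: "finite J" using assms finite_subset by blast
  have "\<exists>l\<in>I. (\<Sum>j\<in>J. U l j * U l j) < 1"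
  proof (rule ccontr)
    assume "\<not> ?thesis"
    then have "(\<Sum>l\<in>I. 1) \<le> (\<Sum>l\<in>I. \<Sum>j\<in>J. U l j * U l j)" by (intro sum_mono) auto
    then have "card I \<le> card J" using frame_col_sum[OF assms(1) fJ assms(3)] by simp
    then show False using psubset_card_mono[OF assms(1,2)] by simp
  qed
  then obtain l where l: "l \<in> I" "(\<Sum>j\<in>J. U l j * U l j) < 1" by blast
  define r where "r = (\<lambda>i. (if i = l then 1 else 0) - (\<Sum>j\<in>J. U l j * U i j))"
  note R = frame_residual[OF assms(1) fJ assms(3) l(1) r_def]
  define s where "s = sqrt (\<Sum>i\<in>I. r i * r i)"
  have pos: "0 < (\<Sum>i\<in>I. r i * r i)" using l(2) R(2) by linarith
  then have s: "s > 0" "s * s = (\<Sum>i\<in>I. r i * r i)" by (simp_all add: s_def)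
  define U' where "U' = (\<lambda>i j. if j = j0 then r i / s else U i j)"
  have o1: "(\<Sum>i\<in>I. (r i / s) * U i j) = 0" "(\<Sum>i\<in>I. U i j * (r i / s)) = 0" if "j \<in> J" for j
  proof -
    have "(\<Sum>i\<in>I. (r i / s) * U i j) = (\<Sum>i\<in>I. r i * U i j) / s"
      by (simp add: sum_divide_distrib)
    then show "(\<Sum>i\<in>I. (r i / s) * U i j) = 0" using R(1)[OF that] by simp
    then show "(\<Sum>i\<in>I. U i j * (r i / s)) = 0" by (simp add: mult.commute)
  qed
  have o2: "(\<Sum>i\<in>I. (r i / s) * (r i / s)) = 1"
  proof -
    have "(\<Sum>i\<in>I. (r i / s) * (r i / s)) = (\<Sum>i\<in>I. r i * r i) / (s * s)"
      by (simp add: sum_divide_distrib)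
    also have "\<dots> = 1" using s pos by simp
    finally show ?thesis .
  qed
  have "frame I (insert j0 J) U'"
    unfolding frame_def
  proof (intro ballI)
    fix i j assume "i \<in> insert j0 J" "j \<in> insert j0 J"
    then show "(\<Sum>l\<in>I. U' l i * U' l j) = (if i = j then 1 else 0)"
      using o1 o2 assms(3,4) by (cases "i = j0"; cases "j = j0") (auto simp: U'_def frame_def)
  qed
  moreover have "\<forall>j\<in>J. \<forall>l. U' l j = U l j" using assms(4) by (auto simp: U'_def)
  ultimately show ?thesis by blast
qed

lemma frame_extend:
  assumes I: "finite I" and J: "J \<subseteq> I" "frame I J U"
  shows "\<exists>U'. frame I I U' \<and> (\<forall>j\<in>J. \<forall>l. U' l j = U l j)"
  using J
proof (induction "card (I - J)" arbitrary: J U rule: less_induct)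
  case less
  show ?case
  proof (cases "J = I")
    case True then show ?thesis using less.prems by blast
  next
    case False
    then obtain j0 where j0: "j0 \<in> I - J" using less.prems by blast
    have "J \<subset> I" using False less.prems by blast
    from frame_extend_one[OF I this less.prems(2) j0] obtain U1
      where U1: "frame I (insert j0 J) U1" "\<And>j l. j \<in> J \<Longrightarrow> U1 l j = U l j" by blast
    have "card (I - insert j0 J) < card (I - J)"
      by (rule psubset_card_mono) (use I j0 in auto)
    from less.hyps[OF this _ U1(1)] j0 less.prems(1) U1(2) show ?thesis by fastforce
  qed
qed

text \<open>For \<open>J = I\<close> the same count of squared lengths forces every residual to
  vanish, so the rows are orthonormal as well and the transpose is a two-sided inverse.\<close>

lemma frame_full_inv:
  assumes I: "finite I" and U: "frame I I U"
  shows "inv_mat I U (transp U)"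
proof -
  have le: "(\<Sum>j\<in>I. U l j * U l j) \<le> 1" if "l \<in> I" for l
    using frame_residual(2)[OF I I U that refl] sum_nonneg[of I "\<lambda>i. ((if i = l then 1 else 0) - (\<Sum>j\<in>I. U l j * U i j)) *
      ((if i = l then 1 else 0) - (\<Sum>j\<in>I. U l j * U i j))"] by simp
  have eq: "(\<Sum>j\<in>I. U l j * U l j) = 1" if l: "l \<in> I" for l
  proof (rule ccontr)
    assume "\<not> ?thesis"
    then have "(\<Sum>j\<in>I. U l j * U l j) < 1" using le[OF l] by simp
    then have "(\<Sum>l\<in>I. \<Sum>j\<in>I. U l j * U l j) < (\<Sum>l\<in>I. 1)"
      using I l le by (intro sum_strict_mono_ex1) auto
    then show False using frame_col_sum[OF I I U] by simp
  qed
  have dual: "(\<Sum>j\<in>I. U l j * U i j) = (if i = l then 1 else 0)" if l: "l \<in> I" and i: "i \<in> I" for l i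
  proof -
    have "(\<Sum>i\<in>I. ((if i = l then 1 else 0) - (\<Sum>j\<in>I. U l j * U i j)) * ((if i = l then 1 else 0) - (\<Sum>j\<in>I. U l j * U i j))) = 0"
      using frame_residual(2)[OF I I U l refl] eq[OF l] by simp
    then have "\<forall>i\<in>I. ((if i = l then 1 else 0) - (\<Sum>j\<in>I. U l j * U i j)) * ((if i = l then 1 else 0) - (\<Sum>j\<in>I. U l j * U i j)) = 0"
      using I by (subst (asm) sum_nonneg_eq_0_iff) auto
    then show ?thesis using i by auto
  qed
  have "lin I I U (lin I I (transp U) x) = x" if "x \<in> vecs I" for x
    unfolding lin_lin[OF I I] by (rule lin_id[OF I that]) (auto simp: mat_mult_def transp_def dual)
  then show ?thesis using frame_transp_lin[OF I I U] by (simp add: inv_mat_def)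
qed

lemma scales_frame:
  assumes I: "finite I" and U: "frame I I U"
  shows "scales I (lin I I U) 1" "scales I (lin I I (transp U)) 1"
proof -
  show s: "scales I (lin I I U) 1"
    by (rule scales_isometry[OF I frame_full_inv[OF I U]]) (rule frame_dot[OF I I U])
  have "scales I (lin I I (transp U)) (1 / 1)"
    using frame_full_inv[OF I U] by (intro scales_inverse[OF s lin_meas']) (auto simp: inv_mat_def)
  then show "scales I (lin I I (transp U)) 1" by simp
qed

section \<open>Gaussian matrices\<close>

definition nrm :: "nat set \<Rightarrow> (nat \<Rightarrow> real) \<Rightarrow> real" where
  "nrm I x = sqrt (dot I x x)"

lemma nrm_meas [measurable (raw)]:
  assumes [measurable]: "f \<in> M \<rightarrow>\<^sub>M leb I"
  shows "(\<lambda>x. nrm I (f x)) \<in> borel_measurable M"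
  unfolding nrm_def by measurable

lemma nrm_nonneg [simp]: "0 \<le> nrm I x"
  by (simp add: nrm_def)

lemma nrm_sq: "(nrm I x)\<^sup>2 = dot I x x"
  by (simp add: nrm_def)

lemma nrm_eq_0: "finite I \<Longrightarrow> nrm I x = 0 \<longleftrightarrow> (\<forall>i\<in>I. x i = 0)"
  by (auto simp: nrm_def dot_def sum_nonneg_eq_0_iff)

lemma nrm_scale: "nrm I (comb I c x 0 y) = \<bar>c\<bar> * nrm I x"
proof -
  have "dot I (comb I c x 0 y) (comb I c x 0 y) = c\<^sup>2 * dot I x x"
    by (simp add: power2_eq_square)
  then show ?thesis by (simp add: nrm_def real_sqrt_mult)
qed

lemma abs_le_nrm: "finite I \<Longrightarrow> i \<in> I \<Longrightarrow> \<bar>x i\<bar> \<le> nrm I x"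
proof -
  assume I: "finite I" "i \<in> I"
  have "(x i)\<^sup>2 \<le> dot I x x"
    unfolding dot_def using I member_le_sum[of i I "\<lambda>i. x i * x i"] by (simp add: power2_eq_square)
  then have "sqrt ((x i)\<^sup>2) \<le> nrm I x" unfolding nrm_def by (rule real_sqrt_le_mono)
  then show ?thesis by simp
qed

lemma gauss_nrm: "gauss I x = exp (- (nrm I x)\<^sup>2 / 2)"
  by (simp add: gauss_def nrm_sq)

lemma AE_nonzero:
  assumes "finite I" "I \<noteq> {}"
  shows "AE x in leb I. nrm I x \<noteq> 0"
proof (rule AE_I')
  show "cube I 0 \<in> null_sets (leb I)"
    using assms by (auto simp: null_sets_def emeasure_cube)
  show "{x \<in> space (leb I). \<not> nrm I x \<noteq> 0} \<subseteq> cube I 0"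
    using assms by (auto simp: nrm_eq_0 cube_iff)
qed

section \<open>Standard Gaussian vectors and matrices\<close>

abbreviation N01 :: "real measure" where "N01 \<equiv> density lborel std_normal_density"

lemma N01_prob: "prob_space N01"
  by (rule prob_space_normal_density) simp

lemma PiM_density_leb:
  assumes I: "finite I" and f: "f \<in> borel_measurable borel" "prob_space (density lborel f)"
  shows "PiM I (\<lambda>_. density lborel f) = density (leb I) (\<lambda>x. \<Prod>i\<in>I. f (x i))"
proof -
  interpret p: prob_space "density lborel f" by fact
  interpret product_sigma_finite "\<lambda>_::nat. density lborel f"
    by unfold_locales
  have [measurable]: "f \<in> borel_measurable borel" by fact
  have m: "(\<lambda>x. \<Prod>i\<in>I. f (x i)) \<in> borel_measurable (leb I)" by measurable
  have "density (leb I) (\<lambda>x. \<Prod>i\<in>I. f (x i)) = PiM I (\<lambda>_. density lborel f)"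
  proof (rule PiM_eqI[OF I])
    show "sets (density (leb I) (\<lambda>x. \<Prod>i\<in>I. f (x i))) = sets (PiM I (\<lambda>_. density lborel f))"
      unfolding leb_def by (simp cong: sets_PiM_cong)
    fix A :: "nat \<Rightarrow> real set" assume "\<And>i. i \<in> I \<Longrightarrow> A i \<in> sets (density lborel f)"
    then have A: "\<And>i. i \<in> I \<Longrightarrow> A i \<in> sets borel" by simp
    have PA: "PiE I A \<in> sets (leb I)"
      unfolding leb_def by (rule sets_PiM_I_finite) (use I A in auto)
    have "emeasure (density (leb I) (\<lambda>x. \<Prod>i\<in>I. f (x i))) (PiE I A) = (\<integral>\<^sup>+x. (\<Prod>i\<in>I. f (x i)) * indicator (PiE I A) x \<partial>leb I)"
      by (rule emeasure_density[OF m PA])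
    also have "\<dots> = (\<integral>\<^sup>+x. (\<Prod>i\<in>I. f (x i) * indicator (A i) (x i)) \<partial>leb I)"
    proof (rule nn_integral_cong)
      fix x assume "x \<in> space (leb I)"
      then have "indicator (PiE I A) x = (\<Prod>i\<in>I. indicator (A i) (x i) :: ennreal)"
        using I by (auto simp: indicator_def PiE_iff prod_zero_iff)
      then show "(\<Prod>i\<in>I. f (x i)) * indicator (PiE I A) x = (\<Prod>i\<in>I. f (x i) * indicator (A i) (x i))"
        by (simp add: prod.distrib)
    qed
    also have "\<dots> = (\<Prod>i\<in>I. (\<integral>\<^sup>+x. f x * indicator (A i) x \<partial>lborel))"
      unfolding leb_def by (rule lborel_prod.product_nn_integral_prod[OF I]) (use A in auto)
    also have "\<dots> = (\<Prod>i\<in>I. emeasure (density lborel f) (A i))"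
      using A by (intro prod.cong refl) (simp add: emeasure_density)
    finally show "emeasure (density (leb I) (\<lambda>x. \<Prod>i\<in>I. f (x i))) (PiE I A) = (\<Prod>i\<in>I. emeasure (density lborel f) (A i))" .
  qed
  then show ?thesis by simp
qed

definition gauss_row :: "nat set \<Rightarrow> (nat \<Rightarrow> real) measure" where
  "gauss_row J = PiM J (\<lambda>_. N01)"

lemma sets_gauss_row [measurable_cong]: "sets (gauss_row J) = sets (leb J)"
  unfolding gauss_row_def leb_def by (rule sets_PiM_cong) auto

lemma space_gauss_row [simp]: "space (gauss_row J) = vecs J"
  by (simp add: gauss_row_def space_PiM)

lemma gauss_row_prob: "prob_space (gauss_row J)"
  unfolding gauss_row_def by (rule prob_space_PiM) (rule N01_prob)

lemma gauss_row_component: "j \<in> J \<Longrightarrow> distributed (gauss_row J) lborel (\<lambda>r. r j) std_normal_density"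
proof -
  assume j: "j \<in> J"
  interpret product_prob_space "\<lambda>_::nat. N01" J
    by (intro product_prob_spaceI N01_prob)
  have "distr (gauss_row J) N01 (\<lambda>r. r j) = N01"
    unfolding gauss_row_def by (rule PiM_component[OF j])
  moreover have "distr (gauss_row J) lborel (\<lambda>r. r j) = distr (gauss_row J) N01 (\<lambda>r. r j)"
    by (rule distr_cong) auto
  moreover have "(\<lambda>r. r j) \<in> gauss_row J \<rightarrow>\<^sub>M lborel"
    using leb_component[OF j] by (simp add: measurable_cong_sets[OF sets_gauss_row refl])
  ultimately show ?thesis by (simp add: distributed_def)
qed

text \<open>Independent centred normal variables add their variances, and the weighted variances
  \<open>(t j)^2\<close> sum to the squared norm of \<open>t\<close>.\<close>

lemma gauss_row_dot:
  assumes J: "finite J" and t: "nrm J t \<noteq> 0"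
  shows "distr (gauss_row J) lborel (\<lambda>r. dot J r t) = density lborel (normal_density 0 (nrm J t))"
proof -
  interpret prob_space "gauss_row J" by (rule gauss_row_prob)
  \<comment> \<open>Normal densities need a positive deviation, so terms with coefficient 0 are
    dropped before the sum rule for independent normals is applied.\<close>
  define J' where "J' = {j\<in>J. t j \<noteq> 0}"
  have J': "finite J'" "J' \<noteq> {}" "J' \<subseteq> J" using J t by (auto simp: J'_def nrm_eq_0)
  have rv: "random_variable borel (\<lambda>r. r j)" if "j \<in> J" for j
    using distributed_measurable[OF gauss_row_component[OF that]] by simp
  have ind: "indep_vars (\<lambda>_. borel) (\<lambda>j r. r j) J"
  proof (subst indep_vars_iff_distr_eq_PiM')
    show "J \<noteq> {}" using J' by auto
    show "random_variable borel (\<lambda>r. r j)" if "j \<in> J" for j by (rule rv[OF that])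
    have "distr (gauss_row J) (PiM J (\<lambda>_. borel)) (\<lambda>x. \<lambda>i\<in>J. x i) = distr (gauss_row J) (gauss_row J) (\<lambda>x. x)"
    proof (rule distr_cong)
      show "sets (PiM J (\<lambda>_. borel)) = sets (gauss_row J)"
        unfolding gauss_row_def by (rule sets_PiM_cong) auto
      show "(\<lambda>i\<in>J. x i) = x" if "x \<in> space (gauss_row J)" for x
        using that by (simp add: PiE_restrict)
    qed simp
    also have "\<dots> = gauss_row J" by simp
    also have "\<dots> = PiM J (\<lambda>i. distr (gauss_row J) borel (\<lambda>r. r i))"
    proof -
      have "PiM J (\<lambda>i. distr (gauss_row J) borel (\<lambda>r. r i)) = PiM J (\<lambda>_. N01)"
      proof (rule PiM_cong[OF refl])
        fix j assume j: "j \<in> J"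
        have "distr (gauss_row J) borel (\<lambda>r. r j) = distr (gauss_row J) lborel (\<lambda>r. r j)" by (rule distr_cong) auto
        then show "distr (gauss_row J) borel (\<lambda>r. r j) = N01"
          using distributed_distr_eq_density[OF gauss_row_component[OF j]] by simp
      qed
      then show "gauss_row J = PiM J (\<lambda>i. distr (gauss_row J) borel (\<lambda>r. r i))" by (simp add: gauss_row_def)
    qed
    finally show "distr (gauss_row J) (PiM J (\<lambda>_. borel)) (\<lambda>x. \<lambda>i\<in>J. x i) = PiM J (\<lambda>i. distr (gauss_row J) borel (\<lambda>r. r i))" .
  qed
  have ind2: "indep_vars (\<lambda>_. borel) (\<lambda>j r. t j * r j) J'"
    by (rule indep_vars_compose2[OF indep_vars_subset[OF ind J'(3)]]) measurable
  have dist: "distributed (gauss_row J) lborel (\<lambda>r. \<Sum>j\<in>J'. t j * r j) (normal_density (\<Sum>j\<in>J'. 0) (sqrt (\<Sum>j\<in>J'. \<bar>t j\<bar>\<^sup>2)))"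
  proof (rule sum_indep_normal[OF J'(1,2) ind2])
    fix j assume j: "j \<in> J'"
    show "0 < \<bar>t j\<bar>" using j by (auto simp: J'_def)
    have "distributed (gauss_row J) lborel (\<lambda>r. 0 + t j * r j) (normal_density (0 + t j * 0) (\<bar>t j\<bar> * 1))"
      by (rule normal_density_affine[OF gauss_row_component]) (use j in \<open>auto simp: J'_def\<close>)
    then show "distributed (gauss_row J) lborel (\<lambda>r. t j * r j) (normal_density 0 \<bar>t j\<bar>)" by simp
  qed
  have "(\<Sum>j\<in>J'. t j * r j) = dot J r t" for r
    unfolding dot_def using J by (intro sum.mono_neutral_cong_left) (auto simp: J'_def)
  moreover have "(\<Sum>j\<in>J'. \<bar>t j\<bar>\<^sup>2) = dot J t t"
    unfolding dot_def using J by (intro sum.mono_neutral_cong_left) (auto simp: J'_def power2_eq_square)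
  ultimately have "distributed (gauss_row J) lborel (\<lambda>r. dot J r t) (normal_density 0 (nrm J t))"
    using dist by (simp add: nrm_def)
  then show ?thesis by (rule distributed_distr_eq_density)
qed

text \<open>The product is over rows, because each coordinate of \<open>G t\<close> is a row of
  \<open>G\<close> paired with \<open>t\<close>; independence of the coordinates of
  \<open>G t\<close> is then immediate.\<close>

definition gauss_mat :: "nat set \<Rightarrow> nat set \<Rightarrow> (nat \<Rightarrow> nat \<Rightarrow> real) measure" where
  "gauss_mat I J = PiM I (\<lambda>_. gauss_row J)"

lemma gauss_mat_prob: "prob_space (gauss_mat I J)"
  unfolding gauss_mat_def by (rule prob_space_PiM) (rule gauss_row_prob)

lemma gauss_mat_row: "i \<in> I \<Longrightarrow> (\<lambda>G. G i) \<in> gauss_mat I J \<rightarrow>\<^sub>M leb J"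
proof -
  assume "i \<in> I"
  then have "(\<lambda>G. G i) \<in> gauss_mat I J \<rightarrow>\<^sub>M gauss_row J" unfolding gauss_mat_def by (rule measurable_component_singleton)
  then show ?thesis by (simp add: measurable_cong_sets[OF refl sets_gauss_row])
qed

lemma gauss_mat_entry [measurable]: "i \<in> I \<Longrightarrow> j \<in> J \<Longrightarrow> (\<lambda>G. G i j) \<in> borel_measurable (gauss_mat I J)"
  using measurable_leb_comp[OF gauss_mat_row] .

lemma nrm_kernel:
  assumes "finite I" "s > 0"
  shows "(\<Prod>i\<in>I. normal_density 0 s (y i)) = (1 / (sqrt (2 * pi) * s) ^ card I) * exp (- (nrm I y)\<^sup>2 / (2 * s\<^sup>2))"
proof -
  have "(\<Prod>i\<in>I. normal_density 0 s (y i)) = (\<Prod>i\<in>I. 1 / (sqrt (2 * pi) * s)) * (\<Prod>i\<in>I. exp (- (y i)\<^sup>2 / (2 * s\<^sup>2)))"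
    using assms by (simp add: normal_density_def real_sqrt_mult prod.distrib[symmetric] prod_dividef power_one_over)
  also have "(\<Prod>i\<in>I. exp (- (y i)\<^sup>2 / (2 * s\<^sup>2))) = exp (- (nrm I y)\<^sup>2 / (2 * s\<^sup>2))"
    unfolding nrm_sq dot_def exp_sum[OF assms(1), symmetric]
    by (simp add: sum_divide_distrib[symmetric] sum_negf power2_eq_square)
  finally show ?thesis by (simp add: power_one_over)
qed

text \<open>The coordinates of \<open>G t\<close> are independent centred normals of deviation |t|.
  This makes the law of a random point in a random subspace explicit.\<close>

lemma gauss_mat_lin:
  assumes I: "finite I" and J: "finite J" and t: "nrm J t \<noteq> 0" and F [measurable]: "F \<in> borel_measurable (leb I)"
  shows "(\<integral>\<^sup>+G. F (lin I J G t) \<partial>gauss_mat I J) =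
    (\<integral>\<^sup>+y. F y * ennreal ((1 / (sqrt (2 * pi) * nrm J t) ^ card I) * exp (- (nrm I y)\<^sup>2 / (2 * (nrm J t)\<^sup>2))) \<partial>leb I)"
proof -
  let ?s = "nrm J t"
  have s: "?s > 0" using t nrm_nonneg[of J t] by linarith
  let ?f = "\<lambda>r. dot J r t"
  have fm: "?f \<in> gauss_row J \<rightarrow>\<^sub>M N01"
  proof -
    have "?f \<in> borel_measurable (leb J)" by measurable
    then show ?thesis by (simp add: measurable_cong_sets[OF sets_gauss_row refl])
  qed
  have setsN: "sets (PiM I (\<lambda>_. N01)) = sets (leb I)"
    unfolding leb_def by (rule sets_PiM_cong) auto
  have "distr (gauss_mat I J) (PiM I (\<lambda>_. N01)) (compose I ?f) = PiM I (\<lambda>_. distr (gauss_row J) N01 ?f)"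
    unfolding gauss_mat_def by (rule distr_PiM_finite_prob_space'[OF I]) (auto intro: gauss_row_prob N01_prob fm)
  also have "distr (gauss_row J) N01 ?f = distr (gauss_row J) lborel ?f" by (rule distr_cong) auto
  also have "\<dots> = density lborel (normal_density 0 ?s)" by (rule gauss_row_dot[OF J t])
  also have "PiM I (\<lambda>_. density lborel (normal_density 0 ?s)) = density (leb I) (\<lambda>x. \<Prod>i\<in>I. ennreal (normal_density 0 ?s (x i)))"
    by (rule PiM_density_leb[OF I]) (use s in \<open>auto intro!: prob_space_normal_density\<close>)
  finally have D: "distr (gauss_mat I J) (PiM I (\<lambda>_. N01)) (compose I ?f) = density (leb I) (\<lambda>x. \<Prod>i\<in>I. ennreal (normal_density 0 ?s (x i)))" .
  have cm: "compose I ?f \<in> gauss_mat I J \<rightarrow>\<^sub>M PiM I (\<lambda>_. N01)"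
  proof -
    have "(\<lambda>G. restrict (\<lambda>i. ?f (G i)) I) \<in> gauss_mat I J \<rightarrow>\<^sub>M leb I"
      by (rule measurable_lbI) (rule dot_meas_const(1)[OF gauss_mat_row])
    moreover have "compose I ?f = (\<lambda>G. restrict (\<lambda>i. ?f (G i)) I)" by (simp add: compose_def fun_eq_iff)
    ultimately show ?thesis by (simp add: measurable_cong_sets[OF refl setsN])
  qed
  have FN: "F \<in> borel_measurable (PiM I (\<lambda>_. N01))" using F by (simp add: measurable_cong_sets[OF setsN refl])
  have cl: "compose I ?f G = lin I J G t" for G
    by (auto simp: compose_def lin_def dot_def fun_eq_iff)
  have "(\<integral>\<^sup>+G. F (lin I J G t) \<partial>gauss_mat I J) = (\<integral>\<^sup>+y. F y \<partial>distr (gauss_mat I J) (PiM I (\<lambda>_. N01)) (compose I ?f))"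
    by (subst nn_integral_distr[OF cm]) (use FN in \<open>simp_all add: cl\<close>)
  also have "\<dots> = (\<integral>\<^sup>+y. (\<Prod>i\<in>I. ennreal (normal_density 0 ?s (y i))) * F y \<partial>leb I)"
    unfolding D by (rule nn_integral_density) measurable
  also have "\<dots> = (\<integral>\<^sup>+y. F y * ennreal ((1 / (sqrt (2 * pi) * ?s) ^ card I) * exp (- (nrm I y)\<^sup>2 / (2 * ?s\<^sup>2))) \<partial>leb I)"
    unfolding nrm_kernel[OF I s, symmetric] by (simp add: prod_ennreal mult.commute)
  finally show ?thesis .
qed

lemma suminf_geometric_half: "k \<ge> 1 \<Longrightarrow> (\<Sum>a. ennreal ((1 / 2 ^ k) ^ a)) \<le> 2"
proof -
  assume k: "k \<ge> (1::nat)"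
  have p: "(2::real) ^ k \<ge> 2" using power_increasing[OF k, of "2::real"] by simp
  have "(\<lambda>a. (1 / 2 ^ k :: real) ^ a) sums (1 / (1 - 1 / 2 ^ k))"
    by (rule geometric_sums) (use p in simp)
  then have "(\<Sum>a. ennreal ((1 / 2 ^ k) ^ a)) = ennreal (1 / (1 - 1 / 2 ^ k))"
    by (intro suminf_ennreal_eq) auto
  also have "\<dots> \<le> ennreal 2"
    by (rule ennreal_leI) (use p in \<open>simp add: field_simps\<close>)
  finally show ?thesis by simp
qed

lemma emeasure_ball_cube:
  assumes "finite J" "r \<ge> 0"
  shows "emeasure (leb J) {x \<in> vecs J. nrm J x < r} \<le> ennreal ((2 * r) ^ card J)"
proof -
  have "{x \<in> vecs J. nrm J x < r} \<subseteq> cube J r"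
    using abs_le_nrm[OF assms(1)] by (auto simp: cube_iff) (meson less_eq_real_def order_trans)
  then show ?thesis using emeasure_mono[of _ "cube J r" "leb J"] assms by (simp add: emeasure_cube)
qed

text \<open>The density, at a point of norm \<open>a\<close>, of the centred normal distribution on
  n-space with deviation \<open>s\<close> in each coordinate. It is read as a function of both
  \<open>a\<close> and \<open>s\<close>.\<close>

definition gauss_kernel :: "nat \<Rightarrow> real \<Rightarrow> real \<Rightarrow> real" where
  "gauss_kernel n a s = (1 / (sqrt (2 * pi) * s) ^ n) * exp (- a\<^sup>2 / (2 * s\<^sup>2))"

text \<open>The exponential beats \<open>1 / s ^ n\<close> as s tends to 0, and for large s it is
  dropped. The constant comes from x^n <= n! exp x with x = 1 / (2 s^2), after bounding u^n by 1 +
  u^(2n) for u = 1 / s.\<close>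

lemma gauss_kernel_bound:
  assumes "s > 0"
  shows "gauss_kernel n 1 s \<le> (1 + 2 ^ n * fact n)" "gauss_kernel n 1 s \<le> 1 / s ^ n"
proof -
  have s2: "1 \<le> sqrt (2 * pi)" using pi_gt3 by simp
  have le: "1 / (sqrt (2 * pi) * s) ^ n \<le> 1 / s ^ n"
    using assms s2 by (intro divide_left_mono power_mono mult_pos_pos) (auto simp: mult_le_cancel_right1)
  have e1: "gauss_kernel n 1 s \<le> (1 / s ^ n) * exp (- 1\<^sup>2 / (2 * s\<^sup>2))"
    unfolding gauss_kernel_def by (rule mult_right_mono[OF le]) simp
  also have "\<dots> \<le> (1 / s ^ n) * 1" by (rule mult_left_mono) (use assms in auto)
  finally show "gauss_kernel n 1 s \<le> 1 / s ^ n" by simp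
  define u where "u = 1 / s"
  define x where "x = u\<^sup>2 / 2"
  have u: "u > 0" using assms by (simp add: u_def)
  have x: "x \<ge> 0" by (simp add: x_def)
  have "u ^ n \<le> 1 + (u\<^sup>2) ^ n"
  proof (cases "u \<le> 1")
    case True
    then have "u ^ n \<le> 1" using u by (intro power_le_one) auto
    moreover have "0 \<le> (u\<^sup>2) ^ n" by simp
    ultimately show ?thesis by linarith
  next
    case False
    then have "u ^ n \<le> u ^ (2 * n)" by (intro power_increasing) auto
    then show ?thesis by (simp add: power_mult[symmetric])
  qed
  also have "(u\<^sup>2) ^ n = 2 ^ n * x ^ n" by (simp add: x_def power_divide)
  also have "x ^ n \<le> fact n * exp x"
  proof -
    have "x ^ n / fact n \<le> exp x"
    proof -
      have "(\<Sum>i\<in>{n}. x ^ i /\<^sub>R fact i) \<le> exp x"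
        unfolding exp_def using x by (intro sum_le_suminf summable_exp_generic) auto
      then show ?thesis by (simp add: field_simps)
    qed
    then show ?thesis by (simp add: field_simps)
  qed
  finally have un: "u ^ n \<le> 1 + 2 ^ n * (fact n * exp x)" by simp
  have "gauss_kernel n 1 s \<le> u ^ n * exp (- x)"
    using e1 by (simp add: u_def x_def power_one_over field_simps)
  also have "\<dots> \<le> (1 + 2 ^ n * (fact n * exp x)) * exp (- x)"
    by (rule mult_right_mono[OF un]) simp
  also have "\<dots> = exp (- x) + 2 ^ n * fact n" by (simp add: distrib_right exp_minus)
  also have "\<dots> \<le> 1 + 2 ^ n * fact n" using x by simp
  finally show "gauss_kernel n 1 s \<le> (1 + 2 ^ n * fact n)" .
qed

text \<open>Dyadic shells: where 2^a <= |t| < 2^(a+1), the kernel is at most 2^(-a n) while the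
  volume grows like 2^(a card J), so \<open>card J < n\<close> gives a geometric series. The ball of
  index a = 0 uses the bound that holds down to deviation 0.\<close>

lemma gauss_kernel_integral:
  assumes J: "finite J" "J \<noteq> {}" and n: "card J < n"
  shows "(\<integral>\<^sup>+t. ennreal (gauss_kernel n 1 (nrm J t)) \<partial>leb J) < \<top>" "(\<integral>\<^sup>+t. ennreal (gauss_kernel n 1 (nrm J t)) \<partial>leb J) \<noteq> 0"
proof -
  have km [measurable]: "(\<lambda>t. gauss_kernel n 1 (nrm J t)) \<in> borel_measurable (leb J)"
    unfolding gauss_kernel_def by measurable
  define C :: real where "C = 1 + 2 ^ n * fact n"
  have C: "C \<ge> 1" by (simp add: C_def)
  let ?B = "\<lambda>a::nat. {t \<in> vecs J. nrm J t < 2 ^ (a + 1)}"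
  have Bm [measurable]: "?B a \<in> sets (leb J)" for a
  proof -
    have "{t \<in> space (leb J). nrm J t < 2 ^ (a + 1)} \<in> sets (leb J)" by measurable
    then show ?thesis by simp
  qed
  have pt: "ennreal (gauss_kernel n 1 (nrm J t)) \<le> (\<Sum>a. ennreal (C / 2 ^ (a * n)) * indicator (?B a) t)"
    if t: "t \<in> vecs J" "nrm J t \<noteq> 0" for t
  proof -
    have s: "nrm J t > 0" using t nrm_nonneg[of J t] by linarith
    obtain b where "nrm J t < real b" using reals_Archimedean2 by blast
    also have "real b < 2 ^ b" by (rule of_nat_less_two_power)
    also have "(2::real) ^ b \<le> 2 ^ (b + 1)" by simp
    finally have ex: "\<exists>b. nrm J t < 2 ^ (b + 1)" by blast
    define a where "a = (LEAST b. nrm J t < 2 ^ (b + 1))"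
    have a: "nrm J t < 2 ^ (a + 1)" unfolding a_def by (rule LeastI_ex[OF ex])
    have "gauss_kernel n 1 (nrm J t) \<le> C / 2 ^ (a * n)"
    proof (cases a)
      case 0 then show ?thesis using gauss_kernel_bound(1)[OF s, of n] by (simp add: C_def)
    next
      case (Suc b)
      have "\<not> nrm J t < 2 ^ (b + 1)" using not_less_Least[of b "\<lambda>b. nrm J t < 2 ^ (b + 1)"] Suc by (simp add: a_def)
      then have "2 ^ a \<le> nrm J t" using Suc by simp
      then have "(2 ^ a) ^ n \<le> nrm J t ^ n" by (rule power_mono) simp
      then have "1 / nrm J t ^ n \<le> 1 / 2 ^ (a * n)"
        using s by (intro divide_left_mono) (auto simp: power_mult)
      also have "\<dots> \<le> C / 2 ^ (a * n)" using C by (simp add: divide_right_mono)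
      finally show ?thesis using gauss_kernel_bound(2)[OF s, of n] by linarith
    qed
    define F where "F a = ennreal (C / 2 ^ (a * n)) * indicator (?B a) t" for a
    have "ennreal (gauss_kernel n 1 (nrm J t)) \<le> F a"
      using \<open>gauss_kernel n 1 (nrm J t) \<le> C / 2 ^ (a * n)\<close> a t by (simp add: F_def ennreal_leI)
    also have "F a = sum F {a}" by simp
    also have "\<dots> \<le> (\<Sum>a. F a)"
      by (rule sum_le_suminf) (auto simp: summableI)
    finally show ?thesis by (simp add: F_def)
  qed
  let ?k = "n - card J"
  have "(\<integral>\<^sup>+t. ennreal (gauss_kernel n 1 (nrm J t)) \<partial>leb J) \<le> (\<integral>\<^sup>+t. (\<Sum>a. ennreal (C / 2 ^ (a * n)) * indicator (?B a) t) \<partial>leb J)"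
  proof (rule nn_integral_mono_AE)
    show "AE t in leb J. ennreal (gauss_kernel n 1 (nrm J t)) \<le> (\<Sum>a. ennreal (C / 2 ^ (a * n)) * indicator (?B a) t)"
      using AE_nonzero[OF J] AE_space[of "leb J"] by eventually_elim (use pt in simp)
  qed
  also have "\<dots> = (\<Sum>a. (\<integral>\<^sup>+t. ennreal (C / 2 ^ (a * n)) * indicator (?B a) t \<partial>leb J))"
    by (rule nn_integral_suminf) measurable
  also have "\<dots> = (\<Sum>a. ennreal (C / 2 ^ (a * n)) * emeasure (leb J) (?B a))"
    by (simp only: nn_integral_cmult_indicator[OF Bm])
  also have "\<dots> \<le> (\<Sum>a. ennreal (C * 4 ^ card J) * ennreal ((1 / 2 ^ ?k) ^ a))"
  proof (rule suminf_le)
    fix a :: nat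
    have "ennreal (C / 2 ^ (a * n)) * emeasure (leb J) (?B a) \<le> ennreal (C / 2 ^ (a * n)) * ennreal ((2 * 2 ^ (a + 1)) ^ card J)"
      by (rule mult_left_mono[OF emeasure_ball_cube[OF J(1)]]) auto
    also have "\<dots> = ennreal (C / 2 ^ (a * n) * (2 * 2 ^ (a + 1)) ^ card J)"
      by (rule ennreal_mult'[symmetric]) (use C in simp)
    also have "C / 2 ^ (a * n) * (2 * 2 ^ (a + 1)) ^ card J = C * 4 ^ card J * (1 / 2 ^ ?k) ^ a"
    proof -
      have "a * (card J + ?k) = a * card J + ?k * a" by (simp add: algebra_simps)
      then have "a * n = a * card J + ?k * a" using n by simp
      then have "(2::real) ^ (a * n) = 2 ^ (a * card J) * 2 ^ (?k * a)" by (simp add: power_add)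
      moreover have "(2 * 2 ^ (a + 1) :: real) ^ card J = 4 ^ card J * 2 ^ (a * card J)"
      proof -
        have "(2 * 2 ^ (a + 1) :: real) = 4 * 2 ^ a" by simp
        then show ?thesis by (simp only: power_mult_distrib power_mult)
      qed
      ultimately show ?thesis by (simp add: power_divide power_mult)
    qed
    also have "ennreal (C * 4 ^ card J * (1 / 2 ^ ?k) ^ a) = ennreal (C * 4 ^ card J) * ennreal ((1 / 2 ^ ?k) ^ a)"
      using C by (intro ennreal_mult') simp
    finally show "ennreal (C / 2 ^ (a * n)) * emeasure (leb J) (?B a) \<le> ennreal (C * 4 ^ card J) * ennreal ((1 / 2 ^ ?k) ^ a)" .
  qed (auto simp: summableI)
  also have "\<dots> = ennreal (C * 4 ^ card J) * (\<Sum>a. ennreal ((1 / 2 ^ ?k) ^ a))" by simp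
  also have "\<dots> \<le> ennreal (C * 4 ^ card J) * 2"
    by (rule mult_left_mono[OF suminf_geometric_half]) (use n in auto)
  also have "\<dots> < \<top>" by (simp add: ennreal_mult_less_top)
  finally show "(\<integral>\<^sup>+t. ennreal (gauss_kernel n 1 (nrm J t)) \<partial>leb J) < \<top>" .
  show "(\<integral>\<^sup>+t. ennreal (gauss_kernel n 1 (nrm J t)) \<partial>leb J) \<noteq> 0"
  proof
    assume "(\<integral>\<^sup>+t. ennreal (gauss_kernel n 1 (nrm J t)) \<partial>leb J) = 0"
    then have "AE t in leb J. ennreal (gauss_kernel n 1 (nrm J t)) = 0"
      by (subst (asm) nn_integral_0_iff_AE) auto
    with AE_nonzero[OF J] have "AE t in leb J. False"
    proof eventually_elim
      case (elim t)
      then have "nrm J t > 0" using nrm_nonneg[of J t] by linarith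
      then have "gauss_kernel n 1 (nrm J t) > 0" by (simp add: gauss_kernel_def)
      then show ?case using elim by simp
    qed
    then have "emeasure (leb J) (space (leb J)) = 0"
      by (subst (asm) AE_iff_measurable[OF sets.top]) auto
    moreover have "emeasure (leb J) (cube J 1) \<le> emeasure (leb J) (space (leb J))"
      by (rule emeasure_space)
    ultimately show False using J by (simp add: emeasure_cube)
  qed
qed

lemma gauss_kernel_scale:
  assumes "a > 0"
  shows "gauss_kernel n a (a * s) = 1 / a ^ n * gauss_kernel n 1 s"
  using assms by (simp add: gauss_kernel_def power_mult_distrib)

lemma gauss_kernel_meas [measurable (raw)]:
  assumes [measurable]: "f \<in> borel_measurable M" "g \<in> borel_measurable M"
  shows "(\<lambda>x. gauss_kernel n (f x) (g x)) \<in> borel_measurable M"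
  unfolding gauss_kernel_def by measurable

lemma comb_zero: "comb I c x 1 (\<lambda>_. 0) = comb I c x 0 x"
  by (rule vecs_eqI[of _ I]) auto

text \<open>The substitution t -> a t, with \<open>gauss_kernel_scale\<close>. The exponent is the
  codimension, and this is the origin of the weight \<open>1 / nrm I y ^ k\<close> in all slicing
  estimates.\<close>

lemma gauss_kernel_integral_scale:
  assumes J: "finite J" and n: "card J \<le> n" and a: "a > 0"
  shows "(\<integral>\<^sup>+t. ennreal (gauss_kernel n a (nrm J t)) \<partial>leb J) =
    ennreal (1 / a ^ (n - card J)) * (\<integral>\<^sup>+t. ennreal (gauss_kernel n 1 (nrm J t)) \<partial>leb J)"
proof -
  have "(\<integral>\<^sup>+t. ennreal (gauss_kernel n a (nrm J t)) \<partial>leb J) =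
     ennreal (\<bar>a\<bar> ^ card J) * (\<integral>\<^sup>+t. ennreal (gauss_kernel n a (nrm J (comb J a t 1 (\<lambda>_. 0)))) \<partial>leb J)"
    by (rule scales_D[OF scales_affine[OF J]]) (use a in auto)
  also have "(\<integral>\<^sup>+t. ennreal (gauss_kernel n a (nrm J (comb J a t 1 (\<lambda>_. 0)))) \<partial>leb J) =
     (\<integral>\<^sup>+t. ennreal (1 / a ^ n) * ennreal (gauss_kernel n 1 (nrm J t)) \<partial>leb J)"
    using a by (intro nn_integral_cong) (simp add: comb_zero nrm_scale gauss_kernel_scale ennreal_mult'[symmetric])
  also have "\<dots> = ennreal (1 / a ^ n) * (\<integral>\<^sup>+t. ennreal (gauss_kernel n 1 (nrm J t)) \<partial>leb J)"
    by (rule nn_integral_cmult) measurable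
  also have "ennreal (\<bar>a\<bar> ^ card J) * \<dots> = ennreal (\<bar>a\<bar> ^ card J * (1 / a ^ n)) * (\<integral>\<^sup>+t. ennreal (gauss_kernel n 1 (nrm J t)) \<partial>leb J)"
    using a by (simp add: mult.assoc[symmetric] ennreal_mult'[symmetric])
  also have "\<bar>a\<bar> ^ card J * (1 / a ^ n) = 1 / a ^ (n - card J)"
    using a n by (simp add: power_diff)
  finally show ?thesis .
qed

lemma lin_gauss_mat_meas [measurable]:
  "(\<lambda>p. lin I J (snd p) (fst p)) \<in> leb J \<Otimes>\<^sub>M gauss_mat I J \<rightarrow>\<^sub>M leb I"
  "(\<lambda>p. lin I J (fst p) (snd p)) \<in> gauss_mat I J \<Otimes>\<^sub>M leb J \<rightarrow>\<^sub>M leb I"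
  unfolding lin_def by (rule measurable_lbI; measurable)+

text \<open>For fixed \<open>t\<close> the inner average is an integral over y against the kernel of
  |y| and |t|. After exchanging the integrals, the integral of this kernel over \<open>t\<close>
  depends on |y| by scaling alone.\<close>

lemma gauss_average:
  assumes I: "finite I" and J: "finite J" "J \<noteq> {}" "card J < card I"
    and h [measurable]: "h \<in> borel_measurable (leb I)"
  shows "(\<integral>\<^sup>+t. (\<integral>\<^sup>+G. h (lin I I T (lin I J G t)) \<partial>gauss_mat I J) \<partial>leb J) =
    (\<integral>\<^sup>+t. ennreal (gauss_kernel (card I) 1 (nrm J t)) \<partial>leb J) *
    (\<integral>\<^sup>+y. h (lin I I T y) * ennreal (1 / nrm I y ^ (card I - card J)) \<partial>leb I)"
proof -
  let ?n = "card I"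
  have I0: "I \<noteq> {}" using J by auto
  interpret pair_sigma_finite "leb J" "leb I" by (rule pair_sigma_finite_leb[OF J(1) I])
  have hm [measurable]: "(\<lambda>y. h (lin I I T y)) \<in> borel_measurable (leb I)" by measurable
  have "(\<integral>\<^sup>+t. (\<integral>\<^sup>+G. h (lin I I T (lin I J G t)) \<partial>gauss_mat I J) \<partial>leb J) =
    (\<integral>\<^sup>+t. (\<integral>\<^sup>+y. h (lin I I T y) * ennreal (gauss_kernel ?n (nrm I y) (nrm J t)) \<partial>leb I) \<partial>leb J)"
  proof (rule nn_integral_cong_AE)
    show "AE t in leb J. (\<integral>\<^sup>+G. h (lin I I T (lin I J G t)) \<partial>gauss_mat I J) =
       (\<integral>\<^sup>+y. h (lin I I T y) * ennreal (gauss_kernel ?n (nrm I y) (nrm J t)) \<partial>leb I)"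
      using AE_nonzero[OF J(1,2)]
    proof eventually_elim
      case (elim t)
      from gauss_mat_lin[OF I J(1) elim hm] show ?case by (simp add: gauss_kernel_def)
    qed
  qed
  also have "\<dots> = (\<integral>\<^sup>+y. (\<integral>\<^sup>+t. h (lin I I T y) * ennreal (gauss_kernel ?n (nrm I y) (nrm J t)) \<partial>leb J) \<partial>leb I)"
    by (rule Fubini'[symmetric]) measurable
  also have "\<dots> = (\<integral>\<^sup>+y. (\<integral>\<^sup>+t. ennreal (gauss_kernel ?n 1 (nrm J t)) \<partial>leb J) * (h (lin I I T y) * ennreal (1 / nrm I y ^ (?n - card J))) \<partial>leb I)"
  proof (rule nn_integral_cong_AE)
    show "AE y in leb I. (\<integral>\<^sup>+t. h (lin I I T y) * ennreal (gauss_kernel ?n (nrm I y) (nrm J t)) \<partial>leb J) =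
       (\<integral>\<^sup>+t. ennreal (gauss_kernel ?n 1 (nrm J t)) \<partial>leb J) * (h (lin I I T y) * ennreal (1 / nrm I y ^ (?n - card J)))"
      using AE_nonzero[OF I I0]
    proof eventually_elim
      case (elim y)
      have y: "nrm I y > 0" using elim nrm_nonneg[of I y] by linarith
      have "(\<integral>\<^sup>+t. h (lin I I T y) * ennreal (gauss_kernel ?n (nrm I y) (nrm J t)) \<partial>leb J) =
         h (lin I I T y) * (\<integral>\<^sup>+t. ennreal (gauss_kernel ?n (nrm I y) (nrm J t)) \<partial>leb J)"
        by (rule nn_integral_cmult) measurable
      then show ?case
        using gauss_kernel_integral_scale[OF J(1) _ y, of ?n] J(3) by (simp add: mult_ac)
    qed
  qed
  also have "\<dots> = (\<integral>\<^sup>+t. ennreal (gauss_kernel ?n 1 (nrm J t)) \<partial>leb J) *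
    (\<integral>\<^sup>+y. h (lin I I T y) * ennreal (1 / nrm I y ^ (?n - card J)) \<partial>leb I)"
    by (rule nn_integral_cmult) measurable
  finally show ?thesis .
qed

text \<open>A kernel vector of \<open>A\<close> would be a direction of translation invariance, so the integral would diverge. This replaces an argument that Gaussian matrices are almost surely injective.\<close>
lemma inj_of_finite_gauss:
  assumes I: "finite I" and J: "finite J"
    and fin: "(\<integral>\<^sup>+t. ennreal (gauss I (lin I J A t)) \<partial>leb J) < \<top>"
    and t0: "t0 \<in> vecs J" "j \<in> J" "t0 j \<noteq> 0"
  shows "dot I (lin I J A t0) (lin I J A t0) > 0"
proof (rule ccontr)
  assume "\<not> ?thesis"
  then have "dot I (lin I J A t0) (lin I J A t0) = 0"
    using dot_self_nonneg[of I "lin I J A t0"] by linarith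
  then have "nrm I (lin I J A t0) = 0" by (simp add: nrm_def)
  then have A0: "lin I J A t0 i = 0" if "i \<in> I" for i using that nrm_eq_0[OF I] by blast
  define K where "K = J - {j}"
  have K: "J = insert j K" "j \<notin> K" "finite K" using J t0 by (auto simp: K_def)
  \<comment> \<open>It sends x(j := y) to x(j := 0) + y t0. Along the last summand \<open>A\<close>
    vanishes, so after this substitution the integrand no longer depends on coordinate j.\<close>
  define S where "S = lin J J (transp (shear j (t0 j) t0))"
  have sS: "scales J S \<bar>t0 j\<bar>" unfolding S_def by (rule scales_transp_shear) (use J t0 in auto)
  let ?F = "\<lambda>t. ennreal (gauss I (lin I J A t))"
  have Fm: "?F \<in> borel_measurable (leb J)" by measurable
  have FS: "?F (S (x(j := y))) = ?F (x(j := 0))" for x y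
  proof -
    have "lin I J A (S (x(j := y))) = comb I 1 (lin I J A (x(j := 0))) y (lin I J A t0)"
      unfolding lin_comb[symmetric]
      by (rule lin_cong) (use J t0 in \<open>auto simp: S_def lin_transp_shear mult.commute\<close>)
    also have "\<dots> = lin I J A (x(j := 0))"
      by (rule vecs_eqI[of _ I]) (auto simp: A0)
    finally show ?thesis by simp
  qed
  have "(\<integral>\<^sup>+t. ?F t \<partial>leb J) = ennreal \<bar>t0 j\<bar> * (\<integral>\<^sup>+t. ?F (S t) \<partial>leb J)"
    by (rule scales_D[OF sS Fm])
  also have "(\<integral>\<^sup>+t. ?F (S t) \<partial>leb J) = (\<integral>\<^sup>+x. (\<integral>\<^sup>+y. ?F (S (x(j := y))) \<partial>lborel) \<partial>leb K)"
  proof -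
    have m: "(\<lambda>t. ?F (S t)) \<in> borel_measurable (leb J)"
      by (rule measurable_compose[OF scales_meas[OF sS] Fm])
    show ?thesis using nn_integral_leb_insert(1)[OF K(3,2), of "\<lambda>t. ?F (S t)"] m unfolding K(1)[symmetric] by simp
  qed
  also have "\<dots> = (\<integral>\<^sup>+x. \<infinity> \<partial>leb K)"
    unfolding FS by (rule nn_integral_cong) (simp add: ennreal_mult_eq_top_iff gauss_def)
  also have "\<dots> = \<infinity> * emeasure (leb K) (space (leb K))" by simp
  also have "\<dots> = \<infinity>"
  proof -
    have "emeasure (leb K) (cube K 1) \<le> emeasure (leb K) (space (leb K))" by (rule emeasure_space)
    then have "emeasure (leb K) (space (leb K)) \<noteq> 0" using K by (auto simp: emeasure_cube)
    then show ?thesis by (simp add: ennreal_top_mult)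
  qed
  finally have "(\<integral>\<^sup>+t. ?F t \<partial>leb J) = \<infinity>" using t0 by (simp add: ennreal_mult_top)
  then show False using fin by simp
qed

text \<open>Cholesky applied to the Gram matrix of \<open>A\<close> gives \<open>M\<close> with |A
  t| = |M t|, so \<open>A\<close> composed with the inverse of \<open>M\<close> is an isometry. The
  factor comes from substituting \<open>M\<close>, hence is the same for all \<open>h\<close>; this
  is what allows ratios to be taken.\<close>

lemma frame_reduction:
  assumes I: "finite I" and J: "finite J"
    and fin: "(\<integral>\<^sup>+t. ennreal (gauss I (lin I J A t)) \<partial>leb J) < \<top>"
  obtains U d where "frame I J U" "d > 0"
    "\<And>h. h \<in> borel_measurable (leb I) \<Longrightarrow> (\<integral>\<^sup>+t. h (lin I J A t) \<partial>leb J) = ennreal d * (\<integral>\<^sup>+t. h (lin I J U t) \<partial>leb J)"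
proof -
  let ?S = "mat_mult I (transp A) A"
  have q: "quad_form J ?S t = dot I (lin I J A t) (lin I J A t)" for t
  proof -
    have "dot I (lin I J A t) (lin I J A t) = dot J t (lin J J ?S t)"
      using I J by (simp add: dot_lin lin_lin)
    also have "\<dots> = quad_form J ?S t"
      by (simp add: dot_def lin_def quad_form_def sum_distrib_left mult_ac)
    finally show ?thesis by simp
  qed
  have "0 < quad_form J ?S t" if "t \<in> vecs J" "\<exists>j\<in>J. t j \<noteq> 0" for t
    unfolding q using inj_of_finite_gauss[OF I J fin that(1)] that(2) by blast
  moreover have "?S i j = ?S j i" for i j by (simp add: mat_mult_def transp_def mult.commute)
  ultimately obtain M N d where M: "vol_mat J M N d" "\<And>x. quad_form J ?S x = dot J (lin J J M x) (lin J J M x)"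
    using cholesky[OF J, of ?S] by metis
  let ?U = "mat_mult J A N"
  have U: "lin I J ?U t = lin I J A (lin J J N t)" for t using J by (simp add: lin_lin)
  have inv: "inv_mat J M N" and sc: "scales J (lin J J M) d" using M(1) by (auto simp: vol_mat_def)
  show thesis
  proof (rule that[of ?U "1 / d"])
    show "frame I J ?U"
    proof (rule frame_of_isometry[OF I J])
      fix x assume "x \<in> vecs J"
      then show "dot I (lin I J ?U x) (lin I J ?U x) = dot J x x"
        unfolding U q[symmetric] M(2) using inv by (simp add: inv_mat_def)
    qed
    show "0 < 1 / d" using scales_pos[OF sc] by simp
    fix h :: "(nat \<Rightarrow> real) \<Rightarrow> ennreal" assume h [measurable]: "h \<in> borel_measurable (leb I)"
    have "(\<integral>\<^sup>+t. h (lin I J ?U t) \<partial>leb J) = ennreal d * (\<integral>\<^sup>+t. h (lin I J ?U (lin J J M t)) \<partial>leb J)"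
      by (rule scales_D[OF sc]) measurable
    also have "(\<integral>\<^sup>+t. h (lin I J ?U (lin J J M t)) \<partial>leb J) = (\<integral>\<^sup>+t. h (lin I J A t) \<partial>leb J)"
      using inv by (intro nn_integral_cong) (simp add: U inv_mat_def)
    finally show "(\<integral>\<^sup>+t. h (lin I J A t) \<partial>leb J) = ennreal (1 / d) * (\<integral>\<^sup>+t. h (lin I J ?U t) \<partial>leb J)"
      using scales_pos[OF sc] by (simp add: mult.assoc[symmetric] ennreal_mult'[symmetric])
  qed
qed

lemma frame_gauss:
  assumes "finite I" "finite J" "frame I J U"
  shows "(\<integral>\<^sup>+t. ennreal (gauss I (lin I J U t)) \<partial>leb J) = ennreal (sqrt (2 * pi) ^ card J)"
  unfolding nn_integral_gauss[OF assms(2), symmetric] by (simp add: gauss_def frame_dot[OF assms])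

text \<open>For a Gaussian matrix \<open>G\<close>, the integral of \<open>h (T (G t))\<close> over \<open>t\<close> averages to a multiple of \<open>\<integral> h (T y) / |y| ^ k\<close>, and for each \<open>G\<close> it is a multiple of the integral of \<open>h\<close> over the image of \<open>T G\<close>. Dividing by the same identity for the Gaussian density, whose integral is the same on all subspaces, eliminates both multiples.\<close>
lemma slice_average:
  assumes I: "finite I" and J: "finite J" "J \<noteq> {}" "card J < card I"
    and h [measurable]: "h \<in> borel_measurable (leb I)"
    and G0: "(\<integral>\<^sup>+y. ennreal (gauss I (lin I I T y)) * ennreal (1 / nrm I y ^ (card I - card J)) \<partial>leb I) < \<top>"
      (is "?G0 < \<top>")
  shows "(\<And>U. frame I J U \<Longrightarrow> (\<integral>\<^sup>+t. h (lin I J U t) \<partial>leb J) \<le> S) \<Longrightarrow>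
      ennreal (sqrt (2 * pi) ^ card J) * (\<integral>\<^sup>+y. h (lin I I T y) * ennreal (1 / nrm I y ^ (card I - card J)) \<partial>leb I) \<le> S * ?G0"
    and "(\<And>U. frame I J U \<Longrightarrow> S \<le> (\<integral>\<^sup>+t. h (lin I J U t) \<partial>leb J)) \<Longrightarrow>
      S * ?G0 \<le> ennreal (sqrt (2 * pi) ^ card J) * (\<integral>\<^sup>+y. h (lin I I T y) * ennreal (1 / nrm I y ^ (card I - card J)) \<partial>leb I)"
proof -
  let ?c = "ennreal (sqrt (2 * pi) ^ card J)"
  let ?H = "\<integral>\<^sup>+y. h (lin I I T y) * ennreal (1 / nrm I y ^ (card I - card J)) \<partial>leb I"
  interpret gauss_mat: prob_space "gauss_mat I J" by (rule gauss_mat_prob)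
  interpret lJ: sigma_finite_measure "leb J" by (rule sigma_finite_leb[OF J(1)])
  interpret pair_sigma_finite "leb J" "gauss_mat I J" by unfold_locales
  define W where "W = (\<integral>\<^sup>+t. ennreal (gauss_kernel (card I) 1 (nrm J t)) \<partial>leb J)"
  have W: "W < \<top>" "W \<noteq> 0" unfolding W_def using gauss_kernel_integral[OF J] by auto
  define P where "P f G = (\<integral>\<^sup>+t. f (lin I I T (lin I J G t)) \<partial>leb J)" for f :: "(nat \<Rightarrow> real) \<Rightarrow> ennreal" and G
  have Pm: "P f \<in> borel_measurable (gauss_mat I J)" if [measurable]: "f \<in> borel_measurable (leb I)" for f
  proof -
    have "(\<lambda>p. lin I I T (lin I J (fst p) (snd p))) \<in> gauss_mat I J \<Otimes>\<^sub>M leb J \<rightarrow>\<^sub>M leb I"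
      by (rule lin_meas[OF lin_gauss_mat_meas(2)])
    then have "(\<lambda>p. f (lin I I T (lin I J (fst p) (snd p)))) \<in> borel_measurable (gauss_mat I J \<Otimes>\<^sub>M leb J)"
      by (rule measurable_compose) fact
    then show ?thesis unfolding P_def[abs_def]
      by (intro lJ.borel_measurable_nn_integral) (simp add: case_prod_beta')
  qed
  have avg: "(\<integral>\<^sup>+G. P f G \<partial>gauss_mat I J) = W * (\<integral>\<^sup>+y. f (lin I I T y) * ennreal (1 / nrm I y ^ (card I - card J)) \<partial>leb I)"
    if [measurable]: "f \<in> borel_measurable (leb I)" for f
  proof -
    have "(\<lambda>p. lin I I T (lin I J (snd p) (fst p))) \<in> leb J \<Otimes>\<^sub>M gauss_mat I J \<rightarrow>\<^sub>M leb I"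
      by (rule lin_meas[OF lin_gauss_mat_meas(1)])
    then have m: "(\<lambda>p. f (lin I I T (lin I J (snd p) (fst p)))) \<in> borel_measurable (leb J \<Otimes>\<^sub>M gauss_mat I J)"
      by (rule measurable_compose) fact
    have "(\<integral>\<^sup>+G. P f G \<partial>gauss_mat I J) = (\<integral>\<^sup>+t. (\<integral>\<^sup>+G. f (lin I I T (lin I J G t)) \<partial>gauss_mat I J) \<partial>leb J)"
      unfolding P_def by (rule Fubini') (use m in \<open>simp add: case_prod_beta'\<close>)
    also have "\<dots> = W * (\<integral>\<^sup>+y. f (lin I I T y) * ennreal (1 / nrm I y ^ (card I - card J)) \<partial>leb I)"
      unfolding W_def by (rule gauss_average[OF I J]) fact
    finally show ?thesis .
  qed
  let ?g = "\<lambda>x. ennreal (gauss I x)"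
  have gm: "?g \<in> borel_measurable (leb I)" by measurable
  have "(\<integral>\<^sup>+G. P ?g G \<partial>gauss_mat I J) < \<top>"
    unfolding avg[OF gm] using W(1) G0 by (simp add: ennreal_mult_less_top)
  \<comment> \<open>A finite average is finite almost everywhere, and finiteness of the Gaussian
    integral is the condition under which \<open>frame_reduction\<close> applies to
    \<open>T G\<close>.\<close>
  then have "AE G in gauss_mat I J. P ?g G \<noteq> \<infinity>"
    by (intro nn_integral_noteq_infinite Pm gm) auto
  then have ae: "AE G in gauss_mat I J. \<exists>U d. frame I J U \<and> 0 < d \<and> P ?g G = ennreal d * ?c \<and>
      P h G = ennreal d * (\<integral>\<^sup>+t. h (lin I J U t) \<partial>leb J)"
  proof eventually_elim
    case (elim G)
    have eq: "lin I I T (lin I J G t) = lin I J (mat_mult I T G) t" for t using I J by (simp add: lin_lin)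
    have "(\<integral>\<^sup>+t. ennreal (gauss I (lin I J (mat_mult I T G) t)) \<partial>leb J) < \<top>"
      using elim by (simp add: P_def eq less_top)
    then obtain U d where U: "frame I J U" "d > 0"
      "\<And>h. h \<in> borel_measurable (leb I) \<Longrightarrow> (\<integral>\<^sup>+t. h (lin I J (mat_mult I T G) t) \<partial>leb J) = ennreal d * (\<integral>\<^sup>+t. h (lin I J U t) \<partial>leb J)"
      using frame_reduction[OF I J(1)] by metis
    have "P ?g G = ennreal d * ?c"
      unfolding P_def eq U(3)[OF gm] frame_gauss[OF I J(1) U(1)] ..
    moreover have "P h G = ennreal d * (\<integral>\<^sup>+t. h (lin I J U t) \<partial>leb J)"
      unfolding P_def eq by (rule U(3)[OF h])
    ultimately show ?case using U(1,2) by blast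
  qed
  have mulW: "a \<le> b" if "W * a \<le> W * b" for a b :: ennreal
    using that W by (metis ennreal_mult_le_mult_iff less_irrefl)
  have cH: "?c * (\<integral>\<^sup>+G. P h G \<partial>gauss_mat I J) = (\<integral>\<^sup>+G. ?c * P h G \<partial>gauss_mat I J)"
    by (rule nn_integral_cmult[symmetric]) (rule Pm[OF h])
  have SG: "S * (\<integral>\<^sup>+G. P ?g G \<partial>gauss_mat I J) = (\<integral>\<^sup>+G. S * P ?g G \<partial>gauss_mat I J)"
    by (rule nn_integral_cmult[symmetric]) (rule Pm[OF gm])
  {
    assume up: "\<And>U. frame I J U \<Longrightarrow> (\<integral>\<^sup>+t. h (lin I J U t) \<partial>leb J) \<le> S"
    have "?c * (\<integral>\<^sup>+G. P h G \<partial>gauss_mat I J) \<le> S * (\<integral>\<^sup>+G. P ?g G \<partial>gauss_mat I J)"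
      unfolding cH SG
    proof (rule nn_integral_mono_AE)
      show "AE G in gauss_mat I J. ?c * P h G \<le> S * P ?g G"
        using ae
      proof eventually_elim
        case (elim G)
        then obtain U d where U: "frame I J U" "P ?g G = ennreal d * ?c" "P h G = ennreal d * (\<integral>\<^sup>+t. h (lin I J U t) \<partial>leb J)"
          by blast
        have "?c * P h G = (ennreal d * ?c) * (\<integral>\<^sup>+t. h (lin I J U t) \<partial>leb J)" by (simp add: U(3) mult_ac)
        also have "\<dots> \<le> (ennreal d * ?c) * S" by (rule mult_left_mono[OF up[OF U(1)]]) simp
        finally show ?case by (simp add: U(2) mult_ac)
      qed
    qed
    then have "W * (?c * ?H) \<le> W * (S * ?G0)" unfolding avg[OF h] avg[OF gm] by (simp add: mult_ac)
    then show "?c * ?H \<le> S * ?G0" by (rule mulW)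
  }
  {
    assume lo: "\<And>U. frame I J U \<Longrightarrow> S \<le> (\<integral>\<^sup>+t. h (lin I J U t) \<partial>leb J)"
    have "S * (\<integral>\<^sup>+G. P ?g G \<partial>gauss_mat I J) \<le> ?c * (\<integral>\<^sup>+G. P h G \<partial>gauss_mat I J)"
      unfolding cH SG
    proof (rule nn_integral_mono_AE)
      show "AE G in gauss_mat I J. S * P ?g G \<le> ?c * P h G"
        using ae
      proof eventually_elim
        case (elim G)
        then obtain U d where U: "frame I J U" "P ?g G = ennreal d * ?c" "P h G = ennreal d * (\<integral>\<^sup>+t. h (lin I J U t) \<partial>leb J)"
          by blast
        have "S * P ?g G = (ennreal d * ?c) * S" by (simp add: U(2) mult_ac)
        also have "\<dots> \<le> (ennreal d * ?c) * (\<integral>\<^sup>+t. h (lin I J U t) \<partial>leb J)" by (rule mult_left_mono[OF lo[OF U(1)]]) simp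
        finally show ?case by (simp add: U(3) mult_ac)
      qed
    qed
    then have "W * (S * ?G0) \<le> W * (?c * ?H)" unfolding avg[OF h] avg[OF gm] by (simp add: mult_ac)
    then show "S * ?G0 \<le> ?c * ?H" by (rule mulW)
  }
qed

section \<open>Volumes of Euclidean balls and the slicing estimates\<close>

definition cball :: "nat set \<Rightarrow> real \<Rightarrow> (nat \<Rightarrow> real) set" where
  "cball I r = {x \<in> vecs I. nrm I x \<le> r}"

definition ball_vol :: "nat set \<Rightarrow> real" where
  "ball_vol I = measure (leb I) (cball I 1)"

lemma cball_sets [measurable]: "cball I r \<in> sets (leb I)"
proof -
  have "{x \<in> space (leb I). nrm I x \<le> r} \<in> sets (leb I)" by measurable
  then show ?thesis by (simp add: cball_def)
qed

lemma cball_subset_cube: "finite I \<Longrightarrow> cball I r \<subseteq> cube I r"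
  using abs_le_nrm[of I] by (auto simp: cball_def cube_iff) (meson order_trans)

lemma cube_subset_cball: "finite I \<Longrightarrow> r \<ge> 0 \<Longrightarrow> cube I r \<subseteq> cball I (sqrt (real (card I)) * r)"
proof
  fix x assume I: "finite I" and r: "r \<ge> 0" and x: "x \<in> cube I r"
  have "dot I x x \<le> (\<Sum>i\<in>I. r * r)"
    unfolding dot_def using x r
    by (intro sum_mono) (metis abs_ge_zero abs_mult_self_eq cube_iff mult_mono)
  then have "nrm I x \<le> sqrt (real (card I) * r\<^sup>2)" unfolding nrm_def by (simp add: power2_eq_square)
  also have "\<dots> = sqrt (real (card I)) * r" using r by (simp add: real_sqrt_mult)
  finally show "x \<in> cball I (sqrt (real (card I)) * r)" using x by (simp add: cball_def cube_iff)
qed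

lemma emeasure_cball_1: "finite I \<Longrightarrow> emeasure (leb I) (cball I 1) = ennreal (ball_vol I)"
proof -
  assume I: "finite I"
  have "emeasure (leb I) (cball I 1) \<le> emeasure (leb I) (cube I 1)"
    by (rule emeasure_mono[OF cball_subset_cube[OF I] cube_sets[OF I]])
  then have "emeasure (leb I) (cball I 1) < \<top>" using I by (simp add: emeasure_cube le_less_trans)
  then show ?thesis unfolding ball_vol_def by (intro emeasure_eq_ennreal_measure) simp
qed

lemma emeasure_cball: 
  assumes I: "finite I" and r: "r > 0"
  shows "emeasure (leb I) (cball I r) = ennreal (r ^ card I * ball_vol I)"
proof -
  have "emeasure (leb I) (cball I r) = ennreal (\<bar>r\<bar> ^ card I) * emeasure (leb I) {x \<in> vecs I. comb I r x 1 (\<lambda>_. 0) \<in> cball I r}"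
    by (rule scales_emeasure[OF scales_affine[OF I]]) (use r in auto)
  also have "{x \<in> vecs I. comb I r x 1 (\<lambda>_. 0) \<in> cball I r} = cball I 1"
    using r by (auto simp: cball_def comb_zero nrm_scale)
  finally show ?thesis using r by (simp add: emeasure_cball_1[OF I] ennreal_mult')
qed

lemma ball_vol_nonneg [simp]: "0 \<le> ball_vol I"
  by (simp add: ball_vol_def)

text \<open>The cube of half-side 1 lies in the ball of radius \<open>sqrt (card I)\<close>.\<close>

lemma ball_vol_lower:
  assumes I: "finite I" "I \<noteq> {}"
  shows "2 ^ card I \<le> sqrt (real (card I)) ^ card I * ball_vol I"
proof -
  have n: "card I > 0" using I by (simp add: card_gt_0_iff)
  have "emeasure (leb I) (cube I 1) \<le> emeasure (leb I) (cball I (sqrt (real (card I)) * 1))"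
    by (rule emeasure_mono[OF cube_subset_cball]) (use I in auto)
  then show ?thesis using I n by (simp add: emeasure_cube emeasure_cball)
qed

lemma ball_vol_pos: "finite I \<Longrightarrow> I \<noteq> {} \<Longrightarrow> 0 < ball_vol I"
proof -
  assume I: "finite I" "I \<noteq> {}"
  have "(0::real) < 2 ^ card I" by simp
  also note ball_vol_lower[OF I]
  finally have "ball_vol I \<noteq> 0" by auto
  then show ?thesis using ball_vol_nonneg[of I] by linarith
qed

text \<open>On the ball of radius sqrt n the Gaussian weight is at least exp (-n/2), while its total
  integral is sqrt (2 pi)^n; the number 5 bounds sqrt (2 pi e).\<close>

lemma ball_vol_upper:
  assumes I: "finite I" "I \<noteq> {}"
  shows "sqrt (real (card I)) ^ card I * ball_vol I \<le> 5 ^ card I"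
proof -
  let ?n = "card I"
  have n: "?n > 0" using I by (simp add: card_gt_0_iff)
  have e: "emeasure (leb I) (cball I (sqrt (real ?n))) = ennreal (sqrt (real ?n) ^ ?n * ball_vol I)"
    by (rule emeasure_cball) (use I n in auto)
  have "ennreal (exp (- real ?n / 2)) * emeasure (leb I) (cball I (sqrt (real ?n))) =
     (\<integral>\<^sup>+x. ennreal (exp (- real ?n / 2)) * indicator (cball I (sqrt (real ?n))) x \<partial>leb I)"
    by (rule nn_integral_cmult_indicator[symmetric]) simp
  also have "\<dots> \<le> (\<integral>\<^sup>+x. ennreal (gauss I x) \<partial>leb I)"
  proof (rule nn_integral_mono)
    fix x
    have "gauss I x \<ge> exp (- real ?n / 2)" if "nrm I x \<le> sqrt (real ?n)"
    proof -
      have "(nrm I x)\<^sup>2 \<le> (sqrt (real ?n))\<^sup>2" using that by (rule power_mono) simp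
      then show ?thesis by (simp add: gauss_nrm)
    qed
    then show "ennreal (exp (- real ?n / 2)) * indicator (cball I (sqrt (real ?n))) x \<le> ennreal (gauss I x)"
      by (auto simp: indicator_def cball_def intro!: ennreal_leI)
  qed
  also have "\<dots> = ennreal (sqrt (2 * pi) ^ ?n)" by (rule nn_integral_gauss[OF I(1)])
  finally have "exp (- real ?n / 2) * (sqrt (real ?n) ^ ?n * ball_vol I) \<le> sqrt (2 * pi) ^ ?n"
    unfolding e by (subst (asm) ennreal_mult'[symmetric]) auto
  then have "sqrt (real ?n) ^ ?n * ball_vol I \<le> exp (real ?n / 2) * sqrt (2 * pi) ^ ?n"
    by (simp add: exp_minus field_simps)
  also have "exp (real ?n / 2) = exp (1 / 2) ^ ?n" by (simp add: exp_of_nat_mult[symmetric])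
  also have "exp (1 / 2) ^ ?n * sqrt (2 * pi) ^ ?n = (exp (1 / 2) * sqrt (2 * pi)) ^ ?n" by (simp add: power_mult_distrib)
  also have "\<dots> \<le> 5 ^ ?n"
  proof (rule power_mono)
    have "exp (1 / 2 :: real) \<le> 1 + 1 / 2 + (1 / 2)\<^sup>2" by (rule exp_bound) auto
    then have e: "exp (1 / 2 :: real) \<le> 7 / 4" by (simp add: power2_eq_square)
    have "sqrt (2 * pi) \<le> sqrt ((5 / 2)\<^sup>2 + 7 / 4)" using pi_less_4 by (intro real_sqrt_le_mono) (simp add: power2_eq_square)
    also have "\<dots> = sqrt 8" by (simp add: power2_eq_square)
    also have "\<dots> \<le> sqrt ((20 / 7)\<^sup>2)" by (intro real_sqrt_le_mono) (simp add: power2_eq_square)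
    finally have p: "sqrt (2 * pi) \<le> 20 / 7" by simp
    have "exp (1 / 2) * sqrt (2 * pi) \<le> 7 / 4 * (20 / 7)" by (rule mult_mono[OF e p]) auto
    then show "exp (1 / 2) * sqrt (2 * pi) \<le> 5" by simp
  qed auto
  finally show ?thesis .
qed

text \<open>In polar coordinates the value is n / (n - k) times s^(n-k) times the volume of the unit
  ball; dyadic shells replace n / (n - k) by 2^(k+1), a loss exponential in k only.\<close>

lemma ball_power_integral:
  assumes I: "finite I" and k: "k < card I" and s: "s > 0"
  shows "(\<integral>\<^sup>+y. ennreal (1 / nrm I y ^ k) * indicator (cball I s) y \<partial>leb I) \<le> ennreal (2 ^ (k + 1) * s ^ (card I - k) * ball_vol I)"
proof -
  let ?n = "card I"
  have I0: "I \<noteq> {}" using k by auto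
  let ?c = "\<lambda>a::nat. (2 ^ (a + 1) / s) ^ k"
  let ?B = "\<lambda>a::nat. cball I (s / 2 ^ a)"
  have pt: "ennreal (1 / nrm I y ^ k) * indicator (cball I s) y \<le> (\<Sum>a. ennreal (?c a) * indicator (?B a) y)"
    if y: "y \<in> vecs I" "nrm I y \<noteq> 0" for y
  proof (cases "nrm I y \<le> s")
    case True
    have p: "nrm I y > 0" using y nrm_nonneg[of I y] by linarith
    obtain b where "s / nrm I y < real b" using reals_Archimedean2 by blast
    also have "real b < 2 ^ b" by (rule of_nat_less_two_power)
    also have "(2::real) ^ b \<le> 2 ^ (b + 1)" by simp
    finally have ex: "\<exists>b. s / nrm I y < 2 ^ (b + 1)" by blast
    define a where "a = (LEAST b. s / nrm I y < 2 ^ (b + 1))"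
    have a: "s / nrm I y < 2 ^ (a + 1)" unfolding a_def by (rule LeastI_ex[OF ex])
    have a2: "nrm I y \<le> s / 2 ^ a"
    proof (cases a)
      case 0 then show ?thesis using True by simp
    next
      case (Suc b)
      have "\<not> s / nrm I y < 2 ^ (b + 1)" using not_less_Least[of b "\<lambda>b. s / nrm I y < 2 ^ (b + 1)"] Suc by (simp add: a_def)
      then have "2 ^ a \<le> s / nrm I y" using Suc by simp
      then show ?thesis using p by (simp add: field_simps)
    qed
    have "1 / nrm I y ^ k = (1 / nrm I y) ^ k" by (simp add: power_one_over)
    also have "\<dots> \<le> ?c a" using a p s by (intro power_mono) (auto simp: field_simps)
    finally have le: "1 / nrm I y ^ k \<le> ?c a" .
    define F where "F a = ennreal (?c a) * indicator (?B a) y" for a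
    have "ennreal (1 / nrm I y ^ k) * indicator (cball I s) y \<le> F a"
      using le a2 y True by (simp add: F_def cball_def ennreal_leI)
    also have "F a = sum F {a}" by simp
    also have "\<dots> \<le> (\<Sum>a. F a)" by (rule sum_le_suminf) (auto simp: summableI)
    finally show ?thesis by (simp add: F_def)
  next
    case False then show ?thesis by (simp add: cball_def)
  qed
  have "(\<integral>\<^sup>+y. ennreal (1 / nrm I y ^ k) * indicator (cball I s) y \<partial>leb I) \<le> (\<integral>\<^sup>+y. (\<Sum>a. ennreal (?c a) * indicator (?B a) y) \<partial>leb I)"
  proof (rule nn_integral_mono_AE)
    show "AE y in leb I. ennreal (1 / nrm I y ^ k) * indicator (cball I s) y \<le> (\<Sum>a. ennreal (?c a) * indicator (?B a) y)"
      using AE_nonzero[OF I I0] AE_space[of "leb I"] by eventually_elim (rule pt, auto)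
  qed
  also have "\<dots> = (\<Sum>a. (\<integral>\<^sup>+y. ennreal (?c a) * indicator (?B a) y \<partial>leb I))"
    by (rule nn_integral_suminf) measurable
  also have "\<dots> = (\<Sum>a. ennreal (?c a) * emeasure (leb I) (?B a))"
    by (simp only: nn_integral_cmult_indicator[OF cball_sets])
  also have "\<dots> = (\<Sum>a. ennreal (2 ^ k * s ^ (?n - k) * ball_vol I) * ennreal ((1 / 2 ^ (?n - k)) ^ a))"
  proof (rule suminf_cong)
    fix a :: nat
    have "?c a * ((s / 2 ^ a) ^ ?n * ball_vol I) = 2 ^ k * s ^ (?n - k) * ball_vol I * (1 / 2 ^ (?n - k)) ^ a"
    proof -
      obtain j where j: "?n = k + j" using le_Suc_ex[OF less_imp_le[OF k]] by metis
      have "2 ^ (a + 1) / s * (s / 2 ^ a) = 2" using s by simp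
      then have 1: "?c a * (s / 2 ^ a) ^ k = 2 ^ k" by (simp only: power_mult_distrib[symmetric])
      have "((2::real) ^ a) ^ j = (2 ^ j) ^ a" by (metis power_mult mult.commute)
      then have 2: "(s / 2 ^ a) ^ j = s ^ j * (1 / 2 ^ j) ^ a" by (simp only: power_divide power_one) simp
      have "?c a * ((s / 2 ^ a) ^ (k + j) * ball_vol I) = (?c a * (s / 2 ^ a) ^ k) * (s / 2 ^ a) ^ j * ball_vol I"
        by (simp only: power_add mult.assoc)
      also have "\<dots> = 2 ^ k * s ^ j * ball_vol I * (1 / 2 ^ j) ^ a"
        unfolding 1 2 by (simp only: mult_ac)
      finally show ?thesis unfolding j by simp
    qed
    then show "ennreal (?c a) * emeasure (leb I) (?B a) = ennreal (2 ^ k * s ^ (?n - k) * ball_vol I) * ennreal ((1 / 2 ^ (?n - k)) ^ a)"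
      using s by (simp only: emeasure_cball[OF I, of "s / 2 ^ a"] divide_pos_pos zero_less_power zero_less_numeral)
        (simp add: ennreal_mult'[symmetric])
  qed
  also have "\<dots> = ennreal (2 ^ k * s ^ (?n - k) * ball_vol I) * (\<Sum>a. ennreal ((1 / 2 ^ (?n - k)) ^ a))" by simp
  also have "\<dots> \<le> ennreal (2 ^ k * s ^ (?n - k) * ball_vol I) * ennreal 2"
    using suminf_geometric_half[of "?n - k"] k by (intro mult_left_mono) auto
  also have "\<dots> = ennreal (2 ^ (k + 1) * s ^ (?n - k) * ball_vol I)"
    using s by (simp add: ennreal_mult'[symmetric] ennreal_mult''[symmetric] mult_ac del: ennreal_numeral)
  finally show ?thesis .
qed

text \<open>Outside radius \<open>s\<close> the weight is at most 1 / s^k and the whole Gaussian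
  integral is used; inside, the Gaussian is at most 1 and the weight is integrated. The free
  parameter \<open>s\<close> is chosen in \<open>slice_upper\<close>.\<close>

lemma gauss_weight_bound:
  assumes I: "finite I" and k: "k < card I" and s: "s > 0" and T: "scales I (lin I I T) d"
  shows "(\<integral>\<^sup>+y. ennreal (gauss I (lin I I T y)) * ennreal (1 / nrm I y ^ k) \<partial>leb I)
    \<le> ennreal (sqrt (2 * pi) ^ card I / (d * s ^ k) + 2 ^ (k + 1) * s ^ (card I - k) * ball_vol I)"
proof -
  have d: "d > 0" by (rule scales_pos[OF T])
  have "(\<integral>\<^sup>+y. ennreal (gauss I (lin I I T y)) * ennreal (1 / nrm I y ^ k) \<partial>leb I) \<le>
    (\<integral>\<^sup>+y. ennreal (1 / s ^ k) * ennreal (gauss I (lin I I T y)) + ennreal (1 / nrm I y ^ k) * indicator (cball I s) y \<partial>leb I)"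
  proof (rule nn_integral_mono)
    fix y assume y: "y \<in> space (leb I)"
    show "ennreal (gauss I (lin I I T y)) * ennreal (1 / nrm I y ^ k) \<le>
       ennreal (1 / s ^ k) * ennreal (gauss I (lin I I T y)) + ennreal (1 / nrm I y ^ k) * indicator (cball I s) y"
    proof (cases "nrm I y \<le> s")
      case True
      have "gauss I (lin I I T y) \<le> 1" by (simp add: gauss_def)
      then have "ennreal (gauss I (lin I I T y)) * ennreal (1 / nrm I y ^ k) \<le> 1 * ennreal (1 / nrm I y ^ k)"
        by (intro mult_right_mono) auto
      then show ?thesis using True y by (simp add: cball_def add_increasing)
    next
      case False
      then have "1 / nrm I y ^ k \<le> 1 / s ^ k" using s by (intro divide_left_mono power_mono) auto
      then have "ennreal (1 / nrm I y ^ k) \<le> ennreal (1 / s ^ k)" by (rule ennreal_leI)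
      then have "ennreal (gauss I (lin I I T y)) * ennreal (1 / nrm I y ^ k) \<le> ennreal (gauss I (lin I I T y)) * ennreal (1 / s ^ k)"
        by (rule mult_left_mono) simp
      then show ?thesis by (simp add: mult.commute add_increasing2)
    qed
  qed
  also have "\<dots> = ennreal (1 / s ^ k) * (\<integral>\<^sup>+y. ennreal (gauss I (lin I I T y)) \<partial>leb I) + (\<integral>\<^sup>+y. ennreal (1 / nrm I y ^ k) * indicator (cball I s) y \<partial>leb I)"
    by (subst nn_integral_add) (auto simp: nn_integral_cmult)
  also have "(\<integral>\<^sup>+y. ennreal (gauss I (lin I I T y)) \<partial>leb I) = ennreal (sqrt (2 * pi) ^ card I / d)"
  proof -
    have "ennreal (sqrt (2 * pi) ^ card I) = ennreal d * (\<integral>\<^sup>+y. ennreal (gauss I (lin I I T y)) \<partial>leb I)"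
      unfolding nn_integral_gauss[OF I, symmetric] by (rule scales_D[OF T]) measurable
    then have "ennreal (1 / d) * ennreal (sqrt (2 * pi) ^ card I) = (ennreal (1 / d) * ennreal d) * (\<integral>\<^sup>+y. ennreal (gauss I (lin I I T y)) \<partial>leb I)"
      by (simp only: mult.assoc)
    also have "ennreal (1 / d) * ennreal d = 1" using d by (simp add: ennreal_mult'[symmetric])
    finally show ?thesis using d by (simp add: ennreal_mult'[symmetric])
  qed
  also have "ennreal (1 / s ^ k) * ennreal (sqrt (2 * pi) ^ card I / d) = ennreal (sqrt (2 * pi) ^ card I / (d * s ^ k))"
    using s d by (simp add: ennreal_mult'[symmetric] mult.commute)
  also have "\<dots> + (\<integral>\<^sup>+y. ennreal (1 / nrm I y ^ k) * indicator (cball I s) y \<partial>leb I) \<le>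
    ennreal (sqrt (2 * pi) ^ card I / (d * s ^ k)) + ennreal (2 ^ (k + 1) * s ^ (card I - k) * ball_vol I)"
    by (rule add_left_mono[OF ball_power_integral[OF I k s]])
  also have "\<dots> = ennreal (sqrt (2 * pi) ^ card I / (d * s ^ k) + 2 ^ (k + 1) * s ^ (card I - k) * ball_vol I)"
    by (rule ennreal_plus[symmetric]) (use s d in auto)
  finally show ?thesis .
qed

text \<open>\<open>h\<close> lives on the image of the unit ball under \<open>T\<close>, an
  ellipsoid of volume \<open>d * ball_vol I\<close>. Pulled back by \<open>T\<close>, the weight 1 /
  |y|^k is at least 1 on the support of \<open>h\<close>, so the weighted integral in
  \<open>slice_average\<close> dominates the plain one.\<close>

lemma slice_upper:
  assumes I: "finite I" and J: "finite J" "J \<noteq> {}" "card J < card I" and T: "scales I (lin I I T) d"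
    and h [measurable]: "h \<in> borel_measurable (leb I)"
    and supp: "\<And>y. y \<in> vecs I \<Longrightarrow> h (lin I I T y) \<noteq> 0 \<Longrightarrow> nrm I y \<le> 1"
    and S: "\<And>U. frame I J U \<Longrightarrow> (\<integral>\<^sup>+t. h (lin I J U t) \<partial>leb J) \<le> S"
  shows "(\<integral>\<^sup>+x. h x \<partial>leb I) \<le> S * ennreal (5 ^ (card I - card J) * (d * ball_vol I) powr (real (card I - card J) / real (card I)))"
proof -
  let ?n = "card I" and ?m = "card J" and ?k = "card I - card J"
  have I0: "I \<noteq> {}" using J by auto
  have "?m > 0" using J by (simp add: card_gt_0_iff)
  then have n: "?n > 0" and k: "?k < ?n" "?k \<ge> 1" "?n - ?k = ?m" using J(3) by linarith+
  have d: "d > 0" by (rule scales_pos[OF T])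
  define E where "E = d * ball_vol I"
  have E: "E > 0" using d ball_vol_pos[OF I I0] by (simp add: E_def)
  define P where "P = sqrt (2 * pi)"
  have P: "P > 0" by (simp add: P_def)
  \<comment> \<open>The solution of d * ball_vol I * s^n = P^n with n = \<open>card I\<close>: it
    makes the two terms of \<open>gauss_weight_bound\<close> equal up to the factor 2^(k+1).\<close>
  define s where "s = P / E powr (1 / real ?n)"
  have s: "s > 0" using P E by (simp add: s_def)
  have Ep: "(E powr (1 / real ?n)) ^ ?n = E" "(E powr (1 / real ?n)) ^ ?k = E powr (real ?k / real ?n)"
    using E n by (simp_all add: powr_realpow[symmetric] powr_powr)
  have sn: "s ^ ?n = P ^ ?n / E" by (simp add: s_def power_divide Ep)
  have sk: "s ^ ?k = P ^ ?k / E powr (real ?k / real ?n)" by (simp add: s_def power_divide Ep)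
  have "s ^ ?m * s ^ ?k = s ^ ?n" using J by (simp add: power_add[symmetric])
  then have sm: "s ^ ?m * ball_vol I = P ^ ?n / (d * s ^ ?k)"
    using s d E unfolding sn E_def by (auto simp: field_simps)
  have PP: "P ^ ?n = P ^ ?m * P ^ ?k" using J by (simp add: power_add[symmetric])
  let ?G = "\<integral>\<^sup>+y. ennreal (gauss I (lin I I T y)) * ennreal (1 / nrm I y ^ ?k) \<partial>leb I"
  have G: "?G \<le> ennreal (P ^ ?n / (d * s ^ ?k) + 2 ^ (?k + 1) * s ^ ?m * ball_vol I)"
    using gauss_weight_bound[OF I k(1) s T] k(3) by (simp add: P_def)
  have fin: "?G < \<top>" by (rule le_less_trans[OF G]) simp
  have "P ^ ?n / (d * s ^ ?k) + 2 ^ (?k + 1) * s ^ ?m * ball_vol I = (1 + 2 ^ (?k + 1)) * (P ^ ?n / (d * s ^ ?k))"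
    by (simp only: mult.assoc sm distrib_right mult_1_left)
  \<comment> \<open>Positive codimension enters here: 1 + 2^(k+1) <= 5^k holds from k = 1 on, with
    equality at k = 1.\<close>
  also have "\<dots> \<le> 5 ^ ?k * (P ^ ?n / (d * s ^ ?k))"
  proof (rule mult_right_mono)
    have "1 + 2 ^ (Suc j + 1) \<le> (5::real) ^ Suc j" for j
    proof -
      have "(2::real) ^ j \<le> 5 ^ j" by (rule power_mono) auto
      moreover have "1 \<le> (5::real) ^ j" by (rule one_le_power) simp
      ultimately have "1 + 4 * 2 ^ j \<le> 5 * (5::real) ^ j" by linarith
      then show ?thesis by simp
    qed
    moreover obtain j where "?k = Suc j" using k(2) by (cases ?k) auto
    ultimately show "1 + 2 ^ (?k + 1) \<le> (5::real) ^ ?k" by metis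
    show "0 \<le> P ^ ?n / (d * s ^ ?k)" using P s d by simp
  qed
  also have "\<dots> = P ^ ?m * (5 ^ ?k * E powr (real ?k / real ?n)) / d"
    unfolding PP sk using P by simp
  finally have G2: "?G \<le> ennreal (P ^ ?m * (5 ^ ?k * E powr (real ?k / real ?n)) / d)"
    using G by (meson ennreal_leI order_trans)
  have "ennreal (P ^ ?m) * (\<integral>\<^sup>+y. h (lin I I T y) * ennreal (1 / nrm I y ^ ?k) \<partial>leb I) \<le> S * ?G"
    unfolding P_def by (rule slice_average(1)[OF I J h fin S])
  also have "\<dots> \<le> S * ennreal (P ^ ?m * (5 ^ ?k * E powr (real ?k / real ?n)) / d)"
    by (rule mult_left_mono[OF G2]) simp
  finally have A: "ennreal (P ^ ?m) * (\<integral>\<^sup>+y. h (lin I I T y) * ennreal (1 / nrm I y ^ ?k) \<partial>leb I)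
     \<le> S * ennreal (P ^ ?m * (5 ^ ?k * E powr (real ?k / real ?n)) / d)" .
  have B: "(\<integral>\<^sup>+y. h (lin I I T y) \<partial>leb I) \<le> (\<integral>\<^sup>+y. h (lin I I T y) * ennreal (1 / nrm I y ^ ?k) \<partial>leb I)"
  proof (rule nn_integral_mono_AE)
    show "AE y in leb I. h (lin I I T y) \<le> h (lin I I T y) * ennreal (1 / nrm I y ^ ?k)"
      using AE_nonzero[OF I I0] AE_space[of "leb I"]
    proof eventually_elim
      case (elim y)
      show ?case
      proof (cases "h (lin I I T y) = 0")
        case False
        then have "nrm I y \<le> 1" using supp elim by simp
        moreover have p: "nrm I y > 0" using elim nrm_nonneg[of I y] by linarith
        ultimately have "nrm I y ^ ?k \<le> 1" by (intro power_le_one) auto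
        then have "1 \<le> 1 / nrm I y ^ ?k" using p by simp
        then have "1 \<le> ennreal (1 / nrm I y ^ ?k)" by (metis ennreal_1 ennreal_leI)
        then show ?thesis using mult_left_mono[of 1 _ "h (lin I I T y)"] by simp
      qed simp
    qed
  qed
  have "(\<integral>\<^sup>+x. h x \<partial>leb I) = ennreal d * (\<integral>\<^sup>+y. h (lin I I T y) \<partial>leb I)" by (rule scales_D[OF T h])
  also have "\<dots> \<le> ennreal d * (\<integral>\<^sup>+y. h (lin I I T y) * ennreal (1 / nrm I y ^ ?k) \<partial>leb I)"
    by (rule mult_left_mono[OF B]) simp
  also have "\<dots> = ennreal (d / P ^ ?m) * (ennreal (P ^ ?m) * (\<integral>\<^sup>+y. h (lin I I T y) * ennreal (1 / nrm I y ^ ?k) \<partial>leb I))"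
    using P d by (simp add: mult.assoc[symmetric] ennreal_mult'[symmetric])
  also have "\<dots> \<le> ennreal (d / P ^ ?m) * (S * ennreal (P ^ ?m * (5 ^ ?k * E powr (real ?k / real ?n)) / d))"
    by (rule mult_left_mono[OF A]) simp
  also have "\<dots> = S * (ennreal (d / P ^ ?m) * ennreal (P ^ ?m * (5 ^ ?k * E powr (real ?k / real ?n)) / d))"
    by (simp add: mult_ac)
  also have "ennreal (d / P ^ ?m) * ennreal (P ^ ?m * (5 ^ ?k * E powr (real ?k / real ?n)) / d) = ennreal (5 ^ ?k * E powr (real ?k / real ?n))"
    using P d by (simp add: ennreal_mult'[symmetric])
  finally show ?thesis by (simp add: E_def)
qed

text \<open>Here \<open>T\<close> is the identity. The weighted Gaussian integral is bounded below
  on the cube of half-side 1, where |y| <= sqrt n and 2^n exp (-n/2) >= 1; the number 3 bounds sqrt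
  (2 pi). Read contrapositively, a small weighted integral of \<open>h\<close> produces a subspace
  with a small section integral.\<close>

lemma slice_lower:
  assumes I: "finite I" and J: "finite J" "J \<noteq> {}" "card J < card I"
    and h [measurable]: "h \<in> borel_measurable (leb I)"
    and S: "\<And>U. frame I J U \<Longrightarrow> S \<le> (\<integral>\<^sup>+t. h (lin I J U t) \<partial>leb J)"
  shows "S \<le> ennreal (3 ^ card J * sqrt (real (card I)) ^ (card I - card J)) *
     (\<integral>\<^sup>+y. h y * ennreal (1 / nrm I y ^ (card I - card J)) \<partial>leb I)"
proof -
  let ?n = "card I" and ?m = "card J" and ?k = "card I - card J"
  let ?T = "\<lambda>i j. if i = j then 1 else 0 :: real"
  have I0: "I \<noteq> {}" using J by auto
  have "?m > 0" using J by (simp add: card_gt_0_iff)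
  then have n: "?n > 0" and k: "?k < ?n" using J(3) by linarith+
  have T: "scales I (lin I I ?T) 1" using vol_mat_id[OF I] by (simp add: vol_mat_def)
  have id: "lin I I ?T y = y" if "y \<in> vecs I" for y by (rule lin_id[OF I that]) simp
  let ?G = "\<integral>\<^sup>+y. ennreal (gauss I (lin I I ?T y)) * ennreal (1 / nrm I y ^ ?k) \<partial>leb I"
  have fin: "?G < \<top>" by (rule le_less_trans[OF gauss_weight_bound[OF I k zero_less_one T]]) simp
  define r where "r = sqrt (real ?n)"
  have r: "r > 0" using n by (simp add: r_def)
  have lower: "ennreal (1 / r ^ ?k) \<le> ?G"
  proof -
    have e: "1 \<le> exp (- real ?n / 2) * 2 ^ ?n"
    proof -
      have "exp (1 / 2 :: real) \<le> 1 + 1 / 2 + (1 / 2)\<^sup>2" by (rule exp_bound) auto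
      then have e: "exp (1 / 2 :: real) \<le> 2" by (simp add: power2_eq_square)
      have "exp (real ?n / 2) = exp (1 / 2) ^ ?n" by (simp add: exp_of_nat_mult[symmetric])
      also have "\<dots> \<le> 2 ^ ?n" by (rule power_mono[OF e]) simp
      finally show ?thesis by (simp add: exp_minus field_simps)
    qed
    have "ennreal (1 / r ^ ?k) \<le> ennreal ((exp (- real ?n / 2) * (1 / r ^ ?k)) * (2 * 1) ^ ?n)"
    proof (rule ennreal_leI)
      have "1 / r ^ ?k * 1 \<le> 1 / r ^ ?k * (exp (- real ?n / 2) * 2 ^ ?n)"
        by (rule mult_left_mono[OF e]) (use r in simp)
      then show "1 / r ^ ?k \<le> (exp (- real ?n / 2) * (1 / r ^ ?k)) * (2 * 1) ^ ?n" by (simp add: mult_ac)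
    qed
    also have "\<dots> = ennreal (exp (- real ?n / 2) * (1 / r ^ ?k)) * emeasure (leb I) (cube I 1)"
      using r I by (subst emeasure_cube) (simp_all add: ennreal_mult'[symmetric])
    also have "\<dots> = (\<integral>\<^sup>+y. ennreal (exp (- real ?n / 2) * (1 / r ^ ?k)) * indicator (cube I 1) y \<partial>leb I)"
      by (rule nn_integral_cmult_indicator[symmetric]) (use I in simp)
    also have "\<dots> \<le> ?G"
    proof (rule nn_integral_mono_AE)
      show "AE y in leb I. ennreal (exp (- real ?n / 2) * (1 / r ^ ?k)) * indicator (cube I 1) y \<le>
          ennreal (gauss I (lin I I ?T y)) * ennreal (1 / nrm I y ^ ?k)"
        using AE_nonzero[OF I I0] AE_space[of "leb I"]
      proof eventually_elim
        case (elim y)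
        have p: "nrm I y > 0" using elim nrm_nonneg[of I y] by linarith
        show ?case
        proof (cases "y \<in> cube I 1")
          case True
          then have nr: "nrm I y \<le> r" using cube_subset_cball[OF I, of 1] by (auto simp: cball_def r_def)
          then have "(nrm I y)\<^sup>2 \<le> r\<^sup>2" by (rule power_mono) simp
          then have g: "exp (- real ?n / 2) \<le> gauss I y" by (simp add: gauss_nrm r_def)
          have "1 / r ^ ?k \<le> 1 / nrm I y ^ ?k" using nr p by (intro divide_left_mono power_mono) auto
          with g have "exp (- real ?n / 2) * (1 / r ^ ?k) \<le> gauss I y * (1 / nrm I y ^ ?k)"
            by (rule mult_mono) (use r in auto)
          then have "ennreal (exp (- real ?n / 2) * (1 / r ^ ?k)) \<le> ennreal (gauss I y) * ennreal (1 / nrm I y ^ ?k)"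
            by (subst ennreal_mult'[symmetric]) (auto intro: ennreal_leI)
          then show ?thesis using elim True by (simp only: id space_leb indicator_simps(1) mult_1_right)
        qed simp
      qed
    qed
    finally show ?thesis .
  qed
  have "S * ?G \<le> ennreal (sqrt (2 * pi) ^ ?m) * (\<integral>\<^sup>+y. h (lin I I ?T y) * ennreal (1 / nrm I y ^ ?k) \<partial>leb I)"
    by (rule slice_average(2)[OF I J h fin S])
  also have "(\<integral>\<^sup>+y. h (lin I I ?T y) * ennreal (1 / nrm I y ^ ?k) \<partial>leb I) = (\<integral>\<^sup>+y. h y * ennreal (1 / nrm I y ^ ?k) \<partial>leb I)"
    by (rule nn_integral_cong) (simp only: space_leb id)
  finally have A: "S * ?G \<le> ennreal (sqrt (2 * pi) ^ ?m) * (\<integral>\<^sup>+y. h y * ennreal (1 / nrm I y ^ ?k) \<partial>leb I)" .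
  have "S = ennreal (r ^ ?k) * (S * ennreal (1 / r ^ ?k))"
    using r by (simp add: mult.left_commute[of _ S] ennreal_mult'[symmetric])
  also have "\<dots> \<le> ennreal (r ^ ?k) * (S * ?G)"
    by (intro mult_left_mono lower) auto
  also have "\<dots> \<le> ennreal (r ^ ?k) * (ennreal (sqrt (2 * pi) ^ ?m) * (\<integral>\<^sup>+y. h y * ennreal (1 / nrm I y ^ ?k) \<partial>leb I))"
    by (rule mult_left_mono[OF A]) simp
  also have "\<dots> \<le> ennreal (r ^ ?k) * (ennreal (3 ^ ?m) * (\<integral>\<^sup>+y. h y * ennreal (1 / nrm I y ^ ?k) \<partial>leb I))"
  proof (intro mult_left_mono mult_right_mono ennreal_leI power_mono)
    have "sqrt (2 * pi) \<le> sqrt (3\<^sup>2)" using pi_less_4 by (intro real_sqrt_le_mono) simp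
    then show "sqrt (2 * pi) \<le> 3" by simp
  qed auto
  also have "\<dots> = ennreal (3 ^ ?m * r ^ ?k) * (\<integral>\<^sup>+y. h y * ennreal (1 / nrm I y ^ ?k) \<partial>leb I)"
    using r by (simp add: ennreal_mult' mult_ac)
  finally show ?thesis by (simp add: r_def)
qed

section \<open>Symmetric convex bodies and polarity\<close>

text \<open>Interior is recorded as a cube about the origin. For symmetric convex sets this is no
  restriction, and it yields positive volume, bounded polars and nondegenerate covariances
  directly.\<close>

definition body :: "nat set \<Rightarrow> (nat \<Rightarrow> real) set \<Rightarrow> bool" where
  "body I K \<longleftrightarrow> K \<subseteq> vecs I \<and> compact K \<and>
     (\<forall>x\<in>K. \<forall>y\<in>K. \<forall>u. 0 \<le> u \<and> u \<le> 1 \<longrightarrow> comb I u x (1 - u) y \<in> K) \<and>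
     (\<forall>x\<in>K. comb I (-1) x 0 x \<in> K) \<and> (\<exists>r>0. cube I r \<subseteq> K)"

definition polar_set :: "nat set \<Rightarrow> (nat \<Rightarrow> real) set \<Rightarrow> (nat \<Rightarrow> real) set" where
  "polar_set I K = {y \<in> vecs I. \<forall>x\<in>K. dot I x y \<le> 1}"

abbreviation lvol :: "nat set \<Rightarrow> (nat \<Rightarrow> real) set \<Rightarrow> real" where
  "lvol I A \<equiv> measure (leb I) A"

text \<open>Compactness refers to the product topology over all naturals. On \<open>vecs I\<close>
  the coordinates outside \<open>I\<close> are constantly \<open>undefined\<close>, so they do not
  affect measurability.\<close>

lemma id_leb_borel: "(\<lambda>x. x) \<in> leb I \<rightarrow>\<^sub>M (borel :: (nat \<Rightarrow> real) measure)"
proof (rule measurable_coordinatewise_then_product)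
  fix i show "(\<lambda>x. x i) \<in> borel_measurable (leb I)"
  proof (cases "i \<in> I")
    case False
    then have "(\<lambda>x. x i) \<in> borel_measurable (leb I) \<longleftrightarrow> (\<lambda>x. undefined :: real) \<in> borel_measurable (leb I)"
      by (intro measurable_cong) (auto simp: PiE_iff extensional_def)
    then show ?thesis by simp
  qed simp
qed

lemma compact_sets_leb:
  assumes "compact K" "K \<subseteq> vecs I"
  shows "K \<in> sets (leb I)"
proof -
  have "(\<lambda>x. x) -` K \<inter> space (leb I) \<in> sets (leb I)"
    by (rule measurable_sets[OF id_leb_borel]) (use assms in \<open>simp add: borel_closed compact_imp_closed\<close>)
  moreover have "(\<lambda>x. x) -` K \<inter> space (leb I) = K" using assms(2) by auto
  ultimately show ?thesis by simp
qed

lemma compact_cube: "compact (cube I r)"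
proof -
  have "cube I r = PiE UNIV (\<lambda>i. if i \<in> I then {-r..r} else {undefined})"
    by (auto simp: cube_def PiE_iff extensional_def split: if_splits)
  moreover have "compactin (product_topology (\<lambda>_. euclidean) UNIV) (PiE UNIV (\<lambda>i. if i \<in> I then {-r..r::real} else {undefined}))"
    by (subst compactin_PiE) auto
  ultimately show ?thesis by (simp add: euclidean_product_topology)
qed

lemma closed_vecs: "closed (vecs I :: (nat \<Rightarrow> real) set)"
proof -
  have "vecs I = (\<Inter>i\<in>-I. {x :: nat \<Rightarrow> real. x i = undefined})"
    by (auto simp: PiE_iff extensional_def)
  moreover have "closed {x :: nat \<Rightarrow> real. x i = undefined}" for i
    by (rule closed_Collect_eq) (auto intro: continuous_on_product_coordinates)
  ultimately show ?thesis by auto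
qed

lemma continuous_dot: "continuous_on A (\<lambda>x. dot I x y)" "continuous_on A (\<lambda>y. dot I x y)" "continuous_on A (\<lambda>x. dot I x x)"
  unfolding dot_def
  by (intro continuous_intros continuous_on_subset[OF continuous_on_product_coordinates] subset_UNIV)+

lemma continuous_restrict:
  fixes f :: "'a::topological_space \<Rightarrow> nat \<Rightarrow> real"
  assumes "\<And>i. i \<in> I \<Longrightarrow> continuous_on A (\<lambda>x. f x i)"
  shows "continuous_on A (\<lambda>x. restrict (f x) I)"
proof (rule continuous_on_coordinatewise_then_product)
  fix i show "continuous_on A (\<lambda>x. restrict (f x) I i)"
    using assms by (cases "i \<in> I") auto
qed

lemma continuous_coord: "continuous_on A (\<lambda>x::nat \<Rightarrow> real. x i)"
  by (rule continuous_on_subset[OF continuous_on_product_coordinates subset_UNIV])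

lemma continuous_lin: "continuous_on A (lin I J M)"
proof -
  have "continuous_on A (\<lambda>x. lin I J M x)"
    unfolding lin_def by (rule continuous_restrict) (intro continuous_intros continuous_coord)
  then show ?thesis by simp
qed

lemma body_subset: "body I K \<Longrightarrow> K \<subseteq> vecs I"
  by (simp add: body_def)

lemma body_compact: "body I K \<Longrightarrow> compact K"
  by (simp add: body_def)

lemma body_sets: "body I K \<Longrightarrow> K \<in> sets (leb I)"
  by (simp add: body_def compact_sets_leb)

lemma body_cube:
  assumes "body I K" obtains r where "r > 0" "cube I r \<subseteq> K"
  using assms by (auto simp: body_def)

text \<open>Symmetry reduces to non-negative coefficients; the missing weight 1 - (a + b) is then
  put on the origin.\<close>

lemma body_comb:
  assumes K: "body I K" and xy: "x \<in> K" "y \<in> K" and ab: "\<bar>a\<bar> + \<bar>b\<bar> \<le> 1"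
  shows "comb I a x b y \<in> K"
proof -
  obtain r where r: "r > 0" "cube I r \<subseteq> K" using K by (rule body_cube)
  define z where "z = (\<lambda>i\<in>I. 0 :: real)"
  have z: "z \<in> K" using r by (auto simp: z_def cube_iff)
  have cv: "comb I u x (1 - u) y \<in> K" if "x \<in> K" "y \<in> K" "0 \<le> u" "u \<le> 1" for x y u
    using K that by (auto simp: body_def)
  have neg: "comb I (-1) x 0 x \<in> K" if "x \<in> K" for x using K that by (auto simp: body_def)
  have pos: "comb I a x b y \<in> K" if "x \<in> K" "y \<in> K" "a \<ge> 0" "b \<ge> 0" "a + b \<le> 1" for a b x y
  proof (cases "a + b = 0")
    case True
    then have "a = 0" "b = 0" using that by linarith+
    then have "comb I a x b y = z" by (intro vecs_eqI[of _ I]) (auto simp: z_def)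
    then show ?thesis using z by simp
  next
    case False
    then have s: "a + b > 0" using that by simp
    have "comb I (a / (a + b)) x (1 - a / (a + b)) y \<in> K"
      by (rule cv) (use that s in auto)
    then have "comb I (a + b) (comb I (a / (a + b)) x (1 - a / (a + b)) y) (1 - (a + b)) z \<in> K"
      by (rule cv[OF _ z]) (use that in auto)
    moreover have "comb I (a + b) (comb I (a / (a + b)) x (1 - a / (a + b)) y) (1 - (a + b)) z = comb I a x b y"
    proof (rule vecs_eqI[of _ I])
      fix i assume i: "i \<in> I"
      have "(a + b) * (a / (a + b) * x i + (1 - a / (a + b)) * y i) = a * x i + b * y i"
      proof -
        have "1 - a / (a + b) = b / (a + b)" using s by (simp add: field_simps)
        then show ?thesis using s by (simp add: distrib_left)
      qed
      then show "comb I (a + b) (comb I (a / (a + b)) x (1 - a / (a + b)) y) (1 - (a + b)) z i = comb I a x b y i"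
        using i by (simp add: z_def)
    qed auto
    ultimately show ?thesis by simp
  qed
  define x' where "x' = (if a \<ge> 0 then x else comb I (-1) x 0 x)"
  define y' where "y' = (if b \<ge> 0 then y else comb I (-1) y 0 y)"
  have "comb I \<bar>a\<bar> x' \<bar>b\<bar> y' \<in> K"
    by (rule pos) (use xy neg ab in \<open>auto simp: x'_def y'_def\<close>)
  moreover have "comb I \<bar>a\<bar> x' \<bar>b\<bar> y' = comb I a x b y"
    by (rule vecs_eqI[of _ I]) (auto simp: x'_def y'_def)
  ultimately show ?thesis by simp
qed

lemma body_neg: "body I K \<Longrightarrow> x \<in> K \<Longrightarrow> comb I (-1) x 0 x \<in> K"
  by (rule body_comb) auto

lemma body_bounded:
  assumes I: "finite I" and K: "body I K"
  obtains R where "R > 0" "K \<subseteq> cube I R"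
proof -
  have "\<exists>R. \<forall>x\<in>K. \<bar>x i\<bar> \<le> R" for i
  proof -
    have "compact ((\<lambda>x. x i) ` K)"
      by (rule compact_continuous_image[OF continuous_coord body_compact[OF K]])
    then have "bounded ((\<lambda>x. x i) ` K)" by (rule compact_imp_bounded)
    then show ?thesis by (auto simp: bounded_iff)
  qed
  then obtain R where R: "\<And>i x. x \<in> K \<Longrightarrow> \<bar>x i\<bar> \<le> R i" by metis
  show ?thesis
  proof
    let ?R = "1 + (\<Sum>i\<in>I. \<bar>R i\<bar>)"
    show "?R > 0" by (simp add: add_pos_nonneg sum_nonneg)
    show "K \<subseteq> cube I ?R"
    proof
      fix x assume x: "x \<in> K"
      have "\<bar>x i\<bar> \<le> ?R" if "i \<in> I" for i
      proof -
        have "\<bar>x i\<bar> \<le> \<bar>R i\<bar>" using R[OF x, of i] by simp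
        also have "\<dots> \<le> (\<Sum>i\<in>I. \<bar>R i\<bar>)" using I that by (intro member_le_sum) auto
        finally show ?thesis by simp
      qed
      then show "x \<in> cube I ?R" using x body_subset[OF K] by (auto simp: cube_iff)
    qed
  qed
qed

lemma body_emeasure:
  assumes I: "finite I" and K: "body I K"
  shows "emeasure (leb I) K = ennreal (lvol I K)"
proof -
  obtain R where R: "R > 0" "K \<subseteq> cube I R" using I K by (rule body_bounded)
  have "emeasure (leb I) K \<le> emeasure (leb I) (cube I R)" by (rule emeasure_mono[OF R(2) cube_sets[OF I]])
  then have "emeasure (leb I) K < \<top>" using I R by (simp add: emeasure_cube le_less_trans)
  then show ?thesis by (intro emeasure_eq_ennreal_measure) simp
qed

lemma body_lvol_pos:
  assumes I: "finite I" and K: "body I K"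
  shows "0 < lvol I K"
proof -
  obtain r where r: "r > 0" "cube I r \<subseteq> K" using K by (rule body_cube)
  have "emeasure (leb I) (cube I r) \<le> emeasure (leb I) K" by (rule emeasure_mono[OF r(2) body_sets[OF K]])
  then have "(2 * r) ^ card I \<le> lvol I K"
    using I r by (simp add: emeasure_cube body_emeasure[OF I K])
  moreover have "0 < (2 * r) ^ card I" using r by simp
  ultimately show ?thesis by linarith
qed

lemma bodyI_closed:
  assumes I: "finite I" and "closed K" "K \<subseteq> cube I R" "r > 0" "cube I r \<subseteq> K"
    "\<And>x y u. x \<in> K \<Longrightarrow> y \<in> K \<Longrightarrow> 0 \<le> u \<Longrightarrow> u \<le> 1 \<Longrightarrow> comb I u x (1 - u) y \<in> K"
    "\<And>x. x \<in> K \<Longrightarrow> comb I (-1) x 0 x \<in> K"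
  shows "body I K"
proof -
  have "compact (cube I R \<inter> K)" by (rule compact_Int_closed[OF compact_cube assms(2)])
  then have "compact K" using assms(3) by (simp add: Int_absorb1)
  moreover have "K \<subseteq> vecs I" using assms(3) cube_iff by blast
  ultimately show ?thesis using assms unfolding body_def by blast
qed

lemma body_polar_set:
  assumes I: "finite I" and K: "body I K"
  shows "body I (polar_set I K)"
proof -
  obtain r where r: "r > 0" "cube I r \<subseteq> K" using K by (rule body_cube)
  obtain R where R: "R > 0" "K \<subseteq> cube I R" using I K by (rule body_bounded)
  show ?thesis
  proof (rule bodyI_closed[OF I])
    have "polar_set I K = vecs I \<inter> (\<Inter>x\<in>K. {y. dot I x y \<le> 1})" by (auto simp: polar_set_def)
    moreover have "closed {y. dot I x y \<le> 1}" for x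
      by (rule closed_Collect_le) (auto intro: continuous_dot)
    ultimately show "closed (polar_set I K)" by (auto intro!: closed_Int closed_vecs)
    show "polar_set I K \<subseteq> cube I (1 / r)"
    proof
      fix y assume y: "y \<in> polar_set I K"
      have "\<bar>y i\<bar> \<le> 1 / r" if i: "i \<in> I" for i
      proof -
        have 1: "comb I r (unitv I i) 0 (unitv I i) \<in> K" "comb I (-r) (unitv I i) 0 (unitv I i) \<in> K"
          using r by (auto simp: subset_iff cube_iff unitv_def)
        have "dot I (comb I r (unitv I i) 0 (unitv I i)) y \<le> 1" "dot I (comb I (-r) (unitv I i) 0 (unitv I i)) y \<le> 1"
          using y 1 by (auto simp: polar_set_def)
        then have "r * y i \<le> 1" "- r * y i \<le> 1" using I i by simp_all
        then show ?thesis using r by (simp add: abs_le_iff field_simps)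
      qed
      then show "y \<in> cube I (1 / r)" using y by (auto simp: cube_iff polar_set_def)
    qed
    define q where "q = 1 / (R * (1 + real (card I)))"
    show q: "q > 0" using R by (simp add: q_def)
    show "cube I q \<subseteq> polar_set I K"
    proof
      fix y assume y: "y \<in> cube I q"
      have "dot I x y \<le> 1" if x: "x \<in> K" for x
      proof -
        have "dot I x y \<le> (\<Sum>i\<in>I. R * q)"
          unfolding dot_def
        proof (rule sum_mono)
          fix i assume i: "i \<in> I"
          have "x i * y i \<le> \<bar>x i\<bar> * \<bar>y i\<bar>" by (metis abs_ge_self abs_mult)
          also have "\<dots> \<le> R * q" using x R y q i by (intro mult_mono) (auto simp: cube_iff subset_iff)
          finally show "x i * y i \<le> R * q" .
        qed
        also have "\<dots> = real (card I) / (1 + real (card I))" using R by (simp add: q_def)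
        also have "\<dots> \<le> 1" by (simp add: field_simps)
        finally show ?thesis .
      qed
      then show "y \<in> polar_set I K" using y by (auto simp: polar_set_def cube_iff)
    qed
    show "comb I u x (1 - u) y \<in> polar_set I K" if xy: "x \<in> polar_set I K" "y \<in> polar_set I K" "0 \<le> u" "u \<le> 1" for x y u
    proof -
      have "u * dot I z x + (1 - u) * dot I z y \<le> 1" if "z \<in> K" for z
        using xy that convex_bound_le[of "dot I z x" 1 "dot I z y" u "1 - u"] by (auto simp: polar_set_def)
      then show ?thesis by (auto simp: polar_set_def)
    qed
    show "comb I (-1) x 0 x \<in> polar_set I K" if x: "x \<in> polar_set I K" for x
    proof -
      have "- dot I z x \<le> 1" if z: "z \<in> K" for z
      proof -
        have "dot I (comb I (-1) z 0 z) x \<le> 1" using body_neg[OF K z] x by (auto simp: polar_set_def)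
        then show ?thesis by simp
      qed
      then show ?thesis by (auto simp: polar_set_def)
    qed
  qed
qed

text \<open>The nearest point \<open>z0\<close> of \<open>K\<close> gives the normal
  \<open>v = x - z0\<close>. Its maximum \<open>c\<close> on \<open>K\<close> is positive because
  \<open>K\<close> contains a small multiple of \<open>v\<close>, so \<open>v\<close> can be
  rescaled into the polar body.\<close>

lemma separation:
  assumes I: "finite I" and K: "body I K" and x: "x \<in> vecs I" "x \<notin> K"
  shows "\<exists>u\<in>polar_set I K. 1 < dot I u x"
proof -
  obtain r where r: "r > 0" "cube I r \<subseteq> K" using K by (rule body_cube)
  have "(\<lambda>i\<in>I. 0) \<in> K" using r by (auto simp: cube_iff)
  then have ne: "K \<noteq> {}" by auto
  have "continuous_on K (\<lambda>z. dot I (comb I 1 x (-1) z) (comb I 1 x (-1) z))"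
  proof -
    have "(\<lambda>z. dot I (comb I 1 x (-1) z) (comb I 1 x (-1) z)) = (\<lambda>z. \<Sum>i\<in>I. (x i - z i) * (x i - z i))"
      by (simp add: dot_def)
    moreover have "continuous_on K (\<lambda>z. \<Sum>i\<in>I. (x i - z i) * (x i - z i))"
      by (intro continuous_intros continuous_coord)
    ultimately show ?thesis by (simp only:)
  qed
  from continuous_attains_inf[OF body_compact[OF K] ne this] obtain z0 where z0: "z0 \<in> K"
    "\<And>z. z \<in> K \<Longrightarrow> dot I (comb I 1 x (-1) z0) (comb I 1 x (-1) z0) \<le> dot I (comb I 1 x (-1) z) (comb I 1 x (-1) z)"
    by blast
  define v where "v = comb I 1 x (-1) z0"
  have v: "v \<in> vecs I" by (simp add: v_def)
  have "x \<noteq> z0" using x z0 by auto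
  then obtain i where "i \<in> I" "x i \<noteq> z0 i" using vecs_eqI[of x I z0] x z0 body_subset[OF K] by blast
  then have "nrm I v \<noteq> 0" using I by (auto simp: nrm_eq_0 v_def)
  then have vv: "dot I v v > 0" using dot_self_nonneg[of I v] by (auto simp: nrm_def less_le)
  have le: "dot I v z \<le> dot I v z0" if z: "z \<in> K" for z
  proof (rule ccontr)
    assume gt: "\<not> dot I v z \<le> dot I v z0"
    define w where "w = comb I 1 z (-1) z0"
    have vw: "dot I v w > 0" using gt by (simp add: w_def)
    have ineq: "2 * dot I v w \<le> e * dot I w w" if e: "0 < e" "e \<le> 1" for e
    proof -
      have "comb I e z (1 - e) z0 \<in> K" by (rule body_comb[OF K z z0(1)]) (use e in auto)
      from z0(2)[OF this] have "dot I v v \<le> dot I (comb I 1 x (-1) (comb I e z (1 - e) z0)) (comb I 1 x (-1) (comb I e z (1 - e) z0))"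
        by (simp only: v_def)
      also have "comb I 1 x (-1) (comb I e z (1 - e) z0) = comb I 1 v (-e) w"
        by (rule vecs_eqI[of _ I]) (auto simp: v_def w_def algebra_simps)
      also have "dot I (comb I 1 v (-e) w) (comb I 1 v (-e) w) = dot I v v - 2 * e * dot I v w + e * e * dot I w w"
        by (simp add: dot_commute[of I w v] algebra_simps)
      finally have "e * (2 * dot I v w) \<le> e * (e * dot I w w)" by (simp add: algebra_simps)
      then show ?thesis using e by simp
    qed
    have ww: "dot I w w \<ge> 0" by simp
    \<comment> \<open>Small enough for the linear gain of moving from \<open>z0\<close> towards z to
      exceed the quadratic loss, contradicting minimality of the distance.\<close>
    define e where "e = min 1 (dot I v w / (1 + dot I w w))"
    have e: "0 < e" "e \<le> 1" using vw ww by (auto simp: e_def add_pos_nonneg)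
    have "e * dot I w w \<le> dot I v w / (1 + dot I w w) * dot I w w"
      by (rule mult_right_mono) (auto simp: e_def)
    also have "\<dots> \<le> dot I v w"
    proof -
      have "dot I v w * dot I w w \<le> dot I v w * (1 + dot I w w)" using vw by (simp add: distrib_left)
      moreover have "1 + dot I w w > 0" using ww by linarith
      ultimately show ?thesis by (simp add: pos_divide_le_eq)
    qed
    finally show False using ineq[OF e] vw by linarith
  qed
  define c where "c = dot I v z0"
  have c: "c > 0"
  proof -
    define e where "e = r / (1 + nrm I v)"
    have e: "e > 0" using r nrm_nonneg[of I v] by (simp add: e_def add_pos_nonneg)
    have "comb I e v 0 v \<in> cube I r"
    proof -
      have "\<bar>e * v i\<bar> \<le> r" if "i \<in> I" for i
      proof -
        have "\<bar>e * v i\<bar> \<le> e * nrm I v" using abs_le_nrm[OF I that, of v] e by (simp add: abs_mult)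
        also have "\<dots> \<le> e * (1 + nrm I v)" using e by simp
        also have "\<dots> = r" using nrm_nonneg[of I v] by (simp add: e_def add_nonneg_eq_0_iff)
        finally show ?thesis .
      qed
      then show ?thesis by (simp add: cube_iff)
    qed
    then have "comb I e v 0 v \<in> K" using r by blast
    then have "dot I v (comb I e v 0 v) \<le> c" unfolding c_def by (rule le)
    then have "e * dot I v v \<le> c" by simp
    then show ?thesis using mult_pos_pos[OF e vv] by linarith
  qed
  define u where "u = comb I (1 / c) v 0 v"
  have "u \<in> polar_set I K"
    using le c by (auto simp: polar_set_def u_def dot_commute[of I _ v] c_def field_simps)
  moreover have "1 < dot I u x"
  proof -
    have "dot I v x = dot I v v + c" by (simp add: v_def c_def)
    then show ?thesis using vv c by (simp add: u_def field_simps)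
  qed
  ultimately show ?thesis by blast
qed

lemma bipolar:
  assumes I: "finite I" and K: "body I K"
  shows "polar_set I (polar_set I K) = K"
proof
  show "polar_set I (polar_set I K) \<subseteq> K"
  proof
    fix x assume x: "x \<in> polar_set I (polar_set I K)"
    show "x \<in> K"
    proof (rule ccontr)
      assume "x \<notin> K"
      with separation[OF I K, of x] x obtain u where "u \<in> polar_set I K" "1 < dot I u x" by (auto simp: polar_set_def)
      then show False using x by (auto simp: polar_set_def)
    qed
  qed
  show "K \<subseteq> polar_set I (polar_set I K)"
    using body_subset[OF K] by (auto simp: polar_set_def dot_commute[of I _ _])
qed

lemma body_lin_image:
  assumes I: "finite I" and K: "body I K" and inv: "inv_mat I M N"
  shows "body I (lin I I M ` K)"
proof -
  obtain r where r: "r > 0" "cube I r \<subseteq> K" using K by (rule body_cube)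
  obtain c where c: "c > 0" "\<And>x r i. (\<forall>j\<in>I. \<bar>x j\<bar> \<le> r) \<Longrightarrow> r \<ge> 0 \<Longrightarrow> i \<in> I \<Longrightarrow> \<bar>lin I I N x i\<bar> \<le> c * r"
    using lin_bound[OF I I, of N] by blast
  have "cube I (r / c) \<subseteq> lin I I M ` K"
  proof
    fix y assume y: "y \<in> cube I (r / c)"
    then have "lin I I N y \<in> cube I r" using c(2)[of y "r / c"] c(1) r by (auto simp: cube_iff)
    then have "lin I I N y \<in> K" using r by auto
    moreover have "lin I I M (lin I I N y) = y" using y inv by (auto simp: inv_mat_def cube_iff)
    ultimately show "y \<in> lin I I M ` K" by (metis imageI)
  qed
  moreover have "r / c > 0" using r c by simp
  moreover have "compact (lin I I M ` K)"
    by (rule compact_continuous_image[OF continuous_lin body_compact[OF K]])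
  moreover have "comb I u x (1 - u) y \<in> lin I I M ` K" if A: "x \<in> lin I I M ` K" "y \<in> lin I I M ` K" "0 \<le> u" "u \<le> 1" for x y u
  proof -
    obtain x' y' where "x' \<in> K" "y' \<in> K" "x = lin I I M x'" "y = lin I I M y'" using A(1,2) by blast
    moreover then have "comb I u x' (1 - u) y' \<in> K" using A by (intro body_comb[OF K]) auto
    ultimately show ?thesis by (metis imageI lin_comb)
  qed
  moreover have "comb I (-1) x 0 x \<in> lin I I M ` K" if A: "x \<in> lin I I M ` K" for x
  proof -
    obtain x' where "x' \<in> K" "x = lin I I M x'" using A by blast
    then show ?thesis using body_neg[OF K, of x'] by (metis imageI lin_comb)
  qed
  moreover have "lin I I M ` K \<subseteq> vecs I" using lin_in by blast
  ultimately show ?thesis unfolding body_def by blast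
qed

lemma lin_image_eq:
  assumes inv: "inv_mat I M N" and K: "K \<subseteq> vecs I"
  shows "lin I I M ` K = {y \<in> vecs I. lin I I N y \<in> K}"
proof
  show "lin I I M ` K \<subseteq> {y \<in> vecs I. lin I I N y \<in> K}"
  proof
    fix y assume "y \<in> lin I I M ` K"
    then obtain x where x: "x \<in> K" "y = lin I I M x" by blast
    then have "lin I I N y = x" using assms by (simp add: inv_mat_def subset_iff)
    then show "y \<in> {y \<in> vecs I. lin I I N y \<in> K}" using x by simp
  qed
  show "{y \<in> vecs I. lin I I N y \<in> K} \<subseteq> lin I I M ` K"
  proof
    fix y assume y: "y \<in> {y \<in> vecs I. lin I I N y \<in> K}"
    then have "y = lin I I M (lin I I N y)" using inv by (auto simp: inv_mat_def)
    then show "y \<in> lin I I M ` K" using y by blast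
  qed
qed

lemma polar_set_lin_image:
  assumes I: "finite I" and inv: "inv_mat I M N" and K: "K \<subseteq> vecs I"
  shows "polar_set I (lin I I M ` K) = lin I I (transp N) ` polar_set I K"
proof -
  have "lin I I (transp N) ` polar_set I K = {y \<in> vecs I. lin I I (transp M) y \<in> polar_set I K}"
    by (rule lin_image_eq[OF inv_mat_sym[OF inv_mat_transp[OF I inv]]]) (auto simp: polar_set_def)
  then show ?thesis using I by (auto simp: polar_set_def dot_lin)
qed

lemma lvol_lin_image:
  assumes I: "finite I" and inv: "inv_mat I M N" and sc: "scales I (lin I I M) d" and K: "body I K"
  shows "lvol I (lin I I M ` K) = d * lvol I K"
proof -
  have b: "body I (lin I I M ` K)" by (rule body_lin_image[OF I K inv])
  have "emeasure (leb I) (lin I I M ` K) = ennreal d * emeasure (leb I) {x \<in> vecs I. lin I I M x \<in> lin I I M ` K}"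
    by (rule scales_emeasure[OF sc body_sets[OF b]])
  also have "{x \<in> vecs I. lin I I M x \<in> lin I I M ` K} = K"
  proof -
    have "x \<in> K" if "x \<in> vecs I" "lin I I M x = lin I I M y" "y \<in> K" for x y
    proof -
      have "x = lin I I N (lin I I M x)" using inv that by (auto simp: inv_mat_def)
      also have "\<dots> = y" using inv that body_subset[OF K] by (auto simp: inv_mat_def)
      finally show ?thesis using that by simp
    qed
    then show ?thesis using body_subset[OF K] by auto
  qed
  finally show ?thesis
    using scales_pos[OF sc] by (simp add: body_emeasure[OF I b] body_emeasure[OF I K] ennreal_mult'[symmetric])
qed

lemma emeasure_affine_vimage:
  assumes I: "finite I" and c: "c \<noteq> 0" and A: "A \<in> sets (leb I)"
  shows "emeasure (leb I) {x \<in> vecs I. comb I c x 1 a \<in> A} = ennreal ((1 / \<bar>c\<bar>) ^ card I) * emeasure (leb I) A"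
proof -
  have "emeasure (leb I) A = ennreal (\<bar>c\<bar> ^ card I) * emeasure (leb I) {x \<in> vecs I. comb I c x 1 a \<in> A}"
    by (rule scales_emeasure[OF scales_affine[OF I c] A])
  then show ?thesis using c by (simp add: mult.assoc[symmetric] ennreal_mult'[symmetric] power_one_over)
qed

lemma affine_vimage_sets:
  assumes "A \<in> sets (leb I)"
  shows "{x \<in> vecs I. comb I c x 1 a \<in> A} \<in> sets (leb I)"
proof -
  have "(\<lambda>x. comb I c x 1 a) \<in> leb I \<rightarrow>\<^sub>M leb I"
    unfolding comb_def by (rule measurable_lbI) auto
  from measurable_sets[OF this assms] have "(\<lambda>x. comb I c x 1 a) -` A \<inter> space (leb I) \<in> sets (leb I)" .
  moreover have "(\<lambda>x. comb I c x 1 a) -` A \<inter> space (leb I) = {x \<in> vecs I. comb I c x 1 a \<in> A}" by auto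
  ultimately show ?thesis by simp
qed

section \<open>Sections and projections\<close>

definition ext0 :: "nat set \<Rightarrow> nat set \<Rightarrow> (nat \<Rightarrow> real) \<Rightarrow> nat \<Rightarrow> real" where
  "ext0 I J y = restrict (\<lambda>i. if i \<in> J then y i else 0) I"

text \<open>Only coordinate subspaces occur. A general subspace is treated by completing an
  orthonormal frame and rotating the body.\<close>

definition sec_set :: "nat set \<Rightarrow> nat set \<Rightarrow> (nat \<Rightarrow> real) set \<Rightarrow> (nat \<Rightarrow> real) set" where
  "sec_set I J K = {y \<in> vecs J. ext0 I J y \<in> K}"

definition proj_set :: "nat set \<Rightarrow> (nat \<Rightarrow> real) set \<Rightarrow> (nat \<Rightarrow> real) set" where
  "proj_set J K = (\<lambda>x. restrict x J) ` K"

lemma ext0_in [simp]: "ext0 I J y \<in> vecs I"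
  by (simp add: ext0_def)

lemma ext0_comb: "J \<subseteq> I \<Longrightarrow> ext0 I J (comb J a x b y) = comb I a (ext0 I J x) b (ext0 I J y)"
  by (rule vecs_eqI[of _ I]) (auto simp: ext0_def)

lemma dot_ext0: "finite I \<Longrightarrow> J \<subseteq> I \<Longrightarrow> dot I x (ext0 I J y) = dot J (restrict x J) y"
  unfolding dot_def by (rule sum.mono_neutral_cong_right) (auto simp: ext0_def)

lemma nrm_ext0: "finite I \<Longrightarrow> J \<subseteq> I \<Longrightarrow> nrm I (ext0 I J y) = nrm J y"
proof -
  assume "finite I" "J \<subseteq> I"
  then have "dot I (ext0 I J y) (ext0 I J y) = dot J y y"
    unfolding dot_def by (intro sum.mono_neutral_cong_right) (auto simp: ext0_def)
  then show ?thesis by (simp add: nrm_def)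
qed

lemma ext0_cube: "J \<subseteq> I \<Longrightarrow> r \<ge> 0 \<Longrightarrow> y \<in> cube J r \<Longrightarrow> ext0 I J y \<in> cube I r"
  by (auto simp: cube_iff ext0_def)

lemma restrict_ext0: "J \<subseteq> I \<Longrightarrow> y \<in> vecs J \<Longrightarrow> restrict (ext0 I J y) J = y"
  by (rule vecs_eqI[of _ J]) (auto simp: ext0_def)

lemma body_sec_set:
  assumes I: "finite I" and J: "J \<subseteq> I" and K: "body I K"
  shows "body J (sec_set I J K)"
proof -
  obtain r where r: "r > 0" "cube I r \<subseteq> K" using K by (rule body_cube)
  obtain R where R: "R > 0" "K \<subseteq> cube I R" using I K by (rule body_bounded)
  show ?thesis
  proof (rule bodyI_closed)
    show "finite J" using I J finite_subset by blast
    have "continuous_on UNIV (\<lambda>y. ext0 I J y)"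
      unfolding ext0_def
    proof (rule continuous_restrict)
      fix i show "continuous_on UNIV (\<lambda>y::nat \<Rightarrow> real. if i \<in> J then y i else 0)"
        by (cases "i \<in> J") (auto intro: continuous_coord)
    qed
    then have "closed ((\<lambda>y. ext0 I J y) -` K)"
      using body_compact[OF K] by (intro closed_vimage) (auto simp: compact_imp_closed)
    moreover have "sec_set I J K = vecs J \<inter> (\<lambda>y. ext0 I J y) -` K" by (auto simp: sec_set_def)
    ultimately show "closed (sec_set I J K)" by (simp only:) (intro closed_Int closed_vecs)
    show "sec_set I J K \<subseteq> cube J R"
    proof
      fix y assume y: "y \<in> sec_set I J K"
      then have e: "ext0 I J y \<in> cube I R" using R by (auto simp: sec_set_def)
      have "\<bar>y i\<bar> \<le> R" if "i \<in> J" for i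
      proof -
        have "\<bar>ext0 I J y i\<bar> \<le> R" using e that J unfolding cube_iff by blast
        then show ?thesis using that J by (auto simp: ext0_def)
      qed
      then show "y \<in> cube J R" using y by (simp add: cube_iff sec_set_def)
    qed
    show "r > 0" by fact
    show "cube J r \<subseteq> sec_set I J K"
    proof
      fix y assume y: "y \<in> cube J r"
      then have "ext0 I J y \<in> K" using ext0_cube[OF J _ y] r by auto
      then show "y \<in> sec_set I J K" using y by (simp add: sec_set_def cube_iff)
    qed
    show "comb J u x (1 - u) y \<in> sec_set I J K" if "x \<in> sec_set I J K" "y \<in> sec_set I J K" "0 \<le> u" "u \<le> 1" for x y u
    proof -
      have "comb I u (ext0 I J x) (1 - u) (ext0 I J y) \<in> K"
        using that by (intro body_comb[OF K]) (auto simp: sec_set_def)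
      then show ?thesis by (simp add: sec_set_def ext0_comb[OF J])
    qed
    show "comb J (-1) x 0 x \<in> sec_set I J K" if "x \<in> sec_set I J K" for x
    proof -
      have "comb I (-1) (ext0 I J x) 0 (ext0 I J x) \<in> K"
        using that by (intro body_comb[OF K]) (auto simp: sec_set_def)
      then show ?thesis by (simp add: sec_set_def ext0_comb[OF J])
    qed
  qed
qed

lemma restrict_comb: "J \<subseteq> I \<Longrightarrow> restrict (comb I a x b y) J = comb J a (restrict x J) b (restrict y J)"
  by (rule vecs_eqI[of _ J]) auto

lemma body_proj_set:
  assumes I: "finite I" and J: "J \<subseteq> I" and K: "body I K"
  shows "body J (proj_set J K)"
proof -
  obtain r where r: "r > 0" "cube I r \<subseteq> K" using K by (rule body_cube)
  have "compact (proj_set J K)"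
    unfolding proj_set_def by (intro compact_continuous_image body_compact[OF K] continuous_restrict continuous_coord)
  moreover have "proj_set J K \<subseteq> vecs J" by (auto simp: proj_set_def)
  moreover have "cube J r \<subseteq> proj_set J K"
  proof
    fix y assume y: "y \<in> cube J r"
    then have "ext0 I J y \<in> K" using ext0_cube[OF J _ y] r by auto
    moreover have "y = restrict (ext0 I J y) J" using y restrict_ext0[OF J] by (simp add: cube_iff)
    ultimately show "y \<in> proj_set J K" unfolding proj_set_def by blast
  qed
  moreover have "comb J u x (1 - u) y \<in> proj_set J K" if A: "x \<in> proj_set J K" "y \<in> proj_set J K" "0 \<le> u" "u \<le> 1" for x y u
  proof -
    obtain x' y' where xy: "x' \<in> K" "y' \<in> K" "x = restrict x' J" "y = restrict y' J" using A(1,2) unfolding proj_set_def by blast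
    then have "comb I u x' (1 - u) y' \<in> K" using A by (intro body_comb[OF K]) auto
    then show ?thesis unfolding proj_set_def xy restrict_comb[OF J, symmetric] by blast
  qed
  moreover have "comb J (-1) x 0 x \<in> proj_set J K" if A: "x \<in> proj_set J K" for x
  proof -
    obtain x' where x: "x' \<in> K" "x = restrict x' J" using A unfolding proj_set_def by blast
    then have "comb I (-1) x' 0 x' \<in> K" by (intro body_comb[OF K]) auto
    then show ?thesis unfolding proj_set_def x restrict_comb[OF J, symmetric] by blast
  qed
  ultimately show ?thesis using r(1) unfolding body_def by blast
qed

lemma polar_set_proj_set:
  assumes "finite I" "J \<subseteq> I"
  shows "polar_set J (proj_set J K) = sec_set I J (polar_set I K)"
  by (auto simp: polar_set_def proj_set_def sec_set_def dot_ext0[OF assms])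

text \<open>Dual to \<open>polar_set_proj_set\<close>: apply that to the polar body and take
  bipolars on both sides.\<close>

lemma polar_set_sec_set:
  assumes I: "finite I" and J: "J \<subseteq> I" and K: "body I K"
  shows "polar_set J (sec_set I J K) = proj_set J (polar_set I K)"
proof -
  have "finite J" using I J finite_subset by blast
  have "polar_set J (proj_set J (polar_set I K)) = sec_set I J (polar_set I (polar_set I K))" by (rule polar_set_proj_set[OF I J])
  also have "polar_set I (polar_set I K) = K" by (rule bipolar[OF I K])
  finally show ?thesis
    using bipolar[OF \<open>finite J\<close> body_proj_set[OF I J body_polar_set[OF I K]]] by simp
qed

definition glue :: "nat set \<Rightarrow> nat set \<Rightarrow> (nat \<Rightarrow> real) \<Rightarrow> (nat \<Rightarrow> real) \<Rightarrow> nat \<Rightarrow> real" where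
  "glue J J' y z = restrict (\<lambda>i. if i \<in> J then y i else z i) (J \<union> J')"

lemma glue_in [simp]: "glue J J' y z \<in> vecs (J \<union> J')"
  unfolding glue_def by (rule restrict_PiE_iff[THEN iffD2]) simp

lemma glue_sets:
  assumes "A \<in> sets (leb (J \<union> J'))" "z \<in> vecs J'"
  shows "{y \<in> vecs J. glue J J' y z \<in> A} \<in> sets (leb J)"
proof -
  have m: "(\<lambda>y. glue J J' y z) \<in> leb J \<rightarrow>\<^sub>M leb (J \<union> J')"
    unfolding glue_def
  proof (rule measurable_lbI)
    fix i show "(\<lambda>y. if i \<in> J then y i else z i) \<in> borel_measurable (leb J)"
      by (cases "i \<in> J") auto
  qed
  from measurable_sets[OF this assms(1)] show ?thesis
    by (simp add: vimage_def Int_def conj_commute)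
qed

lemma emeasure_fold:
  assumes J: "finite J" "finite J'" "J \<inter> J' = {}" and A: "A \<in> sets (leb (J \<union> J'))"
  shows "emeasure (leb (J \<union> J')) A = (\<integral>\<^sup>+z. emeasure (leb J) {y \<in> vecs J. glue J J' y z \<in> A} \<partial>leb J')"
proof -
  have JJ: "J' \<inter> J = {}" "J' \<union> J = J \<union> J'" using J by auto
  have "emeasure (leb (J \<union> J')) A = (\<integral>\<^sup>+x. indicator A x \<partial>PiM (J' \<union> J) (\<lambda>_. lborel))"
    using A by (simp add: JJ(2) leb_def)
  also have "\<dots> = (\<integral>\<^sup>+z. (\<integral>\<^sup>+y. indicator A (merge J' J (z, y)) \<partial>PiM J (\<lambda>_. lborel)) \<partial>PiM J' (\<lambda>_. lborel))"
    by (rule lborel_prod.product_nn_integral_fold[OF JJ(1) J(2,1)]) (use A in \<open>simp add: JJ(2) leb_def\<close>)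
  also have "\<dots> = (\<integral>\<^sup>+z. emeasure (leb J) {y \<in> vecs J. glue J J' y z \<in> A} \<partial>leb J')"
    unfolding leb_def[symmetric]
  proof (rule nn_integral_cong)
    fix z assume z: "z \<in> space (leb J')"
    have "(\<integral>\<^sup>+y. indicator A (merge J' J (z, y)) \<partial>leb J) = (\<integral>\<^sup>+y. indicator {y \<in> vecs J. glue J J' y z \<in> A} y \<partial>leb J)"
    proof (rule nn_integral_cong)
      fix y assume y: "y \<in> space (leb J)"
      have "merge J' J (z, y) = glue J J' y z"
        using JJ J by (auto simp: merge_def glue_def fun_eq_iff)
      then show "indicator A (merge J' J (z, y)) = (indicator {y \<in> vecs J. glue J J' y z \<in> A} y :: ennreal)"
        using y by (simp add: indicator_def)
    qed
    then show "(\<integral>\<^sup>+y. indicator A (merge J' J (z, y)) \<partial>leb J) = emeasure (leb J) {y \<in> vecs J. glue J J' y z \<in> A}"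
      using glue_sets[OF A] z by simp
  qed
  finally show ?thesis .
qed

lemma emeasure_fold_lower:
  assumes J: "finite J" "finite J'" "J \<inter> J' = {}" and A: "A \<in> sets (leb (J \<union> J'))" and B: "B \<in> sets (leb J')"
    and c: "\<And>z. z \<in> B \<Longrightarrow> c \<le> emeasure (leb J) {y \<in> vecs J. glue J J' y z \<in> A}"
  shows "c * emeasure (leb J') B \<le> emeasure (leb (J \<union> J')) A"
proof -
  have "c * emeasure (leb J') B = (\<integral>\<^sup>+z. c * indicator B z \<partial>leb J')"
    by (rule nn_integral_cmult_indicator[OF B, symmetric])
  also have "\<dots> \<le> (\<integral>\<^sup>+z. emeasure (leb J) {y \<in> vecs J. glue J J' y z \<in> A} \<partial>leb J')"
    by (rule nn_integral_mono) (use c in \<open>auto simp: indicator_def\<close>)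
  finally show ?thesis unfolding emeasure_fold[OF J A] .
qed

lemma emeasure_fold_upper:
  assumes J: "finite J" "finite J'" "J \<inter> J' = {}" and A: "A \<in> sets (leb (J \<union> J'))" and B: "B \<in> sets (leb J')"
    and c: "\<And>z. z \<in> B \<Longrightarrow> emeasure (leb J) {y \<in> vecs J. glue J J' y z \<in> A} \<le> c"
    and AB: "\<And>y z. y \<in> vecs J \<Longrightarrow> z \<in> vecs J' \<Longrightarrow> glue J J' y z \<in> A \<Longrightarrow> z \<in> B"
  shows "emeasure (leb (J \<union> J')) A \<le> c * emeasure (leb J') B"
proof -
  have "emeasure (leb (J \<union> J')) A \<le> (\<integral>\<^sup>+z. c * indicator B z \<partial>leb J')"
    unfolding emeasure_fold[OF J A]
  proof (rule nn_integral_mono)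
    fix z assume z: "z \<in> space (leb J')"
    show "emeasure (leb J) {y \<in> vecs J. glue J J' y z \<in> A} \<le> c * indicator B z"
    proof (cases "z \<in> B")
      case True then show ?thesis using c by simp
    next
      case False
      then have "{y \<in> vecs J. glue J J' y z \<in> A} = {}" using AB z by auto
      then show ?thesis by (simp only: emeasure_empty) simp
    qed
  qed
  also have "\<dots> = c * emeasure (leb J') B"
    by (rule nn_integral_cmult_indicator[OF B])
  finally show ?thesis .
qed

text \<open>If two points of \<open>K\<close> lie over the same z, half their difference lies in the
  central section by symmetry. So each fibre fits into a translate of twice that section.\<close>

lemma sec_set_proj_set_upper:
  assumes J: "finite J" "finite J'" "J \<inter> J' = {}" and K: "body (J \<union> J') K"
  shows "lvol (J \<union> J') K \<le> 2 ^ card J * lvol J (sec_set (J \<union> J') J K) * lvol J' (proj_set J' K)"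
proof -
  let ?I = "J \<union> J'"
  have I: "finite ?I" using J by simp
  have bs: "body J (sec_set ?I J K)" by (rule body_sec_set[OF I _ K]) auto
  have bp: "body J' (proj_set J' K)" by (rule body_proj_set[OF I _ K]) auto
  have "emeasure (leb ?I) K \<le> ennreal (2 ^ card J * lvol J (sec_set ?I J K)) * emeasure (leb J') (proj_set J' K)"
  proof (rule emeasure_fold_upper[OF J body_sets[OF K] body_sets[OF bp]])
    fix y z assume yz: "y \<in> vecs J" "z \<in> vecs J'" "glue J J' y z \<in> K"
    have "z = restrict (glue J J' y z) J'"
      by (rule vecs_eqI[OF yz(2)]) (use J(3) in \<open>auto simp: glue_def\<close>)
    then show "z \<in> proj_set J' K" using yz(3) unfolding proj_set_def by blast
  next
    fix z assume "z \<in> proj_set J' K"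
    show "emeasure (leb J) {y \<in> vecs J. glue J J' y z \<in> K} \<le> ennreal (2 ^ card J * lvol J (sec_set ?I J K))"
    proof (cases "{y \<in> vecs J. glue J J' y z \<in> K} = {}")
      case False
      then obtain p where p: "p \<in> vecs J" "glue J J' p z \<in> K" by blast
      let ?a = "comb J (-1/2) p 0 p"
      have "{y \<in> vecs J. glue J J' y z \<in> K} \<subseteq> {y \<in> vecs J. comb J (1/2) y 1 ?a \<in> sec_set ?I J K}"
      proof clarify
        fix y assume y: "y \<in> vecs J" "glue J J' y z \<in> K"
        have "comb ?I (1/2) (glue J J' y z) (-1/2) (glue J J' p z) \<in> K"
          by (rule body_comb[OF K y(2) p(2)]) simp
        also have "comb ?I (1/2) (glue J J' y z) (-1/2) (glue J J' p z) = ext0 ?I J (comb J (1/2) y 1 ?a)"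
          by (rule vecs_eqI[of _ ?I]) (auto simp: glue_def ext0_def)
        finally show "comb J (1/2) y 1 ?a \<in> sec_set ?I J K" by (simp add: sec_set_def)
      qed
      then have "emeasure (leb J) {y \<in> vecs J. glue J J' y z \<in> K} \<le> emeasure (leb J) {y \<in> vecs J. comb J (1/2) y 1 ?a \<in> sec_set ?I J K}"
        by (rule emeasure_mono[OF _ affine_vimage_sets[OF body_sets[OF bs]]])
      also have "\<dots> = ennreal ((1 / \<bar>1/2\<bar>) ^ card J) * emeasure (leb J) (sec_set ?I J K)"
        by (rule emeasure_affine_vimage[OF J(1) _ body_sets[OF bs]]) simp
      also have "\<dots> = ennreal (2 ^ card J * lvol J (sec_set ?I J K))"
        by (simp add: body_emeasure[OF J(1) bs] ennreal_mult'[symmetric])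
      finally show ?thesis .
    next
      case True then show ?thesis by (simp only: emeasure_empty) simp
    qed
  qed
  then show ?thesis
    by (simp add: body_emeasure[OF I K] body_emeasure[OF J(2) bp] ennreal_mult'[symmetric])
qed

text \<open>Over z in half the projection choose q in \<open>K\<close> above 2 z; midpoints of q and
  points of the central section lie in \<open>K\<close> above z, so the fibre contains a translate
  of half the section.\<close>

lemma sec_set_proj_set_lower:
  assumes J: "finite J" "finite J'" "J \<inter> J' = {}" and K: "body (J \<union> J') K"
  shows "lvol J (sec_set (J \<union> J') J K) * lvol J' (proj_set J' K) \<le> 2 ^ card (J \<union> J') * lvol (J \<union> J') K"
proof -
  let ?I = "J \<union> J'"
  have I: "finite ?I" using J by simp
  have bs: "body J (sec_set ?I J K)" by (rule body_sec_set[OF I _ K]) auto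
  have bp: "body J' (proj_set J' K)" by (rule body_proj_set[OF I _ K]) auto
  define B where "B = {z \<in> vecs J'. comb J' 2 z 1 (\<lambda>_. 0) \<in> proj_set J' K}"
  have B: "B \<in> sets (leb J')" unfolding B_def by (rule affine_vimage_sets[OF body_sets[OF bp]])
  have "ennreal ((1/2) ^ card J * lvol J (sec_set ?I J K)) * emeasure (leb J') B \<le> emeasure (leb ?I) K"
  proof (rule emeasure_fold_lower[OF J body_sets[OF K] B])
    fix z assume z: "z \<in> B"
    then obtain q where q: "q \<in> K" "comb J' 2 z 1 (\<lambda>_. 0) = restrict q J'" unfolding B_def proj_set_def by blast
    have zq: "2 * z i = q i" if "i \<in> J'" for i
      using that fun_cong[OF q(2), of i] by simp
    let ?a = "comb J (-1) q 0 q"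
    have "{y \<in> vecs J. comb J 2 y 1 ?a \<in> sec_set ?I J K} \<subseteq> {y \<in> vecs J. glue J J' y z \<in> K}"
    proof clarify
      fix y assume y: "y \<in> vecs J" "comb J 2 y 1 ?a \<in> sec_set ?I J K"
      have "comb ?I (1/2) (ext0 ?I J (comb J 2 y 1 ?a)) (1/2) q \<in> K"
        by (rule body_comb[OF K _ q(1)]) (use y in \<open>auto simp: sec_set_def\<close>)
      also have "comb ?I (1/2) (ext0 ?I J (comb J 2 y 1 ?a)) (1/2) q = glue J J' y z"
      proof (rule vecs_eqI[of _ ?I])
        fix i assume "i \<in> ?I"
        then show "comb ?I (1/2) (ext0 ?I J (comb J 2 y 1 ?a)) (1/2) q i = glue J J' y z i"
          using J(3) zq[of i] by (auto simp: glue_def ext0_def field_simps)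
      qed auto
      finally show "glue J J' y z \<in> K" .
    qed
    then have "emeasure (leb J) {y \<in> vecs J. comb J 2 y 1 ?a \<in> sec_set ?I J K} \<le> emeasure (leb J) {y \<in> vecs J. glue J J' y z \<in> K}"
      using z by (intro emeasure_mono glue_sets[OF body_sets[OF K]]) (auto simp: B_def)
    moreover have "emeasure (leb J) {y \<in> vecs J. comb J 2 y 1 ?a \<in> sec_set ?I J K} = ennreal ((1 / \<bar>2\<bar>) ^ card J) * emeasure (leb J) (sec_set ?I J K)"
      by (rule emeasure_affine_vimage[OF J(1) _ body_sets[OF bs]]) simp
    ultimately show "ennreal ((1/2) ^ card J * lvol J (sec_set ?I J K)) \<le> emeasure (leb J) {y \<in> vecs J. glue J J' y z \<in> K}"
      by (simp add: body_emeasure[OF J(1) bs] ennreal_mult'[symmetric])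
  qed
  moreover have "emeasure (leb J') B = ennreal ((1 / \<bar>2\<bar>) ^ card J') * emeasure (leb J') (proj_set J' K)"
    unfolding B_def by (rule emeasure_affine_vimage[OF J(2) _ body_sets[OF bp]]) simp
  ultimately have "(1/2) ^ card J * lvol J (sec_set ?I J K) * ((1/2) ^ card J' * lvol J' (proj_set J' K)) \<le> lvol ?I K"
    by (simp add: body_emeasure[OF I K] body_emeasure[OF J(2) bp] ennreal_mult'[symmetric])
  moreover have "card ?I = card J + card J'" using J by (simp add: card_Un_disjoint)
  ultimately show ?thesis by (simp add: power_add power_one_over field_simps)
qed

section \<open>The volume product\<close>

definition vol_prod :: "nat set \<Rightarrow> (nat \<Rightarrow> real) set \<Rightarrow> real" where
  "vol_prod I K = lvol I K * lvol I (polar_set I K)"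

lemma vol_prod_pos: "finite I \<Longrightarrow> body I K \<Longrightarrow> 0 < vol_prod I K"
  by (simp add: vol_prod_def body_lvol_pos body_polar_set)

text \<open>The lower volume bound is used for \<open>K\<close>, and for its polar with
  \<open>J\<close> and \<open>J'\<close> exchanged. Polarity swaps sections with projections, so the
  four volumes regroup into two volume products.\<close>

lemma vol_prod_sec_set_proj_set:
  assumes J: "finite J" "finite J'" "J \<inter> J' = {}" and K: "body (J \<union> J') K"
  shows "vol_prod J (sec_set (J \<union> J') J K) * vol_prod J' (proj_set J' K) \<le> 4 ^ card (J \<union> J') * vol_prod (J \<union> J') K"
proof -
  let ?I = "J \<union> J'"
  have I: "finite ?I" using J by simp
  have 1: "lvol J (sec_set ?I J K) * lvol J' (proj_set J' K) \<le> 2 ^ card ?I * lvol ?I K"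
    by (rule sec_set_proj_set_lower[OF J K])
  have K': "body (J' \<union> J) (polar_set ?I K)" using body_polar_set[OF I K] by (simp add: Un_commute)
  have JJ: "J' \<inter> J = {}" using J by auto
  have 2: "lvol J' (sec_set ?I J' (polar_set ?I K)) * lvol J (proj_set J (polar_set ?I K)) \<le> 2 ^ card ?I * lvol ?I (polar_set ?I K)"
    using sec_set_proj_set_lower[OF J(2,1) JJ K'] by (simp add: Un_commute)
  have "vol_prod J (sec_set ?I J K) * vol_prod J' (proj_set J' K) = (lvol J (sec_set ?I J K) * lvol J' (proj_set J' K)) *
      (lvol J' (sec_set ?I J' (polar_set ?I K)) * lvol J (proj_set J (polar_set ?I K)))"
    using polar_set_sec_set[OF I _ K, of J] polar_set_proj_set[OF I, of J' K] by (simp add: vol_prod_def mult_ac)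
  also have "\<dots> \<le> (2 ^ card ?I * lvol ?I K) * (2 ^ card ?I * lvol ?I (polar_set ?I K))"
    by (rule mult_mono[OF 1 2]) auto
  also have "\<dots> = 4 ^ card ?I * vol_prod ?I K"
    by (simp add: vol_prod_def power_mult_distrib[symmetric] mult_ac)
  finally show ?thesis .
qed

lemma vol_prod_lin_image:
  assumes I: "finite I" and K: "body I K" and g: "vol_mat I M N d"
  shows "vol_prod I (lin I I M ` K) = vol_prod I K"
proof -
  have g': "vol_mat I (transp N) (transp M) (1 / d)" by (rule vol_mat_transp[OF I vol_mat_inverse[OF I g]])
  have "lvol I (lin I I M ` K) = d * lvol I K"
    using g by (intro lvol_lin_image[OF I _ _ K]) (auto simp: vol_mat_def)
  moreover have "lvol I (lin I I (transp N) ` polar_set I K) = 1 / d * lvol I (polar_set I K)"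
    using g' by (intro lvol_lin_image[OF I _ _ body_polar_set[OF I K]]) (auto simp: vol_mat_def)
  moreover have "d > 0" using g scales_pos by (auto simp: vol_mat_def)
  moreover have "polar_set I (lin I I M ` K) = lin I I (transp N) ` polar_set I K"
    using g by (intro polar_set_lin_image[OF I _ body_subset[OF K]]) (simp add: vol_mat_def)
  ultimately show ?thesis by (simp add: vol_prod_def)
qed

section \<open>Exponential tilts of the uniform measure\<close>

lemma exp_cubic_bound:
  fixes y :: real
  assumes "\<bar>y\<bar> \<le> 1"
  shows "\<bar>exp y - 1 - y - y\<^sup>2 / 2\<bar> \<le> \<bar>y\<bar> ^ 3"
proof -
  obtain t where t: "\<bar>t\<bar> \<le> \<bar>y\<bar>" "exp y = (\<Sum>m<3. y ^ m / fact m) + exp t / fact 3 * y ^ 3"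
    using Maclaurin_exp_le[of y 3] by blast
  have "exp y - 1 - y - y\<^sup>2 / 2 = exp t / 6 * y ^ 3"
    unfolding t(2) by (simp add: numeral_3_eq_3 power2_eq_square fact_numeral)
  then have "\<bar>exp y - 1 - y - y\<^sup>2 / 2\<bar> = \<bar>exp t / 6 * y ^ 3\<bar>" by (simp only:)
  also have "\<dots> = exp t / 6 * \<bar>y\<bar> ^ 3" by (simp add: abs_mult power_abs)
  also have "exp t / 6 * \<bar>y\<bar> ^ 3 \<le> 1 * \<bar>y\<bar> ^ 3"
  proof (rule mult_right_mono)
    have "exp t \<le> exp 1" using t(1) assms by simp
    then show "exp t / 6 \<le> 1" using exp_le by linarith
  qed simp
  finally show ?thesis by simp
qed

text \<open>Convexity of exp between 0 and p, obtained by averaging 1 + y <= exp y for the distances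
  from the intermediate point \<tau> p to the two ends.\<close>

lemma exp_chord:
  fixes p \<tau> :: real
  assumes "0 \<le> \<tau>" "\<tau> \<le> 1"
  shows "exp (\<tau> * p) \<le> 1 - \<tau> + \<tau> * exp p"
proof -
  have "1 = \<tau> * (1 + (p - \<tau> * p)) + (1 - \<tau>) * (1 - \<tau> * p)" by (simp add: algebra_simps)
  also have "\<dots> \<le> \<tau> * exp (p - \<tau> * p) + (1 - \<tau>) * exp (- (\<tau> * p))"
    using assms exp_ge_add_one_self[of "p - \<tau> * p"] exp_ge_add_one_self[of "- (\<tau> * p)"]
    by (intro add_mono mult_left_mono) auto
  finally have "exp (\<tau> * p) * 1 \<le> exp (\<tau> * p) * (\<tau> * exp (p - \<tau> * p) + (1 - \<tau>) * exp (- (\<tau> * p)))"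
    by (intro mult_left_mono) auto
  also have "\<dots> = \<tau> * exp p + (1 - \<tau>)"
    by (simp add: algebra_simps exp_minus exp_diff)
  finally show ?thesis by simp
qed

section \<open>Covariance and Laplace transform of a bounded probability measure\<close>

locale cov = prob_space P for P :: "(nat \<Rightarrow> real) measure" +
  fixes I :: "nat set" and R :: real
  assumes I: "finite I" and I0: "I \<noteq> {}" and setsP: "sets P = sets (leb I)"
    and supp: "AE z in P. z \<in> cube I R" and R: "R > 0"
begin

definition b :: "nat \<Rightarrow> real" where "b = (\<lambda>i\<in>I. \<integral>z. z i \<partial>P)"
definition S :: "nat \<Rightarrow> nat \<Rightarrow> real" where "S i j = (\<integral>z. (z i - b i) * (z j - b j) \<partial>P)"

definition Dv :: "(nat \<Rightarrow> real) \<Rightarrow> (nat \<Rightarrow> real) \<Rightarrow> real" where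
  "Dv z u = dot I (comb I 1 z (-1) b) u"

lemma Dv_sum: "Dv z u = (\<Sum>i\<in>I. (z i - b i) * u i)"
  by (simp add: Dv_def dot_def)

lemma measP: "f \<in> borel_measurable (leb I) \<Longrightarrow> f \<in> borel_measurable P" for f :: "_ \<Rightarrow> 'b::topological_space"
  by (simp add: measurable_cong_sets[OF setsP refl])

lemma int_bdd:
  fixes f :: "(nat \<Rightarrow> real) \<Rightarrow> real"
  assumes "f \<in> borel_measurable (leb I)" "\<And>z. z \<in> cube I R \<Longrightarrow> \<bar>f z\<bar> \<le> C"
  shows "integrable P f"
  by (rule integrable_const_bound[of _ C]) (use supp assms measP in \<open>auto elim!: eventually_mono\<close>)

lemma b_bound: "i \<in> I \<Longrightarrow> \<bar>b i\<bar> \<le> R"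
proof -
  assume i: "i \<in> I"
  have int: "integrable P (\<lambda>z. z i)" by (rule int_bdd[of _ R]) (use i in \<open>auto simp: cube_iff\<close>)
  have le: "AE z in P. z i \<le> R" "AE z in P. - R \<le> z i"
    using supp by (eventually_elim; use i in \<open>auto simp: cube_iff abs_le_iff minus_le_iff\<close>)+
  have "(\<integral>z. z i \<partial>P) \<le> (\<integral>z. R \<partial>P)" by (rule integral_mono_AE[OF int _ le(1)]) simp
  moreover have "(\<integral>z. - R \<partial>P) \<le> (\<integral>z. z i \<partial>P)" by (rule integral_mono_AE[OF _ int le(2)]) simp
  ultimately show ?thesis using i by (simp add: b_def prob_space abs_le_iff)
qed

text \<open>Support and barycentre both lie in the cube of half-side \<open>R\<close>, so
  \<open>rho * e\<close> bounds the centred functional \<open>Dv z u\<close> whenever the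
  coordinates of \<open>u\<close> are at most \<open>e\<close>.\<close>

definition rho :: real where "rho = 2 * R * real (card I)"

lemma rho: "rho > 0"
  using R I I0 by (simp add: rho_def card_gt_0_iff)

lemma Dv_bound:
  assumes z: "z \<in> cube I R" and u: "\<And>i. i \<in> I \<Longrightarrow> \<bar>u i\<bar> \<le> e" and e: "e \<ge> 0"
  shows "\<bar>Dv z u\<bar> \<le> rho * e"
proof -
  have "\<bar>Dv z u\<bar> \<le> (\<Sum>i\<in>I. \<bar>(z i - b i) * u i\<bar>)" unfolding Dv_sum by (rule sum_abs)
  also have "\<dots> \<le> (\<Sum>i\<in>I. (2 * R) * e)"
  proof (rule sum_mono)
    fix i assume i: "i \<in> I"
    have "\<bar>z i - b i\<bar> \<le> 2 * R" using b_bound[OF i] z i by (auto simp: cube_iff)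
    then show "\<bar>(z i - b i) * u i\<bar> \<le> (2 * R) * e"
      unfolding abs_mult using u[OF i] by (intro mult_mono) auto
  qed
  also have "\<dots> = rho * e" by (simp add: rho_def)
  finally show ?thesis .
qed

lemma Dv_meas: "(\<lambda>z. Dv z u) \<in> borel_measurable (leb I)"
  unfolding Dv_sum[abs_def] by measurable

lemma ex_bound: "\<exists>e\<ge>0. \<forall>i\<in>I. \<bar>u i\<bar> \<le> (e::real)"
proof (intro exI conjI ballI)
  show "0 \<le> (\<Sum>i\<in>I. \<bar>u i\<bar>)" by (simp add: sum_nonneg)
  show "\<bar>u i\<bar> \<le> (\<Sum>i\<in>I. \<bar>u i\<bar>)" if "i \<in> I" for i using I that by (intro member_le_sum) auto
qed

lemma Dv_integrable: "integrable P (\<lambda>z. Dv z u)" "integrable P (\<lambda>z. Dv z u * Dv z w)"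
proof -
  obtain e where e: "e \<ge> 0" "\<And>i. i \<in> I \<Longrightarrow> \<bar>u i\<bar> \<le> e" using ex_bound[of u] by auto
  obtain f where f: "f \<ge> 0" "\<And>i. i \<in> I \<Longrightarrow> \<bar>w i\<bar> \<le> f" using ex_bound[of w] by auto
  show "integrable P (\<lambda>z. Dv z u)"
    by (rule int_bdd[OF Dv_meas]) (rule Dv_bound[OF _ e(2,1)])
  show "integrable P (\<lambda>z. Dv z u * Dv z w)"
  proof (rule int_bdd)
    show "(\<lambda>z. Dv z u * Dv z w) \<in> borel_measurable (leb I)" using Dv_meas by measurable
    fix z assume z: "z \<in> cube I R"
    show "\<bar>Dv z u * Dv z w\<bar> \<le> (rho * e) * (rho * f)"
      unfolding abs_mult using Dv_bound[OF z e(2,1)] Dv_bound[OF z f(2,1)] rho e f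
      by (intro mult_mono) auto
  qed
qed

lemma comp_int: "i \<in> I \<Longrightarrow> integrable P (\<lambda>z. z i)"
  by (rule int_bdd[of _ R]) (auto simp: cube_iff)

lemma cov_int: "i \<in> I \<Longrightarrow> j \<in> I \<Longrightarrow> integrable P (\<lambda>z. (z i - b i) * (z j - b j))"
  using Dv_integrable(2)[of "unitv I i" "unitv I j"] I by (simp add: Dv_def)

lemma Dv_mean: "(\<integral>z. Dv z u \<partial>P) = 0"
proof -
  have "(\<integral>z. Dv z u \<partial>P) = (\<Sum>i\<in>I. (\<integral>z. (z i - b i) * u i \<partial>P))"
    unfolding Dv_sum by (rule Bochner_Integration.integral_sum) (auto intro!: comp_int)
  also have "\<dots> = 0"
    by (rule sum.neutral) (auto simp: comp_int prob_space b_def)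
  finally show ?thesis .
qed

lemma Dv_cov: "(\<integral>z. Dv z u * Dv z w \<partial>P) = dot I u (lin I I S w)"
proof -
  have "(\<integral>z. Dv z u * Dv z w \<partial>P) = (\<integral>z. (\<Sum>i\<in>I. \<Sum>j\<in>I. (u i * w j) * ((z i - b i) * (z j - b j))) \<partial>P)"
    unfolding Dv_sum sum_product by (simp add: mult_ac)
  also have "\<dots> = (\<Sum>i\<in>I. \<Sum>j\<in>I. (u i * w j) * S i j)"
  proof -
    have "(\<integral>z. (\<Sum>i\<in>I. \<Sum>j\<in>I. (u i * w j) * ((z i - b i) * (z j - b j))) \<partial>P) =
      (\<Sum>i\<in>I. (\<integral>z. (\<Sum>j\<in>I. (u i * w j) * ((z i - b i) * (z j - b j))) \<partial>P))"
      by (intro Bochner_Integration.integral_sum Bochner_Integration.integrable_sum integrable_mult_right cov_int)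
    also have "\<dots> = (\<Sum>i\<in>I. \<Sum>j\<in>I. (\<integral>z. (u i * w j) * ((z i - b i) * (z j - b j)) \<partial>P))"
      by (intro sum.cong refl Bochner_Integration.integral_sum integrable_mult_right cov_int)
    finally show ?thesis by (simp add: S_def)
  qed
  also have "\<dots> = dot I u (lin I I S w)"
    by (simp add: dot_def lin_def sum_distrib_left mult_ac)
  finally show ?thesis .
qed

lemma S_sym: "S i j = S j i"
  by (simp add: S_def mult.commute)

lemma quad_form_S: "quad_form I S u = dot I u (lin I I S u)"
  by (simp add: quad_form_def dot_def lin_def sum_distrib_left mult_ac)

text \<open>The Laplace transform of \<open>P\<close> recentred at \<open>x\<close>. It is convex in
  \<open>u\<close>, with a critical point where tilting \<open>P\<close> by \<open>u\<close> moves
  the barycentre to \<open>x\<close>; so minimality identifies the tilt that belongs to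
  \<open>x\<close>.\<close>

definition gx :: "(nat \<Rightarrow> real) \<Rightarrow> (nat \<Rightarrow> real) \<Rightarrow> real" where
  "gx x u = (\<integral>z. exp (dot I (comb I 1 z (-1) x) u) \<partial>P)"

lemma gx_integrable: "integrable P (\<lambda>z. exp (dot I (comb I 1 z (-1) x) u) * F z)"
  if F: "F \<in> borel_measurable (leb I)" "\<And>z. z \<in> cube I R \<Longrightarrow> \<bar>F z\<bar> \<le> C"
proof -
  obtain e where e: "e \<ge> 0" "\<And>i. i \<in> I \<Longrightarrow> \<bar>u i\<bar> \<le> e" using ex_bound[of u] by auto
  have eq: "dot I (comb I 1 z (-1) x) u = Dv z u + (dot I b u - dot I x u)" for z
    by (simp add: Dv_def)
  show ?thesis
  proof (rule int_bdd)
    show "(\<lambda>z. exp (dot I (comb I 1 z (-1) x) u) * F z) \<in> borel_measurable (leb I)"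
      unfolding eq using Dv_meas F(1) by measurable
    fix z assume z: "z \<in> cube I R"
    have "exp (dot I (comb I 1 z (-1) x) u) \<le> exp (rho * e + (dot I b u - dot I x u))"
    proof -
      have "\<bar>Dv z u\<bar> \<le> rho * e" by (rule Dv_bound[OF z]) (use e in auto)
      then show ?thesis unfolding eq by (simp add: abs_le_iff)
    qed
    then show "\<bar>exp (dot I (comb I 1 z (-1) x) u) * F z\<bar> \<le> exp (rho * e + (dot I b u - dot I x u)) * C"
      unfolding abs_mult using F(2)[OF z] by (intro mult_mono) auto
  qed
qed

lemma gx_integrable1: "integrable P (\<lambda>z. exp (dot I (comb I 1 z (-1) x) u))"
  using gx_integrable[of "\<lambda>_. 1" 1 x u] by simp

text \<open>Taylor expansion at 0, with \<open>x\<close> displaced from the barycentre by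
  \<open>S s\<close>: the displacement gives the linear term and the covariance the quadratic one.
  All errors are cubic in h = rho e; the constants 27/8 and 1 add up to less than 5.\<close>

lemma gx_expand:
  assumes s: "\<And>i. i \<in> I \<Longrightarrow> \<bar>s i\<bar> \<le> e / 2" and u: "\<And>i. i \<in> I \<Longrightarrow> \<bar>u i\<bar> \<le> e" and e: "e > 0" "rho * e \<le> 1 / 2"
    and x: "x = comb I 1 b 1 (lin I I S s)"
  shows "\<bar>gx x u - (1 - dot I u (lin I I S s) + quad_form I S u / 2)\<bar> \<le> 5 * (rho * e) ^ 3"
proof -
  define h where "h = rho * e"
  have h: "h > 0" "h \<le> 1 / 2" using e rho by (auto simp: h_def)
  define c where "c = dot I u (lin I I S s)"
  have cE: "c = (\<integral>z. Dv z u * Dv z s \<partial>P)" by (simp add: Dv_cov c_def)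
  have bu: "\<bar>Dv z u\<bar> \<le> h" if "z \<in> cube I R" for z unfolding h_def using Dv_bound[OF that u] e by simp
  have bs: "\<bar>Dv z s\<bar> \<le> h / 2" if "z \<in> cube I R" for z unfolding h_def using Dv_bound[OF that s] e by simp
  have cb: "\<bar>c\<bar> \<le> h * (h / 2)"
  proof -
    have "\<bar>c\<bar> \<le> (\<integral>z. \<bar>Dv z u * Dv z s\<bar> \<partial>P)" unfolding cE by (rule integral_abs_bound)
    also have "\<dots> \<le> (\<integral>z. h * (h / 2) \<partial>P)"
    proof (rule integral_mono_AE)
      show "AE z in P. \<bar>Dv z u * Dv z s\<bar> \<le> h * (h / 2)"
        using supp
      proof eventually_elim
        case (elim z)
        show ?case unfolding abs_mult using bu[OF elim] bs[OF elim] h by (intro mult_mono) auto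
      qed
    qed (auto intro: Dv_integrable integrable_abs)
    finally show ?thesis by (simp add: prob_space)
  qed
  have eq: "dot I (comb I 1 z (-1) x) u = Dv z u - c" for z
    unfolding x by (simp add: Dv_def c_def dot_commute[of I u])
  have hh: "h * (h / 2) \<le> h / 4" using h mult_left_mono[of "h / 2" "1 / 4" h] by simp
  have yb: "\<bar>Dv z u - c\<bar> \<le> 3 / 2 * h" if "z \<in> cube I R" for z
    using abs_triangle_ineq4[of "Dv z u" c] bu[OF that] cb hh h by linarith
  let ?y = "\<lambda>z. Dv z u - c"
  have int1: "integrable P ?y" by (intro Bochner_Integration.integrable_diff Dv_integrable) simp
  have sq: "(?y z)\<^sup>2 = Dv z u * Dv z u - 2 * c * Dv z u + c\<^sup>2" for z by (simp add: power2_eq_square algebra_simps)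
  have int2: "integrable P (\<lambda>z. (?y z)\<^sup>2)" unfolding sq
    by (intro Bochner_Integration.integrable_add Bochner_Integration.integrable_diff Dv_integrable integrable_mult_right) auto
  have int3: "integrable P (\<lambda>z. exp (?y z))" using gx_integrable1[of x u] unfolding eq .
  have E1: "(\<integral>z. ?y z \<partial>P) = - c"
    by (subst Bochner_Integration.integral_diff) (auto simp: Dv_integrable Dv_mean prob_space)
  have E2: "(\<integral>z. (?y z)\<^sup>2 \<partial>P) = quad_form I S u + c\<^sup>2"
  proof -
    have "(\<integral>z. (?y z)\<^sup>2 \<partial>P) = (\<integral>z. Dv z u * Dv z u \<partial>P) - (\<integral>z. 2 * c * Dv z u \<partial>P) + (\<integral>z. c\<^sup>2 \<partial>P)"
      unfolding sq by (simp add: Dv_integrable)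
    then show ?thesis by (simp add: Dv_cov Dv_mean quad_form_S prob_space)
  qed
  have "\<bar>(\<integral>z. exp (?y z) - 1 - ?y z - (?y z)\<^sup>2 / 2 \<partial>P)\<bar> \<le> (\<integral>z. \<bar>exp (?y z) - 1 - ?y z - (?y z)\<^sup>2 / 2\<bar> \<partial>P)"
    by (rule integral_abs_bound)
  also have "\<dots> \<le> (\<integral>z. (3 / 2 * h) ^ 3 \<partial>P)"
  proof (rule integral_mono_AE)
    show "AE z in P. \<bar>exp (?y z) - 1 - ?y z - (?y z)\<^sup>2 / 2\<bar> \<le> (3 / 2 * h) ^ 3"
      using supp
    proof eventually_elim
      case (elim z)
      have "\<bar>?y z\<bar> \<le> 1" using yb[OF elim] h by linarith
      then have "\<bar>exp (?y z) - 1 - ?y z - (?y z)\<^sup>2 / 2\<bar> \<le> \<bar>?y z\<bar> ^ 3" by (rule exp_cubic_bound)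
      also have "\<dots> \<le> (3 / 2 * h) ^ 3" by (rule power_mono[OF yb[OF elim]]) simp
      finally show ?case .
    qed
  qed (use int1 int2 int3 in \<open>auto intro!: integrable_abs\<close>)
  also have "(\<integral>z. exp (?y z) - 1 - ?y z - (?y z)\<^sup>2 / 2 \<partial>P) = gx x u - 1 - (- c) - (quad_form I S u + c\<^sup>2) / 2"
  proof -
    define Y where "Y z = Dv z u - c" for z
    have "integrable P Y" "integrable P (\<lambda>z. (Y z)\<^sup>2)" "integrable P (\<lambda>z. exp (Y z))"
      using int1 int2 int3 by (simp_all add: Y_def[abs_def])
    then have "(\<integral>z. exp (Y z) - 1 - Y z - (Y z)\<^sup>2 / 2 \<partial>P) = (\<integral>z. exp (Y z) \<partial>P) - 1 - (\<integral>z. Y z \<partial>P) - (\<integral>z. (Y z)\<^sup>2 \<partial>P) / 2"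
      by (simp add: prob_space)
    then show ?thesis unfolding Y_def E1 E2 gx_def eq .
  qed
  finally have A: "\<bar>gx x u - 1 + c - (quad_form I S u + c\<^sup>2) / 2\<bar> \<le> (3 / 2 * h) ^ 3" by (simp add: prob_space)
  \<comment> \<open>The displacement term \<open>c\<close> is already quadratic in h, so its square
    fits into the cubic error.\<close>
  have c2: "c\<^sup>2 / 2 \<le> h ^ 3"
  proof -
    have "c\<^sup>2 \<le> (h * (h / 2))\<^sup>2" using cb by (metis abs_ge_zero power2_abs power_mono)
    also have "\<dots> = h ^ 3 * (h / 4)" by (simp add: power2_eq_square power3_eq_cube)
    also have "\<dots> \<le> h ^ 3 * 1" by (rule mult_left_mono) (use h in auto)
    finally show ?thesis using zero_le_power2[of c] by linarith
  qed
  have "(3 / 2 * h) ^ 3 = 27 / 8 * h ^ 3" by (simp add: power3_eq_cube)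
  then show ?thesis using A c2 h unfolding c_def[symmetric] h_def[symmetric] by (simp add: abs_le_iff field_simps) (smt (verit) zero_le_power zero_le_power2)
qed

text \<open>To second order, \<open>gx x u\<close> is \<open>1 + quad_form I S (u - s) / 2\<close> up to a constant; hence \<open>s\<close> beats all points at distance \<open>e / 2\<close>, and by convexity all points further away.\<close>
lemma gx_min:
  assumes v: "v > 0" "\<And>u j. j \<in> I \<Longrightarrow> v * (u j)\<^sup>2 \<le> quad_form I S u"
    and e: "e > 0" "rho * e \<le> 1 / 2" "80 * rho ^ 3 * e < v"
    and s: "\<And>i. i \<in> I \<Longrightarrow> \<bar>s i\<bar> \<le> e / 2"
    and x: "x = comb I 1 b 1 (lin I I S s)"
    and u: "j \<in> I" "\<bar>u j\<bar> \<ge> e"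
  shows "gx x s < gx x u"
proof -
  define w where "w = comb I 1 u (-1) s"
  define m where "m = Max ((\<lambda>i. \<bar>w i\<bar>) ` I)"
  have mw: "\<bar>w i\<bar> \<le> m" if "i \<in> I" for i unfolding m_def using I that by (intro Max_ge) auto
  have "m \<in> (\<lambda>i. \<bar>w i\<bar>) ` I" unfolding m_def using I I0 by (intro Max_in) auto
  then obtain j' where j': "j' \<in> I" "\<bar>w j'\<bar> = m" by auto
  have "w j = u j - s j" using u by (simp add: w_def)
  then have "\<bar>w j\<bar> \<ge> e / 2" using u s[OF u(1)] abs_triangle_ineq2[of "u j" "s j"] by linarith
  then have m: "m \<ge> e / 2" using mw[OF u(1)] by linarith
  have mp: "m > 0" using m e by linarith
  \<comment> \<open>Shrinks w so that its largest coordinate becomes e / 2; then \<open>u'\<close>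
    stays in the range where \<open>gx_expand\<close> applies.\<close>
  define \<tau> where "\<tau> = (e / 2) / m"
  have \<tau>: "0 < \<tau>" "\<tau> \<le> 1" using m mp e by (auto simp: \<tau>_def)
  define u' where "u' = comb I 1 s \<tau> w"
  have wb: "\<bar>\<tau> * w i\<bar> \<le> e / 2" if "i \<in> I" for i
  proof -
    have "\<bar>\<tau> * w i\<bar> \<le> \<tau> * m" using mw[OF that] \<tau> by (simp add: abs_mult)
    then show ?thesis using mp by (simp add: \<tau>_def)
  qed
  have u'b: "\<bar>u' i\<bar> \<le> e" if "i \<in> I" for i
  proof -
    have "u' i = s i + \<tau> * w i" using that by (simp add: u'_def)
    then show ?thesis using abs_triangle_ineq[of "s i" "\<tau> * w i"] wb[OF that] s[OF that] by linarith
  qed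
  have sb: "\<bar>s i\<bar> \<le> e" if "i \<in> I" for i using s[OF that] e by linarith
  have q: "quad_form I S u' / 2 - dot I u' (lin I I S s) + quad_form I S s / 2 = \<tau>\<^sup>2 * quad_form I S w / 2"
  proof -
    have symB: "dot I w (lin I I S s) = dot I s (lin I I S w)"
    proof -
      have "transp S = S" by (simp add: fun_eq_iff transp_def S_sym)
      then show ?thesis using dot_lin[OF I I, of S s w] by (simp add: dot_commute)
    qed
    show ?thesis unfolding quad_form_S u'_def by (simp add: symB power2_eq_square field_simps)
  qed
  have "quad_form I S w \<ge> v * (w j')\<^sup>2" by (rule v(2)[OF j'(1)])
  then have "\<tau>\<^sup>2 * (v * (w j')\<^sup>2) \<le> \<tau>\<^sup>2 * quad_form I S w" by (rule mult_left_mono) simp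
  also have "(w j')\<^sup>2 = m\<^sup>2" using j'(2) by (metis power2_abs)
  also have "\<tau>\<^sup>2 * (v * m\<^sup>2) = v * (e / 2)\<^sup>2" using mp by (simp add: \<tau>_def power_divide)
  finally have q2: "v * (e / 2)\<^sup>2 \<le> \<tau>\<^sup>2 * quad_form I S w" .
  have g1: "\<bar>gx x u' - (1 - dot I u' (lin I I S s) + quad_form I S u' / 2)\<bar> \<le> 5 * (rho * e) ^ 3"
    by (rule gx_expand[OF s u'b e(1,2) x])
  have g2: "\<bar>gx x s - (1 - dot I s (lin I I S s) + quad_form I S s / 2)\<bar> \<le> 5 * (rho * e) ^ 3"
    by (rule gx_expand[OF s sb e(1,2) x])
  \<comment> \<open>Two expansion errors of 5 (rho e)^3 against the quadratic gain v (e/2)^2 / 2;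
    the condition 80 rho^3 e < v is exactly this comparison.\<close>
  have "10 * (rho * e) ^ 3 < v * (e / 2)\<^sup>2 / 2"
  proof -
    have "80 * rho ^ 3 * e * e\<^sup>2 < v * e\<^sup>2" using e by (intro mult_strict_right_mono) auto
    then show ?thesis by (simp add: power_mult_distrib power2_eq_square power3_eq_cube mult_ac)
  qed
  then have lt: "gx x s < gx x u'"
    using g1 g2 q q2 unfolding quad_form_S[of s] by (simp add: abs_le_iff)
  let ?p = "\<lambda>z. dot I (comb I 1 z (-1) x) w"
  let ?a = "\<lambda>z. exp (dot I (comb I 1 z (-1) x) s)"
  have eu': "exp (dot I (comb I 1 z (-1) x) u') = ?a z * exp (\<tau> * ?p z)" for z
    by (simp only: u'_def dot_comb_right exp_add[symmetric] mult_1_left)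
  have eu: "exp (dot I (comb I 1 z (-1) x) u) = ?a z * exp (?p z)" for z
  proof -
    have "dot I (comb I 1 z (-1) x) u = dot I (comb I 1 z (-1) x) s + ?p z"
      unfolding w_def by (simp only: dot_comb_right)
    then show ?thesis by (simp only: exp_add)
  qed
  \<comment> \<open>\<open>u'\<close> lies on the segment from \<open>s\<close> to \<open>u\<close>,
    so the chord inequality transports the strict increase from \<open>u'\<close> out to
    \<open>u\<close>.\<close>
  have "gx x u' \<le> (\<integral>z. (1 - \<tau>) * ?a z + \<tau> * exp (dot I (comb I 1 z (-1) x) u) \<partial>P)"
    unfolding gx_def
  proof (rule integral_mono)
    show "integrable P (\<lambda>z. exp (dot I (comb I 1 z (-1) x) u'))" by (rule gx_integrable1)
    show "integrable P (\<lambda>z. (1 - \<tau>) * ?a z + \<tau> * exp (dot I (comb I 1 z (-1) x) u))"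
      by (intro Bochner_Integration.integrable_add integrable_mult_right gx_integrable1)
    fix z
    have "?a z * exp (\<tau> * ?p z) \<le> ?a z * (1 - \<tau> + \<tau> * exp (?p z))"
      using \<tau> by (intro mult_left_mono exp_chord) auto
    then show "exp (dot I (comb I 1 z (-1) x) u') \<le> (1 - \<tau>) * ?a z + \<tau> * exp (dot I (comb I 1 z (-1) x) u)"
      unfolding eu' eu by (simp only: distrib_left mult_ac)
  qed
  also have "\<dots> = (1 - \<tau>) * gx x s + \<tau> * gx x u"
    by (subst Bochner_Integration.integral_add) (auto intro!: integrable_mult_right gx_integrable1 simp del: dot_comb_left simp: gx_def)
  finally have "\<tau> * gx x s < \<tau> * gx x u" using lt by (simp add: algebra_simps)
  then show ?thesis using \<tau> by simp
qed

end

text \<open>Pair each z with its reflection in coordinate \<open>j\<close>. The two values of the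
  affine function differ by 2 z_j u_j, so their squares add up to at least 2 (z_j u_j)^2 whatever
  \<open>c\<close> is. The slab \<open>B\<close>, where z_j >= r/2, has volume at least
  (r/2)^n.\<close>

lemma cube_variance:
  assumes I: "finite I" and j: "j \<in> I" and r: "r > 0"
  shows "ennreal ((u j)\<^sup>2 * ((r / 2)\<^sup>2 * (r / 2) ^ card I)) \<le>
    (\<integral>\<^sup>+z. indicator (cube I r) z * ennreal ((dot I z u - c)\<^sup>2) \<partial>leb I)"
proof -
  let ?F = "\<lambda>z. indicator (cube I r) z * ennreal ((dot I z u - c)\<^sup>2)"
  let ?\<rho> = "lin I I (shear j (-1) (\<lambda>_. 0))"
  have Fm [measurable]: "?F \<in> borel_measurable (leb I)" using I by measurable
  have sc: "scales I ?\<rho> \<bar>-1\<bar>" by (rule scales_shear[OF I j]) simp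
  have rk: "?\<rho> z k = (if k = j then - z j else z k)" if "k \<in> I" for z k
    using lin_shear[OF I j that] by simp
  have X: "(\<integral>\<^sup>+z. ?F z \<partial>leb I) = (\<integral>\<^sup>+z. ?F (?\<rho> z) \<partial>leb I)"
    using scales_D[OF sc Fm] by simp
  define B where "B = PiE I (\<lambda>i. if i = j then {r / 2..r} else {-r..r})"
  have B: "B \<in> sets (leb I)" unfolding B_def leb_def by (rule sets_PiM_I_finite) (use I in auto)
  have Bsub: "z \<in> cube I r" "r / 2 \<le> z j" if "z \<in> B" for z
  proof -
    have "z \<in> vecs I" using that unfolding B_def by (auto simp: PiE_iff)
    moreover have "\<bar>z i\<bar> \<le> r" if i: "i \<in> I" for i
      using PiE_mem[OF \<open>z \<in> B\<close>[unfolded B_def] i] r by (auto split: if_splits simp: abs_le_iff)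
    ultimately show "z \<in> cube I r" by (simp add: cube_iff)
    show "r / 2 \<le> z j" using PiE_mem[OF \<open>z \<in> B\<close>[unfolded B_def] j] by auto
  qed
  have eB: "ennreal ((r / 2) ^ card I) \<le> emeasure (leb I) B"
  proof -
    have "emeasure (leb I) B = (\<Prod>i\<in>I. emeasure lborel (if i = j then {r / 2..r} else {-r..r}))"
      unfolding B_def by (rule emeasure_leb_PiE[OF I]) auto
    also have "\<dots> = (\<Prod>i\<in>I. ennreal (if i = j then r / 2 else 2 * r))"
      using r by (intro prod.cong) auto
    also have "\<dots> = ennreal (\<Prod>i\<in>I. if i = j then r / 2 else 2 * r)"
      using r by (intro prod_ennreal) auto
    also have "\<dots> \<ge> ennreal (\<Prod>i\<in>I. r / 2)"
      using r by (intro ennreal_leI prod_mono) auto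
    finally show ?thesis by simp
  qed
  have pt: "ennreal (2 * ((u j)\<^sup>2 * (r / 2)\<^sup>2)) * indicator B z \<le> ?F z + ?F (?\<rho> z)" if z: "z \<in> vecs I" for z
  proof (cases "z \<in> B")
    case True
    have zc: "z \<in> cube I r" and zj: "r / 2 \<le> z j" using Bsub[OF True] by auto
    have rz: "?\<rho> z \<in> cube I r" using zc rk[of _ z] unfolding cube_iff by simp
    have d: "dot I (?\<rho> z) u = dot I z u - 2 * (z j * u j)"
    proof -
      have "dot I (?\<rho> z) u = (\<Sum>i\<in>I. z i * u i - (if i = j then 2 * (z j * u j) else 0))"
        unfolding dot_def by (rule sum.cong) (auto simp: rk)
      then show ?thesis using I j by (simp add: sum_subtractf dot_def)
    qed
    have "2 * ((u j)\<^sup>2 * (r / 2)\<^sup>2) \<le> 2 * (z j * u j)\<^sup>2"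
    proof -
      have "(r / 2)\<^sup>2 \<le> (z j)\<^sup>2" using zj r by (intro power_mono) auto
      then have "(u j)\<^sup>2 * (r / 2)\<^sup>2 \<le> (u j)\<^sup>2 * (z j)\<^sup>2" by (rule mult_left_mono) simp
      then show ?thesis by (simp add: power_mult_distrib mult.commute)
    qed
    also have "\<dots> \<le> (dot I z u - c)\<^sup>2 + (dot I (?\<rho> z) u - c)\<^sup>2"
    proof -
      have "0 \<le> (2 * (dot I z u - c) - 2 * (z j * u j))\<^sup>2" by simp
      then show ?thesis unfolding d by (simp add: power2_eq_square algebra_simps)
    qed
    finally have "ennreal (2 * ((u j)\<^sup>2 * (r / 2)\<^sup>2)) \<le> ennreal ((dot I z u - c)\<^sup>2 + (dot I (?\<rho> z) u - c)\<^sup>2)"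
      by (rule ennreal_leI)
    then show ?thesis using True zc rz by simp
  qed simp
  have "ennreal 2 * ennreal ((u j)\<^sup>2 * ((r / 2)\<^sup>2 * (r / 2) ^ card I)) = ennreal (2 * ((u j)\<^sup>2 * (r / 2)\<^sup>2)) * ennreal ((r / 2) ^ card I)"
    using r by (simp add: ennreal_mult'[symmetric] mult_ac del: ennreal_numeral)
  also have "\<dots> \<le> ennreal (2 * ((u j)\<^sup>2 * (r / 2)\<^sup>2)) * emeasure (leb I) B"
    by (rule mult_left_mono[OF eB]) simp
  also have "\<dots> = (\<integral>\<^sup>+z. ennreal (2 * ((u j)\<^sup>2 * (r / 2)\<^sup>2)) * indicator B z \<partial>leb I)"
    by (rule nn_integral_cmult_indicator[OF B, symmetric])
  also have "\<dots> \<le> (\<integral>\<^sup>+z. ?F z + ?F (?\<rho> z) \<partial>leb I)"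
    by (rule nn_integral_mono) (use pt in simp)
  also have "\<dots> = (\<integral>\<^sup>+z. ?F z \<partial>leb I) + (\<integral>\<^sup>+z. ?F (?\<rho> z) \<partial>leb I)"
    by (rule nn_integral_add[OF Fm measurable_compose[OF scales_meas[OF sc] Fm]])
  also have "\<dots> = ennreal 2 * (\<integral>\<^sup>+z. ?F z \<partial>leb I)"
    unfolding X[symmetric] by (simp add: mult_2)
  finally show ?thesis by (subst (asm) ennreal_mult_le_mult_iff) auto
qed

section \<open>Tilts of the uniform measure on a symmetric body\<close>

locale tilted =
  fixes I :: "nat set" and K :: "(nat \<Rightarrow> real) set"
  assumes I: "finite I" and I0: "I \<noteq> {}" and K: "body I K"
begin

abbreviation n :: nat where "n \<equiv> card I"

text \<open>This is n times the polar body, see \<open>Q_eq\<close>. The radius n is a compromise: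
  exponents between -n and n keep all densities within exp (2 n) of uniform, and \<open>Q\<close>
  gains the factor n^n in volume.\<close>

definition Q :: "(nat \<Rightarrow> real) set" where
  "Q = {t \<in> vecs I. \<forall>x\<in>K. \<bar>dot I x t\<bar> \<le> real n}"

definition z :: "(nat \<Rightarrow> real) \<Rightarrow> real" where
  "z t = enn2real (\<integral>\<^sup>+x. indicator K x * ennreal (exp (dot I x t)) \<partial>leb I)"

definition Pt :: "(nat \<Rightarrow> real) \<Rightarrow> (nat \<Rightarrow> real) measure" where
  "Pt t = density (leb I) (\<lambda>x. indicator K x * ennreal (exp (dot I x t) / z t))"

lemma Km [measurable]: "K \<in> sets (leb I)"
  by (rule body_sets[OF K])

lemma n_pos: "n > 0"
  using I I0 by (simp add: card_gt_0_iff)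

lemma vK: "lvol I K > 0"
  by (rule body_lvol_pos[OF I K])

lemma z_eq:
  assumes t: "t \<in> Q"
  shows "(\<integral>\<^sup>+x. indicator K x * ennreal (exp (dot I x t)) \<partial>leb I) = ennreal (z t)"
    and "exp (- real n) * lvol I K \<le> z t" "z t \<le> exp (real n) * lvol I K" "z t > 0"
proof -
  let ?Z = "\<integral>\<^sup>+x. indicator K x * ennreal (exp (dot I x t)) \<partial>leb I"
  have xt: "\<bar>dot I x t\<bar> \<le> real n" if "x \<in> K" for x using t that by (auto simp: Q_def)
  have "?Z \<le> (\<integral>\<^sup>+x. ennreal (exp (real n)) * indicator K x \<partial>leb I)"
    by (rule nn_integral_mono) (use xt in \<open>auto simp: indicator_def abs_le_iff intro!: ennreal_leI\<close>)
  also have "\<dots> = ennreal (exp (real n)) * emeasure (leb I) K" by (rule nn_integral_cmult_indicator[OF Km])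
  finally have up: "?Z \<le> ennreal (exp (real n) * lvol I K)"
    by (simp add: body_emeasure[OF I K] ennreal_mult'[symmetric])
  have "ennreal (exp (- real n)) * emeasure (leb I) K = (\<integral>\<^sup>+x. ennreal (exp (- real n)) * indicator K x \<partial>leb I)"
    by (rule nn_integral_cmult_indicator[OF Km, symmetric])
  also have "\<dots> \<le> ?Z"
    by (rule nn_integral_mono) (use xt in \<open>auto simp: indicator_def abs_le_iff minus_le_iff intro!: ennreal_leI\<close>)
  finally have lo: "ennreal (exp (- real n) * lvol I K) \<le> ?Z"
    by (simp add: body_emeasure[OF I K] ennreal_mult'[symmetric])
  have "?Z < \<top>" using up by (rule le_less_trans) simp
  then show eq: "?Z = ennreal (z t)" by (simp add: z_def)
  have z0: "0 \<le> z t" by (simp add: z_def)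
  show "z t \<le> exp (real n) * lvol I K" using up vK unfolding eq by (simp add: ennreal_le_iff)
  show l: "exp (- real n) * lvol I K \<le> z t" using lo z0 unfolding eq by (simp add: ennreal_le_iff)
  have "0 < exp (- real n) * lvol I K" using vK by simp
  then show "z t > 0" using l by linarith
qed

lemma Pt_integral:
  assumes "F \<in> borel_measurable (leb I)"
  shows "(\<integral>\<^sup>+x. F x \<partial>Pt t) = (\<integral>\<^sup>+x. indicator K x * ennreal (exp (dot I x t) / z t) * F x \<partial>leb I)"
  unfolding Pt_def by (rule nn_integral_density) (use assms in measurable)

lemma sets_Pt: "sets (Pt t) = sets (leb I)"
  by (simp add: Pt_def)

lemma prob_Pt:
  assumes t: "t \<in> Q"
  shows "prob_space (Pt t)"
proof
  have "emeasure (Pt t) (space (Pt t)) = (\<integral>\<^sup>+x. 1 \<partial>Pt t)" by simp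
  also have "\<dots> = (\<integral>\<^sup>+x. indicator K x * ennreal (exp (dot I x t) / z t) * 1 \<partial>leb I)"
    by (rule Pt_integral) simp
  also have "\<dots> = (\<integral>\<^sup>+x. ennreal (1 / z t) * (indicator K x * ennreal (exp (dot I x t))) \<partial>leb I)"
    by (rule nn_integral_cong) (use z_eq(4)[OF t] in \<open>simp add: indicator_def ennreal_mult'[symmetric]\<close>)
  also have "\<dots> = ennreal (1 / z t) * ennreal (z t)"
    unfolding z_eq(1)[OF t, symmetric] by (rule nn_integral_cmult) measurable
  also have "\<dots> = 1" using z_eq(4)[OF t] by (simp add: ennreal_mult'[symmetric])
  finally show "emeasure (Pt t) (space (Pt t)) = 1" .
qed

lemma AE_Pt: "AE x in Pt t. x \<in> K"
  unfolding Pt_def by (subst AE_density) (auto simp: indicator_def)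

lemma dens_bounds:
  assumes t: "t \<in> Q" and x: "x \<in> K"
  shows "exp (- 2 * real n) / lvol I K \<le> exp (dot I x t) / z t" "exp (dot I x t) / z t \<le> exp (2 * real n) / lvol I K"
proof -
  have xt: "- real n \<le> dot I x t" "dot I x t \<le> real n" using t x by (auto simp: Q_def abs_le_iff)
  have "exp (- 2 * real n) / lvol I K = exp (- real n) / (exp (real n) * lvol I K)"
    by (simp add: exp_minus field_simps exp_add[symmetric])
  also have "\<dots> \<le> exp (dot I x t) / z t"
    using xt z_eq[OF t] vK by (intro frac_le) auto
  finally show "exp (- 2 * real n) / lvol I K \<le> exp (dot I x t) / z t" .
  have "exp (dot I x t) / z t \<le> exp (real n) / (exp (- real n) * lvol I K)"
    using xt z_eq[OF t] vK by (intro frac_le) auto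
  also have "\<dots> = exp (2 * real n) / lvol I K"
    by (simp add: exp_minus field_simps exp_add[symmetric])
  finally show "exp (dot I x t) / z t \<le> exp (2 * real n) / lvol I K" .
qed

lemma cov_Pt:
  assumes t: "t \<in> Q" and R: "R > 0" "K \<subseteq> cube I R"
  shows "cov (Pt t) I R"
proof -
  interpret prob_space "Pt t" by (rule prob_Pt[OF t])
  show ?thesis
  proof
    show "AE x in Pt t. x \<in> cube I R" using AE_Pt by (rule eventually_mono) (use R in auto)
  qed (use I I0 R sets_Pt in auto)
qed

text \<open>Uniformity in \<open>t\<close> is the point: \<open>packing\<close> has to choose one
  mesh for all tilts. It holds because every tilted density is at least exp (-2 n) / vol K on a
  fixed cube inside \<open>K\<close>.\<close>

lemma variance_lower:
  obtains v where "v > 0" "\<And>t u j. t \<in> Q \<Longrightarrow> j \<in> I \<Longrightarrow> v * (u j)\<^sup>2 \<le> quad_form I (cov.S (Pt t) I) u"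
proof -
  obtain r where r: "r > 0" "cube I r \<subseteq> K" using K by (rule body_cube)
  obtain R where R: "R > 0" "K \<subseteq> cube I R" using I K by (rule body_bounded)
  define a where "a = exp (- 2 * real n) / lvol I K"
  have a: "a > 0" using vK by (simp add: a_def)
  define \<kappa> where "\<kappa> = (r / 2)\<^sup>2 * (r / 2) ^ n"
  have \<kappa>: "\<kappa> > 0" using r by (simp add: \<kappa>_def)
  show thesis
  proof (rule that[of "a * \<kappa>"])
    show "a * \<kappa> > 0" using a \<kappa> by simp
    fix t and u :: "nat \<Rightarrow> real" and j assume t: "t \<in> Q" and j: "j \<in> I"
    interpret c: cov "Pt t" I R by (rule cov_Pt[OF t R])
    let ?c = "dot I c.b u"
    have Dv: "c.Dv x u = dot I x u - ?c" for x by (simp add: c.Dv_def)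
    have q: "quad_form I c.S u = (\<integral>x. c.Dv x u * c.Dv x u \<partial>Pt t)" by (simp add: c.quad_form_S c.Dv_cov)
    have "ennreal (quad_form I c.S u) = (\<integral>\<^sup>+x. ennreal (c.Dv x u * c.Dv x u) \<partial>Pt t)"
      unfolding q by (rule nn_integral_eq_integral[symmetric, OF c.Dv_integrable(2)]) simp
    also have "\<dots> = (\<integral>\<^sup>+x. ennreal ((dot I x u - ?c)\<^sup>2) \<partial>Pt t)"
      by (simp add: Dv power2_eq_square)
    also have "\<dots> = (\<integral>\<^sup>+x. indicator K x * ennreal (exp (dot I x t) / z t) * ennreal ((dot I x u - ?c)\<^sup>2) \<partial>leb I)"
      by (rule Pt_integral) measurable
    also have "\<dots> \<ge> (\<integral>\<^sup>+x. ennreal a * (indicator (cube I r) x * ennreal ((dot I x u - ?c)\<^sup>2)) \<partial>leb I)"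
    proof (rule nn_integral_mono)
      fix x
      show "ennreal a * (indicator (cube I r) x * ennreal ((dot I x u - ?c)\<^sup>2)) \<le>
          indicator K x * ennreal (exp (dot I x t) / z t) * ennreal ((dot I x u - ?c)\<^sup>2)"
      proof (cases "x \<in> cube I r")
        case True
        then have x: "x \<in> K" using r by auto
        have "ennreal a \<le> ennreal (exp (dot I x t) / z t)"
          unfolding a_def by (rule ennreal_leI[OF dens_bounds(1)[OF t x]])
        then show ?thesis using True x by (simp add: mult_right_mono)
      qed simp
    qed
    also have "(\<integral>\<^sup>+x. ennreal a * (indicator (cube I r) x * ennreal ((dot I x u - ?c)\<^sup>2)) \<partial>leb I) =
      ennreal a * (\<integral>\<^sup>+x. indicator (cube I r) x * ennreal ((dot I x u - ?c)\<^sup>2) \<partial>leb I)"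
      by (rule nn_integral_cmult) (use I in measurable)
    finally have "ennreal a * (\<integral>\<^sup>+x. indicator (cube I r) x * ennreal ((dot I x u - ?c)\<^sup>2) \<partial>leb I) \<le> ennreal (quad_form I c.S u)" .
    moreover have "ennreal a * ennreal ((u j)\<^sup>2 * \<kappa>) \<le> ennreal a * (\<integral>\<^sup>+x. indicator (cube I r) x * ennreal ((dot I x u - ?c)\<^sup>2) \<partial>leb I)"
      unfolding \<kappa>_def by (rule mult_left_mono[OF cube_variance[OF I j r(1)]]) simp
    ultimately have "ennreal (a * ((u j)\<^sup>2 * \<kappa>)) \<le> ennreal (quad_form I c.S u)"
      using a by (simp add: ennreal_mult')
    moreover have "quad_form I c.S u \<ge> 0" unfolding q by (rule integral_nonneg_AE) simp
    ultimately have "a * ((u j)\<^sup>2 * \<kappa>) \<le> quad_form I c.S u" by (simp add: ennreal_le_iff)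
    then show "a * \<kappa> * (u j)\<^sup>2 \<le> quad_form I c.S u" by (simp add: mult_ac)
  qed
qed

text \<open>Up to a factor independent of \<open>u\<close>, the transform of \<open>Pt t\<close> at
  \<open>u\<close> is one and the same integral over \<open>K\<close>, evaluated at t + u. This
  makes minima belonging to different tilts comparable.\<close>

lemma gx_global:
  assumes t: "t \<in> Q" and R: "R > 0" "K \<subseteq> cube I R"
  shows "ennreal (z t * exp (- dot I x t)) * ennreal (cov.gx (Pt t) I x u) =
    (\<integral>\<^sup>+y. indicator K y * ennreal (exp (dot I (comb I 1 y (-1) x) (comb I 1 t 1 u))) \<partial>leb I)"
proof -
  interpret c: cov "Pt t" I R by (rule cov_Pt[OF t R])
  have zt: "z t > 0" by (rule z_eq(4)[OF t])
  have "ennreal (c.gx x u) = (\<integral>\<^sup>+y. ennreal (exp (dot I (comb I 1 y (-1) x) u)) \<partial>Pt t)"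
    unfolding c.gx_def by (rule nn_integral_eq_integral[symmetric, OF c.gx_integrable1]) simp
  also have "\<dots> = (\<integral>\<^sup>+y. indicator K y * ennreal (exp (dot I y t) / z t) * ennreal (exp (dot I (comb I 1 y (-1) x) u)) \<partial>leb I)"
    by (rule Pt_integral) (simp only: dot_comb_left, measurable)
  finally have "ennreal (z t * exp (- dot I x t)) * ennreal (c.gx x u) =
     ennreal (z t * exp (- dot I x t)) * (\<integral>\<^sup>+y. indicator K y * ennreal (exp (dot I y t) / z t) * ennreal (exp (dot I (comb I 1 y (-1) x) u)) \<partial>leb I)"
    by simp
  also have "\<dots> = (\<integral>\<^sup>+y. ennreal (z t * exp (- dot I x t)) * (indicator K y * ennreal (exp (dot I y t) / z t) * ennreal (exp (dot I (comb I 1 y (-1) x) u))) \<partial>leb I)"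
    by (rule nn_integral_cmult[symmetric]) (simp only: dot_comb_left, measurable)
  also have "\<dots> = (\<integral>\<^sup>+y. indicator K y * ennreal (exp (dot I (comb I 1 y (-1) x) (comb I 1 t 1 u))) \<partial>leb I)"
  proof (rule nn_integral_cong)
    fix y
    have "z t * exp (- dot I x t) * (exp (dot I y t) / z t * exp (dot I (comb I 1 y (-1) x) u)) =
        exp (dot I (comb I 1 y (-1) x) (comb I 1 t 1 u))"
      using zt by (simp add: exp_add[symmetric] exp_diff[symmetric] exp_minus field_simps)
    then show "ennreal (z t * exp (- dot I x t)) * (indicator K y * ennreal (exp (dot I y t) / z t) * ennreal (exp (dot I (comb I 1 y (-1) x) u))) =
      indicator K y * ennreal (exp (dot I (comb I 1 y (-1) x) (comb I 1 t 1 u)))"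
      using zt by (simp add: indicator_def ennreal_mult'[symmetric] del: dot_comb_left dot_comb_right)
  qed
  finally show ?thesis .
qed

end

text \<open>Polarising the equality of quadratic forms gives the factorisation of \<open>S\<close>
  as transpose of \<open>M\<close> times \<open>M\<close>.\<close>

lemma lin_of_quad_form:
  assumes I: "finite I" and sym: "\<And>i j. S i j = S j i"
    and q: "\<And>x. quad_form I S x = dot I (lin I I M x) (lin I I M x)"
  shows "lin I I S s = lin I I (transp M) (lin I I M s)"
proof (rule dot_ext[OF I])
  fix u assume u: "u \<in> vecs I"
  have qS: "quad_form I S x = dot I x (lin I I S x)" for x
    by (simp add: quad_form_def dot_def lin_def sum_distrib_left mult_ac)
  have symB: "dot I s (lin I I S u) = dot I u (lin I I S s)"
  proof -
    have "transp S = S" using sym by (simp add: fun_eq_iff transp_def)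
    then show ?thesis using dot_lin[OF I I, of S u s] by (simp add: dot_commute)
  qed
  have "dot I u (lin I I S s) = dot I (lin I I M u) (lin I I M s)"
    using q[of "comb I 1 u 1 s"] q[of u] q[of s] symB dot_commute[of I "lin I I M u" "lin I I M s"]
    unfolding qS by simp
  then show "dot I u (lin I I S s) = dot I u (lin I I (transp M) (lin I I M s))"
    using I by (simp add: dot_lin)
qed auto

lemma body_scale:
  assumes I: "finite I" and K: "body I K" and c: "c > 0"
  shows "body I {y \<in> vecs I. comb I (1 / c) y 0 y \<in> K}"
    and "lvol I {y \<in> vecs I. comb I (1 / c) y 0 y \<in> K} = c ^ card I * lvol I K"
proof -
  define D :: "real \<Rightarrow> nat \<Rightarrow> nat \<Rightarrow> real" where "D a = (\<lambda>i j. if i = j then a else 0)" for a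
  have lD: "lin I I (D a) x = comb I a x 0 x" for a x
  proof (rule vecs_eqI[of _ I])
    fix i assume i: "i \<in> I"
    have "lin I I (D a) x i = (\<Sum>j\<in>I. if j = i then a * x j else 0)"
      unfolding lin_app[OF i] by (rule sum.cong) (auto simp: D_def)
    then show "lin I I (D a) x i = comb I a x 0 x i" using I i by simp
  qed auto
  have inv: "inv_mat I (D c) (D (1 / c))"
  proof -
    have "lin I I (D a) (lin I I (D a') x) = x" if "a * a' = 1" "x \<in> vecs I" for a a' x
      unfolding lD by (rule vecs_eqI[OF comb_in that(2)]) (use that(1) in \<open>simp add: mult.assoc[symmetric]\<close>)
    then show ?thesis using c by (simp add: inv_mat_def)
  qed
  have sc: "scales I (lin I I (D c)) (c ^ card I)"
  proof -
    have "scales I (\<lambda>x. comb I c x 1 (\<lambda>_. 0)) (\<bar>c\<bar> ^ card I)" by (rule scales_affine[OF I]) (use c in simp)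
    then have "scales I (lin I I (D c)) (\<bar>c\<bar> ^ card I)" by (rule scales_cong) (simp only: lD comb_zero)
    then show ?thesis using c by simp
  qed
  have eq: "{y \<in> vecs I. comb I (1 / c) y 0 y \<in> K} = lin I I (D c) ` K"
    using lin_image_eq[OF inv body_subset[OF K]] by (simp only: lD)
  show "body I {y \<in> vecs I. comb I (1 / c) y 0 y \<in> K}"
    unfolding eq by (rule body_lin_image[OF I K inv])
  show "lvol I {y \<in> vecs I. comb I (1 / c) y 0 y \<in> K} = c ^ card I * lvol I K"
    unfolding eq by (rule lvol_lin_image[OF I inv sc K])
qed

lemma sum_emeasure_le:
  assumes "finite T" "disjoint_family_on A T" "\<And>t. t \<in> T \<Longrightarrow> A t \<in> sets M" "\<And>t. t \<in> T \<Longrightarrow> A t \<subseteq> B" "B \<in> sets M"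
  shows "(\<Sum>t\<in>T. emeasure M (A t)) \<le> emeasure M B"
proof -
  have "(\<Sum>t\<in>T. emeasure M (A t)) = emeasure M (\<Union>t\<in>T. A t)"
    using assms by (intro sum_emeasure) auto
  also have "\<dots> \<le> emeasure M B" using assms by (intro emeasure_mono) auto
  finally show ?thesis .
qed

context tilted
begin

lemma Q_eq: "Q = {y \<in> vecs I. comb I (1 / real n) y 0 y \<in> polar_set I K}"
proof -
  have "(\<forall>x\<in>K. \<bar>dot I x t\<bar> \<le> real n) \<longleftrightarrow> (\<forall>x\<in>K. dot I x t \<le> real n)" for t
  proof
    assume A: "\<forall>x\<in>K. dot I x t \<le> real n"
    show "\<forall>x\<in>K. \<bar>dot I x t\<bar> \<le> real n"
    proof
      fix x assume x: "x \<in> K"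
      have "dot I (comb I (-1) x 0 x) t \<le> real n" using A body_neg[OF K x] by blast
      then show "\<bar>dot I x t\<bar> \<le> real n" using A x by (simp add: abs_le_iff)
    qed
  qed auto
  then show ?thesis using n_pos by (auto simp: Q_def polar_set_def field_simps)
qed

lemma body_Q: "body I Q"
  unfolding Q_eq using n_pos by (intro body_scale(1)[OF I body_polar_set[OF I K]]) simp

lemma lvol_Q: "lvol I Q = real n ^ n * lvol I (polar_set I K)"
  unfolding Q_eq using n_pos by (intro body_scale(2)[OF I body_polar_set[OF I K]]) simp

text \<open>A discrete version of \<open>\<integral>\<^bsub>Q\<^esub> det (D\<^sup>2 \<psi>) \<le> vol K\<close> for the logarithmic Laplace transform \<open>\<psi>\<close> of \<open>K\<close>, whose gradient maps into \<open>K\<close> and whose Hessian at \<open>t\<close> is the covariance of \<open>Pt t\<close>: grid points \<open>t\<close> of \<open>Q\<close> give disjoint subsets \<open>A t\<close> of \<open>K\<close>, the images of small cubes under the Hessian. Disjointness holds because \<open>\<integral>\<^bsub>K\<^esub> exp \<langle>y - x, p\<rangle> dy\<close> is minimal over \<open>p\<close> near \<open>t\<close> when \<open>x \<in> A t\<close>.\<close>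
lemma packing:
  obtains t M N d where "t \<in> Q" "vol_mat I M N d"
    "\<And>x. quad_form I (cov.S (Pt t) I) x = dot I (lin I I M x) (lin I I M x)"
    "d\<^sup>2 * lvol I Q \<le> 4 ^ n * lvol I K"
proof -
  obtain v where v: "v > 0" "\<And>t u j. t \<in> Q \<Longrightarrow> j \<in> I \<Longrightarrow> v * (u j)\<^sup>2 \<le> quad_form I (cov.S (Pt t) I) u"
    by (rule variance_lower) blast
  obtain R where R: "R > 0" "K \<subseteq> cube I R" using I K by (rule body_bounded)
  obtain q where q: "q > 0" "cube I q \<subseteq> Q" using body_Q by (rule body_cube)
  note covP = cov_Pt[OF _ R]
  define rho where "rho = cov.rho I R"
  have rho: "rho > 0"
  proof -
    have "(\<lambda>i\<in>I. 0) \<in> Q" using q by (auto simp: cube_iff)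
    from cov.rho[OF covP[OF this]] show ?thesis by (simp add: rho_def)
  qed
  \<comment> \<open>Three requirements on the mesh: rounding in the cover of half of
    \<open>Q\<close> stays inside \<open>Q\<close>, the Taylor expansion applies, and its error
    stays below the variance bound in \<open>gx_min\<close>.\<close>
  define e where "e = min (q / 2) (min (1 / (2 * rho)) (v / (160 * rho ^ 3)))"
  have e: "e > 0" "2 * e \<le> q" "rho * e \<le> 1 / 2" "80 * rho ^ 3 * e < v"
  proof -
    show "e > 0" using q rho v by (simp add: e_def)
    show "2 * e \<le> q" by (simp add: e_def)
    have "rho * e \<le> rho * (1 / (2 * rho))" by (rule mult_left_mono) (use rho in \<open>auto simp: e_def\<close>)
    then show "rho * e \<le> 1 / 2" using rho by simp
    have "80 * rho ^ 3 * e \<le> 80 * rho ^ 3 * (v / (160 * rho ^ 3))"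
      by (rule mult_left_mono) (use rho in \<open>auto simp: e_def\<close>)
    also have "\<dots> = v / 2" using rho by simp
    also have "\<dots> < v" using v by simp
    finally show "80 * rho ^ 3 * e < v" .
  qed
  have "\<exists>M N d. vol_mat I M N d \<and> (\<forall>x. quad_form I (cov.S (Pt t) I) x = dot I (lin I I M x) (lin I I M x))" if t: "t \<in> Q" for t
  proof -
    interpret c: cov "Pt t" I R by (rule covP[OF t])
    have "0 < quad_form I c.S x" if xj: "x \<in> vecs I" "\<exists>j\<in>I. x j \<noteq> 0" for x
    proof -
      obtain j where j: "j \<in> I" "x j \<noteq> 0" using xj(2) by blast
      then have "0 < v * (x j)\<^sup>2" using v by simp
      also have "\<dots> \<le> quad_form I c.S x" by (rule v(2)[OF t j(1)])
      finally show ?thesis .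
    qed
    then show ?thesis using cholesky[OF I, of c.S] c.S_sym by metis
  qed
  then obtain M N d where G: "\<And>t. t \<in> Q \<Longrightarrow> vol_mat I (M t) (N t) (d t)"
    and qM: "\<And>t x. t \<in> Q \<Longrightarrow> quad_form I (cov.S (Pt t) I) x = dot I (lin I I (M t) x) (lin I I (M t) x)"
    by metis
  have dpos: "d t > 0" if "t \<in> Q" for t using G[OF that] scales_pos by (auto simp: vol_mat_def)
  define bb where "bb t = cov.b (Pt t) I" for t
  \<comment> \<open>The inverse of the covariance applied to x - b, written as \<open>N\<close>
    times its transpose; so \<open>A t\<close> is the image of a cube of side e under s -> b + S
    s.\<close>
  define T where "T t x = lin I I (N t) (lin I I (transp (N t)) (comb I 1 x 1 (comb I (-1) (bb t) 0 (bb t))))" for t x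
  define A where "A t = {x \<in> vecs I. T t x \<in> cube I (e / 2)}" for t
  have scT: "scales I (T t) (1 / d t * (1 / d t * 1))" if t: "t \<in> Q" for t
  proof -
    have g: "vol_mat I (N t) (M t) (1 / d t)" by (rule vol_mat_inverse[OF I G[OF t]])
    have 1: "scales I (\<lambda>x. comb I 1 x 1 (comb I (-1) (bb t) 0 (bb t))) 1"
      using scales_affine[OF I, of 1 "comb I (-1) (bb t) 0 (bb t)"] by simp
    have 2: "scales I (lin I I (N t)) (1 / d t)" "scales I (lin I I (transp (N t))) (1 / d t)"
      using g by (simp_all add: vol_mat_def)
    show ?thesis unfolding T_def[abs_def] by (rule scales_comp[OF 2(1) scales_comp[OF 2(2) 1]])
  qed
  have Am: "A t \<in> sets (leb I)" if "t \<in> Q" for t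
  proof -
    have "T t -` cube I (e / 2) \<inter> space (leb I) \<in> sets (leb I)"
      by (rule measurable_sets[OF scales_meas[OF scT[OF that]] cube_sets[OF I]])
    moreover have "T t -` cube I (e / 2) \<inter> space (leb I) = A t" by (auto simp: A_def)
    ultimately show ?thesis by simp
  qed
  \<comment> \<open>\<open>(d t)^2\<close> is the determinant of the covariance of
    \<open>Pt t\<close>, each of the two triangular factors contributing \<open>d t\<close>.\<close>
  have Ae: "emeasure (leb I) (A t) = ennreal ((d t)\<^sup>2 * e ^ n)" if t: "t \<in> Q" for t
  proof -
    have "emeasure (leb I) (cube I (e / 2)) = ennreal (1 / d t * (1 / d t * 1)) * emeasure (leb I) (A t)"
      unfolding A_def by (rule scales_emeasure[OF scT[OF t] cube_sets[OF I]])
    then have "ennreal ((d t)\<^sup>2) * ennreal (e ^ n) = (ennreal ((d t)\<^sup>2) * ennreal (1 / d t * (1 / d t * 1))) * emeasure (leb I) (A t)"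
      using I e by (simp add: emeasure_cube mult.assoc)
    also have "ennreal ((d t)\<^sup>2) * ennreal (1 / d t * (1 / d t * 1)) = 1"
      using dpos[OF t] by (simp add: ennreal_mult'[symmetric] power2_eq_square)
    finally show ?thesis using e by (simp add: ennreal_mult')
  qed
  have rep: "x = comb I 1 (bb t) 1 (lin I I (cov.S (Pt t) I) (T t x))" "\<And>i. i \<in> I \<Longrightarrow> \<bar>T t x i\<bar> \<le> e / 2"
    if t: "t \<in> Q" and x: "x \<in> A t" for t x
  proof -
    interpret c: cov "Pt t" I R by (rule covP[OF t])
    have inv: "inv_mat I (M t) (N t)" "inv_mat I (transp (M t)) (transp (N t))"
      using G[OF t] inv_mat_transp[OF I] by (auto simp: vol_mat_def)
    have xv: "x \<in> vecs I" using x by (simp add: A_def)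
    have "lin I I c.S (T t x) = lin I I (transp (M t)) (lin I I (M t) (T t x))"
      by (rule lin_of_quad_form[OF I c.S_sym qM[OF t]])
    also have "\<dots> = comb I 1 x 1 (comb I (-1) (bb t) 0 (bb t))"
      using inv unfolding T_def by (simp add: inv_mat_def del: lin_comb)
    finally show "x = comb I 1 (bb t) 1 (lin I I c.S (T t x))"
      using xv by (intro vecs_eqI[of _ I]) auto
    show "\<And>i. i \<in> I \<Longrightarrow> \<bar>T t x i\<bar> \<le> e / 2" using x by (simp add: A_def cube_iff)
  qed
  have gmin: "cov.gx (Pt t) I x (T t x) < cov.gx (Pt t) I x u"
    if t: "t \<in> Q" and x: "x \<in> A t" and u: "j \<in> I" "\<bar>u j\<bar> \<ge> e" for t x u j
  proof (rule cov.gx_min[OF covP[OF t], where v = v and e = e and j = j])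
    show "v * (u j)\<^sup>2 \<le> quad_form I (cov.S (Pt t) I) u" if "j \<in> I" for u j by (rule v(2)[OF t that])
    show "cov.rho I R * e \<le> 1 / 2" "80 * cov.rho I R ^ 3 * e < v" using e(3,4) by (simp_all add: rho_def)
    show "x = comb I 1 (cov.b (Pt t) I) 1 (lin I I (cov.S (Pt t) I) (T t x))"
      using rep(1)[OF t x] by (simp add: bb_def)
    show "\<bar>T t x i\<bar> \<le> e / 2" if "i \<in> I" for i by (rule rep(2)[OF t x that])
  qed (use v(1) e(1) u in auto)
  have AK: "A t \<subseteq> K" if t: "t \<in> Q" for t
  proof
    fix x assume x: "x \<in> A t"
    interpret c: cov "Pt t" I R by (rule covP[OF t])
    show "x \<in> K"
    proof (rule ccontr)
      assume "x \<notin> K"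
      with separation[OF I K] x obtain w where w: "w \<in> polar_set I K" "1 < dot I w x" by (auto simp: A_def)
      then have "\<exists>j\<in>I. w j \<noteq> 0" by (auto simp: dot_def intro: ccontr)
      then obtain j where j: "j \<in> I" "w j \<noteq> 0" by blast
      \<comment> \<open>On \<open>K\<close> the separating functional w is at most its value at x,
        so moving from \<open>T t x\<close> along w does not increase \<open>gx\<close>. This step
        length makes coordinate j at least e in modulus, where \<open>gmin\<close> asserts a strict
        increase.\<close>
      define \<tau> where "\<tau> = 2 * e / \<bar>w j\<bar>"
      have \<tau>: "\<tau> > 0" using e j by (simp add: \<tau>_def)
      define u where "u = comb I 1 (T t x) \<tau> w"
      have "\<bar>\<tau> * w j\<bar> = 2 * e" using j e by (simp add: \<tau>_def abs_mult)
      moreover have "u j = T t x j + \<tau> * w j" using j by (simp add: u_def)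
      ultimately have "\<bar>u j\<bar> \<ge> e" using rep(2)[OF t x j(1)] e(1) by linarith
      then have "c.gx x (T t x) < c.gx x u" by (rule gmin[OF t x j(1)])
      moreover have "c.gx x u \<le> c.gx x (T t x)"
        unfolding c.gx_def
      proof (rule integral_mono_AE[OF c.gx_integrable1 c.gx_integrable1])
        show "AE y in Pt t. exp (dot I (comb I 1 y (-1) x) u) \<le> exp (dot I (comb I 1 y (-1) x) (T t x))"
          using AE_Pt
        proof eventually_elim
          case (elim y)
          have "dot I y w \<le> 1" using w elim by (auto simp: polar_set_def)
          then have "dot I (comb I 1 y (-1) x) w \<le> 0" using w(2) by (simp add: dot_commute[of I w x])
          then have "\<tau> * dot I (comb I 1 y (-1) x) w \<le> 0" using \<tau> by (simp add: mult_nonneg_nonpos)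
          then show ?case unfolding u_def by (simp only: dot_comb_right exp_le_cancel_iff)
        qed
      qed
      ultimately show False by simp
    qed
  qed
  define gr where "gr = {t \<in> Q. \<forall>i\<in>I. \<exists>m::int. t i = 2 * e * of_int m}"
  have fin: "finite gr"
  proof -
    obtain RQ where RQ: "RQ > 0" "Q \<subseteq> cube I RQ" using I body_Q by (rule body_bounded)
    define L where "L = \<lceil>RQ / (2 * e)\<rceil>"
    have "gr \<subseteq> PiE I (\<lambda>_. (\<lambda>m::int. 2 * e * of_int m) ` {-L..L})"
    proof
      fix t assume t: "t \<in> gr"
      then have tc: "t \<in> cube I RQ" using RQ by (auto simp: gr_def)
      have "t i \<in> (\<lambda>m::int. 2 * e * of_int m) ` {-L..L}" if i: "i \<in> I" for i
      proof -
        obtain m :: int where m: "t i = 2 * e * of_int m" using t i by (auto simp: gr_def)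
        have "\<bar>2 * e * of_int m\<bar> \<le> RQ" using tc i m by (auto simp: cube_iff)
        then have "\<bar>of_int m\<bar> \<le> RQ / (2 * e)" using e by (simp add: abs_mult field_simps)
        also have "\<dots> \<le> of_int L" unfolding L_def by (rule le_of_int_ceiling)
        finally have "\<bar>m\<bar> \<le> L" by linarith
        then have "m \<in> {-L..L}" by auto
        then show ?thesis using m by blast
      qed
      moreover have "t \<in> vecs I" using tc by (simp add: cube_iff)
      ultimately show "t \<in> PiE I (\<lambda>_. (\<lambda>m::int. 2 * e * of_int m) ` {-L..L})" by (auto simp: PiE_iff)
    qed
    then show ?thesis by (rule finite_subset) (use I in \<open>auto intro!: finite_PiE\<close>)
  qed
  have disj: "disjoint_family_on A gr"
    unfolding disjoint_family_on_def
  proof (intro ballI impI)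
    fix t1 t2 assume t: "t1 \<in> gr" "t2 \<in> gr" "t1 \<noteq> t2"
    have tQ: "t1 \<in> Q" "t2 \<in> Q" using t by (auto simp: gr_def)
    have "t1 \<in> vecs I" "t2 \<in> vecs I" using tQ by (auto simp: Q_def)
    then obtain j where j: "j \<in> I" "t1 j \<noteq> t2 j" using vecs_eqI t(3) by blast
    have far: "\<bar>t1 j - t2 j\<bar> \<ge> 2 * e"
    proof -
      obtain m1 m2 :: int where m: "t1 j = 2 * e * of_int m1" "t2 j = 2 * e * of_int m2" using t(1,2) j(1) unfolding gr_def by blast
      then have "m1 \<noteq> m2" using j by auto
      then have "1 \<le> \<bar>m1 - m2\<bar>" by simp
      then have "(1::real) \<le> \<bar>of_int m1 - of_int m2\<bar>" by (metis of_int_1_le_iff of_int_abs of_int_diff)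
      then have "2 * e * 1 \<le> 2 * e * \<bar>of_int m1 - of_int m2\<bar>" using e by (intro mult_left_mono) auto
      also have "\<dots> = \<bar>t1 j - t2 j\<bar>" using e m by (simp add: abs_mult right_diff_distrib[symmetric])
      finally show ?thesis by simp
    qed
    define F where "F x p = (\<integral>\<^sup>+y. indicator K y * ennreal (exp (dot I (comb I 1 y (-1) x) p)) \<partial>leb I)" for x p
    have lt: "F x (comb I 1 s1 1 (T s1 x)) < F x (comb I 1 s2 1 (T s2 x))"
      if s: "s1 \<in> Q" "s2 \<in> Q" "\<bar>s1 j - s2 j\<bar> \<ge> 2 * e" and x: "x \<in> A s1" "x \<in> A s2" for s1 s2 x
    proof -
      interpret c: cov "Pt s1" I R by (rule covP[OF s(1)])
      define u where "u = comb I 1 (comb I 1 s2 1 (T s2 x)) (-1) s1"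
      have "u j = s2 j + T s2 x j - s1 j" using j by (simp add: u_def)
      then have "\<bar>u j\<bar> \<ge> e" using s(3) rep(2)[OF s(2) x(2) j(1)] e(1) by linarith
      then have g: "c.gx x (T s1 x) < c.gx x u" by (rule gmin[OF s(1) x(1) j(1)])
      have su: "comb I 1 s1 1 u = comb I 1 s2 1 (T s2 x)"
        by (rule vecs_eqI[of _ I]) (auto simp: u_def)
      have c0: "z s1 * exp (- dot I x s1) > 0" using z_eq(4)[OF s(1)] by simp
      have g0: "0 \<le> c.gx x (T s1 x)" unfolding c.gx_def by (rule integral_nonneg_AE) simp
      have "F x (comb I 1 s1 1 (T s1 x)) = ennreal (z s1 * exp (- dot I x s1)) * ennreal (c.gx x (T s1 x))"
        unfolding F_def by (rule gx_global[OF s(1) R, symmetric])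
      also have "\<dots> = ennreal (z s1 * exp (- dot I x s1) * c.gx x (T s1 x))"
        using c0 by (intro ennreal_mult'[symmetric]) simp
      also have "\<dots> < ennreal (z s1 * exp (- dot I x s1) * c.gx x u)"
        using c0 g g0 z_eq(4)[OF s(1)] by (intro ennreal_lessI mult_pos_pos mult_strict_left_mono) auto
      also have "\<dots> = ennreal (z s1 * exp (- dot I x s1)) * ennreal (c.gx x u)"
        using c0 by (intro ennreal_mult') simp
      also have "\<dots> = F x (comb I 1 s1 1 u)"
        unfolding F_def by (rule gx_global[OF s(1) R])
      finally show ?thesis unfolding su .
    qed
    show "A t1 \<inter> A t2 = {}"
    proof (rule ccontr)
      assume "A t1 \<inter> A t2 \<noteq> {}"
      then obtain x where x: "x \<in> A t1" "x \<in> A t2" by blast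
      from lt[OF tQ far x] lt[OF tQ(2,1) _ x(2,1)] far show False by (auto simp: abs_minus_commute)
    qed
  qed
  have "(\<Sum>t\<in>gr. emeasure (leb I) (A t)) \<le> emeasure (leb I) K"
    by (rule sum_emeasure_le[OF fin disj]) (use Am AK Km in \<open>auto simp: gr_def\<close>)
  also have "(\<Sum>t\<in>gr. emeasure (leb I) (A t)) = (\<Sum>t\<in>gr. ennreal ((d t)\<^sup>2 * e ^ n))"
    by (rule sum.cong) (auto simp: gr_def Ae)
  also have "\<dots> = ennreal (\<Sum>t\<in>gr. (d t)\<^sup>2 * e ^ n)"
    using e by (intro sum_ennreal) auto
  finally have sumle: "(\<Sum>t\<in>gr. (d t)\<^sup>2 * e ^ n) \<le> lvol I K"
    using vK by (simp add: body_emeasure[OF I K] ennreal_le_iff)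
  have cover: "lvol I Q \<le> 4 ^ n * e ^ n * real (card gr)"
  proof -
    \<comment> \<open>Half of \<open>Q\<close> is covered by grid cubes with centres in
      \<open>Q\<close>: for x in \<open>H\<close> the rounded point t is the midpoint of 2 x, in
      \<open>Q\<close>, and of 2 (t - x), which lies in the cube of half-side q inside
      \<open>Q\<close>.\<close>
    define H where "H = {x \<in> vecs I. comb I 2 x 1 (\<lambda>_. 0) \<in> Q}"
    define C where "C t = {x \<in> vecs I. comb I 1 x 1 (comb I (-1) t 0 t) \<in> cube I e}" for t
    have Cm: "C t \<in> sets (leb I)" for t unfolding C_def by (rule affine_vimage_sets[OF cube_sets[OF I]])
    have Ce: "emeasure (leb I) (C t) = ennreal ((2 * e) ^ n)" for t
      unfolding C_def using I e by (subst emeasure_affine_vimage[OF I]) (auto simp: emeasure_cube)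
    have "H \<subseteq> (\<Union>t\<in>gr. C t)"
    proof
      fix x assume x: "x \<in> H"
      then have xQ: "comb I 2 x 1 (\<lambda>_. 0) \<in> Q" and xv: "x \<in> vecs I" by (auto simp: H_def)
      define t where "t = (\<lambda>i\<in>I. 2 * e * of_int (round (x i / (2 * e))))"
      have near: "\<bar>x i - t i\<bar> \<le> e" if "i \<in> I" for i
      proof -
        have "\<bar>of_int (round (x i / (2 * e))) - x i / (2 * e)\<bar> \<le> 1 / 2" by (rule of_int_round_abs_le)
        then have "2 * e * \<bar>of_int (round (x i / (2 * e))) - x i / (2 * e)\<bar> \<le> 2 * e * (1 / 2)"
          using e by (intro mult_left_mono) auto
        moreover have "2 * e * \<bar>of_int (round (x i / (2 * e))) - x i / (2 * e)\<bar> = \<bar>t i - x i\<bar>"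
        proof -
          have "2 * e * \<bar>of_int (round (x i / (2 * e))) - x i / (2 * e)\<bar> = \<bar>2 * e * (of_int (round (x i / (2 * e))) - x i / (2 * e))\<bar>"
            using e by (simp add: abs_mult)
          also have "2 * e * (of_int (round (x i / (2 * e))) - x i / (2 * e)) = t i - x i"
            using e that by (simp add: t_def right_diff_distrib)
          finally show ?thesis .
        qed
        ultimately show ?thesis by (simp add: abs_minus_commute)
      qed
      have "comb I 2 t (-2) x \<in> cube I q"
      proof -
        have "\<bar>2 * t i + - 2 * x i\<bar> \<le> q" if "i \<in> I" for i
          using near[OF that] e(2) by (simp add: abs_le_iff)
        then show ?thesis by (simp add: cube_iff)
      qed
      then have "comb I 2 t (-2) x \<in> Q" using q by blast
      then have "comb I (1/2) (comb I 2 x 1 (\<lambda>_. 0)) (1/2) (comb I 2 t (-2) x) \<in> Q"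
        by (intro body_comb[OF body_Q xQ]) auto
      also have "comb I (1/2) (comb I 2 x 1 (\<lambda>_. 0)) (1/2) (comb I 2 t (-2) x) = t"
      proof (rule vecs_eqI[OF comb_in])
        show "t \<in> vecs I" by (simp add: t_def)
      qed (simp add: field_simps)
      finally have tQ: "t \<in> Q" .
      have "\<forall>i\<in>I. \<exists>m::int. t i = 2 * e * of_int m" unfolding t_def by auto
      with tQ have "t \<in> gr" by (simp add: gr_def)
      moreover have "x \<in> C t" using xv near by (simp add: C_def cube_iff)
      ultimately show "x \<in> (\<Union>t\<in>gr. C t)" by blast
    qed
    then have "emeasure (leb I) H \<le> emeasure (leb I) (\<Union>t\<in>gr. C t)"
      using Cm fin by (intro emeasure_mono) auto
    also have "\<dots> \<le> (\<Sum>t\<in>gr. emeasure (leb I) (C t))"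
      by (rule emeasure_subadditive_finite[OF fin]) (use Cm in auto)
    also have "\<dots> = ennreal (real (card gr) * (2 * e) ^ n)"
      unfolding Ce using e by (simp add: ennreal_mult' ennreal_of_nat_eq_real_of_nat)
    finally have 1: "emeasure (leb I) H \<le> ennreal (real (card gr) * (2 * e) ^ n)" .
    have "emeasure (leb I) H = ennreal ((1 / \<bar>2\<bar>) ^ n) * emeasure (leb I) Q"
      unfolding H_def by (rule emeasure_affine_vimage[OF I _ body_sets[OF body_Q]]) simp
    then have "(1 / 2) ^ n * lvol I Q \<le> real (card gr) * (2 * e) ^ n"
      using 1 e by (simp add: body_emeasure[OF I body_Q] ennreal_mult'[symmetric] ennreal_le_iff)
    then have "lvol I Q \<le> 2 ^ n * (real (card gr) * (2 * e) ^ n)" by (simp add: power_one_over field_simps)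
    also have "\<dots> = (2 ^ n * 2 ^ n) * e ^ n * real (card gr)" by (simp add: power_mult_distrib mult_ac)
    also have "(2::real) ^ n * 2 ^ n = 4 ^ n" by (simp add: power_mult_distrib[symmetric])
    finally show ?thesis .
  qed
  \<comment> \<open>Pigeonhole: the disjoint sets give sum of (d t)^2 e^n <= vol K, while the cover
    gives at least vol Q / (4^n e^n) grid points, so some (d t)^2 is at most the average.\<close>
  have "\<exists>t\<in>gr. (d t)\<^sup>2 * lvol I Q \<le> 4 ^ n * lvol I K"
  proof (rule ccontr)
    assume "\<not> ?thesis"
    then have gt: "4 ^ n * lvol I K < (d t)\<^sup>2 * lvol I Q" if "t \<in> gr" for t using that by force
    have ne: "gr \<noteq> {}"
      using cover body_lvol_pos[OF I body_Q] by auto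
    have "real (card gr) * (4 ^ n * lvol I K) * e ^ n = (\<Sum>t\<in>gr. 4 ^ n * lvol I K * e ^ n)" by simp
    also have "\<dots> < (\<Sum>t\<in>gr. (d t)\<^sup>2 * lvol I Q * e ^ n)"
      using gt e by (intro sum_strict_mono[OF fin ne]) auto
    also have "\<dots> = lvol I Q * (\<Sum>t\<in>gr. (d t)\<^sup>2 * e ^ n)" by (simp add: sum_distrib_left mult_ac)
    also have "\<dots> \<le> lvol I Q * lvol I K" by (rule mult_left_mono[OF sumle]) simp
    also have "\<dots> \<le> (4 ^ n * e ^ n * real (card gr)) * lvol I K"
      by (rule mult_right_mono[OF cover]) simp
    finally show False by (simp add: mult_ac)
  qed
  then obtain t where t: "t \<in> gr" "(d t)\<^sup>2 * lvol I Q \<le> 4 ^ n * lvol I K" by blast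
  have tQ: "t \<in> Q" using t by (simp add: gr_def)
  show thesis by (rule that[OF tQ G[OF tQ] qM[OF tQ] t(2)])
qed

end

section \<open>Isotropic position and the fattened body\<close>

lemma nrm_L2: "nrm I x = L2_set x I"
  by (simp add: nrm_def dot_def L2_set_def power2_eq_square)

lemma nrm_triangle: "nrm I (comb I 1 x 1 y) \<le> nrm I x + nrm I y"
proof -
  have "nrm I (comb I 1 x 1 y) = nrm I (\<lambda>i. x i + y i)"
    unfolding nrm_def by (intro arg_cong[where f = sqrt] dot_cong) auto
  then show ?thesis unfolding nrm_L2 using L2_set_triangle_ineq[of x y I] by simp
qed

lemma dot_le_nrm: "dot I x y \<le> nrm I x * nrm I y"
proof -
  have "dot I x y \<le> (\<Sum>i\<in>I. \<bar>x i\<bar> * \<bar>y i\<bar>)"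
    unfolding dot_def by (intro sum_mono) (metis abs_ge_self abs_mult)
  also have "\<dots> \<le> nrm I x * nrm I y" unfolding nrm_L2 by (rule L2_set_mult_ineq)
  finally show ?thesis .
qed

lemma nrm_half:
  assumes "nrm I p \<le> \<rho>" "nrm I q \<le> \<rho>"
  shows "nrm I (comb I (1/2) p (1/2) q) \<le> \<rho>"
proof -
  have "comb I (1/2) p (1/2) q = comb I 1 (comb I (1/2) p 0 p) 1 (comb I (1/2) q 0 q)"
    by (rule vecs_eqI[of _ I]) auto
  then have "nrm I (comb I (1/2) p (1/2) q) \<le> nrm I (comb I (1/2) p 0 p) + nrm I (comb I (1/2) q 0 q)"
    using nrm_triangle by metis
  also have "\<dots> \<le> \<rho>" using assms by (simp add: nrm_scale)
  finally show ?thesis .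
qed

context tilted
begin

text \<open>The transpose of \<open>N\<close> carries the covariance of the chosen tilt to the
  identity, so the squared distance to the barycentre has mean n. The map divides vol K by d and
  multiplies the volume of the polar by d, which turns the bound on d^2 vol Q from
  \<open>packing\<close> into the third claim.\<close>

lemma position:
  obtains K1 b where "body I K1" "vol_prod I K1 = vol_prod I K" "real n ^ n * lvol I (polar_set I K1) \<le> 4 ^ n * lvol I K1"
    "ennreal (exp (- 2 * real n) / 2 * lvol I K1) \<le> emeasure (leb I) {y \<in> K1. nrm I (comb I 1 y (-1) b) \<le> sqrt (2 * real n)}"
proof -
  obtain t M N d where t: "t \<in> Q" and g: "vol_mat I M N d"
    and q: "\<And>x. quad_form I (cov.S (Pt t) I) x = dot I (lin I I M x) (lin I I M x)"
    and dQ: "d\<^sup>2 * lvol I Q \<le> 4 ^ n * lvol I K" by (rule packing) blast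
  obtain R where R: "R > 0" "K \<subseteq> cube I R" using I K by (rule body_bounded)
  interpret c: cov "Pt t" I R by (rule cov_Pt[OF t R])
  have d: "d > 0" using g scales_pos by (auto simp: vol_mat_def)
  have g': "vol_mat I (transp N) (transp M) (1 / d)" by (rule vol_mat_transp[OF I vol_mat_inverse[OF I g]])
  have inv: "inv_mat I (transp N) (transp M)" and sc: "scales I (lin I I (transp N)) (1 / d)" using g' by (auto simp: vol_mat_def)
  have invMN: "inv_mat I M N" using g by (simp add: vol_mat_def)
  define K1 where "K1 = lin I I (transp N) ` K"
  define b1 where "b1 = lin I I (transp N) c.b"
  have bK1: "body I K1" unfolding K1_def by (rule body_lin_image[OF I K inv])
  have vK1: "lvol I K1 = lvol I K / d" unfolding K1_def using lvol_lin_image[OF I inv sc K] by simp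
  have sv1: "vol_prod I K1 = vol_prod I K" unfolding K1_def by (rule vol_prod_lin_image[OF I K g'])
  have vp: "lvol I (polar_set I K1) = d * lvol I (polar_set I K)"
  proof -
    have "lvol I (polar_set I K1) = lvol I (lin I I M ` polar_set I K)"
      unfolding K1_def polar_set_lin_image[OF I inv body_subset[OF K]] by simp
    also have "\<dots> = d * lvol I (polar_set I K)"
      using g by (intro lvol_lin_image[OF I invMN _ body_polar_set[OF I K]]) (simp add: vol_mat_def)
    finally show ?thesis .
  qed
  have three: "real n ^ n * lvol I (polar_set I K1) \<le> 4 ^ n * lvol I K1"
  proof -
    have "real n ^ n * lvol I (polar_set I K1) = d\<^sup>2 * lvol I Q / d" using d by (simp add: vp lvol_Q power2_eq_square)
    also have "\<dots> \<le> 4 ^ n * lvol I K / d" using dQ d by (intro divide_right_mono) auto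
    finally show ?thesis by (simp add: vK1)
  qed
  define f where "f x = (nrm I (comb I 1 (lin I I (transp N) x) (-1) b1))\<^sup>2" for x
  have f_eq: "f x = (\<Sum>i\<in>I. c.Dv x (lin I I N (unitv I i)) * c.Dv x (lin I I N (unitv I i)))" for x
  proof -
    have "comb I 1 (lin I I (transp N) x) (-1) b1 = lin I I (transp N) (comb I 1 x (-1) c.b)" by (simp add: b1_def)
    then have "f x = (\<Sum>i\<in>I. lin I I (transp N) (comb I 1 x (-1) c.b) i * lin I I (transp N) (comb I 1 x (-1) c.b) i)"
      by (simp add: f_def nrm_sq dot_def)
    moreover have "lin I I (transp N) (comb I 1 x (-1) c.b) i = c.Dv x (lin I I N (unitv I i))" if "i \<in> I" for i
    proof -
      have "lin I I (transp N) (comb I 1 x (-1) c.b) i = dot I (lin I I (transp N) (comb I 1 x (-1) c.b)) (unitv I i)"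
        using I that by simp
      also have "\<dots> = c.Dv x (lin I I N (unitv I i))" unfolding c.Dv_def using dot_lin[OF I I, of "transp N" "comb I 1 x (-1) c.b"]
        by (simp only: transp_transp)
      finally show ?thesis .
    qed
    ultimately show ?thesis by simp
  qed
  have fint: "integrable (Pt t) f" unfolding f_eq[abs_def] by (intro Bochner_Integration.integrable_sum c.Dv_integrable)
  have "(\<integral>x. f x \<partial>Pt t) = (\<Sum>i\<in>I. (\<integral>x. c.Dv x (lin I I N (unitv I i)) * c.Dv x (lin I I N (unitv I i)) \<partial>Pt t))"
    unfolding f_eq by (intro Bochner_Integration.integral_sum c.Dv_integrable)
  also have "\<dots> = (\<Sum>i\<in>I. 1)"
  proof (rule sum.cong[OF refl])
    fix i assume i: "i \<in> I"
    have "(\<integral>x. c.Dv x (lin I I N (unitv I i)) * c.Dv x (lin I I N (unitv I i)) \<partial>Pt t) = quad_form I c.S (lin I I N (unitv I i))"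
      by (simp only: c.Dv_cov c.quad_form_S)
    also have "\<dots> = dot I (unitv I i) (unitv I i)"
      unfolding q using invMN by (simp add: inv_mat_def)
    also have "\<dots> = 1" using I i by simp (simp add: unitv_def)
    finally show "(\<integral>x. c.Dv x (lin I I N (unitv I i)) * c.Dv x (lin I I N (unitv I i)) \<partial>Pt t) = 1" .
  qed
  finally have Ef: "(\<integral>x. f x \<partial>Pt t) = real n" by simp
  have fm: "f \<in> borel_measurable (leb I)" unfolding f_eq[abs_def] using c.Dv_meas by measurable
  have nnf: "(\<integral>\<^sup>+x. ennreal (f x) \<partial>Pt t) = ennreal (real n)"
    unfolding Ef[symmetric] by (rule nn_integral_eq_integral[OF fint]) (simp add: f_def)
  define B where "B = {x \<in> vecs I. f x \<le> 2 * real n}"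
  have Bm: "B \<in> sets (leb I)"
  proof -
    have "{x \<in> space (leb I). f x \<le> 2 * real n} \<in> sets (leb I)" using fm by measurable
    then show ?thesis by (simp add: B_def)
  qed
  have spaceP: "space (Pt t) = vecs I" using sets_eq_imp_space_eq[OF sets_Pt[of t]] by simp
  \<comment> \<open>Markov's inequality at twice the mean n. The upper bound exp (2 n) / vol K on
    the tilted density then converts probability 1/2 into a fraction of the volume of
    \<open>K\<close>.\<close>
  have half: "ennreal (1 / 2) \<le> emeasure (Pt t) B"
  proof -
    have Bc: "vecs I - B \<in> sets (Pt t)" using Bm sets.compl_sets[of B "leb I"] by (simp add: sets_Pt)
    have "ennreal (2 * real n) * emeasure (Pt t) (vecs I - B) = (\<integral>\<^sup>+x. ennreal (2 * real n) * indicator (vecs I - B) x \<partial>Pt t)"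
      by (rule nn_integral_cmult_indicator[OF Bc, symmetric])
    also have "\<dots> \<le> (\<integral>\<^sup>+x. ennreal (f x) \<partial>Pt t)"
      by (rule nn_integral_mono) (auto simp: indicator_def B_def intro!: ennreal_leI)
    finally have "ennreal (2 * real n) * emeasure (Pt t) (vecs I - B) \<le> ennreal (real n)" unfolding nnf .
    then have "2 * real n * measure (Pt t) (vecs I - B) \<le> real n"
      by (simp add: c.emeasure_eq_measure ennreal_mult'[symmetric] ennreal_le_iff del: ennreal_mult')
    then have "measure (Pt t) (vecs I - B) \<le> 1 / 2" using n_pos by (simp add: field_simps)
    moreover have "measure (Pt t) (vecs I - B) = 1 - measure (Pt t) B"
      using c.prob_compl[of B] Bm by (simp add: spaceP sets_Pt)
    ultimately have "1 / 2 \<le> measure (Pt t) B" by simp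
    then show ?thesis unfolding c.emeasure_eq_measure by (rule ennreal_leI)
  qed
  have KB: "K \<inter> B \<in> sets (leb I)" using Km Bm by auto
  have "emeasure (Pt t) B = (\<integral>\<^sup>+x. indicator B x \<partial>Pt t)" using Bm by (simp add: sets_Pt)
  also have "\<dots> = (\<integral>\<^sup>+x. indicator K x * ennreal (exp (dot I x t) / z t) * indicator B x \<partial>leb I)"
    by (rule Pt_integral) (use Bm in measurable)
  also have "\<dots> \<le> (\<integral>\<^sup>+x. ennreal (exp (2 * real n) / lvol I K) * indicator (K \<inter> B) x \<partial>leb I)"
    by (rule nn_integral_mono) (auto simp: indicator_def intro!: ennreal_leI dens_bounds(2)[OF t])
  also have "\<dots> = ennreal (exp (2 * real n) / lvol I K) * emeasure (leb I) (K \<inter> B)"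
    by (rule nn_integral_cmult_indicator[OF KB])
  finally have "ennreal (1 / 2) \<le> ennreal (exp (2 * real n) / lvol I K) * emeasure (leb I) (K \<inter> B)"
    using half by (rule order_trans[rotated])
  then have "ennreal (lvol I K * exp (- 2 * real n)) * ennreal (1 / 2) \<le>
      ennreal (lvol I K * exp (- 2 * real n)) * (ennreal (exp (2 * real n) / lvol I K) * emeasure (leb I) (K \<inter> B))"
    by (rule mult_left_mono) simp
  also have "\<dots> = emeasure (leb I) (K \<inter> B)"
    using vK by (simp add: mult.assoc[symmetric] ennreal_mult'[symmetric] exp_minus)
  also have "ennreal (lvol I K * exp (- 2 * real n)) * ennreal (1 / 2) = ennreal (lvol I K * exp (- 2 * real n) / 2)"
    by (subst ennreal_mult'[symmetric]) auto
  finally have KBe: "ennreal (lvol I K * exp (- 2 * real n) / 2) \<le> emeasure (leb I) (K \<inter> B)" .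
  define A1 where "A1 = {y \<in> K1. nrm I (comb I 1 y (-1) b1) \<le> sqrt (2 * real n)}"
  have A1m: "A1 \<in> sets (leb I)"
  proof -
    have "(\<lambda>y. comb I 1 y (-1) b1) \<in> leb I \<rightarrow>\<^sub>M leb I"
      unfolding comb_def by (rule measurable_lbI) auto
    then have "{y \<in> space (leb I). nrm I (comb I 1 y (-1) b1) \<le> sqrt (2 * real n)} \<in> sets (leb I)"
      by measurable
    moreover have "A1 = K1 \<inter> {y \<in> space (leb I). nrm I (comb I 1 y (-1) b1) \<le> sqrt (2 * real n)}"
      using body_subset[OF bK1] by (auto simp: A1_def)
    ultimately show ?thesis using body_sets[OF bK1] by auto
  qed
  have sub: "K \<inter> B \<subseteq> {x \<in> vecs I. lin I I (transp N) x \<in> A1}"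
  proof
    fix x assume x: "x \<in> K \<inter> B"
    have "sqrt (f x) \<le> sqrt (2 * real n)" using x by (auto simp: B_def)
    then have "nrm I (comb I 1 (lin I I (transp N) x) (-1) b1) \<le> sqrt (2 * real n)" by (simp add: f_def)
    then show "x \<in> {x \<in> vecs I. lin I I (transp N) x \<in> A1}" using x by (auto simp: A1_def K1_def B_def)
  qed
  have pre: "{x \<in> vecs I. lin I I (transp N) x \<in> A1} \<in> sets (leb I)"
  proof -
    have "lin I I (transp N) -` A1 \<inter> space (leb I) \<in> sets (leb I)" by (rule measurable_sets[OF lin_meas' A1m])
    moreover have "lin I I (transp N) -` A1 \<inter> space (leb I) = {x \<in> vecs I. lin I I (transp N) x \<in> A1}" by auto
    ultimately show ?thesis by simp
  qed
  have "ennreal (exp (- 2 * real n) / 2 * lvol I K1) = ennreal (1 / d) * ennreal (lvol I K * exp (- 2 * real n) / 2)"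
    using d by (simp add: vK1 ennreal_mult'[symmetric] mult.commute)
  also have "\<dots> \<le> ennreal (1 / d) * emeasure (leb I) {x \<in> vecs I. lin I I (transp N) x \<in> A1}"
    by (intro mult_left_mono order_trans[OF KBe emeasure_mono[OF sub pre]]) simp
  also have "\<dots> = emeasure (leb I) A1" by (rule scales_emeasure[OF sc A1m, symmetric])
  finally show thesis using that[OF bK1 sv1 three] by (simp add: A1_def)
qed

end

text \<open>The set \<open>D\<close> contains \<open>K + \<rho> B\<close>. Every \<open>z\<close> in \<open>(K + \<rho> B + b) / 2\<close> has \<open>vol (K \<inter> (z + \<rho> B)) \<ge> 2^{-n} a vol K\<close>, while this volume integrates to \<open>vol K vol (\<rho> B)\<close> over \<open>z\<close>.\<close>
lemma fat_sum:
  assumes I: "finite I" and K: "body I K" and \<rho>: "\<rho> > 0" and a: "a > 0"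
    and A: "ennreal (a * lvol I K) \<le> emeasure (leb I) {y \<in> K. nrm I (comb I 1 y (-1) b) \<le> \<rho>}"
  obtains D where "D \<in> sets (leb I)" "\<And>x w. x \<in> K \<Longrightarrow> w \<in> vecs I \<Longrightarrow> nrm I (comb I 1 w (-1) x) \<le> \<rho> \<Longrightarrow> w \<in> D"
    "emeasure (leb I) D \<le> ennreal (4 ^ card I / a * (\<rho> ^ card I * ball_vol I))"
proof -
  let ?n = "card I"
  interpret lI: sigma_finite_measure "leb I" by (rule sigma_finite_leb[OF I])
  interpret pair_sigma_finite "leb I" "leb I" by (rule pair_sigma_finite_leb[OF I I])
  have vK: "lvol I K > 0" by (rule body_lvol_pos[OF I K])
  have Km [measurable]: "K \<in> sets (leb I)" by (rule body_sets[OF K])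
  define A where "A = {y \<in> K. nrm I (comb I 1 y (-1) b) \<le> \<rho>}"
  have Am: "A \<in> sets (leb I)"
  proof -
    have "(\<lambda>y. comb I 1 y (-1) b) \<in> leb I \<rightarrow>\<^sub>M leb I"
      unfolding comb_def by (rule measurable_lbI) auto
    then have "{y \<in> space (leb I). nrm I (comb I 1 y (-1) b) \<le> \<rho>} \<in> sets (leb I)" by measurable
    moreover have "A = K \<inter> {y \<in> space (leb I). nrm I (comb I 1 y (-1) b) \<le> \<rho>}"
      using body_subset[OF K] by (auto simp: A_def)
    ultimately show ?thesis by auto
  qed
  define k :: "(nat \<Rightarrow> real) \<Rightarrow> (nat \<Rightarrow> real) \<Rightarrow> ennreal" where
    "k z y = indicator K y * indicator {..\<rho>} (nrm I (comb I 1 y (-1) z))" for z y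
  have km: "(\<lambda>(z, y). k z y) \<in> borel_measurable (leb I \<Otimes>\<^sub>M leb I)" "(\<lambda>(y, z). k z y) \<in> borel_measurable (leb I \<Otimes>\<^sub>M leb I)"
    unfolding k_def by measurable
  define m where "m z = (\<integral>\<^sup>+y. k z y \<partial>leb I)" for z
  have mat_mult: "m \<in> borel_measurable (leb I)"
    unfolding m_def[abs_def] by (rule lI.borel_measurable_nn_integral[OF km(1)])
  have int: "(\<integral>\<^sup>+z. m z \<partial>leb I) = ennreal (lvol I K * (\<rho> ^ ?n * ball_vol I))"
  proof -
    have "(\<integral>\<^sup>+z. m z \<partial>leb I) = (\<integral>\<^sup>+y. (\<integral>\<^sup>+z. k z y \<partial>leb I) \<partial>leb I)"
      unfolding m_def by (rule Fubini'[OF km(2)])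
    also have "\<dots> = (\<integral>\<^sup>+y. ennreal (\<rho> ^ ?n * ball_vol I) * indicator K y \<partial>leb I)"
    proof (rule nn_integral_cong)
      fix y assume y: "y \<in> space (leb I)"
      have "(\<integral>\<^sup>+z. k z y \<partial>leb I) = (\<integral>\<^sup>+z. indicator K y * indicator {z \<in> vecs I. comb I (-1) z 1 y \<in> cball I \<rho>} z \<partial>leb I)"
      proof (rule nn_integral_cong)
        fix z assume "z \<in> space (leb I)"
        moreover have "comb I 1 y (-1) z = comb I (-1) z 1 y" by (rule vecs_eqI[of _ I]) auto
        ultimately show "k z y = indicator K y * indicator {z \<in> vecs I. comb I (-1) z 1 y \<in> cball I \<rho>} z"
          by (simp add: k_def cball_def indicator_def)
      qed
      also have "\<dots> = indicator K y * emeasure (leb I) {z \<in> vecs I. comb I (-1) z 1 y \<in> cball I \<rho>}"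
        by (rule nn_integral_cmult_indicator[OF affine_vimage_sets[OF cball_sets]])
      also have "emeasure (leb I) {z \<in> vecs I. comb I (-1) z 1 y \<in> cball I \<rho>} = ennreal ((1 / \<bar>-1\<bar>) ^ ?n) * emeasure (leb I) (cball I \<rho>)"
        by (rule emeasure_affine_vimage[OF I _ cball_sets]) simp
      finally show "(\<integral>\<^sup>+z. k z y \<partial>leb I) = ennreal (\<rho> ^ ?n * ball_vol I) * indicator K y"
        by (simp add: emeasure_cball[OF I \<rho>] mult.commute)
    qed
    also have "\<dots> = ennreal (\<rho> ^ ?n * ball_vol I) * emeasure (leb I) K" by (rule nn_integral_cmult_indicator[OF Km])
    finally show ?thesis using \<rho> by (simp add: body_emeasure[OF I K] ennreal_mult'[symmetric] mult.commute)
  qed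
  define c where "c = (1 / 2) ^ ?n * (a * lvol I K)"
  have c: "c > 0" using a vK by (simp add: c_def)
  define D0 where "D0 = {z \<in> vecs I. ennreal c \<le> m z}"
  have D0m: "D0 \<in> sets (leb I)"
  proof -
    have "{z \<in> space (leb I). ennreal c \<le> m z} \<in> sets (leb I)" using mat_mult by measurable
    then show ?thesis by (simp add: D0_def)
  qed
  define D where "D = {w \<in> vecs I. comb I (1/2) w 1 (comb I (1/2) b 0 b) \<in> D0}"
  show thesis
  proof (rule that[of D])
    show "D \<in> sets (leb I)" unfolding D_def by (rule affine_vimage_sets[OF D0m])
    fix x w assume x: "x \<in> K" and w: "w \<in> vecs I" "nrm I (comb I 1 w (-1) x) \<le> \<rho>"
    let ?z = "comb I (1/2) w 1 (comb I (1/2) b 0 b)"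
    have "ennreal c \<le> ennreal ((1 / \<bar>2\<bar>) ^ ?n) * emeasure (leb I) A"
      using mult_left_mono[OF assms(5), of "ennreal ((1 / 2) ^ ?n)"] by (simp add: c_def A_def ennreal_mult')
    also have "\<dots> = emeasure (leb I) {y \<in> vecs I. comb I 2 y 1 (comb I (-1) x 0 x) \<in> A}"
      by (rule emeasure_affine_vimage[OF I _ Am, symmetric]) simp
    also have "\<dots> = (\<integral>\<^sup>+y. indicator {y \<in> vecs I. comb I 2 y 1 (comb I (-1) x 0 x) \<in> A} y \<partial>leb I)"
      by (rule nn_integral_indicator[OF affine_vimage_sets[OF Am], symmetric])
    also have "\<dots> \<le> m ?z"
      unfolding m_def
    proof (rule nn_integral_mono)
      fix y assume "y \<in> space (leb I)"
      show "indicator {y \<in> vecs I. comb I 2 y 1 (comb I (-1) x 0 x) \<in> A} y \<le> k ?z y"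
      proof (cases "y \<in> {y \<in> vecs I. comb I 2 y 1 (comb I (-1) x 0 x) \<in> A}")
        case True
        \<comment> \<open>y is the midpoint of x and the point p of \<open>A\<close>, so y minus (w
          + b) / 2 is the mean of x - w and p - b, both of norm at most \<rho>.\<close>
        define p where "p = comb I 2 y 1 (comb I (-1) x 0 x)"
        have p: "p \<in> K" "nrm I (comb I 1 p (-1) b) \<le> \<rho>" and yv: "y \<in> vecs I" using True by (auto simp: p_def A_def)
        have y: "y = comb I (1/2) x (1/2) p" using yv by (intro vecs_eqI[of _ I]) (auto simp: p_def field_simps)
        have yK: "y \<in> K" unfolding y by (rule body_comb[OF K x p(1)]) simp
        have "comb I 1 y (-1) ?z = comb I (1/2) (comb I (-1) (comb I 1 w (-1) x) 0 x) (1/2) (comb I 1 p (-1) b)"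
          by (rule vecs_eqI[of _ I]) (auto simp: p_def field_simps)
        moreover have "nrm I (comb I (-1) (comb I 1 w (-1) x) 0 x) \<le> \<rho>" using w(2) by (simp add: nrm_scale)
        ultimately have "nrm I (comb I 1 y (-1) ?z) \<le> \<rho>" using nrm_half p(2) by metis
        then show ?thesis using yK by (simp add: k_def indicator_def)
      qed simp
    qed
    finally show "w \<in> D" using w by (simp add: D_def D0_def)
  next
    have "ennreal c * emeasure (leb I) D0 = (\<integral>\<^sup>+z. ennreal c * indicator D0 z \<partial>leb I)"
      by (rule nn_integral_cmult_indicator[OF D0m, symmetric])
    also have "\<dots> \<le> (\<integral>\<^sup>+z. m z \<partial>leb I)"
      by (rule nn_integral_mono) (auto simp: D0_def indicator_def)
    finally have D0e: "ennreal c * emeasure (leb I) D0 \<le> ennreal (lvol I K * (\<rho> ^ ?n * ball_vol I))" unfolding int .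
    have "emeasure (leb I) D = ennreal ((1 / \<bar>1/2\<bar>) ^ ?n) * emeasure (leb I) D0"
      unfolding D_def by (rule emeasure_affine_vimage[OF I _ D0m]) simp
    also have "\<dots> = ennreal (2 ^ ?n / c) * (ennreal c * emeasure (leb I) D0)"
      using c by (simp add: mult.assoc[symmetric] ennreal_mult'[symmetric])
    also have "\<dots> \<le> ennreal (2 ^ ?n / c) * ennreal (lvol I K * (\<rho> ^ ?n * ball_vol I))"
      by (rule mult_left_mono[OF D0e]) simp
    also have "\<dots> = ennreal (2 ^ ?n / c * (lvol I K * (\<rho> ^ ?n * ball_vol I)))"
      using c by (simp add: ennreal_mult'[symmetric])
    also have "2 ^ ?n / c * (lvol I K * (\<rho> ^ ?n * ball_vol I)) = 4 ^ ?n / a * (\<rho> ^ ?n * ball_vol I)"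
    proof -
      have "2 ^ ?n / c * lvol I K = 4 ^ ?n / a"
        using a vK by (simp add: c_def power_one_over field_simps power_mult_distrib[symmetric])
      then show ?thesis by (simp only: mult.assoc[symmetric])
    qed
    finally show "emeasure (leb I) D \<le> ennreal (4 ^ ?n / a * (\<rho> ^ ?n * ball_vol I))" .
  qed
qed

section \<open>The Bourgain-Milman inequality\<close>

text \<open>Radii of order sqrt n have volume at least 1 in every dimension up to n, so the radius
  \<open>sqrt (2 n)\<close> from the ambient space can be used unchanged in sections and
  fibres.\<close>

lemma ball_volume_ge_1:
  assumes J: "finite J" "J \<noteq> {}" and r: "sqrt (real (card J)) \<le> r"
  shows "1 \<le> r ^ card J * ball_vol J"
proof -
  have "1 \<le> (2::real) ^ card J" by simp
  also have "\<dots> \<le> sqrt (real (card J)) ^ card J * ball_vol J" by (rule ball_vol_lower[OF J])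
  also have "\<dots> \<le> r ^ card J * ball_vol J" using r by (intro mult_right_mono power_mono) auto
  finally show ?thesis .
qed

text \<open>Szarek's volume ratio argument: a long vector of \<open>K\<close> in a subspace brings a ball of radius \<open>sqrt (2 n)\<close> around it into \<open>D\<close>, which is expensive for the average of \<open>|x| ^ k\<close> over \<open>D\<close>.\<close>
lemma bounded_section:
  assumes I: "finite I" and J: "J \<subseteq> I" "J \<noteq> {}" "card J < card I" "card I \<le> 5 * (card I - card J)"
    and D: "D \<in> sets (leb I)" "emeasure (leb I) D \<le> ennreal (540 ^ card I)"
    and KD: "\<And>x w. x \<in> K \<Longrightarrow> w \<in> vecs I \<Longrightarrow> nrm I (comb I 1 w (-1) x) \<le> sqrt (2 * real (card I)) \<Longrightarrow> w \<in> D"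
    and K: "K \<subseteq> vecs I"
  obtains U where "frame I J U" "\<And>t. t \<in> vecs J \<Longrightarrow> lin I J U t \<in> K \<Longrightarrow> nrm J t \<le> 4 * 1621 ^ 5 * sqrt (real (card I))"
proof -
  let ?n = "card I" and ?m = "card J" and ?k = "card I - card J"
  have fJ: "finite J" using I J finite_subset by blast
  have m: "?m > 0" using fJ J by (simp add: card_gt_0_iff)
  have k: "?k > 0" "?n > 0" using J(3) by auto
  define s where "s = sqrt (real ?n)"
  have s: "s > 0" using k by (simp add: s_def)
  define \<rho> where "\<rho> = sqrt (2 * real ?n)"
  have \<rho>: "\<rho> > 0" "\<rho> \<le> 2 * s"
  proof -
    show "\<rho> > 0" using k by (simp add: \<rho>_def)
    have "\<rho> = sqrt 2 * s" by (simp add: \<rho>_def s_def real_sqrt_mult)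
    moreover have "sqrt 2 \<le> (2::real)" using real_sqrt_le_mono[of 2 4] by simp
    ultimately show "\<rho> \<le> 2 * s" using s by simp
  qed
  \<comment> \<open>The factor |x|^k cancels the weight 1 / |y|^k of \<open>slice_lower\<close>,
    which leaves just the volume of \<open>D\<close>.\<close>
  define h :: "(nat \<Rightarrow> real) \<Rightarrow> ennreal" where "h x = indicator D x * ennreal (nrm I x ^ ?k)" for x
  have hm: "h \<in> borel_measurable (leb I)" unfolding h_def using D(1) by measurable
  \<comment> \<open>The number 1620 is 3 from \<open>slice_lower\<close> times 540 from the volume
    of \<open>D\<close>; 1621 leaves room for a strict inequality.\<close>
  define S where "S = s ^ ?k * 1621 ^ ?n"
  have "\<exists>U. frame I J U \<and> (\<integral>\<^sup>+t. h (lin I J U t) \<partial>leb J) < ennreal S"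
  proof (rule ccontr)
    assume "\<not> ?thesis"
    then have all: "ennreal S \<le> (\<integral>\<^sup>+t. h (lin I J U t) \<partial>leb J)" if "frame I J U" for U using that by (auto simp: not_less)
    have SL: "ennreal S \<le> ennreal (3 ^ ?m * s ^ ?k) * (\<integral>\<^sup>+y. h y * ennreal (1 / nrm I y ^ ?k) \<partial>leb I)"
      unfolding s_def by (rule slice_lower[OF I fJ J(2,3) hm all])
    have "(\<integral>\<^sup>+y. h y * ennreal (1 / nrm I y ^ ?k) \<partial>leb I) \<le> (\<integral>\<^sup>+y. indicator D y \<partial>leb I)"
    proof (rule nn_integral_mono)
      fix y
      have "ennreal (nrm I y ^ ?k) * ennreal (1 / nrm I y ^ ?k) \<le> 1"
        by (cases "nrm I y = 0") (use k in \<open>simp_all add: ennreal_mult'[symmetric]\<close>)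
      then show "h y * ennreal (1 / nrm I y ^ ?k) \<le> indicator D y"
        by (auto simp: h_def indicator_def)
    qed
    also have "(\<integral>\<^sup>+y. indicator D y \<partial>leb I) \<le> ennreal (540 ^ ?n)" using D by simp
    finally have "(\<integral>\<^sup>+y. h y * ennreal (1 / nrm I y ^ ?k) \<partial>leb I) \<le> ennreal (540 ^ ?n)" .
    then have "ennreal S \<le> ennreal (3 ^ ?m * s ^ ?k) * ennreal (540 ^ ?n)"
      by (intro order_trans[OF SL] mult_left_mono) auto
    also have "\<dots> = ennreal (3 ^ ?m * s ^ ?k * 540 ^ ?n)" using s by (intro ennreal_mult'[symmetric]) simp
    finally have "S \<le> 3 ^ ?m * s ^ ?k * 540 ^ ?n" using s by (simp add: ennreal_le_iff)
    also have "\<dots> \<le> 3 ^ ?n * s ^ ?k * 540 ^ ?n"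
      using J(3) s by (intro mult_right_mono power_increasing) auto
    also have "\<dots> = s ^ ?k * 1620 ^ ?n" by (simp add: power_mult_distrib[symmetric] mult_ac)
    also have "\<dots> < S" unfolding S_def using s k by (intro mult_strict_left_mono power_strict_mono) auto
    finally show False by simp
  qed
  then obtain U where U: "frame I J U" "(\<integral>\<^sup>+t. h (lin I J U t) \<partial>leb J) < ennreal S" by blast
  show thesis
  proof (rule that[OF U(1)])
    fix t0 assume t0: "t0 \<in> vecs J" "lin I J U t0 \<in> K"
    define \<tau> where "\<tau> = nrm J t0"
    have nU: "nrm I (lin I J U t) = nrm J t" for t by (simp add: nrm_def frame_dot[OF I fJ U(1)])
    show "nrm J t0 \<le> 4 * 1621 ^ 5 * sqrt (real ?n)"
    proof (cases "\<tau> \<le> 2 * \<rho>")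
      case True
      then have "\<tau> \<le> 4 * s" using \<rho> by linarith
      also have "\<dots> \<le> 4 * 1621 ^ 5 * s" using s by simp
      finally show ?thesis by (simp add: \<tau>_def s_def)
    next
      case False
      define B where "B = {t \<in> vecs J. comb J 1 t 1 (comb J (-1) t0 0 t0) \<in> cball J \<rho>}"
      have Bm: "B \<in> sets (leb J)" unfolding B_def by (rule affine_vimage_sets[OF cball_sets])
      have Be: "emeasure (leb J) B = ennreal (\<rho> ^ ?m * ball_vol J)"
        unfolding B_def by (subst emeasure_affine_vimage[OF fJ _ cball_sets]) (auto simp: emeasure_cball[OF fJ \<rho>(1)])
      have pt: "ennreal ((\<tau> / 2) ^ ?k) * indicator B t \<le> h (lin I J U t)" for t
      proof (cases "t \<in> B")
        case True
        let ?w = "comb J 1 t 1 (comb J (-1) t0 0 t0)"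
        have tv: "t \<in> vecs J" and w: "nrm J ?w \<le> \<rho>" using True by (auto simp: B_def cball_def)
        have "comb I 1 (lin I J U t) (-1) (lin I J U t0) = lin I J U ?w"
          unfolding lin_comb by (rule vecs_eqI[of _ I]) auto
        then have "nrm I (comb I 1 (lin I J U t) (-1) (lin I J U t0)) \<le> \<rho>" using w nU by (simp only:)
        then have inD: "lin I J U t \<in> D" unfolding \<rho>_def by (intro KD[OF t0(2)]) auto
        have "t0 = comb J 1 t 1 (comb J (-1) ?w 0 t)" using t0 by (intro vecs_eqI[of _ J]) auto
        then have "\<tau> \<le> nrm J t + nrm J (comb J (-1) ?w 0 t)" unfolding \<tau>_def using nrm_triangle by metis
        then have "\<tau> \<le> nrm J t + \<rho>" using w by (simp add: nrm_scale)
        then have "\<tau> / 2 \<le> nrm J t" using False by linarith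
        then have "(\<tau> / 2) ^ ?k \<le> nrm J t ^ ?k" using nrm_nonneg[of J t0] by (intro power_mono) (auto simp: \<tau>_def)
        then show ?thesis using inD True by (simp add: h_def nU ennreal_leI)
      qed simp
      have one: "1 \<le> \<rho> ^ ?m * ball_vol J"
        by (rule ball_volume_ge_1[OF fJ J(2)]) (use J(3) in \<open>simp add: \<rho>_def\<close>)
      have t0n: "0 \<le> (\<tau> / 2) ^ ?k" by (simp add: \<tau>_def)
      have "ennreal ((\<tau> / 2) ^ ?k) = ennreal ((\<tau> / 2) ^ ?k) * 1" by simp
      also have "\<dots> \<le> ennreal ((\<tau> / 2) ^ ?k) * emeasure (leb J) B"
        unfolding Be using ennreal_leI[OF one] by (intro mult_left_mono) auto
      also have "\<dots> = (\<integral>\<^sup>+t. ennreal ((\<tau> / 2) ^ ?k) * indicator B t \<partial>leb J)"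
        by (rule nn_integral_cmult_indicator[OF Bm, symmetric])
      also have "\<dots> \<le> (\<integral>\<^sup>+t. h (lin I J U t) \<partial>leb J)" by (rule nn_integral_mono[OF pt])
      also have "\<dots> \<le> ennreal S" using U(2) by simp
      finally have "(\<tau> / 2) ^ ?k \<le> S" using s by (simp add: ennreal_le_iff S_def)
      \<comment> \<open>Proportional codimension, n <= 5 k, turns the constant to the power n into a
        k-th power, so that k-th roots cost only a constant factor.\<close>
      also have "\<dots> \<le> s ^ ?k * 1621 ^ (5 * ?k)"
        unfolding S_def using s J(4) by (intro mult_left_mono power_increasing) auto
      also have "\<dots> = (s * 1621 ^ 5) ^ ?k" by (simp add: power_mult_distrib power_mult)
      finally have "(\<tau> / 2) ^ ?k \<le> (s * 1621 ^ 5) ^ ?k" .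
      then have "\<tau> / 2 \<le> s * 1621 ^ 5"
        by (subst (asm) power_mono_iff) (use k s in \<open>auto simp: \<tau>_def\<close>)
      then have "\<tau> \<le> 2 * 1621 ^ 5 * s" by simp
      also have "\<dots> \<le> 4 * 1621 ^ 5 * s" using s by simp
      finally show ?thesis by (simp add: \<tau>_def s_def)
    qed
  qed
qed

text \<open>Multiplied by sqrt n, this is the radius that \<open>bounded_section\<close> gives for
  the section.\<close>

definition sec_set_radius :: real where "sec_set_radius = 4 * 1621 ^ 5"

text \<open>Here \<open>w\<close> is the volume of \<open>K\<close> in the position of \<open>tilted.position\<close>. The two inequalities combine to \<open>\<sigma> \<ge> c^n \<sigma>^(1/2) \<sigma>'\<close> for the normalised volume products \<open>\<sigma>\<close>, \<open>\<sigma>'\<close> of \<open>K\<close>, \<open>K'\<close>; the exponent \<open>1/2\<close> together with \<open>dim K' \<le> n / 3 < n / 2\<close> is what lets the induction close without losing constants.\<close>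
lemma reduction_step:
  assumes I: "finite I" and n3: "card I \<ge> 3" and K: "body I K"
  obtains J K' where "J \<subseteq> I" "card J = card I div 3" "body J K'"
    "(\<exists>w>0. real (card I) ^ card I * vol_prod I K \<le> 4 ^ card I * w\<^sup>2 \<and>
      w * vol_prod J K' \<le> (4 * 1080 * sec_set_radius * real (card I)) ^ card I / real (card I) ^ card J * vol_prod I K)"
proof -
  let ?n = "card I"
  have I0: "I \<noteq> {}" using n3 by auto
  interpret tl: tilted I K by unfold_locales (rule I, rule I0, rule K)
  obtain K1 b where K1: "body I K1" "vol_prod I K1 = vol_prod I K" "real ?n ^ ?n * lvol I (polar_set I K1) \<le> 4 ^ ?n * lvol I K1"
    "ennreal (exp (- 2 * real ?n) / 2 * lvol I K1) \<le> emeasure (leb I) {y \<in> K1. nrm I (comb I 1 y (-1) b) \<le> sqrt (2 * real ?n)}"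
    by (rule tl.position) blast
  define \<rho> where "\<rho> = sqrt (2 * real ?n)"
  have \<rho>: "\<rho> > 0" using n3 by (simp add: \<rho>_def)
  obtain D where D: "D \<in> sets (leb I)" "\<And>x w. x \<in> K1 \<Longrightarrow> w \<in> vecs I \<Longrightarrow> nrm I (comb I 1 w (-1) x) \<le> \<rho> \<Longrightarrow> w \<in> D"
    "emeasure (leb I) D \<le> ennreal (4 ^ ?n / (exp (- 2 * real ?n) / 2) * (\<rho> ^ ?n * ball_vol I))"
    by (rule fat_sum[OF I K1(1) \<rho> _ K1(4)[folded \<rho>_def]]) (simp, blast)
  \<comment> \<open>Here 540 = 4 * (2 * 9) * (3/2) * 5: the 4 is from \<open>fat_sum\<close>, 2 * 9
    bounds the inverse fraction 2 exp (2 n), 3/2 bounds sqrt 2 in the radius, and 5 is from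
    \<open>ball_vol_upper\<close>.\<close>
  have "4 ^ ?n / (exp (- 2 * real ?n) / 2) * (\<rho> ^ ?n * ball_vol I) \<le> 540 ^ ?n"
  proof -
    have "\<rho> ^ ?n * ball_vol I = sqrt 2 ^ ?n * (sqrt (real ?n) ^ ?n * ball_vol I)"
      by (simp add: \<rho>_def real_sqrt_mult power_mult_distrib)
    also have "\<dots> \<le> (3/2) ^ ?n * 5 ^ ?n"
    proof (intro mult_mono ball_vol_upper[OF I I0] power_mono)
      have "sqrt 2 \<le> sqrt ((3/2)\<^sup>2 :: real)" by (intro real_sqrt_le_mono) (simp add: power2_eq_square)
      then show "sqrt 2 \<le> (3/2 :: real)" by simp
    qed auto
    finally have 1: "\<rho> ^ ?n * ball_vol I \<le> (3/2) ^ ?n * 5 ^ ?n" .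
    have "exp (2 * real ?n) = exp 2 ^ ?n" by (simp add: exp_of_nat_mult[symmetric] mult.commute)
    also have "\<dots> \<le> 9 ^ ?n"
    proof (rule power_mono)
      have "exp (2::real) = exp 1 * exp 1" by (simp add: exp_add[symmetric])
      also have "\<dots> \<le> 3 * 3" using exp_le by (intro mult_mono) auto
      finally show "exp (2::real) \<le> 9" by simp
    qed simp
    finally have 2: "exp (2 * real ?n) \<le> 9 ^ ?n" .
    have "4 ^ ?n / (exp (- 2 * real ?n) / 2) = 4 ^ ?n * (2 * exp (2 * real ?n))" by (simp add: exp_minus field_simps)
    also have "\<dots> \<le> 4 ^ ?n * (2 ^ ?n * 9 ^ ?n)"
    proof (intro mult_left_mono mult_mono 2)
      show "2 \<le> (2::real) ^ ?n" using n3 power_increasing[of 1 ?n "2::real"] by simp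
    qed auto
    finally have 3: "4 ^ ?n / (exp (- 2 * real ?n) / 2) \<le> 4 ^ ?n * (2 ^ ?n * 9 ^ ?n)" .
    have "4 ^ ?n / (exp (- 2 * real ?n) / 2) * (\<rho> ^ ?n * ball_vol I) \<le> 4 ^ ?n * (2 ^ ?n * 9 ^ ?n) * ((3/2) ^ ?n * 5 ^ ?n)"
      by (rule mult_mono[OF 3 1]) (use \<rho> in auto)
    also have "\<dots> = 540 ^ ?n" by (simp only: power_mult_distrib[symmetric]) simp
    finally show ?thesis .
  qed
  then have De: "emeasure (leb I) D \<le> ennreal (540 ^ ?n)" using D(3) by (meson ennreal_leI order_trans)
  obtain J' where J': "J' \<subseteq> I" "card J' = ?n div 3"
    using obtain_subset_with_card_n[of "?n div 3" I] by (metis div_le_dividend)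
  define J where "J = I - J'"
  have fJ: "finite J" "finite J'" and JJ: "J \<inter> J' = {}" "J \<union> J' = I" using I J' finite_subset by (auto simp: J_def)
  have cJ: "card J = ?n - ?n div 3" unfolding J_def using J' I finite_subset by (subst card_Diff_subset) auto
  have J0: "J \<noteq> {}" using cJ n3 by auto
  \<comment> \<open>Rounding is worst at n = 5, where equality holds.\<close>
  have "?n \<le> 5 * (?n div 3)" using n3 by presburger
  then have cJ2: "?n - card J = ?n div 3" "card J < ?n" "?n \<le> 5 * (?n - card J)" "card J + card J' = ?n" using cJ n3 J' by auto
  have Jsub: "J \<subseteq> I" by (auto simp: J_def)
  obtain U where U: "frame I J U" "\<And>t. t \<in> vecs J \<Longrightarrow> lin I J U t \<in> K1 \<Longrightarrow> nrm J t \<le> sec_set_radius * sqrt (real ?n)"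
    unfolding sec_set_radius_def
    by (rule bounded_section[OF I Jsub J0 cJ2(2,3) D(1) De D(2)[unfolded \<rho>_def] body_subset[OF K1(1)]]) blast+
  \<comment> \<open>Completing \<open>U\<close> to an orthogonal matrix and applying the transpose
    to \<open>K1\<close> turns the section by the image of \<open>U\<close> into the coordinate
    section on \<open>J\<close>, without changing volumes.\<close>
  obtain W where W: "frame I I W" "\<And>j l. j \<in> J \<Longrightarrow> W l j = U l j"
    using frame_extend[OF I Jsub U(1)] by blast
  have inv: "inv_mat I W (transp W)" by (rule frame_full_inv[OF I W(1)])
  have gW: "vol_mat I (transp W) W 1" using scales_frame[OF I W(1)] inv by (simp add: vol_mat_def inv_mat_sym)
  define K2 where "K2 = lin I I (transp W) ` K1"
  have K2: "body I K2" unfolding K2_def by (rule body_lin_image[OF I K1(1) inv_mat_sym[OF inv]])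
  have sv2: "vol_prod I K2 = vol_prod I K" unfolding K2_def using vol_prod_lin_image[OF I K1(1) gW] K1(2) by simp
  have v2: "lvol I K2 = lvol I K1"
    unfolding K2_def using lvol_lin_image[OF I inv_mat_sym[OF inv] _ K1(1), of 1] gW by (simp add: vol_mat_def)
  have K2D: "lin I I W x \<in> K1" if "x \<in> K2" for x
    using that inv body_subset[OF K1(1)] by (auto simp: K2_def inv_mat_def)
  let ?s = "sec_set I J K2" and ?p = "proj_set J' K2"
  have bs: "body J ?s" by (rule body_sec_set[OF I Jsub K2])
  have bp: "body J' ?p" by (rule body_proj_set[OF I J'(1) K2])
  have ns: "nrm J y \<le> sec_set_radius * sqrt (real ?n)" if y: "y \<in> ?s" for y
  proof (rule U(2))
    show "y \<in> vecs J" using y by (simp add: sec_set_def)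
    have "lin I I W (ext0 I J y) \<in> K1" using y by (intro K2D) (simp add: sec_set_def)
    also have "lin I I W (ext0 I J y) = lin I J U y"
    proof (rule vecs_eqI[of _ I])
      fix i assume i: "i \<in> I"
      have "(\<Sum>j\<in>I. W i j * ext0 I J y j) = (\<Sum>j\<in>J. U i j * y j)"
        using I Jsub by (intro sum.mono_neutral_cong_right) (auto simp: ext0_def W(2))
      then show "lin I I W (ext0 I J y) i = lin I J U y i" using i by (simp add: lin_app)
    qed auto
    finally show "lin I J U y \<in> K1" .
  qed
  have sec_set_radius: "sec_set_radius > 0" "sec_set_radius \<ge> 1" by (auto simp: sec_set_radius_def)
  define r where "r = 1 / (sec_set_radius * sqrt (real ?n))"
  have r: "r > 0" using sec_set_radius n3 by (auto simp: r_def)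
  \<comment> \<open>The section lies in a ball of radius \<open>sec_set_radius * sqrt n\<close>, so
    its polar contains the ball of the reciprocal radius \<open>r\<close>.\<close>
  have polS: "(1 / (sec_set_radius * real ?n)) ^ card J \<le> lvol J (polar_set J ?s)"
  proof -
    have "cball J r \<subseteq> polar_set J ?s"
    proof
      fix y assume y: "y \<in> cball J r"
      have "dot J x y \<le> 1" if x: "x \<in> ?s" for x
      proof -
        have "dot J x y \<le> nrm J x * nrm J y" by (rule dot_le_nrm)
        also have "\<dots> \<le> (sec_set_radius * sqrt (real ?n)) * r"
          using ns[OF x] y sec_set_radius by (intro mult_mono) (auto simp: cball_def)
        also have "\<dots> = 1" using sec_set_radius n3 by (auto simp: r_def)
        finally show ?thesis .
      qed
      then show "y \<in> polar_set J ?s" using y by (simp add: polar_set_def cball_def)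
    qed
    then have "emeasure (leb J) (cball J r) \<le> emeasure (leb J) (polar_set J ?s)"
      by (rule emeasure_mono[OF _ body_sets[OF body_polar_set[OF fJ(1) bs]]])
    then have A: "r ^ card J * ball_vol J \<le> lvol J (polar_set J ?s)"
      using r by (simp add: emeasure_cball[OF fJ(1)] body_emeasure[OF fJ(1) body_polar_set[OF fJ(1) bs]] ennreal_le_iff)
    have "1 \<le> sqrt (real ?n) ^ card J * ball_vol J"
      by (rule ball_volume_ge_1[OF fJ(1) J0]) (use cJ2 in simp)
    then have "(1 / (sec_set_radius * real ?n)) ^ card J * 1 \<le> (1 / (sec_set_radius * real ?n)) ^ card J * (sqrt (real ?n) ^ card J * ball_vol J)"
      using sec_set_radius by (intro mult_left_mono) auto
    also have "\<dots> = (1 / (sec_set_radius * real ?n) * sqrt (real ?n)) ^ card J * ball_vol J" by (simp only: power_mult_distrib mult.assoc)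
    also have "1 / (sec_set_radius * real ?n) * sqrt (real ?n) = r"
    proof -
      have "1 / (sec_set_radius * (q * q)) * q = 1 / (sec_set_radius * q)" if "q \<noteq> 0" for q :: real
        using sec_set_radius that by (simp add: field_simps)
      from this[of "sqrt (real ?n)"] show ?thesis using n3 by (simp add: r_def)
    qed
    finally show ?thesis using A by simp
  qed
  \<comment> \<open>Over every point of the projection the rotated copy of \<open>D\<close> contains
    a full ball of radius \<rho> in the fibre, of volume at least 1; by Fubini the projection is no
    larger than \<open>D\<close>.\<close>
  have pU: "lvol J' ?p \<le> 540 ^ ?n"
  proof -
    define D2 where "D2 = {x \<in> vecs I. lin I I W x \<in> D}"
    have sW: "scales I (lin I I W) 1" by (rule scales_frame(1)[OF I W(1)])
    have D2m: "D2 \<in> sets (leb I)"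
    proof -
      have "lin I I W -` D \<inter> space (leb I) \<in> sets (leb I)" by (rule measurable_sets[OF lin_meas' D(1)])
      moreover have "lin I I W -` D \<inter> space (leb I) = D2" by (auto simp: D2_def)
      ultimately show ?thesis by simp
    qed
    have D2e: "emeasure (leb I) D2 \<le> ennreal (540 ^ ?n)"
      using De scales_emeasure[OF sW D(1)] by (simp add: D2_def)
    have "1 * emeasure (leb J') ?p \<le> emeasure (leb (J \<union> J')) D2"
    proof (rule emeasure_fold_lower[OF fJ JJ(1) _ body_sets[OF bp]])
      show "D2 \<in> sets (leb (J \<union> J'))" using D2m JJ by simp
      fix z assume "z \<in> ?p"
      then obtain q where q: "q \<in> K2" "z = restrict q J'" unfolding proj_set_def by blast
      have zv: "z \<in> vecs J'" by (simp add: q(2))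
      let ?B = "{y \<in> vecs J. comb J 1 y 1 (comb J (-1) q 0 q) \<in> cball J \<rho>}"
      have "?B \<subseteq> {y \<in> vecs J. glue J J' y z \<in> D2}"
      proof clarify
        fix y assume y: "y \<in> vecs J" "comb J 1 y 1 (comb J (-1) q 0 q) \<in> cball J \<rho>"
        have "comb I 1 (glue J J' y z) (-1) q = ext0 I J (comb J 1 y 1 (comb J (-1) q 0 q))"
          by (rule vecs_eqI[of _ I]) (use JJ in \<open>auto simp: ext0_def glue_def q(2)\<close>)
        then have "nrm I (comb I 1 (glue J J' y z) (-1) q) \<le> \<rho>"
          using y(2) nrm_ext0[OF I Jsub] by (simp add: cball_def)
        then have "nrm I (lin I I W (comb I 1 (glue J J' y z) (-1) q)) \<le> \<rho>"
          by (simp only: nrm_def frame_dot[OF I I W(1)])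
        then have "lin I I W (glue J J' y z) \<in> D"
          by (intro D(2)[OF K2D[OF q(1)]]) auto
        then show "glue J J' y z \<in> D2" using JJ(2) glue_in[of J J' y z] by (simp add: D2_def)
      qed
      then have le: "emeasure (leb J) ?B \<le> emeasure (leb J) {y \<in> vecs J. glue J J' y z \<in> D2}"
        by (rule emeasure_mono) (rule glue_sets[OF _ zv], use D2m JJ in simp)
      have "1 \<le> ennreal (\<rho> ^ card J * ball_vol J)"
        unfolding ennreal_1[symmetric]
        by (rule ennreal_leI, rule ball_volume_ge_1[OF fJ(1) J0]) (use cJ2 in \<open>simp add: \<rho>_def\<close>)
      also have "\<dots> = emeasure (leb J) ?B"
        by (subst emeasure_affine_vimage[OF fJ(1) _ cball_sets]) (auto simp: emeasure_cball[OF fJ(1) \<rho>])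
      also note le
      finally show "1 \<le> emeasure (leb J) {y \<in> vecs J. glue J J' y z \<in> D2}" .
    qed
    then have "emeasure (leb J') ?p \<le> ennreal (540 ^ ?n)" using D2e JJ by simp
    then show ?thesis by (simp add: body_emeasure[OF fJ(2) bp] ennreal_le_iff)
  qed
  have K2': "body (J \<union> J') K2" using K2 JJ by simp
  \<comment> \<open>Since the projection has volume at most 540^n, the section must carry almost all
    of the volume of \<open>K1\<close>; the constant is 2 * 540.\<close>
  have sU: "lvol I K1 \<le> 1080 ^ ?n * lvol J ?s"
  proof -
    have "lvol I K2 \<le> 2 ^ card J * lvol J ?s * lvol J' ?p" using sec_set_proj_set_upper[OF fJ JJ(1) K2'] JJ by simp
    also have "\<dots> \<le> 2 ^ ?n * lvol J ?s * 540 ^ ?n"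
      using pU cJ2 by (intro mult_mono power_increasing) auto
    also have "\<dots> = 1080 ^ ?n * lvol J ?s" by (simp add: power_mult_distrib[symmetric] mult_ac)
    finally show ?thesis by (simp add: v2)
  qed
  have prod: "vol_prod J ?s * vol_prod J' ?p \<le> 4 ^ ?n * vol_prod I K"
    using vol_prod_sec_set_proj_set[OF fJ JJ(1) K2'] JJ sv2 by simp
  show thesis
  proof (rule that[OF J' bp], intro exI[of _ "lvol I K1"] conjI)
    show w: "lvol I K1 > 0" by (rule body_lvol_pos[OF I K1(1)])
    have "real ?n ^ ?n * vol_prod I K = (real ?n ^ ?n * lvol I (polar_set I K1)) * lvol I K1"
      unfolding K1(2)[symmetric] by (simp add: vol_prod_def)
    also have "\<dots> \<le> (4 ^ ?n * lvol I K1) * lvol I K1" by (rule mult_right_mono[OF K1(3)]) simp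
    finally show "real ?n ^ ?n * vol_prod I K \<le> 4 ^ ?n * (lvol I K1)\<^sup>2" by (simp add: power2_eq_square)
    have np: "real ?n > 0" using n3 by simp
    have e4320: "(4320::real) ^ ?n = 4 ^ ?n * 1080 ^ ?n" by (simp only: power_mult_distrib[symmetric]) simp
    have svp: "vol_prod J' ?p \<ge> 0" using vol_prod_pos[OF fJ(2) bp] by simp
    have "lvol I K1 * (1 / (sec_set_radius * real ?n)) ^ card J \<le> (1080 ^ ?n * lvol J ?s) * lvol J (polar_set J ?s)"
      by (rule mult_mono[OF sU polS]) (use w sec_set_radius in auto)
    then have "lvol I K1 * (1 / (sec_set_radius * real ?n)) ^ card J * vol_prod J' ?p \<le> 1080 ^ ?n * (vol_prod J ?s * vol_prod J' ?p)"
      using svp by (auto simp: vol_prod_def mult.assoc[symmetric] intro!: mult_right_mono)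
    also have "\<dots> \<le> 1080 ^ ?n * (4 ^ ?n * vol_prod I K)" by (rule mult_left_mono[OF prod]) simp
    finally have A: "lvol I K1 * (1 / (sec_set_radius * real ?n)) ^ card J * vol_prod J' ?p \<le> 1080 ^ ?n * (4 ^ ?n * vol_prod I K)" .
    have "lvol I K1 * vol_prod J' ?p = (sec_set_radius * real ?n) ^ card J * (lvol I K1 * (1 / (sec_set_radius * real ?n)) ^ card J * vol_prod J' ?p)"
      using sec_set_radius np by (simp add: power_one_over field_simps)
    also have "\<dots> \<le> (sec_set_radius * real ?n) ^ card J * (1080 ^ ?n * (4 ^ ?n * vol_prod I K))"
      by (rule mult_left_mono[OF A]) (use sec_set_radius in simp)
    also have "\<dots> = sec_set_radius ^ card J * (real ?n ^ card J) * (1080 ^ ?n * (4 ^ ?n * vol_prod I K))" by (simp add: power_mult_distrib)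
    also have "\<dots> \<le> sec_set_radius ^ ?n * (real ?n ^ card J) * (1080 ^ ?n * (4 ^ ?n * vol_prod I K))"
      using sec_set_radius cJ2 vol_prod_pos[OF I K] by (intro mult_right_mono power_increasing) auto
    also have "real ?n ^ card J = real ?n ^ ?n / real ?n ^ card J'"
    proof -
      have "real ?n ^ ?n = real ?n ^ card J * real ?n ^ card J'" using cJ2(4) by (metis power_add)
      then show ?thesis using np by simp
    qed
    finally show "lvol I K1 * vol_prod J' ?p \<le> (4 * 1080 * sec_set_radius * real ?n) ^ ?n / real ?n ^ card J' * vol_prod I K"
      by (simp add: power_mult_distrib mult_ac e4320)
  qed
qed

text \<open>The largest |x i| on \<open>K\<close> is attained; with this R, the intervals of
  half-lengths R and 1 / R lie in \<open>K\<close> and in its polar.\<close>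

lemma vol_prod_card_1:
  assumes I: "card I = 1" and K: "body I K"
  shows "4 \<le> vol_prod I K"
proof -
  obtain i where i: "I = {i}" using I by (auto simp: card_1_singleton_iff)
  have fI: "finite I" using i by simp
  obtain r where r: "r > 0" "cube I r \<subseteq> K" using K by (rule body_cube)
  have "(\<lambda>i\<in>I. 0) \<in> cube I r" using r by (simp add: cube_iff)
  then have ne: "K \<noteq> {}" using r by auto
  have "continuous_on K (\<lambda>x. \<bar>x i\<bar>)" by (intro continuous_intros continuous_coord)
  from continuous_attains_sup[OF body_compact[OF K] ne this] obtain x0 where x0: "x0 \<in> K" "\<And>x. x \<in> K \<Longrightarrow> \<bar>x i\<bar> \<le> \<bar>x0 i\<bar>" by blast
  define R where "R = \<bar>x0 i\<bar>"
  have R: "R > 0"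
  proof -
    have "(\<lambda>j\<in>I. r) \<in> K" using r by (auto simp: subset_iff cube_iff)
    from x0(2)[OF this] show ?thesis using r i by (simp add: R_def)
  qed
  have "cube I R \<subseteq> K"
  proof
    fix x assume x: "x \<in> cube I R"
    have "comb I (x i / x0 i) x0 0 x0 \<in> K"
      by (rule body_comb[OF K x0(1) x0(1)]) (use x R i in \<open>auto simp: cube_iff R_def\<close>)
    also have "comb I (x i / x0 i) x0 0 x0 = x"
      using x R i by (intro vecs_eqI[of _ I]) (auto simp: cube_iff R_def)
    finally show "x \<in> K" .
  qed
  then have "emeasure (leb I) (cube I R) \<le> emeasure (leb I) K" by (rule emeasure_mono[OF _ body_sets[OF K]])
  then have 1: "2 * R \<le> lvol I K" using R fI I by (simp add: emeasure_cube body_emeasure[OF fI K] ennreal_le_iff)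
  have bp: "body I (polar_set I K)" by (rule body_polar_set[OF fI K])
  have "cube I (1 / R) \<subseteq> polar_set I K"
  proof
    fix y assume y: "y \<in> cube I (1 / R)"
    have "dot I x y \<le> 1" if x: "x \<in> K" for x
    proof -
      have "dot I x y \<le> \<bar>x i\<bar> * \<bar>y i\<bar>" using abs_ge_self[of "x i * y i"] by (simp add: dot_def i abs_mult)
      also have "\<dots> \<le> R * (1 / R)" using x0(2)[OF x] y i R by (intro mult_mono) (auto simp: R_def cube_iff)
      finally show ?thesis using R by simp
    qed
    then show "y \<in> polar_set I K" using y by (simp add: polar_set_def cube_iff)
  qed
  then have "emeasure (leb I) (cube I (1 / R)) \<le> emeasure (leb I) (polar_set I K)" by (rule emeasure_mono[OF _ body_sets[OF bp]])
  then have 2: "2 * (1 / R) \<le> lvol I (polar_set I K)"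
    using R fI I by (simp add: emeasure_cube body_emeasure[OF fI bp] ennreal_le_iff)
  have "2 * R * (2 * (1 / R)) \<le> vol_prod I K" unfolding vol_prod_def by (rule mult_mono[OF 1 2]) (use R in auto)
  then show ?thesis using R by simp
qed

text \<open>A base case of its own, since n div 3 would be 0. A section and a projection of
  dimension 1 give 4 * 4 against the factor 4^2.\<close>

lemma vol_prod_card_2:
  assumes I: "card I = 2" and K: "body I K"
  shows "1 \<le> vol_prod I K"
proof -
  obtain i j where ij: "I = {i, j}" "i \<noteq> j" using I by (auto simp: card_2_iff)
  have eq: "{i} \<union> {j} = I" using ij by auto
  have K': "body ({i} \<union> {j}) K" using K eq by simp
  have fI: "finite I" using ij by simp
  have "vol_prod {i} (sec_set I {i} K) * vol_prod {j} (proj_set {j} K) \<le> 4 ^ 2 * vol_prod I K"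
    using vol_prod_sec_set_proj_set[of "{i}" "{j}" K] K' ij eq I by simp
  moreover have "4 \<le> vol_prod {i} (sec_set I {i} K)"
    by (rule vol_prod_card_1[OF _ body_sec_set[OF fI _ K]]) (use ij in auto)
  moreover have "4 \<le> vol_prod {j} (proj_set {j} K)"
    by (rule vol_prod_card_1[OF _ body_proj_set[OF fI _ K]]) (use ij in auto)
  ultimately have "4 * 4 \<le> 4 ^ 2 * vol_prod I K"
    using mult_mono[of 4 "vol_prod {i} (sec_set I {i} K)" 4 "vol_prod {j} (proj_set {j} K)"] by linarith
  then show ?thesis by simp
qed

text \<open>With G = 4320 * \<open>sec_set_radius\<close>, where 4320 = 4 * 1080 is the constant of
  \<open>reduction_step\<close>, this solves \<open>bm_base * (4 * G^2) = 1\<close>, the equation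
  that closes the induction.\<close>

definition bm_base :: real where
  "bm_base = 1 / (4 * (4320 * sec_set_radius)\<^sup>2)"

lemma bm_base: "0 < bm_base" "bm_base \<le> 1"
  by (simp_all add: bm_base_def sec_set_radius_def)

text \<open>Write \<sigma> for n^n times the volume product and k for the smaller dimension.
  \<open>reduction_step\<close> and the induction hypothesis give w bm_base^(3 k) <= G^n \<sigma>
  and \<sigma> <= 4^n w^2. Eliminating w leaves bm_base^(6 k) <= (4 G^2)^n \<sigma>, and k <= n / 3
  makes the exponent 3 self-reproducing.\<close>

theorem bourgain_milman:
  assumes "finite I" "I \<noteq> {}" "body I K"
  shows "(bm_base ^ 3) ^ card I \<le> real (card I) ^ card I * vol_prod I K"
  using assms
proof (induction "card I" arbitrary: I K rule: less_induct)
  case less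
  let ?n = "card I"
  note I = less.prems(1,2) and K = less.prems(3)
  have n: "?n > 0" using I by (simp add: card_gt_0_iff)
  have b1: "(bm_base ^ 3) ^ m \<le> 1" for m using bm_base by (simp add: power_le_one)
  consider "?n = 1" | "?n = 2" | "?n \<ge> 3" using n by linarith
  then show ?case
  proof cases
    case 1
    then show ?thesis using vol_prod_card_1[OF 1 K] b1[of 1] by simp
  next
    case 2
    then show ?thesis using vol_prod_card_2[OF 2 K] b1[of 2] by simp
  next
    case 3
    obtain J K' where J: "J \<subseteq> I" "card J = ?n div 3" "body J K'"
      "\<exists>w>0. real ?n ^ ?n * vol_prod I K \<le> 4 ^ ?n * w\<^sup>2 \<and>
        w * vol_prod J K' \<le> (4 * 1080 * sec_set_radius * real ?n) ^ ?n / real ?n ^ card J * vol_prod I K"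
      by (rule reduction_step[OF I(1) 3 K])
    then obtain w where w: "w > 0" "real ?n ^ ?n * vol_prod I K \<le> 4 ^ ?n * w\<^sup>2"
      "w * vol_prod J K' \<le> (4 * 1080 * sec_set_radius * real ?n) ^ ?n / real ?n ^ card J * vol_prod I K" by blast
    let ?k = "card J"
    have k: "?k < ?n" "?k > 0" "?n + 6 * ?k \<le> 3 * ?n" using J(2) 3 by auto
    have fJ: "finite J" "J \<noteq> {}" using J(1) I(1) k finite_subset by auto
    have IH: "(bm_base ^ 3) ^ ?k \<le> real ?k ^ ?k * vol_prod J K'"
      by (rule less.hyps[OF k(1) fJ J(3)])
    define \<sigma> where "\<sigma> = real ?n ^ ?n * vol_prod I K"
    have \<sigma>: "\<sigma> > 0" using vol_prod_pos[OF I(1) K] n by (simp add: \<sigma>_def)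
    define G where "G = 4320 * sec_set_radius"
    have G: "G > 0" by (simp add: G_def sec_set_radius_def)
    have svJ: "vol_prod J K' > 0" by (rule vol_prod_pos[OF fJ(1) J(3)])
    have "(bm_base ^ 3) ^ ?k \<le> real ?n ^ ?k * vol_prod J K'"
      using IH svJ k by (elim order_trans) (intro mult_right_mono power_mono, auto)
    then have "w * (bm_base ^ 3) ^ ?k \<le> w * (real ?n ^ ?k * vol_prod J K')" using w by simp
    also have "\<dots> = real ?n ^ ?k * (w * vol_prod J K')" by simp
    also have "\<dots> \<le> real ?n ^ ?k * ((4 * 1080 * sec_set_radius * real ?n) ^ ?n / real ?n ^ ?k * vol_prod I K)"
      by (rule mult_left_mono[OF w(3)]) simp
    also have "\<dots> = G ^ ?n * \<sigma>" using n by (simp add: \<sigma>_def G_def power_mult_distrib)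
    finally have A: "w * (bm_base ^ 3) ^ ?k \<le> G ^ ?n * \<sigma>" .
    have "(w * (bm_base ^ 3) ^ ?k)\<^sup>2 \<le> (G ^ ?n * \<sigma>)\<^sup>2"
      by (rule power_mono[OF A]) (use w bm_base in simp)
    then have B: "w\<^sup>2 * ((bm_base ^ 3) ^ ?k)\<^sup>2 \<le> (G ^ ?n)\<^sup>2 * \<sigma>\<^sup>2" by (simp add: power_mult_distrib)
    \<comment> \<open>Combined with the squared inequality this eliminates w; the right side then
      carries \<sigma> squared, and one power cancels.\<close>
    have "\<sigma> * ((bm_base ^ 3) ^ ?k)\<^sup>2 \<le> 4 ^ ?n * w\<^sup>2 * ((bm_base ^ 3) ^ ?k)\<^sup>2"
      using w(2) by (intro mult_right_mono) (auto simp: \<sigma>_def)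
    also have "\<dots> = 4 ^ ?n * (w\<^sup>2 * ((bm_base ^ 3) ^ ?k)\<^sup>2)" by simp
    also have "\<dots> \<le> 4 ^ ?n * ((G ^ ?n)\<^sup>2 * \<sigma>\<^sup>2)" by (rule mult_left_mono[OF B]) simp
    also have "\<dots> = \<sigma> * ((4 * G\<^sup>2) ^ ?n * \<sigma>)"
    proof -
      have "(G ^ ?n)\<^sup>2 = (G\<^sup>2) ^ ?n" by (simp add: power_mult[symmetric] mult.commute)
      then show ?thesis by (simp add: power_mult_distrib power2_eq_square mult_ac)
    qed
    finally have C: "((bm_base ^ 3) ^ ?k)\<^sup>2 \<le> (4 * G\<^sup>2) ^ ?n * \<sigma>" using \<sigma> by simp
    have bG: "bm_base * (4 * G\<^sup>2) = 1" using G by (simp add: bm_base_def G_def[symmetric])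
    \<comment> \<open>The exponents compare as n + 6 k <= 3 n, in the right direction because
      \<open>bm_base\<close> is at most 1.\<close>
    have "(bm_base ^ 3) ^ ?n \<le> bm_base ^ ?n * ((bm_base ^ 3) ^ ?k)\<^sup>2"
    proof -
      have "(bm_base ^ 3) ^ ?n = bm_base ^ (3 * ?n)" by (simp add: power_mult)
      also have "\<dots> \<le> bm_base ^ (?n + 6 * ?k)" using bm_base k(3) by (intro power_decreasing) auto
      also have "\<dots> = bm_base ^ ?n * ((bm_base ^ 3) ^ ?k)\<^sup>2"
        by (simp add: power_add power_mult[symmetric] mult_ac)
      finally show ?thesis .
    qed
    also have "\<dots> \<le> bm_base ^ ?n * ((4 * G\<^sup>2) ^ ?n * \<sigma>)" by (rule mult_left_mono[OF C]) (use bm_base in simp)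
    also have "\<dots> = (bm_base * (4 * G\<^sup>2)) ^ ?n * \<sigma>" by (simp only: power_mult_distrib mult.assoc)
    also have "\<dots> = \<sigma>" by (simp add: bG)
    finally show ?thesis by (simp add: \<sigma>_def)
  qed
qed

text \<open>With m and k the two dimensions and n = m + k, the product of balls of radii a = sqrt
  (m/n) and b = sqrt (k/n) lies in the unit ball. The loss a^m is at least 2^(-k), as (n/m)^m <= exp
  k, and is regained from the 2^k in the lower bound for the k-dimensional ball.\<close>

lemma ball_vol_split:
  assumes J: "finite J" "finite J'" "J \<inter> J' = {}" "J \<noteq> {}" "J' \<noteq> {}"
  shows "ball_vol J \<le> sqrt (real (card (J \<union> J'))) ^ card J' * ball_vol (J \<union> J')"
proof -
  let ?I = "J \<union> J'" and ?m = "card J" and ?k = "card J'"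
  define n where "n = real (card ?I)"
  have nmk: "n = real ?m + real ?k" using J by (simp add: n_def card_Un_disjoint)
  have m: "?m > 0" and k: "?k > 0" using J by (simp_all add: card_gt_0_iff)
  have n: "n > 0" using nmk m by simp
  define a where "a = sqrt (real ?m / n)"
  define b where "b = sqrt (real ?k / n)"
  have a: "a > 0" and b: "b > 0" using m k n by (simp_all add: a_def b_def)
  have ab: "a\<^sup>2 + b\<^sup>2 = 1" using n by (simp add: a_def b_def add_divide_distrib[symmetric] nmk[symmetric])
  have "ennreal (a ^ ?m * ball_vol J) * emeasure (leb J') (cball J' b) \<le> emeasure (leb ?I) (cball ?I 1)"
  proof (rule emeasure_fold_lower[OF J(1-3)])
    fix z assume z: "z \<in> cball J' b"
    have "cball J a \<subseteq> {y \<in> vecs J. glue J J' y z \<in> cball ?I 1}"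
    proof clarify
      fix y assume y: "y \<in> cball J a"
      have "dot ?I (glue J J' y z) (glue J J' y z) = dot J (glue J J' y z) (glue J J' y z) + dot J' (glue J J' y z) (glue J J' y z)"
        unfolding dot_def by (rule sum.union_disjoint[OF J(1-3)])
      also have "dot J (glue J J' y z) (glue J J' y z) = dot J y y" by (rule dot_cong) (auto simp: glue_def)
      also have "dot J' (glue J J' y z) (glue J J' y z) = dot J' z z" by (rule dot_cong) (use J(3) in \<open>auto simp: glue_def\<close>)
      also have "dot J y y + dot J' z z \<le> a\<^sup>2 + b\<^sup>2"
      proof -
        have "(nrm J y)\<^sup>2 \<le> a\<^sup>2" "(nrm J' z)\<^sup>2 \<le> b\<^sup>2" using y z by (auto simp: cball_def intro!: power_mono)
        then show ?thesis by (simp add: nrm_sq)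
      qed
      finally have "nrm ?I (glue J J' y z) \<le> 1" by (simp add: ab nrm_def)
      then show "y \<in> vecs J \<and> glue J J' y z \<in> cball ?I 1" using y glue_in[of J J' y z] by (simp add: cball_def)
    qed
    then have "emeasure (leb J) (cball J a) \<le> emeasure (leb J) {y \<in> vecs J. glue J J' y z \<in> cball ?I 1}"
      by (rule emeasure_mono[OF _ glue_sets[OF cball_sets]]) (use z in \<open>simp add: cball_def\<close>)
    then show "ennreal (a ^ ?m * ball_vol J) \<le> emeasure (leb J) {y \<in> vecs J. glue J J' y z \<in> cball ?I 1}"
      by (simp add: emeasure_cball[OF J(1) a])
  qed auto
  then have A: "(a ^ ?m * ball_vol J) * (b ^ ?k * ball_vol J') \<le> ball_vol ?I"
    using J a b by (simp add: emeasure_cball[OF J(2) b] emeasure_cball_1 ennreal_mult'[symmetric] ennreal_le_iff)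
  have "2 ^ ?k \<le> sqrt (real ?k) ^ ?k * ball_vol J'" by (rule ball_vol_lower[OF J(2,5)])
  also have "sqrt (real ?k) ^ ?k = sqrt n ^ ?k * b ^ ?k"
    using n by (simp add: b_def real_sqrt_divide power_divide)
  finally have B: "2 ^ ?k \<le> sqrt n ^ ?k * (b ^ ?k * ball_vol J')" by (simp add: mult_ac)
  have C: "1 \<le> 2 ^ ?k * a ^ ?m"
  proof -
    have "(n / real ?m) ^ ?m \<le> exp (real ?k)"
    proof -
      have "n / real ?m = 1 + real ?k / real ?m" using m by (simp add: nmk field_simps)
      also have "\<dots> \<le> exp (real ?k / real ?m)" by (rule exp_ge_add_one_self)
      finally have "(n / real ?m) ^ ?m \<le> exp (real ?k / real ?m) ^ ?m" by (rule power_mono) (use n in simp)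
      also have "\<dots> = exp (real ?k)" using m by (simp add: exp_of_nat_mult[symmetric])
      finally show ?thesis .
    qed
    also have "exp (real ?k) = exp 1 ^ ?k" by (simp add: exp_of_nat_mult[symmetric])
    also have "\<dots> \<le> 4 ^ ?k" using exp_le by (intro power_mono) auto
    finally have "(n / real ?m) ^ ?m \<le> 4 ^ ?k" .
    moreover have "(a\<^sup>2) ^ ?m * (n / real ?m) ^ ?m = 1"
      using m n by (simp add: a_def power_mult_distrib[symmetric])
    ultimately have "1 \<le> (a\<^sup>2) ^ ?m * 4 ^ ?k"
      using mult_left_mono[of "(n / real ?m) ^ ?m" "4 ^ ?k" "(a\<^sup>2) ^ ?m"] by simp
    also have "(a\<^sup>2) ^ ?m * 4 ^ ?k = (2 ^ ?k * a ^ ?m)\<^sup>2"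
    proof -
      have "(4::real) ^ ?k = (2 ^ ?k)\<^sup>2" by (simp add: power2_eq_square power_mult_distrib[symmetric])
      moreover have "(a\<^sup>2) ^ ?m = (a ^ ?m)\<^sup>2" by (simp add: power_mult[symmetric] mult.commute)
      ultimately show ?thesis by (simp add: power_mult_distrib)
    qed
    finally have "1\<^sup>2 \<le> (2 ^ ?k * a ^ ?m)\<^sup>2" by simp
    then show ?thesis by (rule power2_le_imp_le) (use a in simp)
  qed
  have "ball_vol J * 1 \<le> ball_vol J * (2 ^ ?k * a ^ ?m)" by (rule mult_left_mono[OF C]) simp
  also have "\<dots> = (a ^ ?m * ball_vol J) * 2 ^ ?k" by simp
  also have "\<dots> \<le> (a ^ ?m * ball_vol J) * (sqrt n ^ ?k * (b ^ ?k * ball_vol J'))"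
    by (rule mult_left_mono[OF B]) (use a in simp)
  also have "\<dots> = sqrt n ^ ?k * ((a ^ ?m * ball_vol J) * (b ^ ?k * ball_vol J'))" by simp
  also have "\<dots> \<le> sqrt n ^ ?k * ball_vol ?I" by (rule mult_left_mono[OF A]) (use n in simp)
  finally show ?thesis by (simp add: n_def)
qed

text \<open>This says that c_{n,k} is at least 5^(-k): divide \<open>ball_vol_split\<close> by the
  power k/n of the volume of the large ball, which is at most (5 / sqrt n)^k.\<close>

lemma ball_vol_ratio:
  assumes J: "finite J" "finite J'" "J \<inter> J' = {}" "J \<noteq> {}" "J' \<noteq> {}"
  shows "(1 / 5) ^ card J' * ball_vol J \<le> ball_vol (J \<union> J') powr (real (card J) / real (card (J \<union> J')))"
proof -
  let ?I = "J \<union> J'" and ?k = "card J'"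
  let ?n = "card ?I"
  have I: "finite ?I" "?I \<noteq> {}" using J by auto
  have n: "?n > 0" using I by (simp add: card_gt_0_iff)
  have nmk: "?n = card J + ?k" using J by (simp add: card_Un_disjoint)
  have v: "ball_vol ?I > 0" by (rule ball_vol_pos[OF I])
  define s where "s = sqrt (real ?n)"
  have s: "s > 0" using n by (simp add: s_def)
  have "ball_vol ?I \<le> (5 / s) ^ ?n"
    using ball_vol_upper[OF I] s by (simp add: s_def[symmetric] power_divide field_simps)
  then have "ball_vol ?I powr (real ?k / real ?n) \<le> ((5 / s) ^ ?n) powr (real ?k / real ?n)"
    using v by (intro powr_mono2) auto
  also have "\<dots> = (5 / s) ^ ?k"
    using s n by (simp add: powr_realpow[symmetric] powr_powr)
  finally have A: "ball_vol ?I powr (real ?k / real ?n) \<le> (5 / s) ^ ?k" .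
  have e: "ball_vol ?I = ball_vol ?I powr (real (card J) / real ?n) * ball_vol ?I powr (real ?k / real ?n)"
  proof -
    have "real ?n = real (card J) + real ?k" unfolding nmk by simp
    then have "real (card J) / real ?n + real ?k / real ?n = 1" using n by (metis add_divide_distrib divide_self of_nat_0_less_iff order_less_irrefl)
    then show ?thesis using v by (simp add: powr_add[symmetric])
  qed
  have "ball_vol J \<le> s ^ ?k * ball_vol ?I" unfolding s_def by (rule ball_vol_split[OF J])
  also have "\<dots> = s ^ ?k * (ball_vol ?I powr (real (card J) / real ?n) * ball_vol ?I powr (real ?k / real ?n))"
    using e by simp
  also have "\<dots> \<le> s ^ ?k * (ball_vol ?I powr (real (card J) / real ?n) * (5 / s) ^ ?k)"
    using s by (intro mult_left_mono A) auto
  also have "\<dots> = 5 ^ ?k * ball_vol ?I powr (real (card J) / real ?n)" using s by (simp add: power_divide)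
  finally show ?thesis by (simp add: power_one_over field_simps)
qed

section \<open>The slicing inequality\<close>

lemma Rn_eq: "Rn n = vecs {..<n}" by (simp add: Rn_def)
lemma lebn_eq: "lebn n = leb {..<n}" by (simp add: lebn_def leb_def)
lemma ip_eq: "ip n x y = dot {..<n} x y" by (simp add: ip_def dot_def)
lemma polar_eq: "polar n L = polar_set {..<n} L" by (simp add: polar_def polar_set_def Rn_eq ip_eq)

lemma vol_unit_ball: "vol n (unit_ball n) = ball_vol {..<n}"
proof -
  have "unit_ball n = cball {..<n} 1"
    by (auto simp: unit_ball_def cball_def Rn_eq ip_eq nrm_def)
  then show ?thesis by (simp add: vol_def lebn_eq ball_vol_def)
qed

text \<open>The given interior ball may be centred anywhere. For small z the points x + z and x - z
  are in \<open>L\<close>, hence so is z - x by symmetry, and z is the midpoint of x + z and z -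
  x.\<close>

lemma body_of_convex_body:
  assumes L: "convex_body n L" "origin_symmetric n L" and n: "n > 0"
  shows "body {..<n} L"
proof -
  let ?I = "{..<n}"
  have sub: "L \<subseteq> vecs ?I" and cpt: "compact L" using L by (auto simp: convex_body_def Rn_eq)
  have cv: "comb ?I u x (1 - u) y \<in> L" if "x \<in> L" "y \<in> L" "0 \<le> u" "u \<le> 1" for x y u
    using L that unfolding convex_body_def comb_def by blast
  have sym: "comb ?I (-1) x 0 x \<in> L" if "x \<in> L" for x
  proof -
    have "negn n x \<in> L" using L that by (auto simp: origin_symmetric_def)
    moreover have "negn n x = comb ?I (-1) x 0 x" by (simp add: negn_def comb_def)
    ultimately show ?thesis by simp
  qed
  obtain x r where x: "x \<in> L" "r > 0" "{y \<in> Rn n. ip n (\<lambda>i. y i - x i) (\<lambda>i. y i - x i) < r\<^sup>2} \<subseteq> L"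
    using L(1) by (auto simp: convex_body_def)
  define q where "q = r / (2 * sqrt (real n))"
  have q: "q > 0" using x n by (simp add: q_def)
  have "cube ?I q \<subseteq> L"
  proof
    fix z assume z: "z \<in> cube ?I q"
    have "nrm ?I z \<le> sqrt (real n) * q"
      using cube_subset_cball[of ?I q] z q by (auto simp: cball_def)
    also have "\<dots> < r" using x(2) n by (simp add: q_def)
    finally have "(nrm ?I z)\<^sup>2 < r\<^sup>2" by (intro power_strict_mono) auto
    then have zz: "dot ?I z z < r\<^sup>2" by (simp add: nrm_sq)
    have in1: "comb ?I 1 x c z \<in> L" if c: "c = 1 \<or> c = -1" for c
    proof -
      have "ip n (\<lambda>i. comb ?I 1 x c z i - x i) (\<lambda>i. comb ?I 1 x c z i - x i) = dot ?I z z"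
        unfolding ip_eq dot_def by (rule sum.cong) (use c in auto)
      then have "comb ?I 1 x c z \<in> {y \<in> Rn n. ip n (\<lambda>i. y i - x i) (\<lambda>i. y i - x i) < r\<^sup>2}"
        using zz by (simp add: Rn_eq)
      then show ?thesis using x(3) by blast
    qed
    have "comb ?I (1/2) (comb ?I 1 x 1 z) (1 - 1/2) (comb ?I (-1) (comb ?I 1 x (-1) z) 0 (comb ?I 1 x (-1) z)) \<in> L"
      by (rule cv[OF in1 sym[OF in1]]) auto
    also have "comb ?I (1/2) (comb ?I 1 x 1 z) (1 - 1/2) (comb ?I (-1) (comb ?I 1 x (-1) z) 0 (comb ?I 1 x (-1) z)) = z"
      using z by (intro vecs_eqI[of _ ?I]) (auto simp: cube_iff field_simps)
    finally show "z \<in> L" .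
  qed
  then show ?thesis unfolding body_def using sub cpt cv sym q by blast
qed

text \<open>In \<open>frames\<close> the first index selects the vector, in \<open>frame\<close> the
  coordinate, so the two encodings differ by a transposition.\<close>

lemma frames_frame:
  assumes "frame {..<n} {..<m} U"
  shows "(\<lambda>j. restrict (\<lambda>i. U i j) {..<n}) \<in> frames n m"
    and "frame_map n m (\<lambda>j. restrict (\<lambda>i. U i j) {..<n}) t = lin {..<n} {..<m} U t"
proof -
  show "(\<lambda>j. restrict (\<lambda>i. U i j) {..<n}) \<in> frames n m"
    using assms by (auto simp: frames_def Rn_def ip_def frame_def)
  show "frame_map n m (\<lambda>j. restrict (\<lambda>i. U i j) {..<n}) t = lin {..<n} {..<m} U t"
    by (auto simp: frame_map_def lin_def fun_eq_iff mult.commute intro!: sum.cong)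
qed

lemma frames_imp_frame:
  assumes "U \<in> frames n m"
  shows "frame {..<n} {..<m} (transp U)" "frame_map n m U t = lin {..<n} {..<m} (transp U) t"
  using assms by (auto simp: frames_def frame_def transp_def ip_def frame_map_def lin_def fun_eq_iff mult.commute)

text \<open>\<open>E\<close> is a plus the image of the unit ball under \<open>N\<close>. The centre
  disappears by symmetry of \<open>L\<close>: averaging the polar inequality for (x, a + N z) and
  (-x, a - N z) leaves <x, N z> <= 1 for every unit vector z of the form needed. So the transpose of
  \<open>M\<close> maps the unit ball onto a centred ellipsoid around \<open>L\<close>.\<close>

lemma ellipsoid_bound:
  assumes n: "n > 0" and L: "body {..<n} L" and E: "ellipsoid n E" "E \<subseteq> polar_set {..<n} L"
  obtains M N d where "vol_mat {..<n} M N d" "lvol {..<n} E = ball_vol {..<n} / d"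
    "\<And>x. x \<in> L \<Longrightarrow> nrm {..<n} (lin {..<n} {..<n} (transp N) x) \<le> 1"
proof -
  let ?I = "{..<n}"
  obtain a A where a: "a \<in> vecs ?I" and sym: "\<And>i j. i < n \<Longrightarrow> j < n \<Longrightarrow> A i j = A j i"
    and pos: "\<And>v. v \<in> vecs ?I \<Longrightarrow> v \<noteq> (\<lambda>i\<in>?I. 0) \<Longrightarrow> 0 < quad_form ?I A v"
    and E_eq: "E = {x \<in> vecs ?I. quad_form ?I A (\<lambda>i. x i - a i) \<le> 1}"
    using E(1) unfolding ellipsoid_def Rn_eq quad_form_def by blast
  have "0 < quad_form ?I A v" if "v \<in> vecs ?I" "\<exists>j\<in>?I. v j \<noteq> 0" for v
    using pos[OF that(1)] that(2) by force
  then obtain M N d where g: "vol_mat ?I M N d" and q: "\<And>x. quad_form ?I A x = dot ?I (lin ?I ?I M x) (lin ?I ?I M x)"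
    using cholesky[of ?I A] sym by (metis finite_lessThan lessThan_iff)
  have inv: "inv_mat ?I M N" and sc: "scales ?I (lin ?I ?I M) d" using g by (auto simp: vol_mat_def)
  have d: "d > 0" by (rule scales_pos[OF sc])
  have E2: "E = {x \<in> vecs ?I. lin ?I ?I M (comb ?I 1 x 1 (comb ?I (-1) a 0 a)) \<in> cball ?I 1}"
  proof -
    have "quad_form ?I A (\<lambda>i. x i - a i) \<le> 1 \<longleftrightarrow> lin ?I ?I M (comb ?I 1 x 1 (comb ?I (-1) a 0 a)) \<in> cball ?I 1" for x
    proof -
      have "lin ?I ?I M (\<lambda>i. x i - a i) = lin ?I ?I M (comb ?I 1 x 1 (comb ?I (-1) a 0 a))"
        by (rule lin_cong) auto
      then show ?thesis unfolding q cball_def by (simp del: lin_comb add: nrm_def)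
    qed
    then show ?thesis unfolding E_eq by blast
  qed
  show thesis
  proof (rule that[OF g])
    have tr1: "scales ?I (\<lambda>x. comb ?I 1 x 1 (comb ?I (-1) a 0 a)) 1"
      using scales_affine[of ?I 1 "comb ?I (-1) a 0 a"] by simp
    have "emeasure (leb ?I) (cball ?I 1) = ennreal (d * 1) * emeasure (leb ?I) E"
      unfolding E2 by (rule scales_emeasure[OF scales_comp[OF sc tr1] cball_sets])
    then have "ennreal (1 / d) * ennreal (ball_vol ?I) = (ennreal (1 / d) * ennreal d) * emeasure (leb ?I) E"
      by (simp add: emeasure_cball_1 mult.assoc)
    also have "ennreal (1 / d) * ennreal d = 1" using d by (simp add: ennreal_mult'[symmetric])
    finally have "emeasure (leb ?I) E = ennreal (ball_vol ?I / d)"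
      using d by (simp add: ennreal_mult'[symmetric])
    then show "lvol ?I E = ball_vol ?I / d" using d by (simp add: measure_def)
    fix x assume x: "x \<in> L"
    define w where "w = lin ?I ?I (transp N) x"
    show "nrm ?I (lin ?I ?I (transp N) x) \<le> 1"
    proof (cases "nrm ?I w = 0")
      case False
      then have wp: "nrm ?I w > 0" using nrm_nonneg[of ?I w] by linarith
      have key: "dot ?I x (comb ?I 1 a c (lin ?I ?I N (comb ?I (1 / nrm ?I w) w 0 w))) \<le> 1 \<and>
         dot ?I (comb ?I (-1) x 0 x) (comb ?I 1 a c (lin ?I ?I N (comb ?I (1 / nrm ?I w) w 0 w))) \<le> 1" if c: "c = 1 \<or> c = -1" for c
      proof -
        let ?z = "comb ?I (1 / nrm ?I w) w 0 w"
        let ?y = "comb ?I 1 a c (lin ?I ?I N ?z)"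
        have "comb ?I 1 ?y 1 (comb ?I (-1) a 0 a) = lin ?I ?I N (comb ?I c ?z 0 ?z)"
          unfolding lin_comb[of ?I ?I N c ?z] by (rule vecs_eqI[of _ ?I]) auto
        then have "lin ?I ?I M (comb ?I 1 ?y 1 (comb ?I (-1) a 0 a)) = comb ?I c ?z 0 ?z"
          using inv by (simp add: inv_mat_def del: lin_comb)
        moreover have "nrm ?I (comb ?I c ?z 0 ?z) \<le> 1" using wp c by (auto simp: nrm_scale)
        ultimately have "?y \<in> E" unfolding E2 by (simp add: cball_def del: lin_comb)
        then have "?y \<in> polar_set ?I L" using E(2) by blast
        then show ?thesis using x body_neg[OF L x] unfolding polar_set_def by blast
      qed
      let ?z = "comb ?I (1 / nrm ?I w) w 0 w"
      have "dot ?I x (comb ?I 1 a 1 (lin ?I ?I N ?z)) \<le> 1" using key[of 1] by blast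
      moreover have "dot ?I (comb ?I (-1) x 0 x) (comb ?I 1 a (-1) (lin ?I ?I N ?z)) \<le> 1" using key[of "-1"] by blast
      ultimately have "dot ?I x (lin ?I ?I N ?z) \<le> 1" by (simp del: lin_comb)
      also have "dot ?I x (lin ?I ?I N ?z) = dot ?I w ?z"
        unfolding w_def by (simp only: dot_lin[OF finite_lessThan finite_lessThan] transp_transp)
      also have "dot ?I w ?z = nrm ?I w"
        using wp by (simp add: nrm_sq[symmetric] power2_eq_square)
      finally show ?thesis by (simp add: w_def)
    qed (simp add: w_def)
  qed
qed

text \<open>A small Euclidean ball. It makes the set in the definition of
  \<open>volume_ratio\<close> nonempty, without which its \<open>Inf\<close> would carry no
  information.\<close>

lemma ellipsoid_inside_body:
  assumes n: "n > 0" and K: "body {..<n} K"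
  shows "\<exists>E. ellipsoid n E \<and> E \<subseteq> K"
proof -
  let ?I = "{..<n}"
  obtain r where r: "r > 0" "cube ?I r \<subseteq> K" using K by (rule body_cube)
  define A where "A = (\<lambda>i j::nat. if i = j then 1 / r\<^sup>2 else 0)"
  have q: "(\<Sum>i<n. \<Sum>j<n. A i j * v i * v j) = dot ?I v v / r\<^sup>2" for v
  proof -
    have "(\<Sum>j<n. A i j * v i * v j) = v i * v i / r\<^sup>2" if "i < n" for i
    proof -
      have "(\<Sum>j<n. A i j * v i * v j) = (\<Sum>j<n. if j = i then v i * v i / r\<^sup>2 else 0)"
        by (rule sum.cong) (auto simp: A_def)
      then show ?thesis using that by simp
    qed
    then show ?thesis by (simp add: dot_def sum_divide_distrib)
  qed
  define E where "E = {x \<in> Rn n. (\<Sum>i<n. \<Sum>j<n. A i j * (x i - 0) * (x j - 0)) \<le> 1}"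
  have "ellipsoid n E"
    unfolding ellipsoid_def
  proof (intro bexI[of _ "\<lambda>i\<in>?I. 0"] exI[of _ A] conjI ballI allI impI)
    show "A i j = A j i" for i j by (simp add: A_def)
    show "0 < (\<Sum>i<n. \<Sum>j<n. A i j * v i * v j)" if v: "v \<in> Rn n" "v \<noteq> (\<lambda>i\<in>?I. 0)" for v
    proof -
      have "\<exists>i\<in>?I. v i \<noteq> 0"
      proof (rule ccontr)
        assume "\<not> ?thesis"
        then have "v = (\<lambda>i\<in>?I. 0)" using v(1) by (intro vecs_eqI[of _ ?I]) (auto simp: Rn_eq)
        then show False using v by simp
      qed
      then have "nrm ?I v \<noteq> 0" by (simp add: nrm_eq_0)
      then have "dot ?I v v > 0" using dot_self_nonneg[of ?I v] by (auto simp: nrm_def less_le)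
      then show ?thesis using r by (simp add: q)
    qed
    show "E = {x \<in> Rn n. (\<Sum>i<n. \<Sum>j<n. A i j * (x i - (\<lambda>i\<in>?I. 0) i) * (x j - (\<lambda>i\<in>?I. 0) j)) \<le> 1}"
      by (simp add: E_def)
  qed (simp add: Rn_def)
  moreover have "E \<subseteq> cube ?I r"
  proof
    fix x assume x: "x \<in> E"
    then have "dot ?I x x \<le> r\<^sup>2" using q[of x] r by (simp add: E_def)
    then have "nrm ?I x \<le> r" using r unfolding nrm_def by (metis less_eq_real_def real_sqrt_le_iff real_sqrt_unique)
    then have "x \<in> cball ?I r" using x by (simp add: cball_def E_def Rn_eq)
    then show "x \<in> cube ?I r" using cball_subset_cube[of ?I r] by blast
  qed
  ultimately show ?thesis using r by blast
qed

text \<open>The ellipsoid around \<open>L\<close> has volume d |B| = |B|^2 / |E|. The upper bound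
  25^n / n^n for |B|^2 and the lower bound for the volume product cancel their powers of n, which
  leaves (25 / c)^n |L| |polar L| / |E|. The power k/n then gives the claim, with 125 = 5 * 25 and
  the 5 from \<open>slice_upper\<close>.\<close>

lemma section_bound:
  assumes m: "0 < m" "m < n" and L: "body {..<n} L" and E: "ellipsoid n E" "E \<subseteq> polar_set {..<n} L"
    and h: "h \<in> borel_measurable (leb {..<n})" and hL: "\<And>x. h x \<noteq> 0 \<Longrightarrow> x \<in> L"
    and S: "\<And>U. frame {..<n} {..<m} U \<Longrightarrow> (\<integral>\<^sup>+t. h (lin {..<n} {..<m} U t) \<partial>leb {..<m}) \<le> S"
  shows "(\<integral>\<^sup>+x. h x \<partial>leb {..<n}) \<le> S * ennreal ((125 / bm_base ^ 3) ^ (n - m) *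
     ((lvol {..<n} (polar_set {..<n} L) / lvol {..<n} E) powr (1 / real n)) ^ (n - m) * lvol {..<n} L powr (real (n - m) / real n))"
proof -
  let ?I = "{..<n}" and ?k = "n - m"
  have n: "n > 0" using m by simp
  have I: "finite ?I" "?I \<noteq> {}" using n by auto
  obtain M N d where g: "vol_mat ?I M N d" and vE: "lvol ?I E = ball_vol ?I / d"
    and LN: "\<And>x. x \<in> L \<Longrightarrow> nrm ?I (lin ?I ?I (transp N) x) \<le> 1"
    by (rule ellipsoid_bound[OF n L E]) blast
  have sc: "scales ?I (lin ?I ?I (transp M)) d" and inv: "inv_mat ?I (transp M) (transp N)"
    using vol_mat_transp[OF I(1) g] by (auto simp: vol_mat_def)
  have d: "d > 0" by (rule scales_pos[OF sc])
  have v: "ball_vol ?I > 0" by (rule ball_vol_pos[OF I])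
  have supp: "nrm ?I y \<le> 1" if "y \<in> vecs ?I" "h (lin ?I ?I (transp M) y) \<noteq> 0" for y
    using LN[OF hL[OF that(2)]] inv that(1) by (simp add: inv_mat_def)
  have A: "(\<integral>\<^sup>+x. h x \<partial>leb ?I) \<le> S * ennreal (5 ^ ?k * (d * ball_vol ?I) powr (real ?k / real n))"
  proof -
    have "{..<m} \<noteq> {}" "card {..<m} < card ?I" using m by auto
    from slice_upper[OF I(1) finite_lessThan this sc h supp S] show ?thesis by simp
  qed
  have c: "bm_base ^ 3 > 0" using bm_base by simp
  define c where "c = bm_base ^ 3"
  have cp: "c > 0" using c by (simp add: c_def)
  have vL: "lvol ?I L > 0" and vP: "lvol ?I (polar_set ?I L) > 0"
    using body_lvol_pos[OF I(1) L] body_lvol_pos[OF I(1) body_polar_set[OF I(1) L]] by auto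
  have vEp: "lvol ?I E > 0" using vE v d by simp
  have bm: "c ^ n \<le> real n ^ n * (lvol ?I L * lvol ?I (polar_set ?I L))"
    using bourgain_milman[OF I L] by (simp add: c_def vol_prod_def)
  have up: "real n ^ n * (ball_vol ?I)\<^sup>2 \<le> 25 ^ n"
  proof -
    have "(sqrt (real n) ^ n * ball_vol ?I)\<^sup>2 \<le> (5 ^ n)\<^sup>2"
      using ball_vol_upper[OF I] by (intro power_mono) auto
    moreover have "(sqrt (real n) ^ n)\<^sup>2 = real n ^ n"
    proof -
      have "(sqrt (real n) ^ n)\<^sup>2 = ((sqrt (real n))\<^sup>2) ^ n" by (metis mult.commute power_mult)
      then show ?thesis by simp
    qed
    moreover have "((5::real) ^ n)\<^sup>2 = 25 ^ n" by (simp add: power2_eq_square power_mult_distrib[symmetric])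
    ultimately show ?thesis by (simp add: power_mult_distrib)
  qed
  \<comment> \<open>Dividing and multiplying by |polar L| separates the volume of \<open>L\<close>
    from the quotient whose n-th root enters the volume ratio.\<close>
  define X where "X = (25 / c) ^ n * lvol ?I L * (lvol ?I (polar_set ?I L) / lvol ?I E)"
  have X: "X > 0" using cp vL vP vEp by (simp add: X_def)
  have "d * ball_vol ?I \<le> X"
  proof -
    have dv: "d * ball_vol ?I = (ball_vol ?I)\<^sup>2 / lvol ?I E" using v d by (simp add: vE power2_eq_square)
    have "(ball_vol ?I)\<^sup>2 \<le> 25 ^ n / real n ^ n" using up n by (simp add: field_simps)
    also have "\<dots> \<le> 25 ^ n * (lvol ?I L * lvol ?I (polar_set ?I L) / c ^ n)"
    proof -
      have "1 / real n ^ n \<le> lvol ?I L * lvol ?I (polar_set ?I L) / c ^ n"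
        using bm cp n by (simp add: field_simps)
      from mult_left_mono[OF this, of "25 ^ n"] show ?thesis by simp
    qed
    finally have "(ball_vol ?I)\<^sup>2 / lvol ?I E \<le> 25 ^ n * (lvol ?I L * lvol ?I (polar_set ?I L) / c ^ n) / lvol ?I E"
      using vEp by (intro divide_right_mono) auto
    also have "\<dots> = X" by (simp add: X_def power_divide)
    finally show ?thesis by (simp add: dv)
  qed
  then have "(d * ball_vol ?I) powr (real ?k / real n) \<le> X powr (real ?k / real n)"
    using d v by (intro powr_mono2) auto
  also have "\<dots> = ((25 / c) ^ n) powr (real ?k / real n) * lvol ?I L powr (real ?k / real n) *
      (lvol ?I (polar_set ?I L) / lvol ?I E) powr (real ?k / real n)"
  proof -
    define q where "q = lvol ?I (polar_set ?I L) / lvol ?I E"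
    define e where "e = (25 / c) ^ n"
    have "q > 0" "e > 0" using vP vEp cp by (simp_all add: q_def e_def)
    then have "(e * lvol ?I L * q) powr (real ?k / real n) =
        e powr (real ?k / real n) * lvol ?I L powr (real ?k / real n) * q powr (real ?k / real n)"
      using vL by (simp add: powr_mult)
    then show ?thesis by (simp only: X_def q_def e_def)
  qed
  also have "((25 / c) ^ n) powr (real ?k / real n) = (25 / c) ^ ?k"
    using cp n by (simp add: powr_realpow[symmetric] powr_powr)
  also have "(lvol ?I (polar_set ?I L) / lvol ?I E) powr (real ?k / real n) = ((lvol ?I (polar_set ?I L) / lvol ?I E) powr (1 / real n)) ^ ?k"
    using vP vEp by (simp add: powr_realpow[symmetric] powr_powr)
  finally have "5 ^ ?k * (d * ball_vol ?I) powr (real ?k / real n) \<le>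
     5 ^ ?k * ((25 / c) ^ ?k * lvol ?I L powr (real ?k / real n) * ((lvol ?I (polar_set ?I L) / lvol ?I E) powr (1 / real n)) ^ ?k)"
    by (rule mult_left_mono) simp
  also have "\<dots> = (5 ^ ?k * (25 / c) ^ ?k) * ((lvol ?I (polar_set ?I L) / lvol ?I E) powr (1 / real n)) ^ ?k * lvol ?I L powr (real ?k / real n)"
    by simp
  also have "5 ^ ?k * (25 / c) ^ ?k = (125 / c) ^ ?k" by (simp add: power_mult_distrib[symmetric])
  finally have "ennreal (5 ^ ?k * (d * ball_vol ?I) powr (real ?k / real n)) \<le>
     ennreal ((125 / c) ^ ?k * ((lvol ?I (polar_set ?I L) / lvol ?I E) powr (1 / real n)) ^ ?k * lvol ?I L powr (real ?k / real n))"
    by (rule ennreal_leI)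
  then show ?thesis using A unfolding c_def by (meson mult_left_mono order_trans zero_le)
qed

text \<open>Taking k-th roots gives a lower bound for all elements of \<open>X\<close>, hence for
  the infimum; attainment is avoided.\<close>

lemma Inf_power_bound:
  fixes X :: "real set"
  assumes ne: "X \<noteq> {}" and nn: "\<And>x. x \<in> X \<Longrightarrow> 0 \<le> x" and k: "k > 0" and B: "B \<ge> 0"
    and le: "\<And>x. x \<in> X \<Longrightarrow> \<mu> \<le> B * x ^ k"
  shows "\<mu> \<le> B * Inf X ^ k"
proof (cases "B = 0 \<or> \<mu> \<le> 0")
  case True
  have "0 \<le> Inf X" by (rule cInf_greatest[OF ne nn])
  moreover have "\<mu> \<le> 0" using True ne le by auto
  ultimately show ?thesis using B by (meson mult_nonneg_nonneg order_trans zero_le_power)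
next
  case False
  then have Bp: "B > 0" and mp: "\<mu> > 0" using B by auto
  define q where "q = root k (\<mu> / B)"
  have q: "q \<ge> 0" "q ^ k = \<mu> / B" using k Bp mp by (simp_all add: q_def)
  have "q \<le> x" if "x \<in> X" for x
  proof -
    have "q ^ k \<le> x ^ k" using le[OF that] Bp by (simp add: q(2) field_simps)
    then show ?thesis using power_mono_iff[OF q(1) nn[OF that] k] by simp
  qed
  then have "q \<le> Inf X" by (rule cInf_greatest[OF ne])
  then have "q ^ k \<le> Inf X ^ k" using q(1) by (rule power_mono)
  then show ?thesis using Bp by (simp add: q(2) field_simps)
qed

theorem theorem3:
  shows "\<exists>C::real. \<forall>n k L g.
     2 \<le> n \<longrightarrow> 1 \<le> k \<longrightarrow> k < n \<longrightarrow>
     convex_body n L \<longrightarrow> origin_symmetric n L \<longrightarrow>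
     continuous_on L g \<longrightarrow> (\<forall>x\<in>L. 0 \<le> g x) \<longrightarrow> (\<forall>x\<in>L. g (negn n x) = g x) \<longrightarrow>
     mu n g L \<le> (C * volume_ratio n (polar n L)) ^ k * (real n / real (n - k)) * c_nk n k
        * (SUP U\<in>frames n (n - k). mu_sec n (n - k) g L U) * vol n L powr (real k / real n)"
proof (rule exI[of _ "625 / bm_base ^ 3"], intro allI impI)
  fix n k :: nat and L :: "(nat \<Rightarrow> real) set" and g :: "(nat \<Rightarrow> real) \<Rightarrow> real"
  assume n: "2 \<le> n" and k: "1 \<le> k" "k < n" and cb: "convex_body n L" and os: "origin_symmetric n L"
    and cont: "continuous_on L g" and g0: "\<forall>x\<in>L. 0 \<le> g x"
  let ?I = "{..<n}" and ?m = "n - k"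
  let ?J = "{..<n - k}"
  have np: "n > 0" and m: "0 < ?m" "?m < n" and nm: "n - ?m = k" using n k by auto
  have L: "body ?I L" by (rule body_of_convex_body[OF cb os np])
  have fin: "finite ?I" "finite ?J" by auto
  \<comment> \<open>The density is only controlled on \<open>L\<close>, so it is replaced by its
    extension by 0, which is measurable because \<open>L\<close> is closed and \<open>g\<close> is
    continuous there.\<close>
  define G where "G x = indicator L x * g x" for x
  define h where "h x = ennreal (G x)" for x
  have Gm: "G \<in> borel_measurable (leb ?I)"
  proof -
    have "(\<lambda>x. if x \<in> L then g x else 0) \<in> borel_measurable borel"
      by (rule borel_measurable_continuous_on_if)
        (use cont body_compact[OF L] in \<open>auto simp: borel_closed compact_imp_closed\<close>)
    moreover have "(\<lambda>x. if x \<in> L then g x else 0) = G" by (auto simp: G_def indicator_def)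
    ultimately have "G \<in> borel_measurable borel" by simp
    then show ?thesis by (rule measurable_compose[OF id_leb_borel])
  qed
  have hm: "h \<in> borel_measurable (leb ?I)" unfolding h_def using Gm by measurable
  have G0: "0 \<le> G x" for x using g0 by (simp add: G_def indicator_def)
  obtain R where R: "R > 0" "L \<subseteq> cube ?I R" using fin(1) L by (rule body_bounded)
  obtain B where B: "B \<ge> 0" "\<And>x. x \<in> L \<Longrightarrow> g x \<le> B"
  proof -
    have "compact (g ` L)" by (rule compact_continuous_image[OF cont body_compact[OF L]])
    then have "bounded (g ` L)" by (rule compact_imp_bounded)
    then obtain B where "\<And>x. x \<in> L \<Longrightarrow> \<bar>g x\<bar> \<le> B" by (auto simp: bounded_iff)
    then have "\<And>x. x \<in> L \<Longrightarrow> g x \<le> \<bar>B\<bar>" by force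
    then show thesis using that[of "\<bar>B\<bar>"] by simp
  qed
  define R' where "R' = sqrt (real n) * R"
  have R': "R' > 0" using R np by (simp add: R'_def)
  have LR: "nrm ?I x \<le> R'" if "x \<in> L" for x
    using cube_subset_cball[OF fin(1), of R] R that by (auto simp: cball_def R'_def)
  \<comment> \<open>A frame preserves norms, so every section of \<open>L\<close> lies in one fixed
    ball. This gives integrability and a bound independent of the subspace.\<close>
  have Gmu: "(\<integral>\<^sup>+t. h (lin ?I ?J U t) \<partial>leb ?J) = ennreal (\<integral>t. G (lin ?I ?J U t) \<partial>leb ?J)"
    "(\<integral>t. G (lin ?I ?J U t) \<partial>leb ?J) \<le> B * (R' ^ ?m * ball_vol ?J)" if U: "frame ?I ?J U" for U
  proof -
    have Um: "(\<lambda>t. G (lin ?I ?J U t)) \<in> borel_measurable (leb ?J)"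
      by (rule measurable_compose[OF lin_meas' Gm])
    have "(\<integral>\<^sup>+t. h (lin ?I ?J U t) \<partial>leb ?J) \<le> (\<integral>\<^sup>+t. ennreal B * indicator (cball ?J R') t \<partial>leb ?J)"
    proof (rule nn_integral_mono)
      fix t assume t: "t \<in> space (leb ?J)"
      show "h (lin ?I ?J U t) \<le> ennreal B * indicator (cball ?J R') t"
      proof (cases "lin ?I ?J U t \<in> L")
        case True
        have "nrm ?J t = nrm ?I (lin ?I ?J U t)" by (simp add: nrm_def frame_dot[OF fin U])
        then have "t \<in> cball ?J R'" using LR[OF True] t by (simp add: cball_def)
        then show ?thesis using B True by (simp add: h_def G_def ennreal_leI)
      qed (simp add: h_def G_def)
    qed
    also have "\<dots> = ennreal B * emeasure (leb ?J) (cball ?J R')" by (rule nn_integral_cmult_indicator[OF cball_sets])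
    also have "\<dots> = ennreal (B * (R' ^ ?m * ball_vol ?J))"
      using B R' by (simp add: emeasure_cball ennreal_mult'[symmetric])
    finally have le: "(\<integral>\<^sup>+t. h (lin ?I ?J U t) \<partial>leb ?J) \<le> ennreal (B * (R' ^ ?m * ball_vol ?J))" .
    then have "(\<integral>\<^sup>+t. ennreal (G (lin ?I ?J U t)) \<partial>leb ?J) < \<top>" unfolding h_def by (rule le_less_trans) simp
    then have int: "integrable (leb ?J) (\<lambda>t. G (lin ?I ?J U t))"
      using Um G0 by (intro integrableI_nonneg) auto
    show eq: "(\<integral>\<^sup>+t. h (lin ?I ?J U t) \<partial>leb ?J) = ennreal (\<integral>t. G (lin ?I ?J U t) \<partial>leb ?J)"
      unfolding h_def by (rule nn_integral_eq_integral[OF int]) (simp add: G0)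
    show "(\<integral>t. G (lin ?I ?J U t) \<partial>leb ?J) \<le> B * (R' ^ ?m * ball_vol ?J)"
      using le B R' unfolding eq by (simp add: ennreal_le_iff)
  qed
  let ?S = "SUP U\<in>frames n ?m. mu_sec n ?m g L U"
  \<comment> \<open>The supremum is taken over reals, so boundedness is needed before it can serve
    as an upper bound for the sections.\<close>
  have bdd: "bdd_above ((\<lambda>U. mu_sec n ?m g L U) ` frames n ?m)"
  proof (rule bdd_aboveI2)
    fix U assume U: "U \<in> frames n ?m"
    have "mu_sec n ?m g L U = (\<integral>t. G (lin ?I ?J (transp U) t) \<partial>leb ?J)"
      by (simp add: mu_sec_def lebn_eq G_def frames_imp_frame(2)[OF U])
    then show "mu_sec n ?m g L U \<le> B * (R' ^ ?m * ball_vol ?J)"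
      using Gmu(2)[OF frames_imp_frame(1)[OF U]] by simp
  qed
  have secle: "(\<integral>t. G (lin ?I ?J U t) \<partial>leb ?J) \<le> ?S" if U: "frame ?I ?J U" for U
  proof -
    let ?U = "\<lambda>j. restrict (\<lambda>i. U i j) ?I"
    have "(\<integral>t. G (lin ?I ?J U t) \<partial>leb ?J) = mu_sec n ?m g L ?U"
      by (simp add: mu_sec_def lebn_eq G_def frames_frame(2)[OF U])
    also have "\<dots> \<le> ?S" by (rule cSUP_upper[OF frames_frame(1)[OF U] bdd])
    finally show ?thesis .
  qed
  \<comment> \<open>One frame exists, the coordinate one, and its section integral is non-negative;
    this gives the sign of the supremum.\<close>
  have idf: "frame ?I ?J (\<lambda>i j. if i = j then 1 else 0)"
    using m by (auto simp: frame_def if_distrib[of "\<lambda>x. x * _"] cong: if_cong)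
  have S0: "0 \<le> ?S"
    by (rule order_trans[OF _ secle[OF idf]]) (simp add: G0)
  have hS: "(\<integral>\<^sup>+t. h (lin ?I ?J U t) \<partial>leb ?J) \<le> ennreal ?S" if U: "frame ?I ?J U" for U
    unfolding Gmu(1)[OF U] by (rule ennreal_leI[OF secle[OF U]])
  have hL: "x \<in> L" if "h x \<noteq> 0" for x using that by (cases "x \<in> L") (auto simp: h_def G_def)
  \<comment> \<open>Only an inequality is claimed because a Bochner integral is 0 by convention when
    the function is not integrable; that case is then trivial.\<close>
  have mu_eq: "ennreal (mu n g L) \<le> (\<integral>\<^sup>+x. h x \<partial>leb ?I)"
  proof (cases "integrable (leb ?I) G")
    case True
    have "(\<integral>\<^sup>+x. h x \<partial>leb ?I) = ennreal (\<integral>x. G x \<partial>leb ?I)"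
      unfolding h_def by (rule nn_integral_eq_integral[OF True]) (simp add: G0)
    then show ?thesis by (simp add: mu_def lebn_eq G_def)
  next
    case False
    then have "mu n g L = 0" by (simp add: mu_def lebn_eq G_def[abs_def] not_integrable_integral_eq)
    then show ?thesis by simp
  qed
  define V where "V = lvol ?I L powr (real k / real n)"
  define X where "X = {(vol n (polar n L) / vol n E) powr (1 / real n) | E. ellipsoid n E \<and> E \<subseteq> polar n L}"
  have vr: "volume_ratio n (polar n L) = Inf X" by (simp add: volume_ratio_def X_def)
  have bpol: "body ?I (polar_set ?I L)" by (rule body_polar_set[OF fin(1) L])
  have Xne: "X \<noteq> {}"
    using ellipsoid_inside_body[OF np bpol] by (auto simp: X_def polar_eq)
  have X0: "0 \<le> x" if "x \<in> X" for x using that by (auto simp: X_def)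
  define c where "c = bm_base ^ 3"
  have c: "c > 0" using bm_base by (simp add: c_def)
  define Bd where "Bd = ?S * ((125 / c) ^ k * V)"
  have Bd: "Bd \<ge> 0" unfolding Bd_def using S0 c by (intro mult_nonneg_nonneg) (auto simp: V_def)
  have "mu n g L \<le> Bd * x ^ k" if x: "x \<in> X" for x
  proof -
    obtain E where E: "ellipsoid n E" "E \<subseteq> polar_set ?I L" and xE: "x = (lvol ?I (polar_set ?I L) / lvol ?I E) powr (1 / real n)"
      using x by (auto simp: X_def polar_eq vol_def lebn_eq)
    have "(\<integral>\<^sup>+x. h x \<partial>leb ?I) \<le> ennreal ?S * ennreal ((125 / bm_base ^ 3) ^ (n - ?m) *
       ((lvol ?I (polar_set ?I L) / lvol ?I E) powr (1 / real n)) ^ (n - ?m) * lvol ?I L powr (real (n - ?m) / real n))"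
      by (rule section_bound[OF m L E hm]) (fact hL, fact hS)
    then have "(\<integral>\<^sup>+x. h x \<partial>leb ?I) \<le> ennreal ?S * ennreal ((125 / c) ^ k * x ^ k * V)"
      by (simp only: nm xE c_def V_def)
    also have "\<dots> = ennreal (Bd * x ^ k)"
      using S0 by (simp add: ennreal_mult'[symmetric] Bd_def mult_ac)
    finally have "ennreal (mu n g L) \<le> ennreal (Bd * x ^ k)" using mu_eq by (rule order_trans[rotated])
    then show ?thesis using Bd X0[OF x] by (simp add: ennreal_le_iff)
  qed
  then have main: "mu n g L \<le> Bd * Inf X ^ k"
    using k by (intro Inf_power_bound[OF Xne X0 _ Bd]) auto
  have J': "?J \<union> {n - k..<n} = ?I" "?J \<inter> {n - k..<n} = {}" using k by auto
  have "(1 / 5) ^ card {n - k..<n} * ball_vol ?J \<le> ball_vol ?I powr (real (card ?J) / real (card ?I))"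
    using ball_vol_ratio[of ?J "{n - k..<n}"] J' m k by (simp add: lessThan_empty_iff)
  then have cn: "(1 / 5) ^ k \<le> c_nk n k"
    using ball_vol_pos[of ?J] m k by (simp add: c_nk_def vol_unit_ball field_simps lessThan_empty_iff)
  have rat: "1 \<le> real n / real ?m" using m by simp
  have I0: "0 \<le> Inf X" by (rule cInf_greatest[OF Xne X0])
  \<comment> \<open>The remaining factors of the statement are inserted at the price of 5^k: n / (n
    - k) is at least 1 and c_{n,k} at least 5^(-k). This turns 125 into 625.\<close>
  have "Bd * Inf X ^ k = ((125 / c) ^ k * Inf X ^ k * ?S * V) * 1" by (simp add: Bd_def mult_ac)
  also have "\<dots> \<le> ((125 / c) ^ k * Inf X ^ k * ?S * V) * (5 ^ k * ((real n / real ?m) * c_nk n k))"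
  proof (rule mult_left_mono)
    have "1 * (1 / 5) ^ k \<le> (real n / real ?m) * c_nk n k"
      by (rule mult_mono[OF rat cn]) auto
    then have "5 ^ k * (1 * (1 / 5) ^ k) \<le> 5 ^ k * ((real n / real ?m) * c_nk n k)"
      by (rule mult_left_mono) simp
    then show "1 \<le> 5 ^ k * ((real n / real ?m) * c_nk n k)" by (simp add: power_mult_distrib[symmetric])
    show "0 \<le> (125 / c) ^ k * Inf X ^ k * ?S * V" using I0 S0 c by (simp add: V_def)
  qed
  also have "\<dots> = (5 ^ k * (125 / c) ^ k) * Inf X ^ k * (real n / real ?m) * c_nk n k * ?S * V"
    by (simp add: mult_ac)
  also have "5 ^ k * (125 / c) ^ k = (625 / c) ^ k" by (simp add: power_mult_distrib[symmetric])
  finally have "Bd * Inf X ^ k \<le> (625 / c * Inf X) ^ k * (real n / real ?m) * c_nk n k * ?S * V"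
    by (simp only: power_mult_distrib)
  with main show "mu n g L \<le> (625 / bm_base ^ 3 * volume_ratio n (polar n L)) ^ k * (real n / real (n - k)) * c_nk n k
        * (SUP U\<in>frames n (n - k). mu_sec n (n - k) g L U) * vol n L powr (real k / real n)"
    by (simp add: vr c_def V_def vol_def lebn_eq)
qed

end
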